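(* For every integral dominant $\mathfrak{sp}_{2n}(\mathbb C)$-weight $\lambda$ one has $\Delta(\mathcal L,\tau,<_{\mathrm A}^\xi,\nu^\xi)=\mathcal Q_O(\lambda)-x_\lambda$, where $\mathcal L$ is the equivariant line bundle on the complete symplectic flag variety $F$ associated with $\lambda$, and $\tau$, $<_{\mathrm A}^\xi$, $\nu^\xi$, $x_\lambda$ are as defined in the context.
   Context: **Poset and permutations.** Fix $n\ge 1$. Let $(N,\lessdot)$ be the totally ordered set $\{1\lessdot\dots\lessdot n\lessdot -n\lessdot\dots\lessdot -1\}$. Let $P$ be the set of integer pairs $(i,j)$ with $1\le i\le n$, $i\le|j|\le n$, partially ordered by $(i_1,j_1)\preceq(i_2,j_2)$ iff $i_1\le i_2$ and ($j_1\lessdot j_2$ or $j_1=j_2$). Let $A=\{(i,i):1\le i\le n\}$ and fix $O$ with $A\subset O\subset P$. $\mathcal J$ is the set of order ideals (lower sets) of $P$, and $\mathcal J_k=\{J\in\mathcal J:|J\cap A|=k\}$ for $k\in[1,n]$. For $J\in\mathcal J$ put $M_O(J)=(J\cap O)\cup\max_\prec(J)$, where $\max_\prec(J)$ is the set of maximal elements. $\mathbf 1_X\in\mathbb R^P$ is the indicator vector of $X\subset P$, and $\epsilon_{i,j}$ are the standard basis vectors. For $(i,j)\in P$ let $s_{i,j}$ be the permutation of $N$ exchanging $i$ and $j$ ($s_{i,i}=\mathrm{id}$). For $M\subset P$ let $w_M$ be the product of all $s_{i,j}$, $(i,j)\in M$, ordered first by $i$ increasing from left to right and then by $j$ $\lessdot$-increasing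 from left to right (composition of maps, rightmost factor applied first). Put $w^{O,J}=w_O^{-1}w_{M_O(J)}$, $\langle i,j\rangle=\{p\in P:p\preceq(i,j)\}$, $r(i,j)=w^{O,\langle i,j\rangle}(i)$. (For fixed $i$, $j\mapsto r(i,j)$ is a permutation of $[i,n]\cup[-n,-i]$.) **The map $\xi$.** $\xi:\mathbb R^P\to\mathbb R^P$ is the (unimodular) linear map with $\xi(\epsilon_{i,i})=\epsilon_{i,r(i,i)}$ and, for $j\ne i$, $\xi(\epsilon_{i,j})=\epsilon_{i,r(i,j)}-\epsilon_{i,r(i,j')}$, where $j'$ is the $\lessdot$-maximal element with $j'\lessdot j$ and $(i,j')\in O$. **Polytopes.** For $\lambda=(a_1,\dots,a_n)=\sum a_k\omega_k$ with $a_k\in\mathbb Z_{\ge0}$ put $\lambda(i)=a_i+\dots+a_n$. $\mathcal Q_O(\lambda)\subset\mathbb R^P$ consists of the points $x$ with $x_{i,i}=\lambda(i)$ for all $i$; all $x_{i,j}\ge0$; and for every chain $(p,q)\prec(i_1,j_1)\prec\dots\prec(i_m,j_m)\prec(r,s)$, $m\ge0$, with $(p,q)\in O$, $(r,s)\in P$ and all $(i_l,j_l)\notin O$: $x_{i_1,j_1}+\dots+x_{i_m,j_m}\le x_{p,q}-x_{r,s}$. For each $k\in[1,n]$ there is a unique $J\in\mathcal J_k$ with $w^{O,J}(i)=i$ for all $i\in[1,k]$; let $x_k=\mathbf 1_{M_O(J)}$ for this $J$, and $x_\lambda=a_1x_1+\dots+a_nx_n$. **Plücker algebra.** Let $S=\mathbb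 C[X_{i_1,\dots,i_k}]$ with variables for $k\in[1,n]$, $i_1\lessdot\dots\lessdot i_k$ in $N$, with the convention $X_{i_1,\dots,i_k}=(-1)^\sigma X_{i_{\sigma(1)},\dots,i_{\sigma(k)}}$ (zero if subscripts repeat). $I_{\mathrm A}\subset S$ is the kernel of the map to $\mathbb C[z_{i,j}]_{i\in[1,n],j\in N}$ sending $X_{i_1,\dots,i_k}$ to the determinant $|z_{i,j}|_{i=1,\dots,k;\,j=i_1,\dots,i_k}$. $\mathfrak L\subset S$ is the span of all $X_{i_1,\dots,i_k,1,-1}+\dots+X_{i_1,\dots,i_k,n,-n}$, $k\in[0,n-2]$, $i_1\lessdot\dots\lessdot i_k$. A tuple in $N$ is admissible if its elements are distinct and for each $l\in[1,n]$ at most $l$ of them have absolute value $\le l$. $\Theta$ (resp. $\Theta'$) is the set of admissible (resp. non-admissible) tuples $(i_1\lessdot\dots\lessdot i_k)$ with $k\in[1,n]$, $\Theta_k$ the $k$-element tuples in $\Theta$; $\mathbb C[\Theta]\subset S$ is generated by the variables with subscripts in $\Theta$. For each tuple in $\Theta'$ there is a unique linear combination $R$ of variables of $\mathbb C[\Theta]$ with $X_{i_1,\dots,i_k}-R\in\mathfrak L$; $\rho_1:S\to\mathbb C[\Theta]$ is the homomorphism sending such $X_{i_1,\dots,i_k}$ to $R$ and fixing the variables of $\mathbb C[\Theta]$. Put $I=\rho_1(I_{\mathrm A})$ and $\mathcal R^{\mathrm C}=\mathbb C[\Theta]/I$, graded by $\deg X_{i_1,\dots,i_k}=\omega_k$,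 with components $\mathcal R^{\mathrm C}[\mu]$. The zero set of $I$ in $\mathbb P=\mathbb P(\mathbb C^{\Theta_1})\times\dots\times\mathbb P(\mathbb C^{\Theta_n})$ is the complete flag variety $F$ of $Sp_{2n}(\mathbb C)$. **Orders.** On $P$ define a total order: each element is uniquely $(i,r(i,j'))$; set $(i_1,r(i_1,j_1))<(i_2,r(i_2,j_2))$ if $i_1<i_2$, or $i_1=i_2$ and $j_1\lessdot j_2$, with one exception: if $i_1=i_2$, $j_1\lessdot j_2$, $(i_1,j_1)\in O$ and there is no $j'$ with $j_1\lessdot j'$, ($j'\lessdot j_2$ or $j'=j_2$) and $(i_1,j')\in O$, then $(i_1,r(i_1,j_1))>(i_2,r(i_2,j_2))$. For distinct $d,d'\in\mathbb Z^P$ set $d<d'$ if $d_{i,j}>d'_{i,j}$ for the $<$-minimal $(i,j)$ with $d_{i,j}\ne d'_{i,j}$. On $\mathbb Z^N$ (basis $\zeta_j$, $j\in N$), with $-1\lessdot'1\lessdot'-2\lessdot'2\lessdot'\dots\lessdot'-n\lessdot'n$, set $\sum a_i\zeta_i\ll\sum b_i\zeta_i$ if for some $i$ one has $a_i<b_i$ and $a_j=b_j$ for all $j\lessdot'i$. For $x\in\mathbb Z^P$ let $\mathrm{wt}_{\mathrm A}(x)=\sum x_{i,j}(\zeta_j-\zeta_i)$. Set $x<_{\mathrm A}y$ if $\mathrm{wt}_{\mathrm A}(x)\ll\mathrm{wt}_{\mathrm A}(y)$, or $\mathrm{wt}_{\mathrm A}(x)=\mathrm{wt}_{\mathrm A}(y)$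 and $x<y$. Set $x<_{\mathrm A}^\xi y$ if $\xi(x)<_{\mathrm A}\xi(y)$. **Valuation.** Every variable of $\mathbb C[\Theta]$ equals $\pm X_{w^{O,J}(1),\dots,w^{O,J}(k)}$ for a unique $J\in\mathcal J_k$; give it exponent $\xi(\mathbf 1_{M_O(J)})\in\mathbb Z^P$ and extend additively to monomials. For $x\in\mathbb Z^P$ let $\mathbb C[\Theta]_x$ be the span of monomials whose exponent is $\le_{\mathrm A}x$. For $p\in\mathcal R^{\mathrm C}\setminus\{0\}$ let $\nu(p)$ be the $<_{\mathrm A}$-minimal $x$ such that $p$ lies in the image of $\mathbb C[\Theta]_x$. Elements of $\mathbb C(F)$ are fractions $p/q$ with $p,q\in\mathcal R^{\mathrm C}[\mu]$ for some $\mu$; put $\nu(p/q)=\nu(p)-\nu(q)$ and $\nu^\xi(h)=\xi^{-1}(\nu(h))$ for $h\in\mathbb C(F)\setminus\{0\}$. **Newton--Okounkov body.** For a line bundle $\mathcal L$ on $F$, nonzero $\tau\in H^0(F,\mathcal L)$, a total group order $<'$ on $\mathbb Z^P$ and a map $\nu:\mathbb C(F)\setminus\{0\}\to\mathbb Z^P$ which is a valuation with respect to $<'$ ($\nu(fg)=\nu(f)+\nu(g)$, $\nu(cf)=\nu(f)$ for $c\in\mathbb C^*$, $\nu(f+g)\le'\max_{<'}(\nu(f),\nu(g))$ if $f+g\ne 0$): $\Delta(\mathcal L,\tau,<',\nu)=\overline{\mathrm{conv}\{\nu(\sigma/\tau^{\otimes m})/m: m\in\mathbb Z_{>0},\sigma\in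 H^0(F,\mathcal L^{\otimes m})\setminus\{0\}\}}\subset\mathbb R^P$. Here $\mathcal L$ is the restriction of $\mathcal O(a_1,\dots,a_n)$ from $\mathbb P$ to $F$, so $H^0(F,\mathcal L)=\mathcal R^{\mathrm C}[\lambda]$, and $\tau$ is the image of $\prod_kX_{1,\dots,k}^{a_k}$. *)

theory Defs
  imports
    "HOL-Analysis.Analysis"
    "HOL-Analysis.Finite_Function_Topology"
    "HOL-Combinatorics.Combinatorics"
    "HOL-Algebra.QuotRing"
    "Jordan_Normal_Form.Determinant"
begin

section \<open>The poset and its permutations\<close>

definition signed_range :: "nat \<Rightarrow> int set"
  where "signed_range n = {1..int n} \<union> {- int n..-1}"

text \<open>The order \<open>1 \<lessdot> \<dots> \<lessdot> n \<lessdot> -n \<lessdot> \<dots> \<lessdot> -1\<close>; on nonzero integers it can be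
  described without mentioning \<open>n\<close>.\<close>

definition nless :: "int \<Rightarrow> int \<Rightarrow> bool"  (infix \<open>\<lessdot>\<close> 50)
  where "i \<lessdot> j \<longleftrightarrow> (0 < i \<and> j < 0) \<or> ((0 < i \<longleftrightarrow> 0 < j) \<and> i < j)"

definition poset :: "nat \<Rightarrow> (int \<times> int) set"
  where "poset n = {(i, j). 1 \<le> i \<and> i \<le> int n \<and> i \<le> \<bar>j\<bar> \<and> \<bar>j\<bar> \<le> int n}"

fun pleq :: "int \<times> int \<Rightarrow> int \<times> int \<Rightarrow> bool"  (infix \<open>\<preceq>\<^sub>P\<close> 50)
  where "(i1, j1) \<preceq>\<^sub>P (i2, j2) \<longleftrightarrow> i1 \<le> i2 \<and> (j1 \<lessdot> j2 \<or> j1 = j2)"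

definition pprec :: "int \<times> int \<Rightarrow> int \<times> int \<Rightarrow> bool"  (infix \<open>\<prec>\<^sub>P\<close> 50)
  where "p \<prec>\<^sub>P q \<longleftrightarrow> p \<preceq>\<^sub>P q \<and> p \<noteq> q"

definition diag :: "nat \<Rightarrow> (int \<times> int) set"
  where "diag n = {(i, i) | i. 1 \<le> i \<and> i \<le> int n}"

definition ideals :: "nat \<Rightarrow> (int \<times> int) set set"
  where "ideals n = {J. J \<subseteq> poset n \<and> (\<forall>p\<in>J. \<forall>q\<in>poset n. q \<preceq>\<^sub>P p \<longrightarrow> q \<in> J)}"

definition ideals_k :: "nat \<Rightarrow> nat \<Rightarrow> (int \<times> int) set set"
  where "ideals_k n k = {J \<in> ideals n. card (J \<inter> diag n) = k}"

definition max_elems :: "(int \<times> int) set \<Rightarrow> (int \<times> int) set"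
  where "max_elems J = {p \<in> J. \<not> (\<exists>q\<in>J. p \<prec>\<^sub>P q)}"

definition M_set :: "(int \<times> int) set \<Rightarrow> (int \<times> int) set \<Rightarrow> (int \<times> int) set"
  where "M_set \<O> J = (J \<inter> \<O>) \<union> max_elems J"

text \<open>Permutations of \<open>N\<close> are represented as maps on all integers fixing everything outside \<open>N\<close>.\<close>

definition w_perm :: "nat \<Rightarrow> (int \<times> int) set \<Rightarrow> int \<Rightarrow> int"
  where "w_perm n M =
    foldr (\<lambda>(i, j) f. Transposition.transpose i j \<circ> f)
      [(i, j). i \<leftarrow> [1..int n], j \<leftarrow> [1..int n] @ [- int n..-1], (i, j) \<in> M] id"

definition w_OJ :: "nat \<Rightarrow> (int \<times> int) set \<Rightarrow> (int \<times> int) set \<Rightarrow> int \<Rightarrow> int"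
  where "w_OJ n \<O> J = inv_into UNIV (w_perm n \<O>) \<circ> w_perm n (M_set \<O> J)"

definition down_set :: "nat \<Rightarrow> int \<times> int \<Rightarrow> (int \<times> int) set"
  where "down_set n q = {p \<in> poset n. p \<preceq>\<^sub>P q}"

definition r_map :: "nat \<Rightarrow> (int \<times> int) set \<Rightarrow> int \<Rightarrow> int \<Rightarrow> int"
  where "r_map n \<O> i j = w_OJ n \<O> (down_set n (i, j)) i"


section \<open>The map \<open>\<xi>\<close> and the polytopes\<close>

text \<open>\<open>\<real>\<^sup>P\<close> and \<open>\<int>\<^sup>P\<close> are the finitely supported functions on pairs of integers that are
  supported on \<open>P\<close>. The topology on finitely supported real functions is that of the
  \<open>\<ell>\<^sup>1\<close>-norm, which on \<open>\<real>\<^sup>P\<close> is the Euclidean one.\<close>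

definition vecs :: "nat \<Rightarrow> (int \<times> int \<Rightarrow>\<^sub>0 'a::zero) set"
  where "vecs n = {x. Poly_Mapping.keys x \<subseteq> poset n}"

definition ind :: "(int \<times> int) set \<Rightarrow> (int \<times> int \<Rightarrow>\<^sub>0 'a::semiring_1)"
  where "ind M = (\<Sum>p\<in>M. Poly_Mapping.single p 1)"

definition prev_O :: "(int \<times> int) set \<Rightarrow> int \<Rightarrow> int \<Rightarrow> int"
  where "prev_O \<O> i j =
    (THE j'. j' \<lessdot> j \<and> (i, j') \<in> \<O> \<and> (\<forall>l. l \<lessdot> j \<and> (i, l) \<in> \<O> \<longrightarrow> l \<lessdot> j' \<or> l = j'))"

definition xi :: "nat \<Rightarrow> (int \<times> int) set \<Rightarrow> (int \<times> int \<Rightarrow>\<^sub>0 'a) \<Rightarrow> (int \<times> int \<Rightarrow>\<^sub>0 'a::ab_group_add)"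
  where "xi n \<O> x = (\<Sum>(i, j)\<in>poset n.
    if j = i then Poly_Mapping.single (i, r_map n \<O> i i) (Poly_Mapping.lookup x (i, i))
    else Poly_Mapping.single (i, r_map n \<O> i j) (Poly_Mapping.lookup x (i, j))
       - Poly_Mapping.single (i, r_map n \<O> i (prev_O \<O> i j)) (Poly_Mapping.lookup x (i, j)))"

text \<open>A dominant weight \<open>a\<^sub>1 \<omega>\<^sub>1 + \<dots> + a\<^sub>n \<omega>\<^sub>n\<close> is given by \<open>a :: nat \<Rightarrow> nat\<close>, of which only the
  values on \<open>{1..n}\<close> matter.\<close>

definition lam :: "nat \<Rightarrow> (nat \<Rightarrow> nat) \<Rightarrow> nat \<Rightarrow> nat"
  where "lam n a i = (\<Sum>k=i..n. a k)"

text \<open>Since \<open>\<prec>\<close> is transitive, a list sorted with respect to it is a chain.\<close>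

definition Q_poly :: "nat \<Rightarrow> (int \<times> int) set \<Rightarrow> (nat \<Rightarrow> nat) \<Rightarrow> (int \<times> int \<Rightarrow>\<^sub>0 real) set"
  where "Q_poly n \<O> a = {x \<in> vecs n.
    (\<forall>i\<in>{1..n}. Poly_Mapping.lookup x (int i, int i) = real (lam n a i)) \<and>
    (\<forall>p\<in>poset n. 0 \<le> Poly_Mapping.lookup x p) \<and>
    (\<forall>p\<in>\<O>. \<forall>q\<in>poset n. \<forall>c. set c \<subseteq> poset n - \<O> \<and> sorted_wrt (\<prec>\<^sub>P) (p # c @ [q]) \<longrightarrow>
      (\<Sum>s\<leftarrow>c. Poly_Mapping.lookup x s) \<le> Poly_Mapping.lookup x p - Poly_Mapping.lookup x q)}"

definition J_id :: "nat \<Rightarrow> (int \<times> int) set \<Rightarrow> nat \<Rightarrow> (int \<times> int) set"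
  where "J_id n \<O> k = (THE J. J \<in> ideals_k n k \<and> (\<forall>i\<in>{1..int k}. w_OJ n \<O> J i = i))"

definition x_lam :: "nat \<Rightarrow> (int \<times> int) set \<Rightarrow> (nat \<Rightarrow> nat) \<Rightarrow> (int \<times> int \<Rightarrow>\<^sub>0 real)"
  where "x_lam n \<O> a = (\<Sum>k=1..n. real (a k) *\<^sub>R ind (M_set \<O> (J_id n \<O> k)))"


section \<open>Multivariate polynomials over the complex numbers\<close>

type_synonym 'v cpoly = "('v \<Rightarrow>\<^sub>0 nat) \<Rightarrow>\<^sub>0 complex"

definition pconst :: "complex \<Rightarrow> 'v cpoly"
  where "pconst c = Poly_Mapping.single 0 c"

definition pvar :: "'v \<Rightarrow> 'v cpoly"
  where "pvar v = Poly_Mapping.single (Poly_Mapping.single v 1) 1"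

definition pring :: "'v set \<Rightarrow> 'v cpoly set"
  where "pring V = {p. \<forall>m\<in>Poly_Mapping.keys p. Poly_Mapping.keys m \<subseteq> V}"

text \<open>The algebra homomorphism sending each variable \<open>v\<close> to \<open>f v\<close>:\<close>

definition psubst :: "('v \<Rightarrow> 'w cpoly) \<Rightarrow> 'v cpoly \<Rightarrow> 'w cpoly"
  where "psubst f p = (\<Sum>m\<in>Poly_Mapping.keys p.
    pconst (Poly_Mapping.lookup p m) * (\<Prod>v\<in>Poly_Mapping.keys m. f v ^ Poly_Mapping.lookup m v))"

definition cspan :: "'v cpoly set \<Rightarrow> 'v cpoly set"
  where "cspan = module.span (\<lambda>c p. pconst c * p)"


section \<open>The symplectic Pluecker algebra\<close>

definition tuples :: "nat \<Rightarrow> nat \<Rightarrow> int list set"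
  where "tuples n k = {t. set t \<subseteq> signed_range n \<and> sorted_wrt (\<lessdot>) t \<and> length t = k}"

definition all_tuples :: "nat \<Rightarrow> int list set"
  where "all_tuples n = (\<Union>k\<in>{1..n}. tuples n k)"

text \<open>The variable with arbitrary subscripts; \<open>permute_list \<sigma> [i\<^sub>1, \<dots>, i\<^sub>k]\<close> is
  \<open>[i\<^sub>\<sigma>\<^sub>(\<^sub>1\<^sub>), \<dots>, i\<^sub>\<sigma>\<^sub>(\<^sub>k\<^sub>)]\<close>.\<close>

definition Xvar :: "int list \<Rightarrow> int list cpoly"
  where "Xvar t =
    (if distinct t then
       let \<sigma> = (THE \<sigma>. \<sigma> permutes {..<length t} \<and> sorted_wrt (\<lessdot>) (permute_list \<sigma> t))
       in of_int (sign \<sigma>) * pvar (permute_list \<sigma> t)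
     else 0)"

definition pluecker_minor :: "int list \<Rightarrow> (int \<times> int) cpoly"
  where "pluecker_minor t = Determinant.det
    (Matrix.mat (length t) (length t) (\<lambda>(i, l). pvar (int i + 1, t ! l)))"

definition I_A :: "nat \<Rightarrow> int list cpoly set"
  where "I_A n = {p \<in> pring (all_tuples n). psubst pluecker_minor p = 0}"

definition L_space :: "nat \<Rightarrow> int list cpoly set"
  where "L_space n =
    cspan {\<Sum>l=1..int n. Xvar (t @ [l, - l]) | t. \<exists>k. k + 2 \<le> n \<and> t \<in> tuples n k}"

definition admissible :: "nat \<Rightarrow> int list \<Rightarrow> bool"
  where "admissible n t \<longleftrightarrow>
    distinct t \<and> (\<forall>l\<in>{1..n}. card {i \<in> set t. \<bar>i\<bar> \<le> int l} \<le> l)"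

definition Theta :: "nat \<Rightarrow> int list set"
  where "Theta n = {t \<in> all_tuples n. admissible n t}"

definition Theta' :: "nat \<Rightarrow> int list set"
  where "Theta' n = {t \<in> all_tuples n. \<not> admissible n t}"

definition straighten :: "nat \<Rightarrow> int list \<Rightarrow> int list cpoly"
  where "straighten n t = (THE R. R \<in> cspan (pvar ` Theta n) \<and> pvar t - R \<in> L_space n)"

definition rho1 :: "nat \<Rightarrow> int list cpoly \<Rightarrow> int list cpoly"
  where "rho1 n = psubst (\<lambda>t. if t \<in> Theta' n then straighten n t else pvar t)"

definition I_C :: "nat \<Rightarrow> int list cpoly set"
  where "I_C n = rho1 n ` I_A n"

definition Theta_ring :: "nat \<Rightarrow> int list cpoly ring"
  where "Theta_ring n =
    \<lparr>carrier = pring (Theta n), mult = (*), one = 1, zero = 0, add = (+)\<rparr>"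

definition RC :: "nat \<Rightarrow> int list cpoly set ring"
  where "RC n = Theta_ring n Quot I_C n"

definition cls :: "nat \<Rightarrow> int list cpoly \<Rightarrow> int list cpoly set"
  where "cls n p = I_C n +>\<^bsub>Theta_ring n\<^esub> p"

definition homogeneous :: "nat \<Rightarrow> (nat \<Rightarrow> nat) \<Rightarrow> int list cpoly \<Rightarrow> bool"
  where "homogeneous n \<mu> p \<longleftrightarrow> (\<forall>m\<in>Poly_Mapping.keys p. \<forall>k\<in>{1..n}.
    (\<Sum>t\<in>{t\<in>Poly_Mapping.keys m. length t = k}. Poly_Mapping.lookup m t) = \<mu> k)"

definition RC_comp :: "nat \<Rightarrow> (nat \<Rightarrow> nat) \<Rightarrow> int list cpoly set set"
  where "RC_comp n \<mu> = cls n ` {p \<in> pring (Theta n). homogeneous n \<mu> p}"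


section \<open>The orders\<close>

definition row_exc :: "(int \<times> int) set \<Rightarrow> int \<Rightarrow> int \<Rightarrow> int \<Rightarrow> bool"
  where "row_exc \<O> i j1 j2 \<longleftrightarrow>
    (i, j1) \<in> \<O> \<and> \<not> (\<exists>j'. j1 \<lessdot> j' \<and> (j' \<lessdot> j2 \<or> j' = j2) \<and> (i, j') \<in> \<O>)"

definition pos_less :: "nat \<Rightarrow> (int \<times> int) set \<Rightarrow> int \<times> int \<Rightarrow> int \<times> int \<Rightarrow> bool"
  where "pos_less n \<O> p q \<longleftrightarrow> (\<exists>i1 j1 i2 j2. (i1, j1) \<in> poset n \<and> (i2, j2) \<in> poset n \<and>
    p = (i1, r_map n \<O> i1 j1) \<and> q = (i2, r_map n \<O> i2 j2) \<and>
    (i1 < i2 \<or> (i1 = i2 \<and>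
      ((j1 \<lessdot> j2 \<and> \<not> row_exc \<O> i1 j1 j2) \<or> (j2 \<lessdot> j1 \<and> row_exc \<O> i1 j2 j1)))))"

text \<open>Note the reversal: the vector with the larger first differing coordinate is smaller.\<close>

definition vec_less ::
    "nat \<Rightarrow> (int \<times> int) set \<Rightarrow> (int \<times> int \<Rightarrow>\<^sub>0 int) \<Rightarrow> (int \<times> int \<Rightarrow>\<^sub>0 int) \<Rightarrow> bool"
  where "vec_less n \<O> d d' \<longleftrightarrow> (\<exists>p\<in>poset n. Poly_Mapping.lookup d p > Poly_Mapping.lookup d' p \<and>
    (\<forall>q\<in>poset n. pos_less n \<O> q p \<longrightarrow> Poly_Mapping.lookup d q = Poly_Mapping.lookup d' q))"

text \<open>The order \<open>-1 \<lessdot>' 1 \<lessdot>' -2 \<lessdot>' 2 \<lessdot>' \<dots> \<lessdot>' -n \<lessdot>' n\<close>:\<close>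

definition nless' :: "int \<Rightarrow> int \<Rightarrow> bool"
  where "nless' i j \<longleftrightarrow> \<bar>i\<bar> < \<bar>j\<bar> \<or> (\<bar>i\<bar> = \<bar>j\<bar> \<and> i < j)"

definition wt_less :: "nat \<Rightarrow> (int \<Rightarrow>\<^sub>0 int) \<Rightarrow> (int \<Rightarrow>\<^sub>0 int) \<Rightarrow> bool"
  where "wt_less n a b \<longleftrightarrow> (\<exists>i\<in>signed_range n. Poly_Mapping.lookup a i < Poly_Mapping.lookup b i \<and>
    (\<forall>j\<in>signed_range n. nless' j i \<longrightarrow> Poly_Mapping.lookup a j = Poly_Mapping.lookup b j))"

definition wt_A :: "nat \<Rightarrow> (int \<times> int \<Rightarrow>\<^sub>0 int) \<Rightarrow> (int \<Rightarrow>\<^sub>0 int)"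
  where "wt_A n x = (\<Sum>(i, j)\<in>poset n.
    Poly_Mapping.single j (Poly_Mapping.lookup x (i, j)) - Poly_Mapping.single i (Poly_Mapping.lookup x (i, j)))"

definition less_A ::
    "nat \<Rightarrow> (int \<times> int) set \<Rightarrow> (int \<times> int \<Rightarrow>\<^sub>0 int) \<Rightarrow> (int \<times> int \<Rightarrow>\<^sub>0 int) \<Rightarrow> bool"
  where "less_A n \<O> x y \<longleftrightarrow>
    wt_less n (wt_A n x) (wt_A n y) \<or> (wt_A n x = wt_A n y \<and> vec_less n \<O> x y)"

definition less_A_xi ::
    "nat \<Rightarrow> (int \<times> int) set \<Rightarrow> (int \<times> int \<Rightarrow>\<^sub>0 int) \<Rightarrow> (int \<times> int \<Rightarrow>\<^sub>0 int) \<Rightarrow> bool"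
  where "less_A_xi n \<O> x y \<longleftrightarrow> less_A n \<O> (xi n \<O> x) (xi n \<O> y)"


section \<open>The function field and the valuation\<close>

text \<open>\<open>J_of n \<O> t\<close> is the order ideal indexing the variable with subscripts \<open>t\<close>.\<close>

definition J_of :: "nat \<Rightarrow> (int \<times> int) set \<Rightarrow> int list \<Rightarrow> (int \<times> int) set"
  where "J_of n \<O> t = (THE J. J \<in> ideals_k n (length t) \<and>
    (let X = Xvar (map (w_OJ n \<O> J) [1..int (length t)]) in pvar t = X \<or> pvar t = - X))"

definition expo :: "nat \<Rightarrow> (int \<times> int) set \<Rightarrow> (int list \<Rightarrow>\<^sub>0 nat) \<Rightarrow> (int \<times> int \<Rightarrow>\<^sub>0 int)"
  where "expo n \<O> m = (\<Sum>t\<in>Poly_Mapping.keys m.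
    frag_cmul (int (Poly_Mapping.lookup m t)) (xi n \<O> (ind (M_set \<O> (J_of n \<O> t)))))"

definition filt :: "nat \<Rightarrow> (int \<times> int) set \<Rightarrow> (int \<times> int \<Rightarrow>\<^sub>0 int) \<Rightarrow> int list cpoly set"
  where "filt n \<O> x = cspan {Poly_Mapping.single m 1 | m.
    Poly_Mapping.keys m \<subseteq> Theta n \<and> (less_A n \<O> (expo n \<O> m) x \<or> expo n \<O> m = x)}"

definition nu :: "nat \<Rightarrow> (int \<times> int) set \<Rightarrow> int list cpoly set \<Rightarrow> (int \<times> int \<Rightarrow>\<^sub>0 int)"
  where "nu n \<O> p = (THE x. x \<in> vecs n \<and> p \<in> cls n ` filt n \<O> x \<and>
    (\<forall>y\<in>vecs n. p \<in> cls n ` filt n \<O> y \<longrightarrow> less_A n \<O> x y \<or> x = y))"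

text \<open>Rational functions on \<open>F\<close> are equivalence classes of pairs \<open>(p, q)\<close> of elements of the same
  homogeneous component of the Pluecker algebra with \<open>q \<noteq> 0\<close>.\<close>

definition frac_pairs :: "nat \<Rightarrow> (int list cpoly set \<times> int list cpoly set) set"
  where "frac_pairs n = {(p, q). \<exists>\<mu>. p \<in> RC_comp n \<mu> \<and> q \<in> RC_comp n \<mu> \<and> q \<noteq> \<zero>\<^bsub>RC n\<^esub>}"

definition frac_rel :: "nat \<Rightarrow>
    ((int list cpoly set \<times> int list cpoly set) \<times> (int list cpoly set \<times> int list cpoly set)) set"
  where "frac_rel n = {((p, q), (p', q')). (p, q) \<in> frac_pairs n \<and> (p', q') \<in> frac_pairs n \<and>
    p \<otimes>\<^bsub>RC n\<^esub> q' = p' \<otimes>\<^bsub>RC n\<^esub> q}"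

type_synonym rat_fun = "(int list cpoly set \<times> int list cpoly set) set"

definition ratio :: "nat \<Rightarrow> int list cpoly set \<Rightarrow> int list cpoly set \<Rightarrow> rat_fun"
  where "ratio n p q = frac_rel n `` {(p, q)}"

definition CF :: "nat \<Rightarrow> rat_fun ring"
  where "CF n = \<lparr>
    carrier = frac_pairs n // frac_rel n,
    mult = (\<lambda>f g. \<Union>(p, q)\<in>f. \<Union>(p', q')\<in>g. ratio n (p \<otimes>\<^bsub>RC n\<^esub> p') (q \<otimes>\<^bsub>RC n\<^esub> q')),
    one = ratio n \<one>\<^bsub>RC n\<^esub> \<one>\<^bsub>RC n\<^esub>,
    zero = ratio n \<zero>\<^bsub>RC n\<^esub> \<one>\<^bsub>RC n\<^esub>,
    add = (\<lambda>f g. \<Union>(p, q)\<in>f. \<Union>(p', q')\<in>g.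
      ratio n ((p \<otimes>\<^bsub>RC n\<^esub> q') \<oplus>\<^bsub>RC n\<^esub> (p' \<otimes>\<^bsub>RC n\<^esub> q)) (q \<otimes>\<^bsub>RC n\<^esub> q'))\<rparr>"

definition CF_const :: "nat \<Rightarrow> complex \<Rightarrow> rat_fun"
  where "CF_const n c = ratio n (cls n (pconst c)) \<one>\<^bsub>RC n\<^esub>"

definition nu_F :: "nat \<Rightarrow> (int \<times> int) set \<Rightarrow> rat_fun \<Rightarrow> (int \<times> int \<Rightarrow>\<^sub>0 int)"
  where "nu_F n \<O> h = the_elem ((\<lambda>(p, q). nu n \<O> p - nu n \<O> q) ` h)"

definition nu_xi :: "nat \<Rightarrow> (int \<times> int) set \<Rightarrow> rat_fun \<Rightarrow> (int \<times> int \<Rightarrow>\<^sub>0 int)"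
  where "nu_xi n \<O> h = inv_into (vecs n) (xi n \<O>) (nu_F n \<O> h)"


section \<open>Newton--Okounkov bodies\<close>

definition total_group_order ::
    "nat \<Rightarrow> ((int \<times> int \<Rightarrow>\<^sub>0 int) \<Rightarrow> (int \<times> int \<Rightarrow>\<^sub>0 int) \<Rightarrow> bool) \<Rightarrow> bool"
  where "total_group_order n lt \<longleftrightarrow>
    (\<forall>x\<in>vecs n. \<not> lt x x) \<and>
    (\<forall>x\<in>vecs n. \<forall>y\<in>vecs n. \<forall>z\<in>vecs n. lt x y \<and> lt y z \<longrightarrow> lt x z) \<and>
    (\<forall>x\<in>vecs n. \<forall>y\<in>vecs n. x \<noteq> y \<longrightarrow> lt x y \<or> lt y x) \<and>
    (\<forall>x\<in>vecs n. \<forall>y\<in>vecs n. \<forall>z\<in>vecs n. lt x y \<longrightarrow> lt (x + z) (y + z))"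

definition is_valuation ::
    "nat \<Rightarrow> ((int \<times> int \<Rightarrow>\<^sub>0 int) \<Rightarrow> (int \<times> int \<Rightarrow>\<^sub>0 int) \<Rightarrow> bool) \<Rightarrow>
      (rat_fun \<Rightarrow> (int \<times> int \<Rightarrow>\<^sub>0 int)) \<Rightarrow> bool"
  where "is_valuation n lt \<nu> \<longleftrightarrow>
    (let K = carrier (CF n) - {\<zero>\<^bsub>CF n\<^esub>} in
      (\<forall>f\<in>K. \<nu> f \<in> vecs n) \<and>
      (\<forall>f\<in>K. \<forall>g\<in>K. \<nu> (f \<otimes>\<^bsub>CF n\<^esub> g) = \<nu> f + \<nu> g) \<and>
      (\<forall>f\<in>K. \<forall>c. c \<noteq> 0 \<longrightarrow> \<nu> (CF_const n c \<otimes>\<^bsub>CF n\<^esub> f) = \<nu> f) \<and>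
      (\<forall>f\<in>K. \<forall>g\<in>K. f \<oplus>\<^bsub>CF n\<^esub> g \<noteq> \<zero>\<^bsub>CF n\<^esub> \<longrightarrow>
        (let mx = (if lt (\<nu> f) (\<nu> g) then \<nu> g else \<nu> f); s = \<nu> (f \<oplus>\<^bsub>CF n\<^esub> g)
         in lt s mx \<or> s = mx)))"

text \<open>The equivariant line bundle \<open>\<L>\<close> on \<open>F\<close> of weight \<open>a\<close> enters through its space of global
  sections, which is the homogeneous component of degree \<open>a\<close> of the Pluecker algebra; the tensor
  power \<open>\<L>\<^sup>m\<close> has weight \<open>m a\<close>, and tensor products of sections are products in the algebra.\<close>

definition H0 :: "nat \<Rightarrow> (nat \<Rightarrow> nat) \<Rightarrow> int list cpoly set set"
  where "H0 n a = RC_comp n a"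

definition tau :: "nat \<Rightarrow> (nat \<Rightarrow> nat) \<Rightarrow> int list cpoly set"
  where "tau n a = cls n (\<Prod>k=1..n. Xvar [1..int k] ^ a k)"

text \<open>The body is only defined for a nonzero section and a valuation with respect to a total
  group order.\<close>

definition NO_body :: "nat \<Rightarrow> (nat \<Rightarrow> nat) \<Rightarrow> int list cpoly set \<Rightarrow>
    ((int \<times> int \<Rightarrow>\<^sub>0 int) \<Rightarrow> (int \<times> int \<Rightarrow>\<^sub>0 int) \<Rightarrow> bool) \<Rightarrow>
    (rat_fun \<Rightarrow> (int \<times> int \<Rightarrow>\<^sub>0 int)) \<Rightarrow> (int \<times> int \<Rightarrow>\<^sub>0 real) set"
  where "NO_body n a \<tau> lt \<nu> =
    (if \<tau> \<in> H0 n a - {\<zero>\<^bsub>RC n\<^esub>} \<and> total_group_order n lt \<and> is_valuation n lt \<nu>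
     then closure (convex hull
       {(1 / real m) *\<^sub>R Poly_Mapping.map real_of_int (\<nu> (ratio n \<sigma> (\<tau> [^]\<^bsub>RC n\<^esub> m))) | m \<sigma>.
          0 < m \<and> \<sigma> \<in> H0 n (\<lambda>k. m * a k) - {\<zero>\<^bsub>RC n\<^esub>}})
     else undefined)"

end

theory Submission
  imports Defs
begin

text \<open>The Pluecker algebra is mapped to Laurent polynomials by taking minors of a generic matrix with
  isotropic rows in which the entries \<open>(i, j) \<in> P\<close> are independent variables. For the order
  \<open><\<^sub>A\<close> the leading exponent of the minor attached to an order ideal \<open>J\<close> is the image under
  \<open>\<xi>\<close> of the indicator vector of \<open>M\<^sub>O(J)\<close>. Monomials whose order ideals form a chain have
  distinct leading exponents, so they are linearly independent. On the other hand the Pluecker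
  relations and the linear relations express everything through the monomials that are standard for
  the order \<open>-1 < 1 < -2 < 2 < \<dots>\<close>, and these inject into the chain monomials. Hence both families are
  bases, \<open>\<nu>\<close> is the leading exponent, and its values on sections are, up to \<open>\<xi>\<close>, the sums of
  indicator vectors of sets \<open>M\<^sub>O(J)\<close> with \<open>a\<^sub>k\<close> summands from \<open>J\<^sub>k\<close>. A point of the polytope is the
  average of such sums over level sets of an antitone function on the poset.\<close>

section \<open>Polynomials and Laurent polynomials\<close>

text \<open>The entries \<open>(i, j)\<close> with \<open>|j| < i\<close> of an isotropic flag
  cannot be chosen freely; orthogonality forces them. The comparison of weights, which comes first
  in \<open>less_A\<close>, is what removes them: a forced entry has strictly smaller weight than a
  variable in its place would have, so it drops out of every leading term. Within one weight the
  entries of \<open>w_OJ\<close> are the greedy choice, row by row, for the order on the poset; this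
  makes a single Leibniz term dominant. No straightening law adapted to a general
  \<open>\<O>\<close> is used: spanning is proved for a tableau order that does not mention
  \<open>\<O>\<close>, and \<open>\<O>\<close> enters only through a count. The same device serves
  the variables: that every admissible set comes from an order ideal is checked for the diagonal and
  transferred by comparing cardinalities. As \<open>I_C\<close> is defined as an image, it is not
  clear beforehand that the algebra is a domain. This too is a consequence of the bases, which
  identify \<open>I_C\<close> on each graded piece with the kernel of the map to Laurent
  polynomials.\<close>

abbreviation lk :: "('a \<Rightarrow>\<^sub>0 'b::zero) \<Rightarrow> 'a \<Rightarrow> 'b" where "lk \<equiv> Poly_Mapping.lookup"
abbreviation ks :: "('a \<Rightarrow>\<^sub>0 'b::zero) \<Rightarrow> 'a set" where "ks \<equiv> Poly_Mapping.keys"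
abbreviation sg :: "'a \<Rightarrow> 'b \<Rightarrow> ('a \<Rightarrow>\<^sub>0 'b::zero)" where "sg \<equiv> Poly_Mapping.single"

lemma lk_notin_ks: "x \<notin> ks p \<Longrightarrow> lk p x = 0"
  by (simp add: in_keys_iff)

lemma sum_single_lookup: "finite M \<Longrightarrow> ks p \<subseteq> M \<Longrightarrow> (\<Sum>m\<in>M. sg m (lk p m)) = (p :: 'a \<Rightarrow>\<^sub>0 'b::comm_monoid_add)"
  by (intro poly_mapping_eqI)
     (auto simp: lookup_sum lookup_single when_def in_keys_iff sum.delta' cong: if_cong)

lemma lookup_single0_mult: "lk (sg 0 c * p) x = c * lk (p :: 'a::comm_monoid_add \<Rightarrow>\<^sub>0 complex) x"
  by (simp add: mult_map_scale_conv_mult[symmetric] Poly_Mapping.map.rep_eq when_def)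

lemma keys_single0_mult: "ks (sg 0 c * p) \<subseteq> ks (p :: 'a::comm_monoid_add \<Rightarrow>\<^sub>0 complex)"
  by (auto simp: in_keys_iff lookup_single0_mult)

lemma single0_neg1 [simp]: "sg 0 (- 1) = (- 1 :: 'a::comm_monoid_add \<Rightarrow>\<^sub>0 complex)"
  by (simp add: single_uminus)

lemma single0_1 [simp]: "sg 0 1 = (1 :: 'a::comm_monoid_add \<Rightarrow>\<^sub>0 complex)"
  by (rule single_one)

text \<open>The exponent monoid is left general, so that spans and independence are available for
  polynomials and for Laurent polynomials alike.\<close>

interpretation pv: vector_space "\<lambda>(c::complex) (p::('b::comm_monoid_add \<Rightarrow>\<^sub>0 complex)). sg 0 c * p"
  by unfold_locales (auto simp: algebra_simps single_add mult_single)

lemma cspan_eq: "cspan = pv.span"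
  by (simp add: cspan_def pconst_def fun_eq_iff)

subsection \<open>Evaluation homomorphisms\<close>

definition mev :: "('v \<Rightarrow> ('b::comm_monoid_add \<Rightarrow>\<^sub>0 complex)) \<Rightarrow> ('v \<Rightarrow>\<^sub>0 nat) \<Rightarrow> ('b \<Rightarrow>\<^sub>0 complex)"
  where "mev f m = (\<Prod>v\<in>ks m. f v ^ lk m v)"

text \<open>This is \<open>psubst\<close> with a target whose exponents may lie in any commutative
  monoid; the target needed later has integer exponents of either sign.\<close>

definition psub :: "('v \<Rightarrow> ('b::comm_monoid_add \<Rightarrow>\<^sub>0 complex)) \<Rightarrow> 'v cpoly \<Rightarrow> ('b \<Rightarrow>\<^sub>0 complex)"
  where "psub f p = (\<Sum>m\<in>ks p. sg 0 (lk p m) * mev f m)"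

lemma psubst_eq: "psubst f p = psub f p"
  by (simp add: psubst_def psub_def mev_def pconst_def)

lemma mev_superset: "finite V \<Longrightarrow> ks m \<subseteq> V \<Longrightarrow> mev f m = (\<Prod>v\<in>V. f v ^ lk m v)"
  unfolding mev_def by (rule prod.mono_neutral_left) (auto simp: in_keys_iff)

lemma mev_add: "mev f (m + m') = mev f m * mev f m'"
proof -
  let ?V = "ks m \<union> ks m'"
  have "ks (m + m') \<subseteq> ?V" by (rule keys_add)
  then show ?thesis
    by (simp add: mev_superset[where V = ?V] lookup_add power_add prod.distrib)
qed

lemma mev_0 [simp]: "mev f 0 = 1" by (simp add: mev_def)

lemma mev_single: "mev f (sg v k) = f v ^ k"
  by (cases "k = 0") (auto simp: mev_def)

lemma psub_superset: "finite M \<Longrightarrow> ks p \<subseteq> M \<Longrightarrow> psub f p = (\<Sum>m\<in>M. sg 0 (lk p m) * mev f m)"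
  unfolding psub_def by (rule sum.mono_neutral_left) (auto simp: in_keys_iff)

lemma psub_add: "psub f (p + q) = psub f p + psub f q"
proof -
  let ?M = "ks p \<union> ks q"
  have "ks (p + q) \<subseteq> ?M" by (rule keys_add)
  then show ?thesis
    by (simp add: psub_superset[where M = ?M] lookup_add single_add algebra_simps sum.distrib)
qed

lemma psub_0 [simp]: "psub f 0 = 0" by (simp add: psub_def)

lemma psub_single: "psub f (sg m c) = sg 0 c * mev f m"
  by (cases "c = 0") (auto simp: psub_def)

lemma psub_uminus: "psub f (- p) = - psub f p"
  by (metis add.right_inverse add_eq_0_iff psub_0 psub_add)

lemma psub_diff: "psub f (p - q) = psub f p - psub f q"
  by (metis psub_add psub_uminus add_uminus_conv_diff)

lemma psub_sum: "psub f (\<Sum>i\<in>I. g i) = (\<Sum>i\<in>I. psub f (g i))"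
  by (induction I rule: infinite_finite_induct) (auto simp: psub_add)

lemma psub_mult: "psub f (p * q) = psub f p * psub f q"
proof -
  have p: "p = (\<Sum>m\<in>ks p. sg m (lk p m))" and q: "q = (\<Sum>m\<in>ks q. sg m (lk q m))"
    by (simp_all add: sum_single_lookup)
  have "psub f (p * q) = psub f (\<Sum>m\<in>ks p. \<Sum>m'\<in>ks q. sg (m + m') (lk p m * lk q m'))"
    by (subst p, subst q) (simp add: sum_product mult_single)
  also have "\<dots> = (\<Sum>m\<in>ks p. \<Sum>m'\<in>ks q. (sg 0 (lk p m) * mev f m) * (sg 0 (lk q m') * mev f m'))"
    unfolding psub_sum psub_single mev_add
    by (intro sum.cong refl) (metis (no_types, lifting) add.right_neutral mult.assoc mult.left_commute mult_single)
  also have "\<dots> = psub f p * psub f q"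
    by (simp add: psub_def sum_product)
  finally show ?thesis .
qed

lemma psub_1 [simp]: "psub f 1 = 1"
  by (metis mev_0 mult.right_neutral psub_single single_one)

lemma psub_power: "psub f (p ^ k) = psub f p ^ k"
  by (induction k) (auto simp: psub_mult)

lemma psub_prod: "psub f (\<Prod>i\<in>I. g i) = (\<Prod>i\<in>I. psub f (g i))"
  by (induction I rule: infinite_finite_induct) (auto simp: psub_mult)

lemma psub_pvar [simp]: "psub f (pvar v) = f v"
  by (simp add: pvar_def psub_single mev_single)

lemma psub_scale: "psub f (sg 0 c * p) = sg 0 c * psub f p"
  by (simp add: psub_mult psub_single)

lemma psub_of_int: "psub f (of_int k) = of_int k"
  by (metis mev_0 mult.right_neutral psub_single single_of_int)

lemma psub_comp: "psub g (psub f p) = psub (\<lambda>v. psub g (f v)) p"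
  unfolding psub_def[of f p] psub_def[of "\<lambda>v. psub g (f v)" p]
  by (simp add: psub_sum psub_scale mev_def psub_prod psub_power)

lemma psub_cong: "p \<in> pring V \<Longrightarrow> (\<And>v. v \<in> V \<Longrightarrow> f v = g v) \<Longrightarrow> psub f p = psub g p"
proof -
  assume *: "p \<in> pring V" "\<And>v. v \<in> V \<Longrightarrow> f v = g v"
  have "mev f m = mev g m" if "m \<in> ks p" for m
  proof -
    have "ks m \<subseteq> V" using * that by (auto simp: pring_def)
    then show ?thesis unfolding mev_def using *(2) by (intro prod.cong) (auto dest: subsetD)
  qed
  then show ?thesis by (simp add: psub_def)
qed

lemma mev_pvar: "mev pvar m = sg m 1"
proof -
  have pw: "pvar v ^ k = sg (sg v k) 1" for v k
  proof (induction k)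
    case (Suc k)
    have "pvar v * sg (sg v k) (1::complex) = sg (sg v (Suc k)) 1"
      by (simp add: pvar_def mult_single flip: single_add)
    then show ?case using Suc by simp
  qed auto
  have pr: "finite V \<Longrightarrow> (\<Prod>v\<in>V. sg (h v) (1::complex)) = sg (\<Sum>v\<in>V. h v) 1" for V and h :: "'a \<Rightarrow> 'a \<Rightarrow>\<^sub>0 nat"
    by (induction V rule: finite_induct) (auto simp: mult_single)
  show ?thesis unfolding mev_def pw pr[OF finite_keys] by (simp add: sum_single_lookup)
qed

lemma psub_pvar_id: "psub pvar p = p"
  by (simp add: psub_def mev_pvar mult_single sum_single_lookup)

subsection \<open>Polynomials in a given set of variables\<close>

lemma pring_0 [simp]: "0 \<in> pring V" and pring_1 [simp]: "1 \<in> pring V"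
  by (auto simp: pring_def)

lemma pring_single: "ks m \<subseteq> V \<Longrightarrow> sg m c \<in> pring V"
  by (auto simp: pring_def)

lemma pring_const [simp]: "sg 0 c \<in> pring V"
  by (auto simp: pring_def)

lemma pring_pvar: "v \<in> V \<Longrightarrow> pvar v \<in> pring V"
  by (auto simp: pring_def pvar_def)

lemma pring_add: "p \<in> pring V \<Longrightarrow> q \<in> pring V \<Longrightarrow> p + q \<in> pring V"
  using keys_add[of p q] by (auto simp: pring_def)

lemma pring_uminus: "p \<in> pring V \<Longrightarrow> - p \<in> pring V"
  by (auto simp: pring_def in_keys_iff)

lemma pring_diff: "p \<in> pring V \<Longrightarrow> q \<in> pring V \<Longrightarrow> p - q \<in> pring V"
  by (metis pring_add pring_uminus add_uminus_conv_diff)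

lemma pring_mult: "p \<in> pring V \<Longrightarrow> q \<in> pring V \<Longrightarrow> p * q \<in> pring V"
proof -
  assume *: "p \<in> pring V" "q \<in> pring V"
  { fix m assume "m \<in> ks (p * q)"
    then obtain a b where "m = a + b" "a \<in> ks p" "b \<in> ks q" using keys_mult[of p q] by auto
    then have "ks a \<subseteq> V" "ks b \<subseteq> V" using * by (auto simp: pring_def)
    then have "ks m \<subseteq> V" using keys_add[of a b] \<open>m = a + b\<close> by blast }
  then show ?thesis by (auto simp: pring_def)
qed

lemma pring_sum: "(\<And>i. i \<in> I \<Longrightarrow> g i \<in> pring V) \<Longrightarrow> (\<Sum>i\<in>I. g i) \<in> pring V"
  by (induction I rule: infinite_finite_induct) (auto intro: pring_add)

lemma pring_prod: "(\<And>i. i \<in> I \<Longrightarrow> g i \<in> pring V) \<Longrightarrow> (\<Prod>i\<in>I. g i) \<in> pring V"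
  by (induction I rule: infinite_finite_induct) (auto intro: pring_mult)

lemma pring_power: "p \<in> pring V \<Longrightarrow> p ^ k \<in> pring V"
  by (induction k) (auto intro: pring_mult)

lemma pring_of_int [simp]: "of_int k \<in> pring V"
  by (metis pring_const single_of_int)

lemma pring_mono: "V \<subseteq> W \<Longrightarrow> p \<in> pring V \<Longrightarrow> p \<in> pring W"
  by (auto simp: pring_def)

lemma pring_psub: "p \<in> pring V \<Longrightarrow> (\<And>v. v \<in> V \<Longrightarrow> f v \<in> pring W) \<Longrightarrow> psub f p \<in> pring W"
proof -
  assume *: "p \<in> pring V" "\<And>v. v \<in> V \<Longrightarrow> f v \<in> pring W"
  { fix m assume "m \<in> ks p"
    then have "ks m \<subseteq> V" using *(1) by (auto simp: pring_def)
    then have "mev f m \<in> pring W" unfolding mev_def by (auto intro!: pring_prod pring_power *(2)) }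
  then show ?thesis unfolding psub_def by (auto intro!: pring_sum intro: pring_mult)
qed

lemma pring_cspan: "B \<subseteq> pring V \<Longrightarrow> p \<in> pv.span B \<Longrightarrow> p \<in> pring V"
proof -
  assume B: "B \<subseteq> pring V" and p: "p \<in> pv.span B"
  from p show ?thesis
  proof (induction rule: pv.span_induct_alt)
    case base then show ?case by simp
  next
    case (step c x y)
    then show ?case using B pring_add[OF pring_mult[OF pring_const]] by blast
  qed
qed

subsection \<open>Minors of the first rows of a matrix\<close>

text \<open>The Leibniz sum over an arbitrary commutative ring: leading terms, linear relations and
  Pluecker relations are all read off from its individual terms. Rows are numbered from 1, hence
  \<open>int i + 1\<close>.\<close>

definition minor :: "(int \<Rightarrow> int \<Rightarrow> 'a::comm_ring_1) \<Rightarrow> int list \<Rightarrow> 'a" where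
  "minor Z t = (\<Sum>p | p permutes {..<length t}. of_int (sign p) * (\<Prod>i<length t. Z (int i + 1) (t ! p i)))"

lemma bij_betw_comp_permutes:
  assumes "\<sigma> permutes A"
  shows "bij_betw (\<lambda>p. \<sigma> \<circ> p) {p. p permutes A} {p. p permutes A}"
proof (rule bij_betw_byWitness[where f' = "\<lambda>p. inv_into UNIV \<sigma> \<circ> p"])
  show "\<forall>p\<in>{p. p permutes A}. inv_into UNIV \<sigma> \<circ> (\<sigma> \<circ> p) = p"
    using assms by (simp add: o_assoc permutes_inv_o)
  show "\<forall>p\<in>{p. p permutes A}. \<sigma> \<circ> (inv_into UNIV \<sigma> \<circ> p) = p"
    using assms by (simp add: o_assoc permutes_inv_o)
  show "(\<lambda>p. \<sigma> \<circ> p) ` {p. p permutes A} \<subseteq> {p. p permutes A}"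
    using assms by (auto intro: permutes_compose)
  show "(\<lambda>p. inv_into UNIV \<sigma> \<circ> p) ` {p. p permutes A} \<subseteq> {p. p permutes A}"
    using assms by (auto intro: permutes_compose permutes_inv)
qed

lemma minor_permute:
  assumes "\<sigma> permutes {..<length t}"
  shows "minor Z (permute_list \<sigma> t) = of_int (sign \<sigma>) * minor Z t"
proof -
  let ?k = "length t"
  have perm: "permutation \<sigma>" using assms permutation_permutes by blast
  have "minor Z (permute_list \<sigma> t)
      = (\<Sum>p | p permutes {..<?k}. of_int (sign p) * (\<Prod>i<?k. Z (int i + 1) (t ! \<sigma> (p i))))"
    unfolding minor_def length_permute_list
  proof (intro sum.cong refl arg_cong2[of _ _ _ _ "(*)"] prod.cong)
    fix p i assume "p \<in> {p. p permutes {..<?k}}" "i \<in> {..<?k}"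
    then have "p i < ?k" using permutes_in_image[of p "{..<?k}" i] by auto
    then show "Z (int i + 1) (permute_list \<sigma> t ! p i) = Z (int i + 1) (t ! \<sigma> (p i))"
      using assms by (simp add: permute_list_nth)
  qed
  also have "\<dots> = (\<Sum>p | p permutes {..<?k}. of_int (sign \<sigma>) * (of_int (sign (\<sigma> \<circ> p)) * (\<Prod>i<?k. Z (int i + 1) (t ! (\<sigma> \<circ> p) i))))"
  proof (intro sum.cong refl)
    fix p assume "p \<in> {p. p permutes {..<?k}}"
    then have "permutation p" using permutation_permutes by blast
    then have "sign \<sigma> * sign (\<sigma> \<circ> p) = sign p" using perm by (simp add: sign_compose)
    then have "of_int (sign p) = (of_int (sign \<sigma>) * of_int (sign (\<sigma> \<circ> p)) :: 'a)"
      by (metis of_int_mult)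
    then show "of_int (sign p) * (\<Prod>i<?k. Z (int i + 1) (t ! \<sigma> (p i))) =
       of_int (sign \<sigma>) * (of_int (sign (\<sigma> \<circ> p)) * (\<Prod>i<?k. Z (int i + 1) (t ! (\<sigma> \<circ> p) i)))"
      by (simp add: mult.assoc)
  qed
  also have "\<dots> = of_int (sign \<sigma>) * minor Z t"
    unfolding minor_def sum_distrib_left[symmetric]
    by (subst sum.reindex_bij_betw[OF bij_betw_comp_permutes[OF assms], of "\<lambda>p. of_int (sign p) * (\<Prod>i<?k. Z (int i + 1) (t ! p i))"]) (rule refl)
  finally show ?thesis .
qed

lemma poly_mapping_eq_uminus_self: "x = - x \<Longrightarrow> x = (0 :: 'a \<Rightarrow>\<^sub>0 complex)"
proof (rule poly_mapping_eqI)
  fix k assume "x = - x"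
  then have "lk x k = - lk x k" by (metis lookup_uminus)
  then show "lk x k = lk 0 k" by simp
qed

text \<open>Composing with the transposition of \<open>a\<close> and \<open>b\<close> is a bijection
  of the permutations that changes the sign and preserves \<open>f\<close>, so the sum equals its
  own negative.\<close>

lemma sum_permutes_antisym:
  assumes "a \<noteq> b" "a \<in> A" "b \<in> A" "finite A"
    and "\<And>p. p permutes A \<Longrightarrow> f (p \<circ> Transposition.transpose a b) = (f p :: 'a::comm_monoid_add \<Rightarrow>\<^sub>0 complex)"
  shows "(\<Sum>p | p permutes A. of_int (sign p) * f p) = 0"
proof (rule poly_mapping_eq_uminus_self)
  let ?\<tau> = "Transposition.transpose a b"
  have t: "?\<tau> permutes A" using assms by (simp add: permutes_swap_id)
  have bij: "bij_betw (\<lambda>p. p \<circ> ?\<tau>) {p. p permutes A} {p. p permutes A}"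
    by (rule bij_betw_byWitness[where f' = "\<lambda>p. p \<circ> ?\<tau>"])
       (use t in \<open>auto simp: o_assoc[symmetric] intro: permutes_compose\<close>)
  have "(\<Sum>p | p permutes A. of_int (sign p) * f p)
      = (\<Sum>p | p permutes A. of_int (sign (p \<circ> ?\<tau>)) * f (p \<circ> ?\<tau>))"
    by (rule sum.reindex_bij_betw[OF bij, symmetric])
  also have "\<dots> = (\<Sum>p | p permutes A. - (of_int (sign p) * f p))"
  proof (intro sum.cong refl)
    fix p assume "p \<in> {p. p permutes A}"
    then have p: "p permutes A" by simp
    then have "sign (p \<circ> ?\<tau>) = - sign p"
      using assms(1,4) t permutation_permutes by (subst sign_compose) (auto simp: sign_swap_id)
    then show "of_int (sign (p \<circ> ?\<tau>)) * f (p \<circ> ?\<tau>) = - (of_int (sign p) * f p)"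
      using assms(5)[OF p] by simp
  qed
  also have "\<dots> = - (\<Sum>p | p permutes A. of_int (sign p) * f p)" by (rule sum_negf)
  finally show "(\<Sum>p | p permutes A. of_int (sign p) * f p) = - (\<Sum>p | p permutes A. of_int (sign p) * f p)" .
qed

lemma minor_not_distinct:
  fixes Z :: "int \<Rightarrow> int \<Rightarrow> 'a::comm_monoid_add \<Rightarrow>\<^sub>0 complex"
  assumes "\<not> distinct t"
  shows "minor Z t = 0"
proof -
  let ?k = "length t"
  obtain a b where ab: "a < ?k" "b < ?k" "a \<noteq> b" "t ! a = t ! b"
    using assms by (auto simp: distinct_conv_nth)
  let ?\<tau> = "Transposition.transpose a b"
  have t: "?\<tau> permutes {..<?k}" using ab by (simp add: permutes_swap_id)
  have "permute_list ?\<tau> t = t"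
    by (rule nth_equalityI) (use ab t in \<open>auto simp: permute_list_nth Transposition.transpose_def\<close>)
  then have "minor Z t = of_int (sign ?\<tau>) * minor Z t" using minor_permute[OF t, of Z] by simp
  then have "minor Z t = - minor Z t" using ab by (simp add: sign_swap_id)
  then show ?thesis by (rule poly_mapping_eq_uminus_self)
qed

lemma psub_minor: "psub f (minor Z t) = minor (\<lambda>i j. psub f (Z i j)) t"
  by (simp add: minor_def psub_sum psub_mult psub_of_int psub_prod)

lemma pluecker_minor_eq: "pluecker_minor t = minor (\<lambda>i j. pvar (i, j)) t"
proof -
  have e: "{0..<length t} = {..<length t}" by auto
  show ?thesis unfolding pluecker_minor_def minor_def
    by (subst Determinant.det_def'[of _ "length t"])
       (auto simp: e intro!: sum.cong prod.cong dest: permutes_in_image)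
qed

section \<open>The permutations attached to order ideals\<close>

definition comps :: "('b \<Rightarrow> 'a \<Rightarrow> 'a) \<Rightarrow> 'b list \<Rightarrow> 'a \<Rightarrow> 'a"
  where "comps g xs = foldr (\<lambda>x f. g x \<circ> f) xs id"

lemma comps_Nil [simp]: "comps g [] = id"
  and comps_Cons [simp]: "comps g (x # xs) = g x \<circ> comps g xs"
  by (simp_all add: comps_def)

lemma comps_append: "comps g (xs @ ys) = comps g xs \<circ> comps g ys"
  by (induction xs) auto

lemma comps_fix: "(\<And>y. y \<in> set xs \<Longrightarrow> g y x = x) \<Longrightarrow> comps g xs x = x"
  by (induction xs) auto

lemma permutes_comps: "(\<And>y. y \<in> set xs \<Longrightarrow> g y permutes A) \<Longrightarrow> comps g xs permutes A"
  by (induction xs) (auto simp: permutes_id id_def[symmetric] intro: permutes_compose)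

text \<open>The rightmost factor is applied first and carries \<open>i\<close> to
  \<open>last L\<close>; by distinctness no remaining factor moves that element. The head
  \<open>i\<close> accounts for the identity factor.\<close>

lemma comps_transpose_last:
  "distinct L \<Longrightarrow> L \<noteq> [] \<Longrightarrow> hd L = i \<Longrightarrow> comps (Transposition.transpose i) L i = last L"
proof (induction L rule: rev_induct)
  case (snoc y L)
  show ?case
  proof (cases "L = []")
    case False
    then have "y \<noteq> i" using snoc.prems by (metis distinct_append hd_append hd_in_set disjoint_iff list.set_intros(1))
    then have "comps (Transposition.transpose i) L y = y"
      using snoc.prems(1) by (intro comps_fix) (auto simp: Transposition.transpose_def)
    then show ?thesis by (simp add: comps_append)
  qed (use snoc in auto)
qed simp

locale marked_poset =
  fixes n :: nat and \<O> :: "(int \<times> int) set"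
  assumes n1: "1 \<le> n" and diag_O: "diag n \<subseteq> \<O>" and O_poset: "\<O> \<subseteq> poset n"
begin

text \<open>The place of \<open>j\<close> in the sequence \<open>1, ..., n, -n, ..., -1\<close>,
  from \<open>1\<close> to \<open>2 * n\<close>. It turns \<lessdot> into the order of the integers,
  so that comparisons become linear arithmetic.\<close>

definition ky :: "int \<Rightarrow> int" where "ky j = (if 0 < j then j else 2 * int n + 1 + j)"

definition rws :: "int \<Rightarrow> int set" where "rws i = {j. i \<le> \<bar>j\<bar> \<and> \<bar>j\<bar> \<le> int n}"

lemma poset_iff: "(i, j) \<in> poset n \<longleftrightarrow> 1 \<le> i \<and> i \<le> int n \<and> j \<in> rws i"
  by (auto simp: poset_def rws_def)

declare pleq.simps [simp del]

lemma subset_posetD: "M \<subseteq> poset n \<Longrightarrow> (i, j) \<in> M \<Longrightarrow> 1 \<le> i \<and> i \<le> int n \<and> j \<in> rws i"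
  using poset_iff by blast

lemma row1: "rws 1 = signed_range n"
  by (auto simp: rws_def signed_range_def)

lemma row_mono: "i \<le> i' \<Longrightarrow> rws i' \<subseteq> rws i"
  by (auto simp: rws_def)

lemma finite_row [simp]: "finite (rws i)"
  by (rule finite_subset[of _ "{- int n..int n}"]) (auto simp: rws_def)

lemma finite_poset [simp]: "finite (poset n)"
  by (rule finite_subset[of _ "{1..int n} \<times> {- int n..int n}"]) (auto simp: poset_def)

lemma O_row: "(i, j) \<in> \<O> \<Longrightarrow> 1 \<le> i \<and> i \<le> int n \<and> j \<in> rws i"
  using O_poset poset_iff by blast

lemma diag_in_O: "1 \<le> i \<Longrightarrow> i \<le> int n \<Longrightarrow> (i, i) \<in> \<O>"
  using diag_O by (auto simp: diag_def)

lemma ky_inj: "i \<in> rws 1 \<Longrightarrow> j \<in> rws 1 \<Longrightarrow> ky i = ky j \<longleftrightarrow> i = j"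
  by (auto simp: rws_def ky_def split: if_splits)

lemma ky_inj_row: "1 \<le> k \<Longrightarrow> i \<in> rws k \<Longrightarrow> j \<in> rws k \<Longrightarrow> ky i = ky j \<longleftrightarrow> i = j"
  using ky_inj row_mono[of 1 k] by auto

lemma nless_ky: "i \<in> rws 1 \<Longrightarrow> j \<in> rws 1 \<Longrightarrow> i \<lessdot> j \<longleftrightarrow> ky i < ky j"
  by (auto simp: rws_def ky_def nless_def split: if_splits)

lemma ky_bounds: "i \<in> rws 1 \<Longrightarrow> 1 \<le> ky i \<and> ky i \<le> 2 * int n"
  by (auto simp: rws_def ky_def split: if_splits)

lemma ky_diag: "1 \<le> i \<Longrightarrow> j \<in> rws i \<Longrightarrow> ky i \<le> ky j"
  by (auto simp: rws_def ky_def split: if_splits)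

lemma pleq_ky: "(i, j) \<in> poset n \<Longrightarrow> (i', j') \<in> poset n \<Longrightarrow> (i, j) \<preceq>\<^sub>P (i', j') \<longleftrightarrow> i \<le> i' \<and> ky j \<le> ky j'"
proof -
  assume "(i, j) \<in> poset n" "(i', j') \<in> poset n"
  then have "j \<in> rws 1" "j' \<in> rws 1" using row_mono[of 1] by (auto simp: poset_iff)
  then show ?thesis using nless_ky[of j j'] ky_inj[of j j'] by (auto simp: pleq.simps)
qed

lemma pprec_ky: "(i, j) \<in> poset n \<Longrightarrow> (i', j') \<in> poset n \<Longrightarrow>
    (i, j) \<prec>\<^sub>P (i', j') \<longleftrightarrow> i \<le> i' \<and> ky j \<le> ky j' \<and> (i, j) \<noteq> (i', j')"
  unfolding pprec_def using pleq_ky by auto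

lemma ex_max_ky: "finite S \<Longrightarrow> x \<in> S \<Longrightarrow> \<exists>p\<in>S. \<forall>j\<in>S. ky j \<le> ky p"
  using Max_in[of "ky ` S"] Max_ge[of "ky ` S"] by fastforce

section \<open>The product of one row as a permutation\<close>

definition js :: "int list" where "js = [1..int n] @ [- int n..-1]"

lemma set_js: "set js = rws 1" by (auto simp: js_def rws_def)

lemma sorted_upto_less: "sorted_wrt (<) [a..b::int]"
  by (induction a b rule: upto.induct) (subst upto.simps, auto)

lemma sorted_js: "sorted_wrt (\<lambda>a b. ky a < ky b) js"
proof -
  have "sorted_wrt (\<lambda>a b. ky a < ky b) [1..int n]"
    by (rule sorted_wrt_mono_rel[OF _ sorted_upto_less]) (auto simp: ky_def)
  moreover have "sorted_wrt (\<lambda>a b. ky a < ky b) [- int n..-1]"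
    by (rule sorted_wrt_mono_rel[OF _ sorted_upto_less]) (auto simp: ky_def)
  ultimately show ?thesis by (auto simp: js_def sorted_wrt_append ky_def)
qed

lemma distinct_js: "distinct js" by (auto simp: js_def)

definition rowl :: "(int \<times> int) set \<Rightarrow> int \<Rightarrow> int list" where "rowl M i = filter (\<lambda>j. (i, j) \<in> M) js"

definition rowp :: "(int \<times> int) set \<Rightarrow> int \<Rightarrow> int \<Rightarrow> int"
  where "rowp M i = comps (Transposition.transpose i) (rowl M i)"

lemma w_perm_eq: "w_perm n M = comps (rowp M) [1..int n]"
proof -
  define F :: "int \<times> int \<Rightarrow> (int \<Rightarrow> int) \<Rightarrow> (int \<Rightarrow> int)" where "F = (\<lambda>(i, j) f. Transposition.transpose i j \<circ> f)"
  have inner: "foldr F [(i, j). j \<leftarrow> ys, (i, j) \<in> M] g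
      = comps (Transposition.transpose i) (filter (\<lambda>j. (i, j) \<in> M) ys) \<circ> g" for ys i g
    by (induction ys) (auto simp: F_def o_assoc)
  have "foldr F [(i, j). i \<leftarrow> is, j \<leftarrow> js, (i, j) \<in> M] id = comps (rowp M) is" for "is"
    by (induction "is") (simp_all add: inner rowp_def rowl_def)
  then show ?thesis by (simp add: w_perm_def F_def js_def)
qed

lemma transpose_permutes_row: "1 \<le> i \<Longrightarrow> i \<le> int n \<Longrightarrow> j \<in> rws i \<Longrightarrow> Transposition.transpose i j permutes rws i"
  by (rule permutes_swap_id) (auto simp: rws_def)

lemma rowp_permutes: "M \<subseteq> poset n \<Longrightarrow> 1 \<le> i \<Longrightarrow> i \<le> int n \<Longrightarrow> rowp M i permutes rws i"
  unfolding rowp_def by (rule permutes_comps) (auto simp: rowl_def poset_iff intro!: transpose_permutes_row)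

lemma rowp_fix: "x \<noteq> i \<Longrightarrow> (i, x) \<notin> M \<Longrightarrow> rowp M i x = x"
  unfolding rowp_def by (rule comps_fix) (auto simp: rowl_def Transposition.transpose_def)

lemma sorted_rowl: "sorted_wrt (\<lambda>a b. ky a < ky b) (rowl M i)"
  unfolding rowl_def by (rule sorted_wrt_filter[OF sorted_js])

lemma set_rowl: "M \<subseteq> poset n \<Longrightarrow> set (rowl M i) = {j. (i, j) \<in> M}"
  using row_mono[of 1] by (fastforce simp: rowl_def set_js poset_iff)

lemma hd_sorted_ky:
  assumes "sorted_wrt (\<lambda>a b. ky a < ky b) L" "x \<in> set L" "\<And>y. y \<in> set L \<Longrightarrow> ky x \<le> ky y"
  shows "hd L = x"
  using assms by (cases L) force+

lemma last_sorted_ky: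
  assumes "sorted_wrt (\<lambda>a b. ky a < ky b) L" "x \<in> set L" "\<And>y. y \<in> set L \<Longrightarrow> ky y \<le> ky x"
  shows "last L = x"
  using assms by (cases L rule: rev_cases) (force simp: sorted_wrt_append)+

lemma rowp_last:
  assumes "M \<subseteq> poset n" "(i, i) \<in> M" "(i, l) \<in> M" "\<And>j. (i, j) \<in> M \<Longrightarrow> ky j \<le> ky l"
  shows "rowp M i i = l"
proof -
  have d: "distinct (rowl M i)" by (simp add: rowl_def distinct_js)
  have i: "1 \<le> i" using assms(1,2) by (auto simp: poset_iff)
  have hd: "hd (rowl M i) = i"
    using assms(1,2) i by (intro hd_sorted_ky[OF sorted_rowl]) (auto simp: set_rowl poset_iff intro!: ky_diag)
  have la: "last (rowl M i) = l"
    using assms by (intro last_sorted_ky[OF sorted_rowl]) (auto simp: set_rowl)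
  have ne: "rowl M i \<noteq> []" using set_rowl[OF assms(1), of i] assms(2) by auto
  show ?thesis unfolding rowp_def using comps_transpose_last[OF d ne hd] la by simp
qed

text \<open>Factors with index beyond \<open>x\<close> stand to the right, are applied first and fix
  \<open>x\<close>. Only the members of the row up to \<open>x\<close> can influence its
  image.\<close>

lemma rowp_cong:
  assumes "x \<noteq> i" "x \<in> rws 1" "\<And>y. y \<in> rws 1 \<Longrightarrow> ky y \<le> ky x \<Longrightarrow> (i, y) \<in> M \<longleftrightarrow> (i, y) \<in> M'"
  shows "rowp M i x = rowp M' i x"
proof -
  obtain L1 L2 where L: "js = L1 @ x # L2" using assms(2) set_js split_list by metis
  have s: "sorted_wrt (\<lambda>a b. ky a < ky b) (L1 @ x # L2)" using sorted_js L by simp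
  have fix2: "comps (Transposition.transpose i) (filter (\<lambda>j. (i, j) \<in> K) L2) x = x" for K
    using distinct_js L assms(1) by (intro comps_fix) (auto simp: Transposition.transpose_def)
  have eq: "filter (\<lambda>j. (i, j) \<in> M) (L1 @ [x]) = filter (\<lambda>j. (i, j) \<in> M') (L1 @ [x])"
    using s set_js L by (intro filter_cong refl assms(3)) (force simp: sorted_wrt_append)+
  have "rowp K i x = comps (Transposition.transpose i) (filter (\<lambda>j. (i, j) \<in> K) (L1 @ [x])) x" for K
  proof -
    have "rowl K i = filter (\<lambda>j. (i, j) \<in> K) (L1 @ [x]) @ filter (\<lambda>j. (i, j) \<in> K) L2"
      by (simp add: rowl_def L)
    then show ?thesis by (simp add: rowp_def comps_append fix2 del: filter_append)
  qed
  then show ?thesis by (simp only: eq)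
qed

text \<open>The factor of \<open>x\<close> carries \<open>x\<close> to \<open>i\<close>, and the
  factors before it carry \<open>i\<close> to the last of them, the predecessor of \<open>x\<close>.
  Together with \<open>rowp_last\<close> this shows that the product of a row is a cycle.\<close>

lemma rowp_prev:
  assumes M: "M \<subseteq> poset n" "(i, i) \<in> M" and x: "(i, x) \<in> M" "x \<noteq> i"
    and p: "(i, p) \<in> M" "ky p < ky x" "\<And>j. (i, j) \<in> M \<Longrightarrow> ky j < ky x \<Longrightarrow> ky j \<le> ky p"
  shows "rowp M i x = p"
proof -
  let ?c = "comps (Transposition.transpose i)"
  have i: "1 \<le> i" using M by (auto simp: poset_iff)
  obtain L1 L2 where L: "rowl M i = L1 @ x # L2" using x(1) set_rowl[OF M(1)] split_list by (metis mem_Collect_eq)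
  have s: "sorted_wrt (\<lambda>a b. ky a < ky b) (L1 @ x # L2)" using sorted_rowl L by metis
  have set: "set L1 \<union> {x} \<union> set L2 = {j. (i, j) \<in> M}" using set_rowl[OF M(1), of i] L by auto
  have d: "distinct (L1 @ x # L2)" using L distinct_js by (metis distinct_filter rowl_def)
  have L1: "y \<in> set L1 \<longleftrightarrow> (i, y) \<in> M \<and> ky y < ky x" for y
  proof
    assume "y \<in> set L1"
    moreover from this have "y \<in> {j. (i, j) \<in> M}" using set by blast
    ultimately show "(i, y) \<in> M \<and> ky y < ky x" using s by (simp add: sorted_wrt_append)
  next
    assume y: "(i, y) \<in> M \<and> ky y < ky x"
    then have "y \<in> set L1 \<union> {x} \<union> set L2" using set by blast
    moreover have "\<forall>z\<in>set L2. ky x < ky z" using s by (simp add: sorted_wrt_append)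
    ultimately show "y \<in> set L1" using y by fastforce
  qed
  have sL1: "sorted_wrt (\<lambda>a b. ky a < ky b) L1" using s by (simp add: sorted_wrt_append)
  have "?c L2 x = x" using d x(2) by (intro comps_fix) (auto simp: Transposition.transpose_def)
  then have "rowp M i x = ?c L1 i" by (simp add: rowp_def L comps_append)
  moreover have pL: "p \<in> set L1" using L1 p(1,2) by simp
  have ip: "ky i \<le> ky y" if "(i, y) \<in> M" for y
    using that M(1) i poset_iff[of i y] by (auto intro!: ky_diag)
  have iL: "i \<in> set L1"
  proof -
    have "ky i \<noteq> ky x" using x M i ky_inj_row[of i i x] poset_iff by (metis subsetD)
    then show ?thesis using ip[OF x(1)] L1 M(2) by simp
  qed
  have "hd L1 = i" by (rule hd_sorted_ky[OF sL1 iL]) (simp add: ip L1)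
  moreover have "last L1 = p" by (rule last_sorted_ky[OF sL1 pL]) (simp add: p(3) L1)
  ultimately show ?thesis using comps_transpose_last[of L1 i] d iL by (metis distinct_append empty_iff empty_set)
qed

text \<open>\<open>U i\<close> is the product of the factors of \<open>w\<^sub>O\<close> in the rows from \<open>i\<close> on; its inverse \<open>rr i\<close>
  turns out to be \<open>j \<mapsto> r(i, j)\<close>.\<close>

definition U :: "int \<Rightarrow> int \<Rightarrow> int" where "U i = comps (rowp \<O>) [i..int n]"
definition mid :: "int \<Rightarrow> int \<Rightarrow> int \<Rightarrow> int" where "mid i i' = comps (rowp \<O>) [i..i' - 1]"
definition rr :: "int \<Rightarrow> int \<Rightarrow> int" where "rr i = inv_into UNIV (U i)"

lemma U_permutes: "1 \<le> i \<Longrightarrow> U i permutes rws i"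
  unfolding U_def by (rule permutes_comps) (auto intro!: permutes_subset[OF rowp_permutes[OF O_poset]] row_mono)

lemma rr_permutes: "1 \<le> i \<Longrightarrow> rr i permutes rws i"
  unfolding rr_def by (rule permutes_inv[OF U_permutes])

lemma rr_in_row: "1 \<le> i \<Longrightarrow> rr i l \<in> rws i \<longleftrightarrow> l \<in> rws i"
  using rr_permutes permutes_in_image by metis

lemma U_in_row: "1 \<le> i \<Longrightarrow> U i l \<in> rws i \<longleftrightarrow> l \<in> rws i"
  using U_permutes permutes_in_image by metis

lemma rr_inj: "1 \<le> i \<Longrightarrow> rr i l = rr i l' \<longleftrightarrow> l = l'"
  using rr_permutes permutes_inj by (metis injD)

lemma U_rr: "1 \<le> i \<Longrightarrow> U i (rr i l) = l"
  unfolding rr_def using U_permutes permutes_inverses(1) by metis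

lemma rr_U: "1 \<le> i \<Longrightarrow> rr i (U i l) = l"
  unfolding rr_def using U_permutes permutes_inverses(2) by metis

lemma U_mid: "i \<le> i' \<Longrightarrow> i' \<le> int n + 1 \<Longrightarrow> U i = mid i i' \<circ> U i'"
proof (cases "i' \<le> int n")
  case True
  moreover assume "i \<le> i'"
  ultimately show ?thesis unfolding U_def mid_def comps_append[symmetric] by (simp add: upto_split1)
next
  case False
  moreover assume "i' \<le> int n + 1"
  ultimately have "i' = int n + 1" by simp
  then show ?thesis by (simp add: U_def mid_def)
qed

text \<open>A value of \<open>rr\<close> in row \<open>i'\<close> is rewritten as a value of
  \<open>rr\<close> in an earlier row \<open>i\<close>. This makes entries that belong to different
  rows comparable.\<close>

lemma rr_mid: "1 \<le> i \<Longrightarrow> i \<le> i' \<Longrightarrow> i' \<le> int n + 1 \<Longrightarrow> rr i' l = rr i (mid i i' l)"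
proof -
  assume *: "1 \<le> i" "i \<le> i'" "i' \<le> int n + 1"
  have "U i (rr i' l) = mid i i' l" using U_mid[OF *(2,3)] U_rr[of i' l] * by simp
  then show ?thesis using rr_U[of i "rr i' l"] * by simp
qed

text \<open>An element other than \<open>i\<close> is fixed or goes to its predecessor in
  \<open>\<O>\<close>, so it never moves upwards. Taking \<open>x\<close> from
  \<open>rws (i + 1)\<close> excludes the exceptional argument \<open>i\<close>.\<close>

lemma rowp_O_bound:
  assumes "1 \<le> i" "i \<le> int n" "x \<in> rws (i + 1)"
  shows "rowp \<O> i x \<in> rws i \<and> ky (rowp \<O> i x) \<le> ky x"
proof -
  have x: "x \<in> rws i" "x \<noteq> i" using assms by (auto simp: rws_def)
  have 1: "rowp \<O> i x \<in> rws i" using x(1) rowp_permutes[OF O_poset assms(1,2)] permutes_in_image by metis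
  have "ky (rowp \<O> i x) \<le> ky x"
  proof (cases "(i, x) \<in> \<O>")
    case False then show ?thesis using rowp_fix x by simp
  next
    case True
    let ?S = "{j \<in> rws i. (i, j) \<in> \<O> \<and> ky j < ky x}"
    have "ky i \<noteq> ky x" using x assms ky_inj_row[of i i x] by (auto simp: rws_def)
    then have "i \<in> ?S" using ky_diag[OF assms(1) x(1)] diag_in_O assms by (auto simp: rws_def)
    then obtain p where p: "p \<in> ?S" "\<And>j. j \<in> ?S \<Longrightarrow> ky j \<le> ky p"
      using ex_max_ky[of ?S] by auto
    have "rowp \<O> i x = p"
    proof (rule rowp_prev[OF O_poset])
      show "(i, i) \<in> \<O>" using diag_in_O assms by simp
      show "ky j \<le> ky p" if "(i, j) \<in> \<O>" "ky j < ky x" for j using p(2) O_row that by blast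
    qed (use True x p(1) in auto)
    then show ?thesis using p by auto
  qed
  with 1 show ?thesis by simp
qed

lemma mid_bound:
  assumes "i \<le> i'" "1 \<le> i" "i' \<le> int n" "x \<in> rws i'"
  shows "mid i i' x \<in> rws i \<and> ky (mid i i' x) \<le> ky x"
  using assms(1,2)
proof (induction i rule: int_le_induct)
  case base then show ?case using assms by (simp add: mid_def)
next
  case (step i)
  have "mid (i - 1) i' x = rowp \<O> (i - 1) (mid i i' x)"
    using step by (simp add: mid_def upto_rec1)
  moreover have "mid i i' x \<in> rws i \<and> ky (mid i i' x) \<le> ky x" using step by simp
  ultimately show ?case using rowp_O_bound[of "i - 1" "mid i i' x"] step assms by fastforce
qed

section \<open>Order ideals row by row\<close>

lemma M_set_subset: "J \<in> ideals n \<Longrightarrow> M_set \<O> J \<subseteq> J" and ideal_poset: "J \<in> ideals n \<Longrightarrow> J \<subseteq> poset n"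
  by (auto simp: M_set_def max_elems_def ideals_def)

lemma ideal_down: "J \<in> ideals n \<Longrightarrow> (i, j) \<in> J \<Longrightarrow> (i', j') \<in> poset n \<Longrightarrow> i' \<le> i \<Longrightarrow> ky j' \<le> ky j \<Longrightarrow> (i', j') \<in> J"
proof -
  assume *: "J \<in> ideals n" "(i, j) \<in> J" "(i', j') \<in> poset n" "i' \<le> i" "ky j' \<le> ky j"
  then have "(i, j) \<in> poset n" using ideal_poset by blast
  then have "(i', j') \<preceq>\<^sub>P (i, j)" using * by (subst pleq_ky) auto
  then show ?thesis using * unfolding ideals_def by blast
qed

lemma pleq_refl: "p \<in> poset n \<Longrightarrow> p \<preceq>\<^sub>P p"
  by (cases p) (simp add: pleq.simps)

lemma ideal_diag: "J \<in> ideals n \<Longrightarrow> (i, j) \<in> J \<Longrightarrow> (i, i) \<in> J"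
  using ideal_poset[of J] by (intro ideal_down[of J i j i i]) (auto simp: poset_iff rws_def intro!: ky_diag)

definition is_lst :: "(int \<times> int) set \<Rightarrow> int \<Rightarrow> int \<Rightarrow> bool"
  where "is_lst J i l \<longleftrightarrow> (i, l) \<in> M_set \<O> J \<and> (\<forall>j. (i, j) \<in> M_set \<O> J \<longrightarrow> ky j \<le> ky l)"

lemma is_lst_ex:
  assumes "J \<in> ideals n" "(i, i) \<in> J"
  shows "\<exists>l. is_lst J i l"
proof -
  let ?S = "{j. (i, j) \<in> M_set \<O> J}"
  have sub: "?S \<subseteq> rws i" using M_set_subset[OF assms(1)] ideal_poset[OF assms(1)] by (auto simp: poset_iff)
  then have fin: "finite ?S" using finite_subset finite_row by blast
  have "(i, i) \<in> \<O>" using subset_posetD[OF ideal_poset[OF assms(1)] assms(2)] by (simp add: diag_in_O)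
  then have "i \<in> ?S" using assms(2) by (auto simp: M_set_def)
  then obtain l where "l \<in> ?S" "\<And>j. j \<in> ?S \<Longrightarrow> ky j \<le> ky l"
    using ex_max_ky[OF fin] by blast
  then show ?thesis by (auto simp: is_lst_def)
qed

text \<open>A maximal element of \<open>J\<close> is the rightmost one of its row, so at most the
  last member of a row of \<open>M_set\<close> can lie outside \<open>\<O>\<close>. A row is
  therefore known once its last member is.\<close>

lemma is_lst_row:
  assumes J: "J \<in> ideals n" and l: "is_lst J i l"
  shows "(i, j) \<in> M_set \<O> J \<longleftrightarrow> j = l \<or> ((i, j) \<in> \<O> \<and> ky j < ky l)"
proof
  have ip: "M_set \<O> J \<subseteq> poset n" using M_set_subset[OF J] ideal_poset[OF J] by blast
  have lJ: "(i, l) \<in> J" "(i, l) \<in> poset n" using l M_set_subset[OF J] ip by (auto simp: is_lst_def)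
  { assume j: "(i, j) \<in> M_set \<O> J"
    then have jp: "(i, j) \<in> poset n" using ip by blast
    have le: "ky j \<le> ky l" using l j by (auto simp: is_lst_def)
    show "j = l \<or> ((i, j) \<in> \<O> \<and> ky j < ky l)"
    proof (cases "j = l")
      case False
      then have "ky j \<noteq> ky l" using ky_inj_row[of i j l] jp lJ(2) by (auto simp: poset_iff)
      moreover have "(i, j) \<prec>\<^sub>P (i, l)" using le False jp lJ(2) by (subst pprec_ky) auto
      then have "(i, j) \<notin> max_elems J" using lJ(1) by (auto simp: max_elems_def)
      then have "(i, j) \<in> \<O>" using j by (auto simp: M_set_def)
      ultimately show ?thesis using le by simp
    qed simp }
  { assume "j = l \<or> ((i, j) \<in> \<O> \<and> ky j < ky l)"
    then show "(i, j) \<in> M_set \<O> J"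
    proof
      assume *: "(i, j) \<in> \<O> \<and> ky j < ky l"
      then have "(i, j) \<in> J" using ideal_down[OF J lJ(1), of i j] O_poset by auto
      then show ?thesis using * by (auto simp: M_set_def)
    qed (use l in \<open>auto simp: is_lst_def\<close>) }
qed

lemma inv_comp_apply: "bij f \<Longrightarrow> bij g \<Longrightarrow> inv_into UNIV (f \<circ> g) (f x) = inv_into UNIV g x"
  by (metis bij_is_inj bij_is_surj comp_apply inv_f_f surj_f_inv_f inj_compose)

text \<open>Later rows do not move \<open>i\<close>, row \<open>i\<close> carries \<open>i\<close>
  to its last member \<open>l\<close>, and earlier rows act on \<open>l\<close> as they do in the
  product for \<open>\<O>\<close>. The inverse of that product cancels the earlier rows and leaves
  the inverse of \<open>U i\<close> at \<open>l\<close>.\<close>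

lemma w_OJ_eq:
  assumes J: "J \<in> ideals n" and l: "is_lst J i l"
  shows "w_OJ n \<O> J i = rr i l"
proof -
  let ?M = "M_set \<O> J"
  have MP: "?M \<subseteq> poset n" using M_set_subset[OF J] ideal_poset[OF J] by blast
  have lM: "(i, l) \<in> ?M" using l by (simp add: is_lst_def)
  then have lJ: "(i, l) \<in> J" using M_set_subset[OF J] by blast
  have i: "1 \<le> i" "i \<le> int n" "l \<in> rws i" using lM MP by (auto simp: poset_iff)
  have iM: "(i, i) \<in> ?M" using ideal_diag[OF J lJ] diag_in_O i by (auto simp: M_set_def)
  have 1: "comps (rowp ?M) [i + 1..int n] i = i"
    using i by (intro comps_fix rowp_fix) (auto simp: rws_def dest!: subset_posetD[OF MP])
  have 2: "rowp ?M i i = l" using l by (intro rowp_last[OF MP iM lM]) (simp add: is_lst_def)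
  have "[1..int n] = [1..i - 1] @ i # [i + 1..int n]" using i by (simp add: upto_split1[of 1 i] upto_rec1[of i])
  then have 3: "w_perm n ?M i = comps (rowp ?M) [1..i - 1] l"
    by (simp add: w_perm_eq comps_append 1 2)
  \<comment> \<open>In an earlier row a member of \<open>M_set\<close> up to \<open>l\<close> lies
    strictly below \<open>(i, l)\<close>; it is not maximal in \<open>J\<close> and must come from
    \<open>\<O>\<close>.\<close>
  have agree: "(i', y) \<in> ?M \<longleftrightarrow> (i', y) \<in> \<O>" if "i' < i" "1 \<le> i'" "y \<in> rws 1" "ky y \<le> ky l" for i' y
  proof
    assume y: "(i', y) \<in> ?M"
    then have "(i', y) \<prec>\<^sub>P (i, l)" using that MP lM by (subst pprec_ky) auto
    then have "(i', y) \<notin> max_elems J" using lJ by (auto simp: max_elems_def)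
    then show "(i', y) \<in> \<O>" using y by (auto simp: M_set_def)
  next
    assume y: "(i', y) \<in> \<O>"
    then have "(i', y) \<in> J" using that ideal_down[OF J lJ, of i' y] O_poset by auto
    then show "(i', y) \<in> ?M" using y by (auto simp: M_set_def)
  qed
  \<comment> \<open>The bound by \<open>ky l\<close> survives the induction because the row products
    of \<open>\<O>\<close> do not move these elements upwards; the agreement of the rows stays
    applicable.\<close>
  have 4: "comps (rowp ?M) [1..k - 1] x = comps (rowp \<O>) [1..k - 1] x"
    if "1 \<le> k" "k \<le> i" "x \<in> rws k" "ky x \<le> ky l" for k x
    using that
  proof (induction k arbitrary: x rule: int_ge_induct)
    case base then show ?case by simp
  next
    case (step k)
    have "[1..k + 1 - 1] = [1..k - 1] @ [k]" using step by (simp add: upto_rec2)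
    then have e: "comps (rowp K) [1..k + 1 - 1] x = comps (rowp K) [1..k - 1] (rowp K k x)" for K
      by (simp add: comps_append)
    have x1: "x \<in> rws 1" "x \<noteq> k" using step row_mono[of 1 "k + 1"] by (auto simp: rws_def)
    have eq: "rowp ?M k x = rowp \<O> k x"
    proof (rule rowp_cong[OF x1(2,1)])
      fix y assume "y \<in> rws 1" "ky y \<le> ky x"
      then show "(k, y) \<in> ?M \<longleftrightarrow> (k, y) \<in> \<O>" using agree[of k y] step.hyps step.prems by linarith
    qed
    have bd: "rowp \<O> k x \<in> rws k" "ky (rowp \<O> k x) \<le> ky x"
      using rowp_O_bound[of k x] step.hyps step.prems i by linarith+
    have "comps (rowp ?M) [1..k - 1] (rowp \<O> k x) = comps (rowp \<O>) [1..k - 1] (rowp \<O> k x)"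
      by (rule step.IH) (use step.prems bd in linarith)+
    then show ?case unfolding e eq .
  qed
  have "comps (rowp \<O>) [1..i - 1] permutes rws 1"
    using i by (intro permutes_comps permutes_subset[OF rowp_permutes[OF O_poset]] row_mono) auto
  then have b: "bij (comps (rowp \<O>) [1..i - 1])" "bij (U i)" using U_permutes i permutes_bij by blast+
  have 5: "w_perm n \<O> = comps (rowp \<O>) [1..i - 1] \<circ> U i"
    unfolding U_def comps_append[symmetric] w_perm_eq using i by (simp add: upto_split1[of 1 i])
  show ?thesis
    unfolding w_OJ_def comp_apply 3 rr_def using 4[of i l] i inv_comp_apply[OF b] by (simp add: 5)
qed

lemma down_set_ideal: "(i, l) \<in> poset n \<Longrightarrow> down_set n (i, l) \<in> ideals n"
proof -
  assume il: "(i, l) \<in> poset n"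
  { fix p q assume p: "p \<in> down_set n (i, l)" "q \<in> poset n" "q \<preceq>\<^sub>P p"
    obtain a b c d where pq: "p = (a, b)" "q = (c, d)" by (cases p, cases q) auto
    have "q \<in> down_set n (i, l)" using p il unfolding down_set_def pq by (auto simp: pleq_ky) }
  then show ?thesis by (auto simp: ideals_def down_set_def)
qed

lemma r_map_eq:
  assumes "(i, l) \<in> poset n"
  shows "r_map n \<O> i l = rr i l"
  unfolding r_map_def
proof (rule w_OJ_eq[OF down_set_ideal[OF assms]])
  have D: "(i', j) \<in> down_set n (i, l) \<longleftrightarrow> (i', j) \<in> poset n \<and> i' \<le> i \<and> ky j \<le> ky l" for i' j
    using assms pleq_ky[of i' j i l] by (auto simp: down_set_def)
  have "(i, l) \<in> max_elems (down_set n (i, l))"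
    using assms unfolding max_elems_def
    by (auto simp: D pprec_ky poset_iff dest!: ky_inj_row[THEN iffD1, rotated -1] intro: order_antisym)
  then show "is_lst (down_set n (i, l)) i l"
    using M_set_subset[OF down_set_ideal[OF assms]] D by (auto simp: is_lst_def M_set_def)
qed

end

section \<open>Lexicographic orders\<close>

text \<open>Both orders on exponents have this form: the weight order directly, the order on vectors
  with its arguments exchanged, because there the larger first coordinate makes the vector
  smaller.\<close>

definition lexlt :: "'p set \<Rightarrow> ('p \<Rightarrow> 'p \<Rightarrow> bool) \<Rightarrow> ('p \<Rightarrow> int) \<Rightarrow> ('p \<Rightarrow> int) \<Rightarrow> bool"
  where "lexlt A R a b \<longleftrightarrow> (\<exists>p\<in>A. a p < b p \<and> (\<forall>q\<in>A. R q p \<longrightarrow> a q = b q))"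

lemma lexlt_irrefl: "\<not> lexlt A R a a"
  by (auto simp: lexlt_def)

lemma lexlt_add: "lexlt A R (\<lambda>p. a p + c p) (\<lambda>p. b p + c p) \<longleftrightarrow> lexlt A R a b"
  by (auto simp: lexlt_def)

lemma lexlt_trans:
  assumes R: "\<And>p q. p \<in> A \<Longrightarrow> q \<in> A \<Longrightarrow> p = q \<or> R p q \<or> R q p" "\<And>p q r. R p q \<Longrightarrow> R q r \<Longrightarrow> R p r"
    and "lexlt A R a b" "lexlt A R b c"
  shows "lexlt A R a c"
proof -
  obtain p where p: "p \<in> A" "a p < b p" "\<And>q. q \<in> A \<Longrightarrow> R q p \<Longrightarrow> a q = b q" using assms(3) by (auto simp: lexlt_def)
  obtain q where q: "q \<in> A" "b q < c q" "\<And>r. r \<in> A \<Longrightarrow> R r q \<Longrightarrow> b r = c r" using assms(4) by (auto simp: lexlt_def)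
  consider "p = q" | "R p q" | "R q p" using R(1) p(1) q(1) by blast
  then show ?thesis
  proof cases
    case 1
    then have "a p < c p" "\<And>r. r \<in> A \<Longrightarrow> R r p \<Longrightarrow> a r = c r" using p q by auto
    then show ?thesis using p(1) unfolding lexlt_def by blast
  next
    case 2
    then have "a p < c p" "\<And>r. r \<in> A \<Longrightarrow> R r p \<Longrightarrow> a r = c r" using p q R(2) by (force, metis)
    then show ?thesis using p(1) unfolding lexlt_def by blast
  next
    case 3
    then have "a q < c q" "\<And>r. r \<in> A \<Longrightarrow> R r q \<Longrightarrow> a r = c r" using p q R(2) by (force, metis)
    then show ?thesis using q(1) unfolding lexlt_def by blast
  qed
qed

lemma lexlt_total:
  assumes "finite A" and R: "\<And>p. \<not> R p p" "\<And>p q r. R p q \<Longrightarrow> R q r \<Longrightarrow> R p r"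
    and "p0 \<in> A" "a p0 \<noteq> b p0"
  shows "lexlt A R a b \<or> lexlt A R b a"
proof -
  let ?D = "{p \<in> A. a p \<noteq> b p}"
  have "\<exists>m\<in>?D. \<forall>x\<in>?D. x \<noteq> m \<longrightarrow> \<not> R x m"
  proof (rule Finite_Set.bex_min_element)
    show "finite ?D" "?D \<noteq> {}" using assms by auto
    show "asymp_on ?D R" using R by (metis asymp_onI)
    show "transp_on ?D R" using R(2) by (metis transp_onI)
  qed
  then obtain m where m: "m \<in> ?D" "\<forall>x\<in>?D. x \<noteq> m \<longrightarrow> \<not> R x m" by (rule bexE)
  then have eq: "a x = b x" if "x \<in> A" "R x m" for x using that R(1) by auto
  have "a m < b m \<or> b m < a m" using m by auto
  then show ?thesis
  proof
    assume "a m < b m" then show ?thesis unfolding lexlt_def using m(1) eq by blast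
  next
    assume "b m < a m" then show ?thesis unfolding lexlt_def using m(1) eq by (intro disjI2 bexI[of _ m]) auto
  qed
qed

context marked_poset begin

section \<open>The orders on exponents\<close>

text \<open>Numbers the blocks into which the members of \<open>\<O>\<close> cut row
  \<open>i\<close>; each member of \<open>\<O>\<close> opens a block.\<close>

definition blk :: "int \<Rightarrow> int \<Rightarrow> nat" where "blk i j = card {y \<in> rws i. (i, y) \<in> \<O> \<and> ky y \<le> ky j}"

text \<open>Within row \<open>i\<close> the order on \<open>P\<close> moves each element of \<open>\<O>\<close> behind the block of elements
  outside \<open>\<O>\<close> that follows it, so it is the order of these numbers.\<close>

definition rk :: "int \<Rightarrow> int \<Rightarrow> int"
  where "rk i j = (4 * int n + 4) * int (blk i j) + (if (i, j) \<in> \<O> then 2 * int n + 2 else 0) + ky j"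

lemma blk_le: "ky j1 \<le> ky j2 \<Longrightarrow> blk i j1 \<le> blk i j2"
  unfolding blk_def by (rule card_mono) auto

lemma blk_less: "ky j1 < ky j2 \<Longrightarrow> (i, y) \<in> \<O> \<Longrightarrow> ky j1 < ky y \<Longrightarrow> ky y \<le> ky j2 \<Longrightarrow> blk i j1 < blk i j2"
proof -
  assume *: "ky j1 < ky j2" "(i, y) \<in> \<O>" "ky j1 < ky y" "ky y \<le> ky j2"
  let ?S = "\<lambda>j. {y \<in> rws i. (i, y) \<in> \<O> \<and> ky y \<le> ky j}"
  have "y \<in> ?S j2" "y \<notin> ?S j1" using * O_row by auto
  moreover have "?S j1 \<subseteq> ?S j2" using * by auto
  ultimately show ?thesis unfolding blk_def by (intro psubset_card_mono) auto
qed

lemma blk_neqD: "blk i j1 < blk i j2 \<Longrightarrow> \<exists>y. (i, y) \<in> \<O> \<and> ky j1 < ky y \<and> ky y \<le> ky j2"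
proof (rule ccontr)
  assume *: "blk i j1 < blk i j2" "\<nexists>y. (i, y) \<in> \<O> \<and> ky j1 < ky y \<and> ky y \<le> ky j2"
  have "blk i j2 \<le> blk i j1" unfolding blk_def by (rule card_mono) (use *(2) in force)+
  then show False using *(1) by simp
qed

lemma row_exc_iff:
  assumes "1 \<le> i" "j1 \<in> rws i" "j2 \<in> rws i" "ky j1 < ky j2"
  shows "row_exc \<O> i j1 j2 \<longleftrightarrow> (i, j1) \<in> \<O> \<and> blk i j1 = blk i j2"
proof -
  have r: "rws i \<subseteq> rws 1" using row_mono assms(1) by simp
  have eq: "j1 \<lessdot> j' \<and> (j' \<lessdot> j2 \<or> j' = j2) \<longleftrightarrow> ky j1 < ky j' \<and> ky j' \<le> ky j2" if "(i, j') \<in> \<O>" for j'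
  proof -
    have "j' \<in> rws 1" using O_row[OF that] r by blast
    then show ?thesis using nless_ky[of j1 j'] nless_ky[of j' j2] ky_inj[of j' j2] assms r by auto
  qed
  have "row_exc \<O> i j1 j2 \<longleftrightarrow> (i, j1) \<in> \<O> \<and> \<not> (\<exists>j'. ky j1 < ky j' \<and> ky j' \<le> ky j2 \<and> (i, j') \<in> \<O>)"
    unfolding row_exc_def using eq by blast
  also have "(\<exists>j'. ky j1 < ky j' \<and> ky j' \<le> ky j2 \<and> (i, j') \<in> \<O>) \<longleftrightarrow> blk i j1 < blk i j2"
    using blk_less[OF assms(4)] blk_neqD by blast
  finally show ?thesis using blk_le[of j1 j2 i] assms(4) by auto
qed

text \<open>The summand \<open>2 * n + 2\<close> exceeds every value of \<open>ky\<close>, so a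
  member of \<open>\<O>\<close> comes behind the rest of its block; the factor
  \<open>4 * n + 4\<close> exceeds whatever is added within a block, so the blocks keep their
  order.\<close>

lemma rk_less:
  assumes "1 \<le> i" "j1 \<in> rws i" "j2 \<in> rws i" "ky j1 < ky j2"
  shows "if row_exc \<O> i j1 j2 then rk i j2 < rk i j1 else rk i j1 < rk i j2"
proof -
  have b: "1 \<le> ky j1" "ky j2 \<le> 2 * int n" using ky_bounds assms row_mono[of 1 i] by auto
  have le: "blk i j1 \<le> blk i j2" using blk_le assms(4) by simp
  have O2: "(i, j2) \<in> \<O> \<Longrightarrow> blk i j1 < blk i j2" using blk_less[OF assms(4)] assms(4) by simp
  have big: "(4 * int n + 4) * int (blk i j1) + (4 * int n + 4) \<le> (4 * int n + 4) * int (blk i j2)" if "blk i j1 < blk i j2"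
  proof -
    have "(4 * int n + 4) * (int (blk i j1) + 1) \<le> (4 * int n + 4) * int (blk i j2)"
      using that by (intro mult_left_mono) auto
    then show ?thesis by (simp add: algebra_simps)
  qed
  show ?thesis
  proof (cases "blk i j1 < blk i j2")
    case True
    then show ?thesis using big[OF True] b assms(4) by (simp add: row_exc_iff[OF assms] rk_def)
  next
    case False
    then have "blk i j1 = blk i j2" "(i, j2) \<notin> \<O>" using le O2 by auto
    then show ?thesis using b assms(4) by (simp add: row_exc_iff[OF assms] rk_def)
  qed
qed

lemma rk_iff:
  assumes "1 \<le> i" "j1 \<in> rws i" "j2 \<in> rws i"
  shows "(j1 \<lessdot> j2 \<and> \<not> row_exc \<O> i j1 j2) \<or> (j2 \<lessdot> j1 \<and> row_exc \<O> i j2 j1) \<longleftrightarrow> rk i j1 < rk i j2"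
proof -
  have r: "j1 \<in> rws 1" "j2 \<in> rws 1" using assms row_mono[of 1 i] by auto
  consider "ky j1 < ky j2" | "ky j2 < ky j1" | "j1 = j2" using ky_inj[OF r] by linarith
  then show ?thesis
  proof cases
    case 1 then show ?thesis using rk_less[OF assms 1] nless_ky[OF r] nless_ky[OF r(2,1)] by (auto split: if_splits)
  next
    case 2 then show ?thesis using rk_less[OF assms(1,3,2) 2] nless_ky[OF r] nless_ky[OF r(2,1)] by (auto split: if_splits)
  qed (auto simp: nless_def)
qed

lemma rk_inj: "1 \<le> i \<Longrightarrow> j1 \<in> rws i \<Longrightarrow> j2 \<in> rws i \<Longrightarrow> rk i j1 = rk i j2 \<Longrightarrow> j1 = j2"
  using rk_less[of i j1 j2] rk_less[of i j2 j1] ky_inj_row[of i j1 j2]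
  by (metis less_irrefl linorder_neqE)

text \<open>The second coordinate of \<open>p\<close> is a value of \<open>rr\<close>;
  \<open>U\<close> recovers its argument, whose rank decides.\<close>

definition pk :: "int \<times> int \<Rightarrow> int" where "pk p = rk (fst p) (U (fst p) (snd p))"

lemma pos_less_iff: "pos_less n \<O> p q \<longleftrightarrow>
  p \<in> poset n \<and> q \<in> poset n \<and> (fst p < fst q \<or> (fst p = fst q \<and> pk p < pk q))"
proof
  assume "pos_less n \<O> p q"
  then obtain i1 j1 i2 j2 where *: "(i1, j1) \<in> poset n" "(i2, j2) \<in> poset n"
    "p = (i1, r_map n \<O> i1 j1)" "q = (i2, r_map n \<O> i2 j2)"
    "i1 < i2 \<or> (i1 = i2 \<and> ((j1 \<lessdot> j2 \<and> \<not> row_exc \<O> i1 j1 j2) \<or> (j2 \<lessdot> j1 \<and> row_exc \<O> i1 j2 j1)))"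
    unfolding pos_less_def by blast
  then have "i1 = i2 \<longrightarrow> ((j1 \<lessdot> j2 \<and> \<not> row_exc \<O> i1 j1 j2) \<or> (j2 \<lessdot> j1 \<and> row_exc \<O> i1 j2 j1)) = (rk i1 j1 < rk i1 j2)"
    using rk_iff[of i1 j1 j2] by (auto simp: poset_iff)
  with * show "p \<in> poset n \<and> q \<in> poset n \<and> (fst p < fst q \<or> (fst p = fst q \<and> pk p < pk q))"
    by (auto simp: r_map_eq poset_iff rr_in_row pk_def U_rr)
next
  assume *: "p \<in> poset n \<and> q \<in> poset n \<and> (fst p < fst q \<or> (fst p = fst q \<and> pk p < pk q))"
  obtain i1 x1 i2 x2 where pq: "p = (i1, x1)" "q = (i2, x2)" by (cases p, cases q) auto
  let ?j1 = "U i1 x1" and ?j2 = "U i2 x2"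
  have i: "1 \<le> i1" "1 \<le> i2" using * pq by (auto simp: poset_iff)
  have P: "(i1, ?j1) \<in> poset n" "(i2, ?j2) \<in> poset n"
    using * pq i by (simp_all add: poset_iff U_in_row)
  have "p = (i1, r_map n \<O> i1 ?j1)" "q = (i2, r_map n \<O> i2 ?j2)" using P i pq by (simp_all add: r_map_eq rr_U)
  moreover have "i1 < i2 \<or> (i1 = i2 \<and> ((?j1 \<lessdot> ?j2 \<and> \<not> row_exc \<O> i1 ?j1 ?j2) \<or> (?j2 \<lessdot> ?j1 \<and> row_exc \<O> i1 ?j2 ?j1)))"
    using * pq rk_iff[of i1 ?j1 ?j2] P by (auto simp: poset_iff pk_def)
  ultimately show "pos_less n \<O> p q" unfolding pos_less_def using P by blast
qed

lemma pos_less_irrefl: "\<not> pos_less n \<O> p p"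
  and pos_less_trans: "pos_less n \<O> p q \<Longrightarrow> pos_less n \<O> q r \<Longrightarrow> pos_less n \<O> p r"
  by (auto simp: pos_less_iff)

lemma pos_less_total:
  assumes "p \<in> poset n" "q \<in> poset n"
  shows "p = q \<or> pos_less n \<O> p q \<or> pos_less n \<O> q p"
proof (cases "fst p = fst q \<and> pk p = pk q")
  case True
  obtain i x1 x2 where pq: "p = (i, x1)" "q = (i, x2)" using True by (cases p, cases q) auto
  have i: "1 \<le> i" and x: "x1 \<in> rws i" "x2 \<in> rws i" using assms pq by (auto simp: poset_iff)
  have "U i x1 \<in> rws i" "U i x2 \<in> rws i" using x i by (simp_all add: U_in_row)
  then have "U i x1 = U i x2" using rk_inj[OF i] True pq by (simp add: pk_def)
  then show ?thesis using rr_U[OF i] pq by metis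
qed (use assms in \<open>auto simp: pos_less_iff\<close>)

section \<open>The weight order and the combined order\<close>

lemma vec_less_lex: "vec_less n \<O> d d' \<longleftrightarrow> lexlt (poset n) (pos_less n \<O>) (lk d') (lk d)"
  unfolding vec_less_def lexlt_def by metis

lemma wt_less_lex: "wt_less n a b \<longleftrightarrow> lexlt (rws 1) nless' (lk a) (lk b)"
  unfolding wt_less_def lexlt_def row1 by metis

lemma nless'_order: "\<not> nless' i i" "nless' i j \<Longrightarrow> nless' j k \<Longrightarrow> nless' i k" "i = j \<or> nless' i j \<or> nless' j i"
  by (auto simp: nless'_def)

lemma wt_A_add: "wt_A n (x + y) = wt_A n x + wt_A n y"
  by (simp add: wt_A_def lookup_add single_add sum.distrib[symmetric] case_prod_unfold algebra_simps)

lemma wt_A_0 [simp]: "wt_A n 0 = 0"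
  by (simp add: wt_A_def)

lemma wt_A_sum: "wt_A n (\<Sum>i\<in>I. f i) = (\<Sum>i\<in>I. wt_A n (f i))"
  by (induction I rule: infinite_finite_induct) (auto simp: wt_A_add)

lemma wt_A_single: "(i, j) \<in> poset n \<Longrightarrow> wt_A n (sg (i, j) c) = sg j c - sg i c"
proof -
  assume p: "(i, j) \<in> poset n"
  have "wt_A n (sg (i, j) c) = (\<Sum>p\<in>poset n. if p = (i, j) then sg j c - sg i c else 0)"
    unfolding wt_A_def
  proof (intro sum.cong refl)
    fix p assume "p \<in> poset n"
    obtain a b where ab: "p = (a, b)" by (cases p)
    show "(case p of (i', j') \<Rightarrow> sg j' (lk (sg (i, j) c) (i', j')) - sg i' (lk (sg (i, j) c) (i', j')))
        = (if p = (i, j) then sg j c - sg i c else 0)"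
      by (cases "p = (i, j)") (auto simp: ab lookup_single when_def)
  qed
  then show ?thesis using p by simp
qed

lemma keys_wt_A: "ks (wt_A n x) \<subseteq> rws 1"
proof -
  have s: "ks (case p of (i, j) \<Rightarrow> sg j (lk x (i, j)) - sg i (lk x (i, j))) \<subseteq> rws 1" if p: "p \<in> poset n" for p
  proof -
    obtain i j where ij: "p = (i, j)" by (cases p)
    have "i \<in> rws 1" "j \<in> rws 1" using p ij row_mono[of 1 i] by (auto simp: poset_iff rws_def)
    then show ?thesis unfolding ij using keys_diff[of "sg j (lk x (i, j))" "sg i (lk x (i, j))"] by (auto split: if_splits)
  qed
  show ?thesis unfolding wt_A_def by (rule order_trans[OF keys_sum]) (use s in blast)
qed

definition leA :: "(int \<times> int \<Rightarrow>\<^sub>0 int) \<Rightarrow> (int \<times> int \<Rightarrow>\<^sub>0 int) \<Rightarrow> bool"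
  where "leA x y \<longleftrightarrow> less_A n \<O> x y \<or> x = y"

lemma wt_less_irrefl: "\<not> wt_less n a a"
  by (simp add: wt_less_lex lexlt_irrefl)

lemma wt_less_trans: "wt_less n a b \<Longrightarrow> wt_less n b c \<Longrightarrow> wt_less n a c"
  unfolding wt_less_lex
  using lexlt_trans[of "rws 1" nless' "lk a" "lk b" "lk c", OF nless'_order(3,2)] .

lemma wt_less_add: "wt_less n (a + c) (b + c) \<longleftrightarrow> wt_less n a b"
  using lexlt_add[of "rws 1" nless' "lk a" "lk c" "lk b"] by (simp add: wt_less_lex lookup_add[abs_def])

lemma wt_less_total: "ks a \<subseteq> rws 1 \<Longrightarrow> ks b \<subseteq> rws 1 \<Longrightarrow> a \<noteq> b \<Longrightarrow> wt_less n a b \<or> wt_less n b a"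
proof -
  assume *: "ks a \<subseteq> rws 1" "ks b \<subseteq> rws 1" "a \<noteq> b"
  then obtain p where "lk a p \<noteq> lk b p" by (metis poly_mapping_eqI)
  moreover from this have "p \<in> rws 1" using * by (metis lk_notin_ks subsetD)
  ultimately show ?thesis unfolding wt_less_lex using nless'_order by (intro lexlt_total) auto
qed

lemma vec_less_irrefl: "\<not> vec_less n \<O> a a"
  by (simp add: vec_less_lex lexlt_irrefl)

lemma vec_less_trans: "vec_less n \<O> a b \<Longrightarrow> vec_less n \<O> b c \<Longrightarrow> vec_less n \<O> a c"
  unfolding vec_less_lex
  using lexlt_trans[of "poset n" "pos_less n \<O>" "lk c" "lk b" "lk a", OF pos_less_total pos_less_trans] .

lemma vec_less_add: "vec_less n \<O> (a + c) (b + c) \<longleftrightarrow> vec_less n \<O> a b"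
  using lexlt_add[of "poset n" "pos_less n \<O>" "lk b" "lk c" "lk a"] by (simp add: vec_less_lex lookup_add[abs_def])

lemma less_A_irrefl: "\<not> less_A n \<O> x x"
  by (simp add: less_A_def wt_less_irrefl vec_less_irrefl)

lemma less_A_trans: "less_A n \<O> x y \<Longrightarrow> less_A n \<O> y z \<Longrightarrow> less_A n \<O> x z"
  unfolding less_A_def using wt_less_trans vec_less_trans by metis

lemma less_A_add: "less_A n \<O> (x + z) (y + z) \<longleftrightarrow> less_A n \<O> x y"
  by (simp add: less_A_def wt_A_add wt_less_add vec_less_add)

lemma less_A_total: "x \<in> vecs n \<Longrightarrow> y \<in> vecs n \<Longrightarrow> x \<noteq> y \<Longrightarrow> less_A n \<O> x y \<or> less_A n \<O> y x"
proof -
  assume *: "x \<in> vecs n" "y \<in> vecs n" "x \<noteq> y"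
  then obtain p where p: "lk y p \<noteq> lk x p" by (metis poly_mapping_eqI)
  then have "p \<in> poset n" using * unfolding vecs_def by (metis (no_types, lifting) lk_notin_ks mem_Collect_eq subsetD)
  then have "vec_less n \<O> x y \<or> vec_less n \<O> y x" unfolding vec_less_lex
    using p pos_less_irrefl pos_less_trans by (intro lexlt_total) auto
  then show ?thesis using wt_less_total[OF keys_wt_A keys_wt_A, of x y] unfolding less_A_def by metis
qed

lemma leA_refl [simp]: "leA x x" by (simp add: leA_def)

lemma leA_trans: "leA x y \<Longrightarrow> leA y z \<Longrightarrow> leA x z"
  unfolding leA_def using less_A_trans by metis

lemma leA_antisym: "leA x y \<Longrightarrow> leA y x \<Longrightarrow> x = y"
  unfolding leA_def using less_A_trans less_A_irrefl by metis

lemma leA_total: "x \<in> vecs n \<Longrightarrow> y \<in> vecs n \<Longrightarrow> leA x y \<or> leA y x"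
  unfolding leA_def using less_A_total by metis

lemma leA_add: "leA x y \<Longrightarrow> leA x' y' \<Longrightarrow> leA (x + x') (y + y')"
proof -
  assume "leA x y" "leA x' y'"
  then have "leA (x + x') (y + x')" "leA (x' + y) (y' + y)" by (auto simp: leA_def less_A_add)
  then show ?thesis using leA_trans[of "x + x'" "y + x'" "y + y'"] by (simp add: add.commute)
qed

text \<open>A strict inequality in either summand would make the sum strict. This is why only one
  pair of exponents contributes to the leading term of a product.\<close>

lemma leA_add_eq: "leA x y \<Longrightarrow> leA x' y' \<Longrightarrow> x + x' = y + y' \<Longrightarrow> x = y \<and> x' = y'"
proof -
  assume *: "leA x y" "leA x' y'" "x + x' = y + y'"
  have 1: "leA (x + x') (y + x')" using *(1) by (auto simp: leA_def less_A_add)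
  have "leA (x' + y) (y' + y)" using *(2) by (auto simp: leA_def less_A_add)
  then have "leA (y + x') (x + x')" by (simp add: *(3) add.commute)
  with 1 have "leA (y + x') (x + x')" "leA (x + x') (y + x')" by simp_all
  then have "x + x' = y + x'" by (rule leA_antisym[rotated])
  then show ?thesis using * by simp
qed

lemma vecs_0 [simp]: "0 \<in> vecs n" by (simp add: vecs_def)

lemma vecs_add: "x \<in> vecs n \<Longrightarrow> (y :: int \<times> int \<Rightarrow>\<^sub>0 'a::comm_monoid_add) \<in> vecs n \<Longrightarrow> x + y \<in> vecs n"
  using keys_add[of x y] by (auto simp: vecs_def)

lemma vecs_sum: "(\<And>i. i \<in> I \<Longrightarrow> f i \<in> vecs n) \<Longrightarrow> (\<Sum>i\<in>I. f i) \<in> vecs n"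
  by (induction I rule: infinite_finite_induct) (auto intro: vecs_add)

lemma vecs_single: "p \<in> poset n \<Longrightarrow> sg p c \<in> vecs n"
  by (auto simp: vecs_def)

lemma vecs_diff: "x \<in> vecs n \<Longrightarrow> (y :: int \<times> int \<Rightarrow>\<^sub>0 int) \<in> vecs n \<Longrightarrow> x - y \<in> vecs n"
  using keys_diff[of x y] by (auto simp: vecs_def)

section \<open>The map xi\<close>

definition prevp :: "int \<Rightarrow> int \<Rightarrow> int \<Rightarrow> bool"
  where "prevp i j p \<longleftrightarrow> (i, p) \<in> \<O> \<and> ky p < ky j \<and> (\<forall>l. (i, l) \<in> \<O> \<and> ky l < ky j \<longrightarrow> ky l \<le> ky p)"

lemma prevp_ex:
  assumes "1 \<le> i" "i \<le> int n" "j \<in> rws i" "j \<noteq> i"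
  shows "\<exists>p. prevp i j p"
proof -
  let ?S = "{p \<in> rws i. (i, p) \<in> \<O> \<and> ky p < ky j}"
  have "ky i \<noteq> ky j" using assms ky_inj_row[of i i j] by (auto simp: rws_def)
  then have "i \<in> ?S" using ky_diag[of i j] assms diag_in_O by (auto simp: rws_def)
  moreover have "finite ?S" by simp
  ultimately obtain p where "p \<in> ?S" "\<forall>l\<in>?S. ky l \<le> ky p" using ex_max_ky by blast
  then show ?thesis unfolding prevp_def using O_row by (intro exI[of _ p]) auto
qed

lemma prev_O_eq:
  assumes "1 \<le> i" "j \<in> rws i" "prevp i j p"
  shows "prev_O \<O> i j = p"
proof -
  have k: "l \<lessdot> j \<longleftrightarrow> ky l < ky j" "l \<in> rws i" "l \<in> rws 1" if "(i, l) \<in> \<O>" for l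
    using nless_ky[of l j] O_row[OF that] row_mono[of 1 i] assms by auto
  have p: "(i, p) \<in> \<O>" using assms by (simp add: prevp_def)
  have e: "l \<lessdot> l' \<or> l = l' \<longleftrightarrow> ky l \<le> ky l'" if "(i, l) \<in> \<O>" "(i, l') \<in> \<O>" for l l'
    using nless_ky[of l l'] ky_inj[of l l'] k[OF that(1)] k[OF that(2)] by auto
  have iff: "j' \<lessdot> j \<and> (i, j') \<in> \<O> \<and> (\<forall>l. l \<lessdot> j \<and> (i, l) \<in> \<O> \<longrightarrow> l \<lessdot> j' \<or> l = j') \<longleftrightarrow> prevp i j j'" for j'
    unfolding prevp_def using k(1) e by blast
  show ?thesis unfolding prev_O_def iff
  proof (rule the_equality)
    show "prevp i j p" by fact
  next
    fix q assume "prevp i j q"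
    then have "ky q = ky p" "(i, q) \<in> \<O>" using assms(3) by (auto simp: prevp_def intro: order_antisym)
    then show "q = p" using ky_inj k(3) p by metis
  qed
qed

definition xi_term :: "(int \<times> int \<Rightarrow>\<^sub>0 'a) \<Rightarrow> int \<times> int \<Rightarrow> (int \<times> int \<Rightarrow>\<^sub>0 'a::ab_group_add)"
  where "xi_term x p = (let c = lk x p in
    if snd p = fst p then sg (fst p, rr (fst p) (fst p)) c
    else sg (fst p, rr (fst p) (snd p)) c - sg (fst p, rr (fst p) (prev_O \<O> (fst p) (snd p))) c)"

lemma prev_O_row: "1 \<le> i \<Longrightarrow> i \<le> int n \<Longrightarrow> j \<in> rws i \<Longrightarrow> j \<noteq> i \<Longrightarrow> prev_O \<O> i j \<in> rws i \<and> prevp i j (prev_O \<O> i j)"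
  using prevp_ex[of i j] prev_O_eq[of i j] by (auto simp: prevp_def dest: O_row)

lemma xi_eq: "xi n \<O> x = (\<Sum>p\<in>poset n. xi_term x p)"
  unfolding xi_def
proof (intro sum.cong refl)
  fix p assume p: "p \<in> poset n"
  obtain i j where ij: "p = (i, j)" by (cases p)
  have i: "1 \<le> i" "i \<le> int n" "j \<in> rws i" using p ij by (auto simp: poset_iff)
  have 1: "r_map n \<O> i j = rr i j" "r_map n \<O> i i = rr i i" using i by (simp_all add: r_map_eq poset_iff rws_def)
  have 2: "r_map n \<O> i (prev_O \<O> i j) = rr i (prev_O \<O> i j)" if "j \<noteq> i"
    using prev_O_row[OF i that] i by (simp add: r_map_eq poset_iff)
  show "(case p of (i, j) \<Rightarrow> if j = i then sg (i, r_map n \<O> i i) (lk x (i, i))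
     else sg (i, r_map n \<O> i j) (lk x (i, j)) - sg (i, r_map n \<O> i (prev_O \<O> i j)) (lk x (i, j))) = xi_term x p"
    using 1 2 by (auto simp: ij xi_term_def Let_def)
qed

lemma xi_add: "xi n \<O> (x + y) = xi n \<O> x + xi n \<O> y"
  by (auto simp: xi_eq sum.distrib[symmetric] xi_term_def Let_def lookup_add single_add algebra_simps intro!: sum.cong)

lemma xi_0 [simp]: "xi n \<O> 0 = (0 :: int \<times> int \<Rightarrow>\<^sub>0 'a::ab_group_add)"
proof -
  have "xi_term 0 p = (0 :: int \<times> int \<Rightarrow>\<^sub>0 'a)" for p by (simp add: xi_term_def)
  then show ?thesis by (simp add: xi_eq)
qed

lemma xi_sum: "xi n \<O> (\<Sum>i\<in>I. f i) = (\<Sum>i\<in>I. xi n \<O> (f i))"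
  by (induction I rule: infinite_finite_induct) (auto simp: xi_add)

lemma xi_diff: "xi n \<O> (x - y) = xi n \<O> x - xi n \<O> y"
  using xi_add[of "x - y" y] by (simp add: algebra_simps)

lemma xi_cmul: "xi n \<O> (frag_cmul c x) = frag_cmul c (xi n \<O> x)"
proof -
  have "xi_term (frag_cmul c x) p = frag_cmul c (xi_term x p)" for p
    by (rule poly_mapping_eqI) (simp add: xi_term_def Let_def lookup_minus lookup_single when_def)
  then show ?thesis by (simp add: xi_eq frag_cmul_sum)
qed

lemma xi_single:
  assumes "(i, l) \<in> poset n"
  shows "xi n \<O> (sg (i, l) c) = (if l = i then sg (i, rr i i) c else sg (i, rr i l) c - sg (i, rr i (prev_O \<O> i l)) c)"
proof -
  have "xi n \<O> (sg (i, l) c) = (\<Sum>p\<in>poset n. if p = (i, l) then xi_term (sg (i, l) c) p else 0)"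
    unfolding xi_eq by (intro sum.cong refl) (auto simp: xi_term_def lookup_single when_def)
  also have "\<dots> = xi_term (sg (i, l) c) (i, l)" using assms by simp
  finally show ?thesis by (simp add: xi_term_def)
qed

lemma xi_vecs: "xi n \<O> (x :: int \<times> int \<Rightarrow>\<^sub>0 int) \<in> vecs n"
  unfolding xi_eq
proof (rule vecs_sum)
  fix p assume p: "p \<in> poset n"
  obtain i j where ij: "p = (i, j)" by (cases p)
  have i: "1 \<le> i" "i \<le> int n" "j \<in> rws i" using p ij by (auto simp: poset_iff)
  have "i \<in> rws i" using i by (simp add: rws_def)
  then have 1: "(i, rr i j) \<in> poset n" "(i, rr i i) \<in> poset n" using i by (simp_all add: poset_iff rr_in_row)
  have 2: "(i, rr i (prev_O \<O> i j)) \<in> poset n" if "j \<noteq> i"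
    using prev_O_row[OF i that] i by (simp add: poset_iff rr_in_row)
  show "xi_term x p \<in> vecs n"
    using 1 2 by (auto simp: xi_term_def ij Let_def intro!: vecs_single vecs_diff)
qed

text \<open>The shape of row \<open>i\<close> of \<open>M_set\<close> when its last member is
  \<open>l\<close>; compare \<open>is_lst_row\<close>.\<close>

definition seg :: "int \<Rightarrow> int \<Rightarrow> int set" where "seg i l = insert l {j. (i, j) \<in> \<O> \<and> ky j < ky l}"

lemma finite_seg [simp]: "finite (seg i l)"
  unfolding seg_def by (rule finite.insertI, rule finite_subset[of _ "rws i"]) (auto dest: O_row)

lemma seg_row: "l \<in> rws i \<Longrightarrow> seg i l \<subseteq> rws i"
  by (auto simp: seg_def dest: O_row)

text \<open>A telescoping sum: for \<open>j \<noteq> i\<close> the image of a basis vector is the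
  difference of the vectors attached to \<open>j\<close> and to its predecessor in
  \<open>\<O>\<close>, and the members of \<open>seg i l\<close> run through these predecessors down
  to \<open>i\<close>.\<close>

lemma xi_seg:
  assumes "(i, l) \<in> poset n"
  shows "(\<Sum>j\<in>seg i l. xi n \<O> (sg (i, j) c)) = sg (i, rr i l) c"
  using assms
proof (induction "nat (ky l)" arbitrary: l rule: less_induct)
  case less
  have i: "1 \<le> i" "i \<le> int n" "l \<in> rws i" using less.prems by (auto simp: poset_iff)
  show ?case
  proof (cases "l = i")
    case True
    have "seg i i = {i}" using ky_diag[OF i(1)] by (force simp: seg_def dest: O_row)
    then show ?thesis using True less.prems by (simp add: xi_single)
  next
    case False
    define p where "p = prev_O \<O> i l"
    have p: "p \<in> rws i" "prevp i l p" using prev_O_row[OF i False] by (simp_all add: p_def)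
    have pO: "(i, p) \<in> \<O>" "ky p < ky l" using p(2) by (auto simp: prevp_def)
    have "seg i l = insert l (seg i p)"
    proof -
      have "ky j < ky l \<longleftrightarrow> j = p \<or> ky j < ky p" if "(i, j) \<in> \<O>" for j
        using that p pO ky_inj_row[OF i(1), of j p] O_row[OF that] unfolding prevp_def by force
      then show ?thesis using pO by (auto simp: seg_def)
    qed
    moreover have "l \<notin> seg i p" using pO by (auto simp: seg_def)
    moreover have "0 < ky p" using ky_bounds[of p] row_mono[of 1 i] i p by auto
    then have "(\<Sum>j\<in>seg i p. xi n \<O> (sg (i, j) c)) = sg (i, rr i p) c"
      using pO p i by (intro less.hyps) (auto simp: poset_iff)
    ultimately show ?thesis using less.prems False by (simp add: xi_single p_def)
  qed
qed

text \<open>By \<open>xi_seg\<close> every basis vector is the image of a sum over a segment, and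
  \<open>U\<close> tells which one.\<close>

lemma xi_surj:
  assumes "y \<in> vecs n"
  shows "\<exists>x\<in>vecs n. xi n \<O> x = (y :: int \<times> int \<Rightarrow>\<^sub>0 int)"
proof -
  let ?g = "\<lambda>p. \<Sum>j\<in>seg (fst p) (U (fst p) (snd p)). sg (fst p, j) (lk y p)"
  have P: "(fst p, U (fst p) (snd p)) \<in> poset n" "1 \<le> fst p" "fst p \<le> int n" if "p \<in> poset n" for p
    using that by (cases p, simp add: poset_iff U_in_row)+
  have "?g p \<in> vecs n" if "p \<in> poset n" for p
    using P[OF that] seg_row[of "U (fst p) (snd p)" "fst p"]
    by (intro vecs_sum vecs_single) (auto simp: poset_iff)
  then have 1: "(\<Sum>p\<in>poset n. ?g p) \<in> vecs n" by (rule vecs_sum)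
  have "xi n \<O> (\<Sum>p\<in>poset n. ?g p) = (\<Sum>p\<in>poset n. sg p (lk y p))"
    unfolding xi_sum using P by (intro sum.cong refl) (simp add: xi_seg rr_U)
  also have "\<dots> = y" using assms by (intro sum_single_lookup) (auto simp: vecs_def)
  finally show ?thesis using 1 by blast
qed

text \<open>Triangularity: if \<open>l\<close> is the last place of row \<open>i\<close> in the
  support of \<open>x\<close>, then the coordinate \<open>(i, rr i l)\<close> of the image receives
  only the value of \<open>x\<close> at \<open>(i, l)\<close>, since any further contribution would
  come from a later place.\<close>

lemma xi_kernel:
  assumes x: "x \<in> vecs n" and 0: "xi n \<O> x = 0"
  shows "(x :: int \<times> int \<Rightarrow>\<^sub>0 int) = 0"
proof (rule ccontr)
  assume "x \<noteq> 0"
  then obtain i l0 where "(i, l0) \<in> ks x" by (metis keys_eq_empty equals0I surj_pair)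
  then have l0: "l0 \<in> {l \<in> rws i. (i, l) \<in> ks x}" and i: "1 \<le> i" "i \<le> int n"
    using x by (auto simp: vecs_def dest: subset_posetD)
  obtain l where l: "l \<in> rws i" "(i, l) \<in> ks x" "\<And>j. j \<in> rws i \<Longrightarrow> (i, j) \<in> ks x \<Longrightarrow> ky j \<le> ky l"
    using ex_max_ky[OF _ l0] by auto
  have "lk (xi_term x p) (i, rr i l) = (if p = (i, l) then lk x (i, l) else 0)" if p: "p \<in> poset n" for p
  proof -
    obtain a b where ab: "p = (a, b)" by (cases p)
    have a: "1 \<le> a" "a \<le> int n" "b \<in> rws a" using p ab by (auto simp: poset_iff)
    have pv: "prev_O \<O> a b \<noteq> b" "prevp a b (prev_O \<O> a b)" if "b \<noteq> a"
      using prev_O_row[OF a that] by (auto simp: prevp_def)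
    have z: "lk x (i, b) = 0" if "a = i" "b \<noteq> i" "prev_O \<O> i b = l"
    proof -
      have "ky l < ky b" using pv that by (auto simp: prevp_def)
      then show ?thesis using l(3)[of b] a that by (auto simp: in_keys_iff)
    qed
    show ?thesis
      using pv z a by (auto simp: ab xi_term_def Let_def lookup_minus lookup_single when_def rr_inj)
  qed
  then have "lk (xi n \<O> x) (i, rr i l) = (\<Sum>p\<in>poset n. if p = (i, l) then lk x (i, l) else 0)"
    by (simp add: xi_eq lookup_sum)
  then have "lk x (i, l) = 0" using 0 l i by (simp add: poset_iff)
  then show False using l(2) by (simp add: in_keys_iff)
qed

lemma xi_bij: "bij_betw (xi n \<O>) (vecs n) (vecs n :: (int \<times> int \<Rightarrow>\<^sub>0 int) set)"
proof (rule bij_betw_imageI)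
  show "inj_on (xi n \<O>) (vecs n :: (int \<times> int \<Rightarrow>\<^sub>0 int) set)"
  proof (rule inj_onI)
    fix x y :: "int \<times> int \<Rightarrow>\<^sub>0 int" assume "x \<in> vecs n" "y \<in> vecs n" "xi n \<O> x = xi n \<O> y"
    then have "x - y = 0" by (intro xi_kernel[OF vecs_diff]) (simp_all add: xi_diff)
    then show "x = y" by simp
  qed
  show "xi n \<O> ` vecs n = (vecs n :: (int \<times> int \<Rightarrow>\<^sub>0 int) set)"
    using xi_surj xi_vecs by (auto simp: image_iff)
qed

section \<open>The tuples attached to order ideals\<close>

definition lst :: "(int \<times> int) set \<Rightarrow> int \<Rightarrow> int" where "lst J i = (SOME l. is_lst J i l)"
definition ideal_tuple :: "(int \<times> int) set \<Rightarrow> int \<Rightarrow> int" where "ideal_tuple J i = rr i (lst J i)"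

lemma lst: "J \<in> ideals n \<Longrightarrow> (i, i) \<in> J \<Longrightarrow> is_lst J i (lst J i)"
  unfolding lst_def using is_lst_ex someI_ex by metis

lemma w_OJ_ideal_tuple: "J \<in> ideals n \<Longrightarrow> (i, i) \<in> J \<Longrightarrow> w_OJ n \<O> J i = ideal_tuple J i"
  using w_OJ_eq lst unfolding ideal_tuple_def by blast

lemma lst_J: "J \<in> ideals n \<Longrightarrow> (i, i) \<in> J \<Longrightarrow> (i, lst J i) \<in> J"
  using lst M_set_subset unfolding is_lst_def by blast

lemma ideal_tuple_row: "J \<in> ideals n \<Longrightarrow> (i, i) \<in> J \<Longrightarrow> ideal_tuple J i \<in> rws i"
  using subset_posetD[OF ideal_poset lst_J] unfolding ideal_tuple_def by (simp add: rr_in_row)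

lemma ideals_k_diag:
  assumes "J \<in> ideals_k n k"
  shows "(i, i) \<in> J \<longleftrightarrow> 1 \<le> i \<and> i \<le> int k" and "k \<le> n" and "J \<in> ideals n"
proof -
  have J: "J \<in> ideals n" and c: "card (J \<inter> diag n) = k" using assms by (auto simp: ideals_k_def)
  show "J \<in> ideals n" by fact
  let ?I = "{i. (i, i) \<in> J}"
  have sub: "?I \<subseteq> {1..int n}" using subset_posetD[OF ideal_poset[OF J]] by auto
  have fin: "finite ?I" using finite_subset[OF sub] by simp
  have "J \<inter> diag n = (\<lambda>i. (i, i)) ` ?I" using sub by (auto simp: diag_def)
  then have cI: "card ?I = k" using c by (simp add: card_image inj_on_def)
  then show "k \<le> n" using card_mono[OF _ sub] by simp
  have down: "i' \<in> ?I" if "i \<in> ?I" "1 \<le> i'" "i' \<le> i" for i i'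
    using that sub ideal_down[OF J, of i i i' i'] by (force simp: poset_iff rws_def ky_def)
  have "?I = {1..int k}"
  proof (cases "?I = {}")
    case True
    then have "k = 0" using cI by (metis card.empty)
    then show ?thesis using True by simp
  next
    case False
    let ?m = "Max ?I"
    have m: "?m \<in> ?I" using Max_in[OF fin False] .
    have m1: "1 \<le> ?m" using m sub by (meson atLeastAtMost_iff subsetD)
    have eq: "?I = {1..?m}"
    proof
      show "?I \<subseteq> {1..?m}" using sub Max_ge[OF fin] by (meson atLeastAtMost_iff subsetD subsetI)
      show "{1..?m} \<subseteq> ?I" using down[OF m] by auto
    qed
    have "card {1..?m} = k" using cI eq by simp
    then have "int k = ?m" using m1 by simp
    moreover note eq
    ultimately show ?thesis by simp
  qed
  then show "(i, i) \<in> J \<longleftrightarrow> 1 \<le> i \<and> i \<le> int k" by auto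
qed

text \<open>The purpose of \<open>xi\<close>: each row of \<open>M_set\<close> is a segment and
  collapses to one basis vector. The result is the exponent of a product of matrix entries, one from
  each of the first \<open>k\<close> rows.\<close>

lemma xi_ind_M:
  assumes J: "J \<in> ideals_k n k"
  shows "xi n \<O> (ind (M_set \<O> J)) = (\<Sum>i\<in>{1..int k}. sg (i, ideal_tuple J i) (1::int))"
proof -
  note Jk = ideals_k_diag[OF J]
  have M: "M_set \<O> J = Sigma {1..int k} (\<lambda>i. seg i (lst J i))"
  proof (rule Set.set_eqI)
    fix p :: "int \<times> int"
    obtain i j where p: "p = (i, j)" by (cases p)
    show "p \<in> M_set \<O> J \<longleftrightarrow> p \<in> Sigma {1..int k} (\<lambda>i. seg i (lst J i))"
    proof (cases "(i, i) \<in> J")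
      case True
      then show ?thesis using is_lst_row[OF Jk(3) lst[OF Jk(3) True], of j] Jk(1)[of i] p by (auto simp: seg_def)
    next
      case False
      then have "p \<notin> M_set \<O> J" using ideal_diag[OF Jk(3)] M_set_subset[OF Jk(3)] p by blast
      then show ?thesis using False Jk(1)[of i] p by auto
    qed
  qed
  have "xi n \<O> (ind (M_set \<O> J)) = (\<Sum>p\<in>M_set \<O> J. xi n \<O> (sg p (1::int)))"
    by (simp add: ind_def xi_sum)
  also have "\<dots> = (\<Sum>i\<in>{1..int k}. \<Sum>j\<in>seg i (lst J i). xi n \<O> (sg (i, j) 1))"
    unfolding M by (subst sum.Sigma) (auto simp: case_prod_unfold)
  also have "\<dots> = (\<Sum>i\<in>{1..int k}. sg (i, ideal_tuple J i) 1)"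
    using lst_J[OF Jk(3)] Jk(1) ideal_poset[OF Jk(3)]
    by (intro sum.cong refl) (subst xi_seg, auto simp: ideal_tuple_def)
  finally show ?thesis .
qed

text \<open>The last member of row \<open>i'\<close> is transported to row \<open>i\<close>, where
  it becomes \<open>m\<close>, and its rank is compared with that of the last member
  \<open>l\<close>. If \<open>m\<close> lies beyond \<open>l\<close>, then \<open>l\<close> belongs
  to \<open>\<O>\<close> and \<open>m\<close> to the block of \<open>l\<close>, and this is the case
  for which the order on the poset has its exception.\<close>

lemma ideal_tuple_greedy:
  assumes J: "J \<in> ideals n" and i: "(i, i) \<in> J" "(i', i') \<in> J" "i < i'"
  shows "pos_less n \<O> (i, ideal_tuple J i') (i, ideal_tuple J i)"
proof -
  note ip = subset_posetD[OF ideal_poset[OF J]]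
  define l l' where "l = lst J i" and "l' = lst J i'"
  have l: "is_lst J i l" "(i, l) \<in> J" "l \<in> rws i" and l': "(i', l') \<in> J" "l' \<in> rws i'"
    using lst[OF J] lst_J[OF J] i ip unfolding l_def l'_def by blast+
  have ib: "1 \<le> i" "i' \<le> int n" "i \<le> int n" using ip i by auto
  \<comment> \<open>\<open>u\<close> is the transport to row \<open>i + 1\<close>. The product of
    row \<open>i\<close> is split off because its effect depends on whether \<open>(i, u)\<close>
    belongs to \<open>\<O>\<close>.\<close>
  define u where "u = mid (i + 1) i' l'"
  have u: "u \<in> rws (i + 1)" "ky u \<le> ky l'" using mid_bound[of "i + 1" i' l'] i ib l' by (auto simp: u_def)
  then have ui: "u \<in> rws i" "u \<noteq> i" using row_mono[of i "i + 1"] ib by (auto simp: rws_def)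
  define m where "m = rowp \<O> i u"
  have "mid i i' l' = m" using i by (simp add: m_def u_def mid_def upto_rec1)
  then have wm: "ideal_tuple J i' = rr i m" using rr_mid[of i i' l'] ib i by (simp add: ideal_tuple_def l'_def)
  have mrow: "m \<in> rws i" using rowp_O_bound[of i u] ib i u by (simp add: m_def)
  have m: "if (i, u) \<in> \<O> then prevp i u m else m = u"
  proof (cases "(i, u) \<in> \<O>")
    case False then show ?thesis using ui rowp_fix by (simp add: m_def)
  next
    case True
    obtain p where p: "prevp i u p" using prevp_ex[of i u] ui ib i by auto
    have "rowp \<O> i u = p"
      using p True ui diag_in_O ib i by (intro rowp_prev[OF O_poset]) (auto simp: prevp_def)
    then show ?thesis using True p by (simp add: m_def)
  qed
  have uJ: "(i, l') \<in> J" using ideal_down[OF J l'(1), of i l'] l' row_mono[of i i'] i ib by (auto simp: poset_iff)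
  have uJ': "(i, u) \<in> J" using ideal_down[OF J uJ, of i u] u ui ib i by (auto simp: poset_iff)
  have uM: "(i, u) \<in> \<O> \<Longrightarrow> ky u \<le> ky l" using uJ' l(1) by (auto simp: is_lst_def M_set_def)
  have km: "ky m \<le> ky u" using m by (auto simp: prevp_def split: if_splits)
  have "rk i m < rk i l"
  proof (cases "ky m < ky l")
    case True
    have "\<not> row_exc \<O> i m l"
    proof
      assume "row_exc \<O> i m l"
      then have e: "(i, m) \<in> \<O>" "blk i m = blk i l" using row_exc_iff[OF ib(1) mrow l(3) True] by auto
      have "(i, u) \<in> \<O>" using m e(1) by (auto split: if_splits)
      moreover from this have "ky m < ky u" using m by (auto simp: prevp_def)
      ultimately have "blk i m < blk i l" using blk_less[OF True] uM by blast
      then show False using e by simp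
    qed
    then show ?thesis using rk_less[OF ib(1) mrow l(3) True] by simp
  next
    case False
    have uO: "(i, u) \<notin> \<O>"
    proof
      assume "(i, u) \<in> \<O>"
      then have "ky m < ky u" "ky u \<le> ky l" using m uM by (auto simp: prevp_def)
      then show False using False by simp
    qed
    then have mu: "m = u" using m by simp
    \<comment> \<open>If \<open>m = l\<close>, then \<open>(i, l)\<close> would be a member of
      \<open>M_set\<close> outside \<open>\<O>\<close> lying strictly below \<open>(i', l')\<close>,
      although only maximal elements can lie outside \<open>\<O>\<close>.\<close>
    have neq: "m \<noteq> l"
    proof
      assume "m = l"
      then have ll: "ky l \<le> ky l'" "(i, l) \<notin> \<O>" using u mu uO by auto
      have "(i, l) \<prec>\<^sub>P (i', l')"
        using ll i l l' ip ideal_poset[OF J] by (subst pprec_ky) auto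
      then have "(i, l) \<notin> max_elems J" using l' by (auto simp: max_elems_def)
      then show False using l(1) ll by (auto simp: is_lst_def M_set_def)
    qed
    have lt: "ky l < ky m" using False neq ky_inj_row[OF ib(1) mrow l(3)] by simp
    have "(i, l) \<in> \<O>"
    proof (rule ccontr)
      assume "(i, l) \<notin> \<O>"
      then have "(i, l) \<in> max_elems J" using l(1) by (auto simp: is_lst_def M_set_def)
      moreover have "(i, l) \<prec>\<^sub>P (i, u)" using lt mu uJ' l ideal_poset[OF J] neq by (subst pprec_ky) auto
      ultimately show False using uJ' by (auto simp: max_elems_def)
    qed
    moreover have "\<not> blk i l < blk i m"
    proof
      assume "blk i l < blk i m"
      then obtain y where y: "(i, y) \<in> \<O>" "ky l < ky y" "ky y \<le> ky m" using blk_neqD by blast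
      have "(i, y) \<in> J" using ideal_down[OF J uJ', of i y] y mu O_poset by auto
      then have "(i, y) \<in> M_set \<O> J" using y by (auto simp: M_set_def)
      then show False using l(1) y by (force simp: is_lst_def)
    qed
    then have "blk i l = blk i m" using blk_le[of l m i] lt by simp
    ultimately have "row_exc \<O> i l m" using row_exc_iff[OF ib(1) l(3) mrow lt] by simp
    then show ?thesis using rk_less[OF ib(1) l(3) mrow lt] by simp
  qed
  moreover have "ideal_tuple J i = rr i l" by (simp add: ideal_tuple_def l_def)
  ultimately show ?thesis
    using ib i mrow l by (simp add: pos_less_iff wm pk_def U_rr poset_iff rr_in_row)
qed

lemma ideal_tuple_inj:
  assumes "J \<in> ideals n" "(i, i) \<in> J" "(i', i') \<in> J" "ideal_tuple J i = ideal_tuple J i'"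
  shows "i = i'"
  using ideal_tuple_greedy[OF assms(1,2,3)] ideal_tuple_greedy[OF assms(1,3,2)] assms(4) pos_less_irrefl
  by (metis linorder_neqE)

lemma ideal_eq_down: 
  assumes J: "J \<in> ideals n"
  shows "J = {p \<in> poset n. \<exists>q\<in>M_set \<O> J. p \<preceq>\<^sub>P q}"
proof
  note ip = subset_posetD[OF ideal_poset[OF J]]
  show "J \<subseteq> {p \<in> poset n. \<exists>q\<in>M_set \<O> J. p \<preceq>\<^sub>P q}"
  proof
    fix p assume p: "p \<in> J"
    obtain i j where pij: "p = (i, j)" by (cases p)
    \<comment> \<open>\<open>?f\<close> grows strictly along the order, so an element of
      \<open>J\<close> above \<open>p\<close> at which it is largest is maximal in
      \<open>J\<close>.\<close>
    let ?S = "{q \<in> J. p \<preceq>\<^sub>P q}" and ?f = "\<lambda>q. fst q + ky (snd q)"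
    have fin: "finite ?S" using finite_subset[OF ideal_poset[OF J]] by simp
    have "p \<in> ?S" using p pleq_refl ideal_poset[OF J] by blast
    then have ne: "?f ` ?S \<noteq> {}" by blast
    have "Max (?f ` ?S) \<in> ?f ` ?S" using Max_in[OF _ ne] fin by simp
    then obtain q where q: "q \<in> J" "p \<preceq>\<^sub>P q" "?f q = Max (?f ` ?S)" by auto
    have "\<not> q \<prec>\<^sub>P q'" if q': "q' \<in> J" for q'
    proof
      assume lt: "q \<prec>\<^sub>P q'"
      obtain a b c d where ab: "q = (a, b)" "q' = (c, d)" by (cases q, cases q') auto
      have P: "(i, j) \<in> poset n" "(a, b) \<in> poset n" "(c, d) \<in> poset n"
        using ideal_poset[OF J] p q(1) q' ab pij by auto
      have le: "a \<le> c" "ky b \<le> ky d" "(a, b) \<noteq> (c, d)" using lt pprec_ky P ab by auto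
      have "p \<preceq>\<^sub>P q'" using q(2) le pleq_ky[OF P(1,2)] pleq_ky[OF P(1,3)] unfolding ab pij by auto
      then have "?f q' \<in> ?f ` ?S" using q' by blast
      then have "?f q' \<le> ?f q" unfolding q(3) using fin by (intro Max_ge) auto
      then have "a = c" "ky b = ky d" using le ab by auto
      then show False using le(3) P ky_inj_row[of a b d] by (auto simp: poset_iff)
    qed
    then have "q \<in> M_set \<O> J" using q(1) by (auto simp: M_set_def max_elems_def)
    then show "p \<in> {p \<in> poset n. \<exists>q\<in>M_set \<O> J. p \<preceq>\<^sub>P q}" using q p ideal_poset[OF J] by auto
  qed
  show "{p \<in> poset n. \<exists>q\<in>M_set \<O> J. p \<preceq>\<^sub>P q} \<subseteq> J"
    using J M_set_subset[OF J] by (auto simp: ideals_def)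
qed

lemma first_diff:
  fixes f g :: "int \<Rightarrow> int"
  assumes "i0 \<in> {1..k}" "f i0 \<noteq> g i0"
  shows "\<exists>i\<in>{1..k}. f i \<noteq> g i \<and> (\<forall>i'. 1 \<le> i' \<and> i' < i \<longrightarrow> f i' = g i')"
proof -
  define D where "D = {i \<in> {1..k}. f i \<noteq> g i}"
  have fin: "finite D" by (rule finite_subset[of _ "{1..k}"]) (auto simp: D_def)
  have ne: "i0 \<in> D" using assms by (auto simp: D_def)
  have m: "Min D \<in> D" using Min_in[OF fin] ne by auto
  have "f i' = g i'" if "1 \<le> i'" "i' < Min D" for i'
  proof (rule ccontr)
    assume "f i' \<noteq> g i'"
    then have "i' \<in> D" using that m by (auto simp: D_def)
    then show False using Min_le[OF fin] that by fastforce
  qed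
  then show ?thesis using m by (intro bexI[of _ "Min D"]) (auto simp: D_def)
qed

text \<open>At the first row where the two tuples differ, each entry occurs later in the other
  tuple, and greediness makes each of the two smaller than the other. Equal tuples have equal last
  members, hence equal rows of \<open>M_set\<close>, and \<open>M_set\<close> generates the
  ideal.\<close>

lemma ideal_tuple_determines:
  assumes J: "J \<in> ideals_k n k" "J' \<in> ideals_k n k" and eq: "ideal_tuple J ` {1..int k} = ideal_tuple J' ` {1..int k}"
  shows "J = J'"
proof -
  note Jk = ideals_k_diag[OF J(1)] and Jk' = ideals_k_diag[OF J(2)]
  have aux: "pos_less n \<O> (i, ideal_tuple J1 i) (i, ideal_tuple J2 i)"
    if "J1 \<in> ideals_k n k" "J2 \<in> ideals_k n k" "ideal_tuple J1 ` {1..int k} = ideal_tuple J2 ` {1..int k}" "i \<in> {1..int k}"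
      "ideal_tuple J1 i \<noteq> ideal_tuple J2 i" "\<forall>i'. 1 \<le> i' \<and> i' < i \<longrightarrow> ideal_tuple J1 i' = ideal_tuple J2 i'" for J1 J2 i
  proof -
    note k1 = ideals_k_diag[OF that(1)] and k2 = ideals_k_diag[OF that(2)]
    note eq12 = that(3) and i_mem = that(4)
    obtain i' where i': "i' \<in> {1..int k}" "ideal_tuple J1 i = ideal_tuple J2 i'" using eq12 i_mem by (metis image_iff image_eqI)
    have "\<not> i' < i"
    proof
      assume "i' < i"
      then have "ideal_tuple J1 i' = ideal_tuple J1 i" using that(6) i' by auto
      then show False using ideal_tuple_inj[OF k1(3), of i' i] k1(1) i'(1) that(4) \<open>i' < i\<close> by auto
    qed
    moreover have "i' \<noteq> i" using that(5) i' by auto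
    ultimately show ?thesis using ideal_tuple_greedy[OF k2(3), of i i'] k2(1) i' that(4) by auto
  qed
  have weq: "ideal_tuple J i = ideal_tuple J' i" if "i \<in> {1..int k}" for i
  proof (rule ccontr)
    assume "ideal_tuple J i \<noteq> ideal_tuple J' i"
    from first_diff[of i "int k" "ideal_tuple J" "ideal_tuple J'", OF that this] obtain i1 where
      i1: "i1 \<in> {1..int k}" "ideal_tuple J i1 \<noteq> ideal_tuple J' i1" "\<forall>i'. 1 \<le> i' \<and> i' < i1 \<longrightarrow> ideal_tuple J i' = ideal_tuple J' i'" by blast
    have "pos_less n \<O> (i1, ideal_tuple J i1) (i1, ideal_tuple J' i1)" using aux[OF J eq i1] .
    moreover have "pos_less n \<O> (i1, ideal_tuple J' i1) (i1, ideal_tuple J i1)"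
      using aux[OF J(2,1) eq[symmetric] i1(1)] i1 by auto
    ultimately show False using pos_less_trans pos_less_irrefl by blast
  qed
  have leq: "lst J i = lst J' i" if "i \<in> {1..int k}" for i
    using weq[OF that] rr_inj[of i] that by (auto simp: ideal_tuple_def)
  have "M_set \<O> J = M_set \<O> J'"
  proof (rule Set.set_eqI)
    fix p :: "int \<times> int"
    obtain i j where p: "p = (i, j)" by (cases p)
    show "p \<in> M_set \<O> J \<longleftrightarrow> p \<in> M_set \<O> J'"
    proof (cases "i \<in> {1..int k}")
      case True
      then show ?thesis
        using is_lst_row[OF Jk(3) lst[OF Jk(3)], of i j] is_lst_row[OF Jk'(3) lst[OF Jk'(3)], of i j] Jk(1)[of i] Jk'(1)[of i] p leq[OF True] by auto
    next
      case False
      then have "(i, i) \<notin> J" "(i, i) \<notin> J'" using Jk(1)[of i] Jk'(1)[of i] by auto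
      then have "p \<notin> J" "p \<notin> J'" using ideal_diag Jk(3) Jk'(3) p by blast+
      then show ?thesis using M_set_subset Jk(3) Jk'(3) by blast
    qed
  qed
  then show ?thesis using ideal_eq_down[OF Jk(3)] ideal_eq_down[OF Jk'(3)] by simp
qed

section \<open>Admissible sets\<close>

definition admk :: "nat \<Rightarrow> int set set"
  where "admk k = {S. S \<subseteq> rws 1 \<and> card S = k \<and> (\<forall>l\<in>{1..n}. card {i \<in> S. \<bar>i\<bar> \<le> int l} \<le> l)}"

lemma finite_admk: "finite (admk k)"
  by (rule finite_subset[of _ "Pow (rws 1)"]) (auto simp: admk_def)

lemma ideal_tuple_inj_on: "J \<in> ideals_k n k \<Longrightarrow> inj_on (ideal_tuple J) {1..int k}"
  using ideal_tuple_inj ideals_k_diag by (intro inj_onI) (metis atLeastAtMost_iff)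

text \<open>The entry of row \<open>i\<close> has absolute value at least \<open>i\<close>, so the
  entries bounded by \<open>l\<close> come from the first \<open>l\<close> rows.\<close>

lemma ideal_tuple_admk:
  assumes J: "J \<in> ideals_k n k"
  shows "ideal_tuple J ` {1..int k} \<in> admk k"
proof -
  note Jk = ideals_k_diag[OF J]
  have r: "ideal_tuple J i \<in> rws i" if "i \<in> {1..int k}" for i using ideal_tuple_row[OF Jk(3)] Jk(1) that by auto
  have "card {i \<in> ideal_tuple J ` {1..int k}. \<bar>i\<bar> \<le> int l} \<le> l" for l
  proof -
    have "{i \<in> ideal_tuple J ` {1..int k}. \<bar>i\<bar> \<le> int l} \<subseteq> ideal_tuple J ` {1..int l}" using r by (force simp: rws_def)
    then have "card {i \<in> ideal_tuple J ` {1..int k}. \<bar>i\<bar> \<le> int l} \<le> card (ideal_tuple J ` {1..int l})" by (intro card_mono) auto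
    also have "\<dots> \<le> l" using card_image_le[of "{1..int l}" "ideal_tuple J"] by simp
    finally show ?thesis .
  qed
  moreover have "ideal_tuple J ` {1..int k} \<subseteq> rws 1" using r row_mono[of 1] by force
  ultimately show ?thesis unfolding admk_def using ideal_tuple_inj_on[OF J] by (auto simp: card_image)
qed

end

text \<open>For \<open>\<O>\<close> equal to the diagonal all the permutations involved are trivial, and an admissible set
  is reached by pairing its elements outside \<open>{1..k}\<close> with the missing elements of \<open>{1..k}\<close>.\<close>

locale marked_poset_diag = marked_poset n "diag n" for n
begin

lemma rr_diag: "1 \<le> i \<Longrightarrow> rr i l = l"
proof -
  assume i: "1 \<le> i"
  have "rowp (diag n) i x = x" for i x
  proof -
    have "\<forall>y\<in>set (rowl (diag n) i). y = i" by (auto simp: rowl_def diag_def)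
    then show ?thesis unfolding rowp_def by (intro comps_fix) auto
  qed
  then have "U i l = l" unfolding U_def by (intro comps_fix)
  then show ?thesis using rr_U[OF i, of l] by simp
qed

lemma admk_surj:
  assumes S: "S \<in> admk k" and k: "k \<le> n"
  shows "\<exists>J\<in>ideals_k n k. ideal_tuple J ` {1..int k} = S"
proof -
  have S1: "S \<subseteq> rws 1" "card S = k" and adm: "\<And>l. l \<in> {1..n} \<Longrightarrow> card {i \<in> S. \<bar>i\<bar> \<le> int l} \<le> l"
    using S by (auto simp: admk_def)
  have finS: "finite S" using finite_subset[OF S1(1)] by simp
  \<comment> \<open>The missing elements of \<open>{1..k}\<close> in increasing and the surplus
    elements of \<open>S\<close> in decreasing order: the opposite monotonicity makes the points
    \<open>(ps ! a, qs ! a)\<close> pairwise incomparable.\<close>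
  define ps where "ps = filter (\<lambda>i. i \<notin> S) [1..int k]"
  define qs where "qs = rev (filter (\<lambda>j. j \<in> S \<and> j \<notin> {1..int k}) js)"
  define m where "m = length ps"
  have sps: "set ps = {1..int k} - S" and sqs: "set qs = S - {1..int k}"
    using S1(1) set_js by (auto simp: ps_def qs_def)
  have dps: "distinct ps" and dqs: "distinct qs" using distinct_js by (auto simp: ps_def qs_def)
  have m: "m = length qs"
  proof -
    have "card ({1..int k} - S) = k - card (S \<inter> {1..int k})" by (simp add: card_Diff_subset_Int Int_commute)
    moreover have "card (S - {1..int k}) = k - card (S \<inter> {1..int k})" using S1 finS by (simp add: card_Diff_subset_Int)
    ultimately show ?thesis using sps sqs distinct_card[OF dps] distinct_card[OF dqs] by (simp add: m_def)
  qed
  have psmono: "ps ! a < ps ! b" if "a < b" "b < m" for a b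
    using that sorted_wrt_nth_less[OF sorted_wrt_filter[OF sorted_upto_less[of 1 "int k"]], of a b] by (simp add: ps_def m_def)
  have qsmono: "ky (qs ! b) < ky (qs ! a)" if "a < b" "b < m" for a b
  proof -
    have "sorted_wrt (\<lambda>x y. ky y < ky x) qs" unfolding qs_def sorted_wrt_rev
      using sorted_wrt_filter[OF sorted_js] by simp
    then show ?thesis using that m sorted_wrt_nth_less by fastforce
  qed
  have psb: "ps ! a \<in> {1..int k} - S" "ps ! a \<in> {1..int k}" if "a < m" for a using that sps nth_mem[of a ps] by (auto simp: m_def)
  have qsb: "qs ! a \<in> S - {1..int k}" "qs ! a \<in> rws 1" if "a < m" for a using that sqs nth_mem[of a qs] S1 m by auto
  have qlarge: "int k < ky (qs ! a)" if "a < m" for a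
    using qsb[OF that] k by (auto simp: ky_def rws_def)
  have gP: "(ps ! a, qs ! a) \<in> poset n" if a: "a < m" for a
  proof -
    \<comment> \<open>Admissibility enters here. If \<open>l = |qs ! a|\<close> were less than
      \<open>ps ! a\<close>, then \<open>S\<close> would contain the \<open>a + 1\<close> surplus
      elements up to index \<open>a\<close> and all but at most \<open>a\<close> of the numbers
      \<open>1, ..., l\<close>, so \<open>l + 1\<close> elements of absolute value at most
      \<open>l\<close>.\<close>
    have "ps ! a \<le> \<bar>qs ! a\<bar>"
    proof (rule ccontr)
      assume c: "\<not> ps ! a \<le> \<bar>qs ! a\<bar>"
      define l where "l = nat \<bar>qs ! a\<bar>"
      have l: "int l = \<bar>qs ! a\<bar>" "1 \<le> l" "int l < ps ! a" "l \<le> n" using c qsb[OF a] by (auto simp: l_def rws_def)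
      have lk: "int l < int k" using l(3) psb[OF a] by auto
      have qn: "qs ! a < 0" using qsb[OF a] lk l(1,2) by (cases "qs ! a > 0") auto
      let ?A = "(!) qs ` {..a}" and ?B = "{1..int l} - (!) ps ` {..<a}"
      have A: "x \<in> S \<and> \<bar>x\<bar> \<le> int l \<and> x \<notin> {1..int k}" if "x \<in> ?A" for x
      proof -
        obtain b where b: "b \<le> a" "x = qs ! b" using \<open>x \<in> ?A\<close> by auto
        then have "ky (qs ! a) \<le> ky x" using qsmono[of b a] a by (cases "b = a") auto
        moreover have "x \<in> S - {1..int k}" "x \<in> rws 1" using qsb[of b] b a by auto
        ultimately show ?thesis using qn l(1) by (auto simp: ky_def rws_def split: if_splits)
      qed
      have B: "x \<in> S \<and> \<bar>x\<bar> \<le> int l \<and> x \<in> {1..int k}" if "x \<in> ?B" for x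
      proof -
        have xk: "x \<in> {1..int k}" "x \<le> int l" using that lk by auto
        have "x \<in> S"
        proof (rule ccontr)
          assume "x \<notin> S"
          then obtain b where b: "b < m" "x = ps ! b" using sps xk in_set_conv_nth[of x ps] by (auto simp: m_def)
          then have "\<not> b < a" using that by auto
          then have "ps ! a \<le> x" using psmono[of a b] b by (cases "a = b") auto
          then show False using xk l by simp
        qed
        then show ?thesis using xk by auto
      qed
      have "card ?A = a + 1"
        using dqs a m by (subst card_image) (auto simp: inj_on_def nth_eq_iff_index_eq)
      moreover have "l - a \<le> card ?B"
      proof -
        have "card ((!) ps ` {..<a}) \<le> a" using card_image_le[of "{..<a}" "(!) ps"] by simp
        then show ?thesis using diff_card_le_card_Diff[of "(!) ps ` {..<a}" "{1..int l}"] by simp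
      qed
      moreover have "?A \<inter> ?B = {}" using A B by blast
      then have "card (?A \<union> ?B) = card ?A + card ?B" by (intro card_Un_disjoint) auto
      moreover have "?A \<union> ?B \<subseteq> {i \<in> S. \<bar>i\<bar> \<le> int l}" using A B by blast
      then have "card (?A \<union> ?B) \<le> card {i \<in> S. \<bar>i\<bar> \<le> int l}" using finS by (intro card_mono) auto
      ultimately have "l + 1 \<le> card {i \<in> S. \<bar>i\<bar> \<le> int l}" by linarith
      then show False using adm[of l] l by auto
    qed
    then show ?thesis using psb[OF a] qsb[OF a] k by (auto simp: poset_iff rws_def)
  qed
  \<comment> \<open>The diagonal points give the generated ideal the right diagonal; the remaining
    points turn out to be maximal elements of it.\<close>
  define G where "G = (\<lambda>i. (i, i)) ` {1..int k} \<union> (\<lambda>a. (ps ! a, qs ! a)) ` {..<m}"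
  have GP: "G \<subseteq> poset n" using gP k by (auto simp: G_def poset_iff rws_def)
  define J where "J = {p \<in> poset n. \<exists>g\<in>G. p \<preceq>\<^sub>P g}"
  have Jiff: "(i, j) \<in> J \<longleftrightarrow> (i, j) \<in> poset n \<and> ((\<exists>c\<in>{1..int k}. i \<le> c \<and> ky j \<le> ky c) \<or> (\<exists>a<m. i \<le> ps ! a \<and> ky j \<le> ky (qs ! a)))" for i j
  proof (cases "(i, j) \<in> poset n")
    case True
    have "(i, j) \<preceq>\<^sub>P (c, d) \<longleftrightarrow> i \<le> c \<and> ky j \<le> ky d" if "(c, d) \<in> G" for c d
      using pleq_ky[OF True] that GP by blast
    then have "(\<exists>g\<in>G. (i, j) \<preceq>\<^sub>P g) \<longleftrightarrow> (\<exists>(c, d)\<in>G. i \<le> c \<and> ky j \<le> ky d)" by fast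
    also have "\<dots> \<longleftrightarrow> ((\<exists>c\<in>{1..int k}. i \<le> c \<and> ky j \<le> ky c) \<or> (\<exists>a<m. i \<le> ps ! a \<and> ky j \<le> ky (qs ! a)))"
      by (auto simp: G_def)
    finally show ?thesis using True by (simp add: J_def)
  qed (simp add: J_def)
  have JP: "J \<subseteq> poset n" by (auto simp: J_def)
  have Jid: "J \<in> ideals n"
  proof -
    have "q \<in> J" if "p \<in> J" "q \<in> poset n" "q \<preceq>\<^sub>P p" for p q
    proof -
      obtain a b c d where pq: "p = (a, b)" "q = (c, d)" by (cases p, cases q) auto
      have "c \<le> a" "ky d \<le> ky b" using that pq JP pleq_ky[of c d a b] by auto
      moreover have "(a, b) \<in> J" "(c, d) \<in> poset n" using that(1,2) pq by simp_all
      ultimately show ?thesis unfolding pq Jiff by (meson order_trans)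
    qed
    then show ?thesis using JP by (auto simp: ideals_def)
  qed
  have Jd: "(i, i) \<in> J \<longleftrightarrow> i \<in> {1..int k}" for i
  proof
    assume "(i, i) \<in> J"
    then have "1 \<le> i" "(\<exists>c\<in>{1..int k}. i \<le> c) \<or> (\<exists>a<m. i \<le> ps ! a)" by (auto simp: Jiff poset_iff)
    then show "i \<in> {1..int k}" using psb by force
  next
    assume "i \<in> {1..int k}"
    then show "(i, i) \<in> J" using k by (auto simp: Jiff poset_iff rws_def)
  qed
  have "J \<inter> diag n = (\<lambda>i. (i, i)) ` {1..int k}"
    using Jd k by (fastforce simp: diag_def)
  then have Jk: "J \<in> ideals_k n k" using Jid by (simp add: ideals_k_def card_image inj_on_def)
  have maxG: "max_elems J \<subseteq> G"
  proof
    fix p assume p: "p \<in> max_elems J"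
    then obtain g where g: "g \<in> G" "p \<preceq>\<^sub>P g" by (auto simp: max_elems_def J_def)
    have "g \<in> J" using g GP by (cases g) (auto simp: J_def intro!: bexI[of _ g] pleq_refl)
    then show "p \<in> G" using p g by (auto simp: max_elems_def pprec_def)
  qed
  have l1: "is_lst J i i" if i: "i \<in> {1..int k}" "i \<in> S" for i
  proof -
    have "j = i" if "(i, j) \<in> M_set (diag n) J" for j
    proof -
      have "(i, j) \<in> diag n \<or> (i, j) \<in> G" using that maxG by (auto simp: M_set_def)
      moreover have "i \<noteq> ps ! a" if "a < m" for a using psb[OF that] i by auto
      ultimately show ?thesis by (auto simp: diag_def G_def)
    qed
    moreover have "(i, i) \<in> M_set (diag n) J" using Jd i k by (auto simp: M_set_def diag_def)
    ultimately show ?thesis by (auto simp: is_lst_def)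
  qed
  have l2: "is_lst J (ps ! a) (qs ! a)" if a: "a < m" for a
  proof -
    have gJ: "(ps ! a, qs ! a) \<in> J" using gP[OF a] a by (auto simp: Jiff)
    have "(ps ! a, qs ! a) \<in> max_elems J"
    proof -
      have False if q: "(i', j') \<in> J" "(ps ! a, qs ! a) \<prec>\<^sub>P (i', j')" for i' j'
      proof -
        have le: "ps ! a \<le> i'" "ky (qs ! a) \<le> ky j'" "(ps ! a, qs ! a) \<noteq> (i', j')"
          using pprec_ky[OF gP[OF a], of i' j'] q JP by auto
        have "\<not> (\<exists>c\<in>{1..int k}. i' \<le> c \<and> ky j' \<le> ky c)"
          using le(2) qlarge[OF a] by (auto simp: ky_def)
        then obtain b where b: "b < m" "i' \<le> ps ! b" "ky j' \<le> ky (qs ! b)" using q(1) by (auto simp: Jiff)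
        have "\<not> a < b" using qsmono[of a b] b le by auto
        moreover have "\<not> b < a" using psmono[of b a] b le a by auto
        ultimately have "b = a" by simp
        then have "i' = ps ! a" "ky j' = ky (qs ! a)" using b le by auto
        moreover have "j' \<in> rws 1" using q(1) JP row_mono[of 1 i'] subset_posetD by blast
        ultimately show False using le(3) ky_inj qsb(2)[OF a] by auto
      qed
      then show ?thesis using gJ by (auto simp: max_elems_def)
    qed
    moreover have "ky j \<le> ky (qs ! a)" if j: "(ps ! a, j) \<in> M_set (diag n) J" for j
    proof -
      have "(ps ! a, j) \<in> diag n \<or> (ps ! a, j) \<in> G" using j maxG by (auto simp: M_set_def)
      then have "j = ps ! a \<or> (\<exists>b<m. ps ! a = ps ! b \<and> j = qs ! b)" by (auto simp: diag_def G_def)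
      moreover have "ky (ps ! a) \<le> ky (qs ! a)" using qlarge[OF a] psb[OF a] by (auto simp: ky_def)
      moreover have "b = a" if "b < m" "ps ! a = ps ! b" for b
        using that a dps by (simp add: nth_eq_iff_index_eq m_def)
      ultimately show ?thesis by auto
    qed
    ultimately show ?thesis by (auto simp: is_lst_def M_set_def)
  qed
  have lu: "lst J i = l" if "is_lst J i l" for i l
  proof -
    have e: "is_lst J i (lst J i)" unfolding lst_def using that by (rule someI)
    then have "ky (lst J i) = ky l" "(i, lst J i) \<in> J" "(i, l) \<in> J"
      using that M_set_subset[OF Jid] by (auto simp: is_lst_def intro: order_antisym)
    then show ?thesis using ky_inj_row[of i "lst J i" l] subset_posetD[OF JP] by blast
  qed
  have w1: "ideal_tuple J i = i" if "i \<in> {1..int k}" "i \<in> S" for i using lu[OF l1[OF that]] that by (simp add: ideal_tuple_def rr_diag)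
  have w2: "ideal_tuple J (ps ! a) = qs ! a" if "a < m" for a using lu[OF l2[OF that]] psb[OF that] by (simp add: ideal_tuple_def rr_diag)
  have "ideal_tuple J ` {1..int k} = S"
  proof
    show "ideal_tuple J ` {1..int k} \<subseteq> S"
    proof
      fix x assume "x \<in> ideal_tuple J ` {1..int k}"
      then obtain i where i: "i \<in> {1..int k}" "x = ideal_tuple J i" by auto
      show "x \<in> S"
      proof (cases "i \<in> S")
        case False
        then obtain a where "a < m" "i = ps ! a" using i sps in_set_conv_nth[of i ps] by (auto simp: m_def)
        then show ?thesis using w2 i qsb by auto
      qed (use w1 i in auto)
    qed
    show "S \<subseteq> ideal_tuple J ` {1..int k}"
    proof
      fix x assume x: "x \<in> S"
      show "x \<in> ideal_tuple J ` {1..int k}"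
      proof (cases "x \<in> {1..int k}")
        case False
        then obtain a where a: "a < m" "x = qs ! a" using x sqs in_set_conv_nth[of x qs] m by auto
        then show ?thesis using w2[of a] psb[of a] by (metis imageI)
      qed (use w1[of x] x in \<open>metis imageI\<close>)
    qed
  qed
  then show ?thesis using Jk by blast
qed

end

context marked_poset begin

text \<open>Neither side mentions \<open>\<O>\<close>, so the diagonal may be put in its place,
  where every admissible set is reached.\<close>

lemma card_admk_le: "k \<le> n \<Longrightarrow> card (admk k) \<le> card (ideals_k n k)"
proof -
  assume k: "k \<le> n"
  interpret D: marked_poset_diag n
    by unfold_locales (use n1 in \<open>auto simp: diag_def poset_def\<close>)
  have fin: "finite (ideals_k n k)" by (rule finite_subset[of _ "Pow (poset n)"]) (auto simp: ideals_k_def ideals_def)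
  have "admk k \<subseteq> (\<lambda>J. D.ideal_tuple J ` {1..int k}) ` ideals_k n k"
  proof
    fix S assume "S \<in> admk k"
    then obtain J where "J \<in> ideals_k n k" "D.ideal_tuple J ` {1..int k} = S" using D.admk_surj[OF _ k] by blast
    then show "S \<in> (\<lambda>J. D.ideal_tuple J ` {1..int k}) ` ideals_k n k" by blast
  qed
  then show ?thesis using surj_card_le[OF fin] by blast
qed

text \<open>Injectivity is known for the given \<open>\<O>\<close>; surjectivity follows because the
  image is at least as large as the finite set \<open>admk k\<close> that contains it.\<close>

lemma bij_ideals_admk:
  assumes "k \<le> n"
  shows "bij_betw (\<lambda>J. ideal_tuple J ` {1..int k}) (ideals_k n k) (admk k)"
proof -
  let ?f = "\<lambda>J. ideal_tuple J ` {1..int k}"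
  have inj: "inj_on ?f (ideals_k n k)" using ideal_tuple_determines by (intro inj_onI)
  have sub: "?f ` ideals_k n k \<subseteq> admk k" using ideal_tuple_admk by auto
  have "card (?f ` ideals_k n k) = card (ideals_k n k)" using inj by (rule card_image)
  then have "card (admk k) \<le> card (?f ` ideals_k n k)" using card_admk_le[OF assms] by simp
  then have "?f ` ideals_k n k = admk k" using card_seteq[OF finite_admk sub] by simp
  then show ?thesis using inj by (simp add: bij_betw_def)
qed

end

type_synonym laurent = "(int \<times> int \<Rightarrow>\<^sub>0 int) \<Rightarrow>\<^sub>0 complex"

context marked_poset begin

section \<open>Leading exponents of Laurent polynomials\<close>

text \<open>The coefficient \<open>c\<close> may be \<open>0\<close>, in which case all exponents of \<open>f\<close> are strictly below \<open>x\<close>.\<close>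

definition leads :: "laurent \<Rightarrow> (int \<times> int \<Rightarrow>\<^sub>0 int) \<Rightarrow> complex \<Rightarrow> bool"
  where "leads f x c \<longleftrightarrow> (\<forall>y\<in>ks f. leA y x) \<and> lk f x = c"

lemma leads_add: "leads f x c \<Longrightarrow> leads g x d \<Longrightarrow> leads (f + g) x (c + d)"
  using keys_add[of f g] by (auto simp: leads_def lookup_add)

lemma leads_0: "leads 0 x 0" by (simp add: leads_def)

lemma leads_sum: "(\<And>i. i \<in> I \<Longrightarrow> leads (f i) x (c i)) \<Longrightarrow> leads (\<Sum>i\<in>I. f i) x (\<Sum>i\<in>I. c i)"
  by (induction I rule: infinite_finite_induct) (auto simp: leads_0 leads_add)

lemma leads_single: "leads (sg x c) x c"
  by (auto simp: leads_def)

lemma leads_1: "leads 1 0 1"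
  using leads_single[of 0 1] by simp

text \<open>By \<open>leA_add_eq\<close> only the pair \<open>(x, y)\<close> of exponents
  contributes to \<open>x + y\<close>. Vanishing coefficients are covered, so strictly lower terms
  need no separate treatment.\<close>

lemma leads_mult:
  assumes f: "leads f x c" and g: "leads g y d"
  shows "leads (f * g) (x + y) (c * d)"
proof -
  have "leA z (x + y)" if z: "z \<in> ks (f * g)" for z
  proof -
    obtain a b where "z = a + b" "a \<in> ks f" "b \<in> ks g" using keys_mult[of f g] z by auto
    then show ?thesis using f g by (auto simp: leads_def intro: leA_add)
  qed
  moreover have "lk (f * g) (x + y) = c * d"
  proof -
    have fg: "f * g = (\<Sum>a\<in>ks f. \<Sum>b\<in>ks g. sg (a + b) (lk f a * lk g b))"
      using sum_single_lookup[of "ks f" f] sum_single_lookup[of "ks g" g]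
      by (metis (no_types, lifting) finite_keys mult_single order_refl sum.cong sum_product)
    have z: "lk (sg (a + b) (lk f a * lk g b)) (x + y) = (if b = y then if a = x then c * d else 0 else 0)"
      if "a \<in> ks f" "b \<in> ks g" for a b
    proof -
      have "leA a x" "leA b y" using that f g by (auto simp: leads_def)
      then have "a + b = x + y \<longleftrightarrow> a = x \<and> b = y" using leA_add_eq[of a x b y] by auto
      then show ?thesis using f g by (auto simp: lookup_single when_def leads_def)
    qed
    have "lk (f * g) (x + y) = (\<Sum>a\<in>ks f. \<Sum>b\<in>ks g. if b = y then if a = x then c * d else 0 else 0)"
      unfolding fg lookup_sum by (intro sum.cong refl z)
    also have "\<dots> = (if y \<in> ks g then if x \<in> ks f then c * d else 0 else 0)" by simp
    also have "\<dots> = c * d" using f g by (auto simp: leads_def in_keys_iff)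
    finally show ?thesis .
  qed
  ultimately show ?thesis by (simp add: leads_def)
qed

lemma leads_prod: "finite I \<Longrightarrow> (\<And>i. i \<in> I \<Longrightarrow> leads (f i) (x i) (c i)) \<Longrightarrow> leads (\<Prod>i\<in>I. f i) (\<Sum>i\<in>I. x i) (\<Prod>i\<in>I. c i)"
  by (induction I rule: finite_induct) (auto simp: leads_1 leads_mult)

lemma leads_scale: "leads f x c \<Longrightarrow> leads (sg 0 d * f) x (d * c)"
  using leads_mult[OF leads_single[of 0 d]] by simp

lemma leads_of_int: "leads f x c \<Longrightarrow> leads (of_int d * f) x (of_int d * c)"
  using leads_scale[of f x c "of_int d"] by simp

lemma leads_power: "leads f x c \<Longrightarrow> leads (f ^ k) (frag_cmul (int k) x) (c ^ k)"
proof (induction k)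
  case (Suc k)
  then have "leads (f * f ^ k) (x + frag_cmul (int k) x) (c * c ^ k)" by (intro leads_mult) auto
  then show ?case by (simp add: frag_cmul_distrib add.commute)
qed (simp add: leads_1)

lemma leads_less: "(\<And>y. y \<in> ks f \<Longrightarrow> less_A n \<O> y x) \<Longrightarrow> leads f x 0"
  unfolding leads_def leA_def using less_A_irrefl by (metis lk_notin_ks)

text \<open>The order is total on exponents that live on the poset; this condition therefore
  guarantees that a nonzero Laurent polynomial has a leading exponent.\<close>

definition supported :: "laurent \<Rightarrow> bool" where "supported f \<longleftrightarrow> ks f \<subseteq> vecs n"

lemma supported_0 [simp]: "supported 0" and supported_single: "x \<in> vecs n \<Longrightarrow> supported (sg x c)"
  by (auto simp: supported_def)

lemma supported_1 [simp]: "supported 1" using supported_single[of 0 1] by simp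

lemma supported_of_int [simp]: "supported (of_int c)" using supported_single[of 0 "of_int c"] by simp

lemma supported_add: "supported f \<Longrightarrow> supported g \<Longrightarrow> supported (f + g)"
  using keys_add[of f g] by (auto simp: supported_def)

lemma supported_diff: "supported f \<Longrightarrow> supported g \<Longrightarrow> supported (f - g)"
  using keys_diff[of f g] by (auto simp: supported_def)

lemma supported_mult: "supported f \<Longrightarrow> supported g \<Longrightarrow> supported (f * g)"
  using keys_mult[of f g] vecs_add unfolding supported_def by blast

lemma supported_sum: "(\<And>i. i \<in> I \<Longrightarrow> supported (f i)) \<Longrightarrow> supported (\<Sum>i\<in>I. f i)"
  by (induction I rule: infinite_finite_induct) (auto intro: supported_add)

lemma supported_prod: "(\<And>i. i \<in> I \<Longrightarrow> supported (f i)) \<Longrightarrow> supported (\<Prod>i\<in>I. f i)"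
  by (induction I rule: infinite_finite_induct) (auto intro: supported_mult)

lemma supported_power: "supported f \<Longrightarrow> supported (f ^ k)"
  by (induction k) (auto intro: supported_mult)

lemma leA_max_ex:
  assumes "finite A" "A \<noteq> {}" "A \<subseteq> vecs n"
  shows "\<exists>x\<in>A. \<forall>y\<in>A. leA y x"
  using assms
proof (induction rule: finite_ne_induct)
  case (insert a A)
  then obtain x where x: "x \<in> A" "\<forall>y\<in>A. leA y x" by auto
  have "leA a x \<or> leA x a" using insert.prems x leA_total by blast
  then show ?case using x leA_trans by (metis insert_iff leA_refl)
qed simp

definition lead :: "laurent \<Rightarrow> (int \<times> int \<Rightarrow>\<^sub>0 int)"
  where "lead f = (THE x. x \<in> ks f \<and> (\<forall>y\<in>ks f. leA y x))"

lemma leads_lead: "leads f x c \<Longrightarrow> c \<noteq> 0 \<Longrightarrow> lead f = x"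
  unfolding lead_def leads_def
  by (rule the_equality) (auto simp: in_keys_iff intro: leA_antisym)

lemma lead_leads: "supported f \<Longrightarrow> f \<noteq> 0 \<Longrightarrow> leads f (lead f) (lk f (lead f)) \<and> lk f (lead f) \<noteq> 0 \<and> lead f \<in> vecs n"
proof -
  assume *: "supported f" "f \<noteq> 0"
  then obtain x where x: "x \<in> ks f" "\<forall>y\<in>ks f. leA y x"
    using leA_max_ex[of "ks f"] by (auto simp: supported_def)
  then have "lead f = x" by (intro leads_lead[of f x "lk f x"]) (auto simp: leads_def in_keys_iff)
  then show ?thesis using x * by (auto simp: leads_def in_keys_iff supported_def)
qed

lemma leads_nonzero: "leads f x c \<Longrightarrow> c \<noteq> 0 \<Longrightarrow> f \<noteq> 0"
  by (auto simp: leads_def)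

lemma supported_mult_nonzero: "supported f \<Longrightarrow> supported g \<Longrightarrow> f \<noteq> 0 \<Longrightarrow> g \<noteq> 0 \<Longrightarrow> f * g \<noteq> 0"
  and lead_mult: "supported f \<Longrightarrow> supported g \<Longrightarrow> f \<noteq> 0 \<Longrightarrow> g \<noteq> 0 \<Longrightarrow> lead (f * g) = lead f + lead g"
proof -
  assume *: "supported f" "supported g" "f \<noteq> 0" "g \<noteq> 0"
  note f = lead_leads[OF *(1,3)] and g = lead_leads[OF *(2,4)]
  have "leads (f * g) (lead f + lead g) (lk f (lead f) * lk g (lead g))"
    using leads_mult[OF conjunct1[OF f] conjunct1[OF g]] .
  moreover have "lk f (lead f) * lk g (lead g) \<noteq> 0" using f g by simp
  ultimately show "f * g \<noteq> 0" "lead (f * g) = lead f + lead g" using leads_nonzero leads_lead by blast+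
qed

lemma lead_le: "supported f \<Longrightarrow> f \<noteq> 0 \<Longrightarrow> (\<And>y. y \<in> ks f \<Longrightarrow> leA y x) \<Longrightarrow> leA (lead f) x"
  using lead_leads[of f] by (auto simp: in_keys_iff)

section \<open>A generic isotropic flag\<close>

text \<open>The entries \<open>|j| \<ge> i\<close> of the \<open>i\<close>-th row are independent variables, those with \<open>0 < j < i\<close> vanish,
  and the remaining ones are determined by orthogonality to the preceding rows.\<close>

declare sum.cong [fundef_cong]

function isotropic :: "int \<Rightarrow> int \<Rightarrow> laurent" where
  "isotropic i j = (if i \<le> \<bar>j\<bar> then sg (sg (i, j) 1) 1 else if 0 \<le> j then 0
     else sg (sg (- j, - j) (- 1)) 1 *
       (\<Sum>l\<in>{- j + 1..int n}. isotropic i l * sg (sg (- j, - l) 1) 1 - isotropic i (- l) * sg (sg (- j, l) 1) 1))"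
  by pat_completeness auto
termination
  by (relation "Wellfounded.measure (\<lambda>(i, j). nat (i - \<bar>j\<bar>))") auto

declare isotropic.simps [simp del]

lemma isotropic_var: "i \<le> \<bar>j\<bar> \<Longrightarrow> isotropic i j = sg (sg (i, j) 1) 1"
  by (subst isotropic.simps) simp

lemma isotropic_0: "0 \<le> j \<Longrightarrow> j < i \<Longrightarrow> isotropic i j = 0"
  by (subst isotropic.simps) simp

lemma isotropic_solved: "0 < m \<Longrightarrow> m < i \<Longrightarrow> isotropic i (- m) = sg (sg (m, m) (- 1)) 1 *
    (\<Sum>l\<in>{m + 1..int n}. isotropic i l * isotropic m (- l) - isotropic i (- l) * isotropic m l)"
  by (subst isotropic.simps) (auto simp: isotropic_var intro!: arg_cong2[of _ _ _ _ "(*)"] sum.cong)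

definition omg :: "int \<Rightarrow> int \<Rightarrow> laurent"
  where "omg p q = (\<Sum>l\<in>{1..int n}. isotropic p l * isotropic q (- l) - isotropic p (- l) * isotropic q l)"

text \<open>For \<open>l < m\<close> both rows vanish at \<open>l\<close>. At \<open>l = m\<close>
  only the solved entry at \<open>- m\<close> survives, multiplied by the variable at
  \<open>(m, m)\<close>; the definition of the solved entry divides by that variable, which is the
  reason for working with Laurent polynomials.\<close>

lemma omg_less:
  assumes "1 \<le> m" "m < i" "i \<le> int n"
  shows "omg i m = 0"
proof -
  let ?f = "\<lambda>l. isotropic i l * isotropic m (- l) - isotropic i (- l) * isotropic m l"
  have "{1..int n} = {1..m - 1} \<union> insert m {m + 1..int n}" using assms by auto
  moreover have "(\<Sum>l\<in>{1..m - 1} \<union> insert m {m + 1..int n}. ?f l) = (\<Sum>l\<in>{1..m - 1}. ?f l) + (\<Sum>l\<in>insert m {m + 1..int n}. ?f l)"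
    by (rule sum.union_disjoint) auto
  ultimately have "omg i m = (\<Sum>l\<in>{1..m - 1}. ?f l) + (?f m + (\<Sum>l\<in>{m + 1..int n}. ?f l))"
    by (simp add: omg_def)
  also have "(\<Sum>l\<in>{1..m - 1}. ?f l) = 0" using assms by (intro sum.neutral) (auto simp: isotropic_0)
  also have "?f m = - (\<Sum>l\<in>{m + 1..int n}. ?f l)"
  proof -
    let ?S = "\<Sum>l\<in>{m + 1..int n}. ?f l"
    have i: "sg (sg (m, m) (- 1 :: int)) (1::complex) * sg (sg (m, m) 1) 1 = 1"
      by (simp add: mult_single single_add[symmetric])
    have "isotropic i (- m) * isotropic m m = (sg (sg (m, m) (- 1)) 1 * ?S) * sg (sg (m, m) 1) 1"
      using assms by (simp add: isotropic_solved isotropic_var)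
    also have "\<dots> = (sg (sg (m, m) (- 1)) 1 * sg (sg (m, m) 1) 1) * ?S" by (simp only: mult.assoc mult.commute mult.left_commute)
    also have "\<dots> = ?S" by (simp only: i mult_1_left)
    finally show ?thesis using assms by (simp add: isotropic_0)
  qed
  finally show ?thesis by simp
qed

lemma omg_swap: "omg q p = - omg p q"
  unfolding omg_def sum_negf[symmetric] by (intro sum.cong refl) (simp add: algebra_simps)

lemma omg_0:
  assumes "1 \<le> p" "p \<le> int n" "1 \<le> q" "q \<le> int n"
  shows "omg p q = 0"
proof -
  consider "p < q" | "q < p" | "p = q" by linarith
  then show ?thesis
  proof cases
    case 1 then show ?thesis using omg_less[of p q] omg_swap[of p q] assms by simp
  next
    case 2 then show ?thesis using omg_less assms by simp
  next
    case 3 then show ?thesis using omg_swap[of p p] poly_mapping_eq_uminus_self by metis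
  qed
qed

lemma supported_isotropic: "1 \<le> i \<Longrightarrow> i \<le> int n \<Longrightarrow> j \<in> rws 1 \<Longrightarrow> supported (isotropic i j)"
proof (induction i j rule: isotropic.induct)
  case (1 i j)
  consider "i \<le> \<bar>j\<bar>" | "0 \<le> j" "j < i" | "j < 0" "- j < i" using 1(3) by linarith
  then show ?case
  proof cases
    case 1
    then show ?thesis using "1.prems" by (auto simp: isotropic_var poset_iff rws_def intro!: supported_single vecs_single)
  next
    case 2 then show ?thesis by (simp add: isotropic_0)
  next
    case 3
    define m where "m = - j"
    have m: "0 < m" "m < i" "j = - m" using 3 by (auto simp: m_def)
    have c: "\<not> i \<le> \<bar>j\<bar>" "\<not> 0 \<le> j" using 3 by auto
    have mr: "m \<in> rws 1" "m \<le> int n" using "1.prems"(3) m by (auto simp: rws_def)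
    have sgv: "supported (sg (sg (m, b) c) 1)" if "m \<le> \<bar>b\<bar>" "\<bar>b\<bar> \<le> int n" for b c
      using that m mr by (intro supported_single vecs_single) (auto simp: poset_iff rws_def)
    have "supported (isotropic i l * sg (sg (m, - l) 1) 1 - isotropic i (- l) * sg (sg (m, l) 1) 1)" if l: "l \<in> {- j + 1..int n}" for l
    proof -
      have lr: "l \<in> rws 1" "- l \<in> rws 1" using l m by (auto simp: rws_def)
      have "supported (isotropic i l)" "supported (isotropic i (- l))" using "1.IH"[OF c l] "1.prems" lr by auto
      then show ?thesis using l m by (intro supported_diff supported_mult sgv) auto
    qed
    then have "supported (\<Sum>l\<in>{- j + 1..int n}. isotropic i l * sg (sg (m, - l) 1) 1 - isotropic i (- l) * sg (sg (m, l) 1) 1)" by (rule supported_sum)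
    moreover have "supported (sg (sg (m, m) (- 1)) 1)" using mr m by (intro sgv) auto
    ultimately show ?thesis using c by (subst isotropic.simps) (auto simp: m_def intro: supported_mult)
  qed
qed

section \<open>Weights of the solved entries\<close>

definition wle :: "(int \<Rightarrow>\<^sub>0 int) \<Rightarrow> (int \<Rightarrow>\<^sub>0 int) \<Rightarrow> bool" where "wle a b \<longleftrightarrow> wt_less n a b \<or> a = b"

lemma wle_refl [simp]: "wle a a" by (simp add: wle_def)

lemma wt_less_add2: "wt_less n a b \<Longrightarrow> wle c d \<Longrightarrow> wt_less n (a + c) (b + d)"
  unfolding wle_def using wt_less_add wt_less_trans by (metis add.commute)

lemma wt_less_add2': "wle a b \<Longrightarrow> wt_less n c d \<Longrightarrow> wt_less n (a + c) (b + d)"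
  using wt_less_add2[of c d a b] by (simp add: add.commute)

lemma wle_less_trans: "wle a b \<Longrightarrow> wt_less n b c \<Longrightarrow> wt_less n a c"
  using wt_less_trans by (auto simp: wle_def)

lemma wle_add: "wle a b \<Longrightarrow> wle c d \<Longrightarrow> wle (a + c) (b + d)"
  using wt_less_add2[of a b c d] wt_less_add2'[of a b c d] by (auto simp: wle_def)

lemma wle_sum: "(\<And>i. i \<in> I \<Longrightarrow> wle (a i) (b i)) \<Longrightarrow> wle (\<Sum>i\<in>I. a i) (\<Sum>i\<in>I. b i)"
  by (induction I rule: infinite_finite_induct) (auto intro: wle_add)

lemma wt_isotropic_var: "i \<le> \<bar>j\<bar> \<Longrightarrow> 1 \<le> i \<Longrightarrow> j \<in> rws 1 \<Longrightarrow> x \<in> ks (isotropic i j) \<Longrightarrow> wt_A n x = sg j 1 - sg i 1"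
  by (auto simp: isotropic_var wt_A_single poset_iff rws_def split: if_splits)

text \<open>In the order \<open>nless'\<close> the index \<open>- m\<close> precedes
  \<open>m\<close>, \<open>l\<close> and \<open>- l\<close>, and only the right-hand side has a
  nonzero coefficient there.\<close>

lemma pair_wt_less:
  assumes "1 \<le> m" "m < l" "l \<le> int n"
  shows "wt_less n (sg l 1 + sg (- l) 1 - sg m 1) (sg (- m) 1)"
  unfolding wt_less_def
proof (intro bexI conjI)
  show "- m \<in> signed_range n" using assms by (auto simp: signed_range_def)
  show "lk (sg l 1 + sg (- l) 1 - sg m 1) (- m) < lk (sg (- m) (1::int)) (- m)"
    using assms by (auto simp: lookup_add lookup_minus lookup_single when_def)
  show "\<forall>j\<in>signed_range n. nless' j (- m) \<longrightarrow> lk (sg l 1 + sg (- l) 1 - sg m 1) j = lk (sg (- m) (1::int)) j"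
    using assms by (auto simp: lookup_add lookup_minus lookup_single when_def nless'_def)
qed

lemma keys_mult_single: "x \<in> ks (f * sg a c) \<Longrightarrow> \<exists>y\<in>ks f. x = y + a"
  for f :: "'b::comm_monoid_add \<Rightarrow>\<^sub>0 complex"
proof -
  assume "x \<in> ks (f * sg a c)"
  then obtain y z where "x = y + z" "y \<in> ks f" "z \<in> ks (sg a c)" using keys_mult by blast
  then show ?thesis by (auto split: if_splits)
qed

lemma keys_single_mult: "x \<in> ks (sg a c * f) \<Longrightarrow> \<exists>y\<in>ks f. x = y + a"
  for f :: "'b::comm_monoid_add \<Rightarrow>\<^sub>0 complex"
  using keys_mult_single[of x f a c] by (simp add: mult.commute)

lemma in_keys_sum: "x \<in> ks (\<Sum>i\<in>I. f i) \<Longrightarrow> \<exists>i\<in>I. x \<in> ks (f i)"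
  using keys_sum[of f I] by blast

lemma in_keys_diff: "x \<in> ks (f - g) \<Longrightarrow> x \<in> ks f \<or> x \<in> ks (g :: 'b \<Rightarrow>\<^sub>0 complex)"
  by (auto simp: in_keys_iff lookup_minus)

text \<open>Each term of a solved entry at \<open>- m\<close> replaces this index by a pair
  \<open>l\<close>, \<open>- l\<close> with \<open>l > m\<close> and removes \<open>m\<close>, which
  lowers the weight by \<open>pair_wt_less\<close>. The factor taken from row \<open>i\<close> may
  itself be a solved entry; by induction this only lowers the weight further.\<close>

lemma wt_isotropic_solved: "1 \<le> i \<Longrightarrow> i \<le> int n \<Longrightarrow> j \<in> rws 1 \<Longrightarrow> \<bar>j\<bar> < i \<Longrightarrow> x \<in> ks (isotropic i j) \<Longrightarrow>
    wt_less n (wt_A n x) (sg j 1 - sg i 1)"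
proof (induction i j arbitrary: x rule: isotropic.induct)
  case (1 i j)
  have c: "\<not> i \<le> \<bar>j\<bar>" using 1 by auto
  have c2: "\<not> 0 \<le> j" using 1 isotropic_0[of j i] by (auto simp: abs_if split: if_splits)
  define m where "m = - j"
  have m: "1 \<le> m" "m < i" "j = - m" using c c2 by (auto simp: m_def)
  let ?f = "\<lambda>l. isotropic i l * sg (sg (m, - l) 1) 1 - isotropic i (- l) * sg (sg (m, l) 1) 1"
  have "x \<in> ks (sg (sg (m, m) (- 1)) 1 * (\<Sum>l\<in>{- j + 1..int n}. ?f l))"
    using "1.prems"(5) c c2 by (subst (asm) isotropic.simps) (auto simp: m_def)
  then obtain y where y: "x = y + sg (m, m) (- 1)" "y \<in> ks (\<Sum>l\<in>{- j + 1..int n}. ?f l)"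
    using keys_single_mult by blast
  from in_keys_sum[OF y(2)] obtain l where l: "l \<in> {- j + 1..int n}" "y \<in> ks (?f l)" ..
  have lb: "m < l" "l \<le> int n" using l m by auto
  obtain e y1 where e: "e = l \<or> e = - l" "y = y1 + sg (m, - e) 1" "y1 \<in> ks (isotropic i e)"
  proof -
    note in_keys_diff[OF l(2)]
    then show thesis
    proof
      assume "y \<in> ks (isotropic i l * sg (sg (m, - l) 1) 1)"
      then obtain y1 where "y = y1 + sg (m, - l) 1" "y1 \<in> ks (isotropic i l)" using keys_mult_single by blast
      then show thesis using that by blast
    next
      assume "y \<in> ks (isotropic i (- l) * sg (sg (m, l) 1) 1)"
      then obtain y1 where "y = y1 + sg (m, l) 1" "y1 \<in> ks (isotropic i (- l))" using keys_mult_single by blast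
      then show thesis using that[of "- l" y1] by simp
    qed
  qed
  have er: "e \<in> rws 1" using e(1) lb m by (auto simp: rws_def)
  have w1: "wle (wt_A n y1) (sg e 1 - sg i 1)"
  proof (cases "i \<le> \<bar>e\<bar>")
    case True
    then show ?thesis using wt_isotropic_var[OF True "1.prems"(1) er e(3)] by (simp add: wle_def)
  next
    case False
    then have "\<bar>e\<bar> < i" by simp
    then show ?thesis using "1.IH"[OF c c2 l(1)] "1.prems" er e(1,3) by (auto simp: wle_def)
  qed
  have mn: "m \<le> int n" "1 \<le> int n" using m 1 by auto
  have "wt_A n x = 0 + (wt_A n y1 + (sg (- e) 1 - sg m 1))"
    using m mn lb e(1) by (auto simp: y e(2) wt_A_add wt_A_single poset_iff rws_def)
  moreover have "wle (wt_A n y1 + (sg (- e) 1 - sg m 1)) ((sg e 1 - sg i 1) + (sg (- e) 1 - sg m 1))"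
    using w1 by (intro wle_add) (auto simp: wle_def)
  moreover have "(sg e 1 - sg i 1) + (sg (- e) 1 - sg m 1) = (sg l 1 + sg (- l) 1 - sg m 1) + (- sg i (1::int))"
    using e(1) by auto
  moreover have "wt_less n ((sg l 1 + sg (- l) 1 - sg m 1) + (- sg i 1)) (sg (- m) 1 + (- sg i 1))"
    using pair_wt_less[OF m(1) lb] by (simp only: wt_less_add)
  ultimately have "wt_less n (wt_A n x) (sg (- m) 1 + - sg i 1)"
    using wle_less_trans by (metis (no_types) add_0)
  then show ?case using m by simp
qed

lemma wt_isotropic: "1 \<le> i \<Longrightarrow> i \<le> int n \<Longrightarrow> j \<in> rws 1 \<Longrightarrow> x \<in> ks (isotropic i j) \<Longrightarrow> wle (wt_A n x) (sg j 1 - sg i 1)"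
  using wt_isotropic_var[of i j x] wt_isotropic_solved[of i j x] by (cases "i \<le> \<bar>j\<bar>") (auto simp: wle_def)

section \<open>Leading terms of the minors\<close>

definition dd :: "nat \<Rightarrow> (int \<Rightarrow> int) \<Rightarrow> (int \<times> int \<Rightarrow>\<^sub>0 int)" where "dd k f = (\<Sum>i\<in>{1..int k}. sg (i, f i) 1)"

lemma lookup_dd: "lk (dd k f) (i, j) = (if i \<in> {1..int k} \<and> f i = j then 1 else 0)"
proof -
  have "lk (dd k f) (i, j) = (\<Sum>i'\<in>{1..int k}. if i' = i then (if f i = j then 1 else 0) else 0)"
    unfolding dd_def lookup_sum by (intro sum.cong refl) (auto simp: lookup_single when_def)
  then show ?thesis by simp
qed

lemma wt_dd:
  assumes "k \<le> n" "\<And>i. i \<in> {1..int k} \<Longrightarrow> f i \<in> rws i" "inj_on f {1..int k}"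
  shows "wt_A n (dd k f) = (\<Sum>s\<in>f ` {1..int k}. sg s 1) - (\<Sum>i\<in>{1..int k}. sg i 1)"
proof -
  have "wt_A n (dd k f) = (\<Sum>i\<in>{1..int k}. sg (f i) 1 - sg i 1)"
    unfolding dd_def wt_A_sum using assms by (intro sum.cong refl) (simp add: wt_A_single poset_iff)
  then show ?thesis using assms(3) by (simp add: sum_subtractf sum.reindex)
qed

text \<open>In the first row \<open>i\<close> where \<open>f\<close> deviates, \<open>f i\<close> is
  an entry that the tuple uses later, hence smaller than the entry of row \<open>i\<close> by
  greediness. The first difference of the exponents is thus an additional 1 in
  \<open>dd k f\<close>, and the order counts the larger coordinate as smaller.\<close>

lemma vec_less_ideal_tuple:
  assumes J: "J \<in> ideals_k n k" and f: "f ` {1..int k} = ideal_tuple J ` {1..int k}" "inj_on f {1..int k}"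
    "\<And>i. i \<in> {1..int k} \<Longrightarrow> f i \<in> rws i" and ne: "\<exists>i\<in>{1..int k}. f i \<noteq> ideal_tuple J i"
  shows "vec_less n \<O> (dd k f) (dd k (ideal_tuple J))"
proof -
  note Jk = ideals_k_diag[OF J]
  obtain i where i: "i \<in> {1..int k}" "f i \<noteq> ideal_tuple J i" "\<And>i'. 1 \<le> i' \<Longrightarrow> i' < i \<Longrightarrow> f i' = ideal_tuple J i'"
    using ne first_diff by metis
  obtain i' where i': "i' \<in> {1..int k}" "f i = ideal_tuple J i'" using f(1) i(1) by (metis image_iff image_eqI)
  have "\<not> i' < i"
  proof
    assume lt: "i' < i"
    then have "f i' = f i" using i i' by auto
    then show False using inj_onD[OF f(2), of i' i] i(1) i'(1) lt by simp
  qed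
  moreover have "i' \<noteq> i" using i(2) i'(2) by metis
  ultimately have pl: "pos_less n \<O> (i, f i) (i, ideal_tuple J i)" using ideal_tuple_greedy[OF Jk(3), of i i'] Jk(1) i(1) i' by auto
  show ?thesis unfolding vec_less_def
  proof (intro bexI conjI ballI impI)
    show "(i, f i) \<in> poset n" using pl by (simp add: pos_less_iff)
    show "lk (dd k (ideal_tuple J)) (i, f i) < lk (dd k f) (i, f i)" using i by (auto simp: lookup_dd)
    fix q assume q: "pos_less n \<O> q (i, f i)"
    obtain a b where ab: "q = (a, b)" by (cases q)
    have ai: "1 \<le> a" "a \<le> i" using q ab by (auto simp: pos_less_iff poset_iff)
    show "lk (dd k f) q = lk (dd k (ideal_tuple J)) q"
    proof (cases "a = i")
      case True
      have "b \<noteq> f i" using q ab True pos_less_irrefl by auto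
      moreover have "b \<noteq> ideal_tuple J i" using q ab True pl pos_less_trans pos_less_irrefl by blast
      ultimately show ?thesis using True by (auto simp: ab lookup_dd)
    next
      case False
      then show ?thesis using i(3)[of a] ai by (auto simp: ab lookup_dd)
    qed
  qed
qed

lemma prod_single: "finite I \<Longrightarrow> (\<Prod>i\<in>I. sg (x i) (1::complex)) = sg (\<Sum>i\<in>I. x i) (1 :: complex)" for x :: "'i \<Rightarrow> 'b::comm_monoid_add"
  by (induction I rule: finite_induct) (auto simp: mult_single)

lemma prod_keys: "finite I \<Longrightarrow> x \<in> ks (\<Prod>i\<in>I. f i :: laurent) \<Longrightarrow> \<exists>y. x = (\<Sum>i\<in>I. y i) \<and> (\<forall>i\<in>I. y i \<in> ks (f i))"
proof (induction I arbitrary: x rule: finite_induct)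
  case (insert a I)
  then have "x \<in> ks (f a * (\<Prod>i\<in>I. f i))" by simp
  then obtain u v where uv: "x = u + v" "u \<in> ks (f a)" "v \<in> ks (\<Prod>i\<in>I. f i)" using keys_mult by blast
  then obtain y where y: "v = (\<Sum>i\<in>I. y i)" "\<forall>i\<in>I. y i \<in> ks (f i)" using insert by blast
  have "(\<Sum>i\<in>I. (y(a := u)) i) = (\<Sum>i\<in>I. y i)" using insert.hyps by (intro sum.cong) auto
  then show ?case using insert.hyps uv y by (intro exI[of _ "y(a := u)"]) auto
qed auto

text \<open>This treats one Leibniz term. All terms would have the same weight if every entry were a
  variable; a solved entry lowers the weight strictly, and among products of variables the order on
  vectors singles out the one given by the tuple.\<close>

lemma leads_prod_isotropic:
  assumes J: "J \<in> ideals_k n k" and f: "f ` {1..int k} = ideal_tuple J ` {1..int k}" "inj_on f {1..int k}"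
  shows "leads (\<Prod>i\<in>{1..int k}. isotropic i (f i)) (dd k (ideal_tuple J)) (if \<forall>i\<in>{1..int k}. f i = ideal_tuple J i then 1 else 0)"
proof -
  note Jk = ideals_k_diag[OF J]
  have wr: "ideal_tuple J i \<in> rws i" if "i \<in> {1..int k}" for i using ideal_tuple_row[OF Jk(3)] Jk(1) that by auto
  have fr: "f i \<in> rws 1" if i: "i \<in> {1..int k}" for i
  proof -
    obtain i' where "i' \<in> {1..int k}" "f i = ideal_tuple J i'" using f(1) i by (metis image_iff image_eqI)
    then show ?thesis using wr[of i'] row_mono[of 1 i'] by auto
  qed
  have wtw: "wt_A n (dd k (ideal_tuple J)) = (\<Sum>s\<in>ideal_tuple J ` {1..int k}. sg s 1) - (\<Sum>i\<in>{1..int k}. sg i 1)"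
    using Jk(2) wr ideal_tuple_inj_on[OF J] by (intro wt_dd) auto
  show ?thesis
  proof (cases "\<forall>i\<in>{1..int k}. i \<le> \<bar>f i\<bar>")
    case True
    then have fri: "f i \<in> rws i" if "i \<in> {1..int k}" for i using fr[OF that] that by (auto simp: rws_def)
    have "(\<Prod>i\<in>{1..int k}. isotropic i (f i)) = (\<Prod>i\<in>{1..int k}. sg (sg (i, f i) 1) 1)"
      using True by (intro prod.cong refl) (simp add: isotropic_var)
    also have "\<dots> = sg (dd k f) 1" by (simp add: prod_single dd_def)
    finally have pr: "(\<Prod>i\<in>{1..int k}. isotropic i (f i)) = sg (dd k f) 1" .
    show ?thesis
    proof (cases "\<forall>i\<in>{1..int k}. f i = ideal_tuple J i")
      case True
      then have "dd k f = dd k (ideal_tuple J)" by (simp add: dd_def)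
      then show ?thesis using True pr leads_single by simp
    next
      case False
      then have "vec_less n \<O> (dd k f) (dd k (ideal_tuple J))" using f fri by (intro vec_less_ideal_tuple[OF J]) auto
      moreover have "wt_A n (dd k f) = wt_A n (dd k (ideal_tuple J))" by (simp only: wt_dd[OF Jk(2) fri f(2)] wtw f(1))
      ultimately have "less_A n \<O> (dd k f) (dd k (ideal_tuple J))" by (simp add: less_A_def)
      then have "leads (sg (dd k f) 1) (dd k (ideal_tuple J)) 0" by (intro leads_less) auto
      then show ?thesis unfolding pr if_not_P[OF False] .
    qed
  next
    case False
    then obtain i0 where i0: "i0 \<in> {1..int k}" "\<bar>f i0\<bar> < i0" by auto
    have "i0 \<le> \<bar>ideal_tuple J i0\<bar>" using wr[OF i0(1)] by (simp add: rws_def)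
    then have "f i0 \<noteq> ideal_tuple J i0" using i0(2) by linarith
    then have nf: "\<not> (\<forall>i\<in>{1..int k}. f i = ideal_tuple J i)" using i0(1) by blast
    have "leads (\<Prod>i\<in>{1..int k}. isotropic i (f i)) (dd k (ideal_tuple J)) 0"
    proof (rule leads_less)
      fix x assume "x \<in> ks (\<Prod>i\<in>{1..int k}. isotropic i (f i))"
      then obtain y where y: "x = (\<Sum>i\<in>{1..int k}. y i)" "\<forall>i\<in>{1..int k}. y i \<in> ks (isotropic i (f i))"
        using prod_keys[of "{1..int k}" x "\<lambda>i. isotropic i (f i)"] by auto
      have b: "1 \<le> i" "i \<le> int n" if "i \<in> {1..int k}" for i using that Jk(2) by auto
      have s: "(\<Sum>i\<in>{1..int k}. h i) = h i0 + (\<Sum>i\<in>{1..int k} - {i0}. h i)" for h :: "int \<Rightarrow> int \<Rightarrow>\<^sub>0 int"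
        using i0 by (simp add: sum.remove)
      have "wt_less n (wt_A n (y i0) + (\<Sum>i\<in>{1..int k} - {i0}. wt_A n (y i)))
         ((sg (f i0) 1 - sg i0 1) + (\<Sum>i\<in>{1..int k} - {i0}. sg (f i) 1 - sg i 1))"
        using y(2) i0 b fr by (intro wt_less_add2 wle_sum wt_isotropic wt_isotropic_solved) auto
      then have "wt_less n (wt_A n x) (\<Sum>i\<in>{1..int k}. sg (f i) 1 - sg i 1)"
        by (simp only: y(1) wt_A_sum s[of "\<lambda>i. wt_A n (y i)"] s[of "\<lambda>i. sg (f i) 1 - sg i 1"])
      also have "(\<Sum>i\<in>{1..int k}. sg (f i) 1 - sg i 1) = (\<Sum>s\<in>f ` {1..int k}. sg s 1) - (\<Sum>i\<in>{1..int k}. sg i (1::int))"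
        using f(2) by (simp add: sum_subtractf sum.reindex)
      finally show "less_A n \<O> x (dd k (ideal_tuple J))" by (simp add: less_A_def wtw f(1))
    qed
    then show ?thesis unfolding if_not_P[OF nf] .
  qed
qed

text \<open>Exactly one permutation, called \<open>q\<close> below, brings the columns into the
  order of the tuple, so the leading coefficient is its sign.\<close>

lemma leads_minor:
  assumes J: "J \<in> ideals_k n k" and t: "distinct t" "length t = k" "set t = ideal_tuple J ` {1..int k}"
  shows "\<exists>c. c \<noteq> 0 \<and> leads (minor isotropic t) (dd k (ideal_tuple J)) c"
proof -
  let ?P = "{p. p permutes {..<k}}"
  define F where "F p i = t ! p (nat (i - 1))" for p i
  have img: "F p ` {1..int k} = set t" "inj_on (F p) {1..int k}" if p: "p permutes {..<k}" for p
  proof -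
    have n1: "(\<lambda>i. nat (i - 1)) ` {1..int k} = {..<k}"
    proof (safe)
      fix x assume "x < k" then show "x \<in> (\<lambda>i. nat (i - 1)) ` {1..int k}" by (intro image_eqI[of _ _ "int x + 1"]) auto
    qed auto
    have "F p ` {1..int k} = (!) t ` (p ` ((\<lambda>i. nat (i - 1)) ` {1..int k}))" by (auto simp: F_def)
    also have "\<dots> = set t" using t(2) by (simp add: n1 permutes_image[OF p]) (auto simp: set_conv_nth)
    finally show "F p ` {1..int k} = set t" .
    moreover have "card (set t) = k" using t distinct_card by metis
    ultimately show "inj_on (F p) {1..int k}" by (intro eq_card_imp_inj_on) auto
  qed
  have pr: "(\<Prod>i<k. isotropic (int i + 1) (t ! p i)) = (\<Prod>i\<in>{1..int k}. isotropic i (F p i))" for p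
    by (rule prod.reindex_bij_witness[of _ "\<lambda>i. nat (i - 1)" "\<lambda>i. int i + 1"]) (auto simp: F_def)
  define c where "c p = (if \<forall>i\<in>{1..int k}. F p i = ideal_tuple J i then 1 else 0 :: complex)" for p
  have LEp: "leads (of_int (sign p) * (\<Prod>i<k. isotropic (int i + 1) (t ! p i))) (dd k (ideal_tuple J)) (of_int (sign p) * c p)" if "p permutes {..<k}" for p
    unfolding pr c_def using img[OF that] t(3) by (intro leads_of_int leads_prod_isotropic[OF J]) auto
  have "leads (minor isotropic t) (dd k (ideal_tuple J)) (\<Sum>p\<in>?P. of_int (sign p) * c p)"
    unfolding minor_def t(2) by (rule leads_sum) (use LEp in auto)
  moreover have "(\<Sum>p\<in>?P. of_int (sign p) * c p) \<noteq> 0"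
  proof -
    define q where "q i = (if i < k then (THE j. j < k \<and> t ! j = ideal_tuple J (int i + 1)) else i)" for i
    have qex: "\<exists>!j. j < k \<and> t ! j = ideal_tuple J (int i + 1)" if "i < k" for i
    proof -
      have "ideal_tuple J (int i + 1) \<in> set t" using t(3) that by auto
      then show ?thesis using t(1,2) by (metis in_set_conv_nth nth_eq_iff_index_eq)
    qed
    have q: "q i < k" "t ! q i = ideal_tuple J (int i + 1)" if "i < k" for i
      using theI'[OF qex[OF that]] that by (auto simp: q_def)
    have "inj_on q {..<k}"
    proof (rule inj_onI)
      fix x y assume xy: "x \<in> {..<k}" "y \<in> {..<k}" "q x = q y"
      then have "ideal_tuple J (int x + 1) = ideal_tuple J (int y + 1)" using q by (metis lessThan_iff)
      then show "x = y" using inj_onD[OF ideal_tuple_inj_on[OF J], of "int x + 1" "int y + 1"] xy by simp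
    qed
    moreover have "q ` {..<k} \<subseteq> {..<k}" using q(1) by auto
    ultimately have "bij_betw q {..<k} {..<k}"
      by (simp add: bij_betw_def endo_inj_surj)
    then have qp: "q permutes {..<k}" by (intro bij_imp_permutes) (auto simp: q_def)
    have cp: "c p = (if p = q then 1 else 0)" if p: "p permutes {..<k}" for p
    proof -
      have "(\<forall>i\<in>{1..int k}. F p i = ideal_tuple J i) \<longleftrightarrow> p = q"
      proof
        assume a: "\<forall>i\<in>{1..int k}. F p i = ideal_tuple J i"
        show "p = q"
        proof
          fix i show "p i = q i"
          proof (cases "i < k")
            case True
            then have "t ! p i = ideal_tuple J (int i + 1)" using a[rule_format, of "int i + 1"] by (simp add: F_def)
            moreover have "p i < k" using permutes_in_image[OF p, of i] True by simp
            ultimately show ?thesis using q[OF True] nth_eq_iff_index_eq[OF t(1), of "p i" "q i"] t(2) by simp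
          qed (use permutes_not_in[OF p] q_def in auto)
        qed
      next
        assume pq: "p = q"
        show "\<forall>i\<in>{1..int k}. F p i = ideal_tuple J i"
        proof
          fix i assume i: "i \<in> {1..int k}"
          then have "nat (i - 1) < k" "int (nat (i - 1)) + 1 = i" by auto
          then show "F p i = ideal_tuple J i" using q(2)[of "nat (i - 1)"] pq by (simp only: F_def)
        qed
      qed
      then show ?thesis by (simp add: c_def)
    qed
    have "(\<Sum>p\<in>?P. of_int (sign p) * c p) = (\<Sum>p\<in>?P. if p = q then of_int (sign q) else 0)"
      using cp by (intro sum.cong) auto
    also have "\<dots> = of_int (sign q)" using qp by (simp add: finite_permutations)
    finally show ?thesis by (simp add: sign_def)
  qed
  ultimately show ?thesis by blast
qed

lemma supported_minor: "length t \<le> n \<Longrightarrow> set t \<subseteq> rws 1 \<Longrightarrow> supported (minor isotropic t)"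
proof -
  assume *: "length t \<le> n" "set t \<subseteq> rws 1"
  have "supported (isotropic (int i + 1) (t ! p i))" if "p permutes {..<length t}" "i < length t" for p i
  proof -
    have "p i < length t" using permutes_in_image[OF that(1), of i] that(2) by simp
    then have "t ! p i \<in> rws 1" using *(2) nth_mem by blast
    then show ?thesis using that *(1) by (intro supported_isotropic) auto
  qed
  then show ?thesis unfolding minor_def by (intro supported_sum supported_mult supported_prod) auto
qed

section \<open>Variables with arbitrary subscripts\<close>

definition srt :: "int set \<Rightarrow> int list" where "srt S = filter (\<lambda>j. j \<in> S) js"

lemma set_srt: "S \<subseteq> rws 1 \<Longrightarrow> set (srt S) = S"
  using set_js by (auto simp: srt_def)

lemma distinct_srt [simp]: "distinct (srt S)"
  using distinct_js by (simp add: srt_def)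

lemma sorted_ky_eq_nless: "set t \<subseteq> rws 1 \<Longrightarrow> sorted_wrt (\<lessdot>) t \<longleftrightarrow> sorted_wrt (\<lambda>a b. ky a < ky b) t"
proof (induction t)
  case (Cons a t)
  then have "a \<lessdot> b \<longleftrightarrow> ky a < ky b" if "b \<in> set t" for b using that nless_ky[of a b] by auto
  then show ?case using Cons by auto
qed simp

lemma sorted_srt: "S \<subseteq> rws 1 \<Longrightarrow> sorted_wrt (\<lessdot>) (srt S)"
  using sorted_ky_eq_nless[of "srt S"] set_srt sorted_wrt_filter[OF sorted_js] by (simp add: srt_def)

lemma srt_unique:
  assumes "set t \<subseteq> rws 1" "sorted_wrt (\<lessdot>) t"
  shows "t = srt (set t)"
proof -
  have k: "sorted_wrt (<) (map ky t)" "sorted_wrt (<) (map ky (srt (set t)))"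
    using assms sorted_ky_eq_nless[of t] sorted_ky_eq_nless[of "srt (set t)"] sorted_srt[of "set t"] set_srt[of "set t"]
    by (auto simp: sorted_wrt_map)
  have "set (map ky t) = set (map ky (srt (set t)))" using set_srt[of "set t"] assms by simp
  then have "map ky t = map ky (srt (set t))" using k strict_sorted_equal by blast
  moreover have "inj_on ky (set t \<union> set (srt (set t)))"
    using ky_inj assms set_srt[of "set t"] by (auto simp: inj_on_def)
  ultimately show ?thesis using map_inj_on by blast
qed

lemma length_srt: "S \<subseteq> rws 1 \<Longrightarrow> length (srt S) = card S"
  using distinct_card[OF distinct_srt, of S] set_srt by simp

lemma tuples_iff: "t \<in> tuples n k \<longleftrightarrow> set t \<subseteq> rws 1 \<and> t = srt (set t) \<and> card (set t) = k"
proof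
  assume "t \<in> tuples n k"
  then have *: "set t \<subseteq> rws 1" "sorted_wrt (\<lessdot>) t" "length t = k" by (auto simp: tuples_def row1)
  then have "t = srt (set t)" by (intro srt_unique)
  moreover from this have "card (set t) = k" using * length_srt[of "set t"] by simp
  ultimately show "set t \<subseteq> rws 1 \<and> t = srt (set t) \<and> card (set t) = k" using * by simp
next
  assume *: "set t \<subseteq> rws 1 \<and> t = srt (set t) \<and> card (set t) = k"
  then have "sorted_wrt (\<lessdot>) t" "length t = k" using sorted_srt[of "set t"] length_srt[of "set t"] by metis+
  then show "t \<in> tuples n k" using * by (auto simp: tuples_def row1)
qed

lemma srt_tuples: "S \<subseteq> rws 1 \<Longrightarrow> card S = k \<Longrightarrow> srt S \<in> tuples n k"
  by (simp add: tuples_iff set_srt)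

lemma tuplesD: "t \<in> tuples n k \<Longrightarrow> set t \<subseteq> rws 1 \<and> distinct t \<and> length t = k \<and> t = srt (set t)"
  using tuples_iff[of t k] distinct_srt[of "set t"] distinct_card[of t] by metis

section \<open>Signs of reordered variables\<close>

lemma permute_list_inj:
  assumes "distinct t" "\<sigma> permutes {..<length t}" "\<tau> permutes {..<length t}" "permute_list \<sigma> t = permute_list \<tau> t"
  shows "\<sigma> = \<tau>"
proof
  fix i show "\<sigma> i = \<tau> i"
  proof (cases "i < length t")
    case True
    then have "\<sigma> i < length t" "\<tau> i < length t" using permutes_in_image assms(2,3) by (metis lessThan_iff)+
    moreover have "t ! \<sigma> i = t ! \<tau> i" using assms(4) permute_list_nth[OF assms(2) True] permute_list_nth[OF assms(3) True] by simp
    ultimately show ?thesis using assms(1) nth_eq_iff_index_eq by blast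
  next
    case False
    then show ?thesis using permutes_not_in[OF assms(2)] permutes_not_in[OF assms(3)] by simp
  qed
qed

lemma Xvar_sort:
  assumes t: "distinct t" "set t \<subseteq> rws 1" and \<sigma>: "\<sigma> permutes {..<length t}" "permute_list \<sigma> t = srt (set t)"
  shows "Xvar t = of_int (sign \<sigma>) * pvar (srt (set t))"
proof -
  have "(THE \<sigma>. \<sigma> permutes {..<length t} \<and> sorted_wrt (\<lessdot>) (permute_list \<sigma> t)) = \<sigma>"
  proof (rule the_equality)
    show "\<sigma> permutes {..<length t} \<and> sorted_wrt (\<lessdot>) (permute_list \<sigma> t)" using \<sigma> sorted_srt t by simp
    fix \<tau> assume \<tau>: "\<tau> permutes {..<length t} \<and> sorted_wrt (\<lessdot>) (permute_list \<tau> t)"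
    then have "set (permute_list \<tau> t) = set t" by simp
    then have "permute_list \<tau> t = srt (set t)" using srt_unique[of "permute_list \<tau> t"] t \<tau> by simp
    then show "\<tau> = \<sigma>" using permute_list_inj[OF t(1)] \<tau> \<sigma> by metis
  qed
  then show ?thesis using t \<sigma> by (simp add: Xvar_def Let_def)
qed

lemma sort_perm_ex:
  assumes "distinct t" "set t \<subseteq> rws 1"
  shows "\<exists>\<sigma>. \<sigma> permutes {..<length t} \<and> permute_list \<sigma> t = srt (set t)"
proof -
  have "mset (srt (set t)) = mset t" 
    using set_eq_iff_mset_eq_distinct[of "srt (set t)" t] assms set_srt[OF assms(2)] by simp
  then obtain p where "p permutes {..<length t}" "permute_list p t = srt (set t)"
    by (rule mset_eq_permutation)
  then show ?thesis by blast
qed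

lemma Xvar_not_distinct: "\<not> distinct t \<Longrightarrow> Xvar t = 0"
  by (simp add: Xvar_def)

lemma Xvar_tuple: "t \<in> tuples n k \<Longrightarrow> Xvar t = pvar t"
proof -
  assume "t \<in> tuples n k"
  then have t: "set t \<subseteq> rws 1" "distinct t" "t = srt (set t)" using tuplesD by blast+
  have "permute_list id t = srt (set t)" by (subst permute_list_id) (rule t(3))
  from Xvar_sort[OF t(2,1) permutes_id this] have "Xvar t = pvar (srt (set t))" by simp
  also have "srt (set t) = t" by (rule t(3)[symmetric])
  finally show ?thesis .
qed

lemma Xvar_cases:
  assumes "set t \<subseteq> rws 1"
  shows "Xvar t = 0 \<or> (distinct t \<and> (Xvar t = pvar (srt (set t)) \<or> Xvar t = - pvar (srt (set t))))"
proof (cases "distinct t")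
  case True
  then obtain \<sigma> where \<sigma>: "\<sigma> permutes {..<length t}" "permute_list \<sigma> t = srt (set t)" using sort_perm_ex assms by blast
  show ?thesis using Xvar_sort[OF True assms \<sigma>] True by (cases \<sigma> rule: sign_cases) auto
qed (simp add: Xvar_not_distinct)

lemma Xvar_permute:
  assumes "set t \<subseteq> rws 1" "\<tau> permutes {..<length t}"
  shows "Xvar (permute_list \<tau> t) = of_int (sign \<tau>) * Xvar t"
proof (cases "distinct t")
  case True
  let ?t = "permute_list \<tau> t"
  have t': "distinct ?t" "set ?t = set t" using True assms by simp_all
  obtain \<sigma> where \<sigma>: "\<sigma> permutes {..<length t}" "permute_list \<sigma> ?t = srt (set t)"
    using sort_perm_ex[of ?t] t' assms by auto
  have "permute_list (\<tau> \<circ> \<sigma>) t = srt (set t)" using permute_list_compose[OF \<sigma>(1), of \<tau>] \<sigma>(2) by simp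
  moreover have "\<tau> \<circ> \<sigma> permutes {..<length t}" using \<sigma> assms by (simp add: permutes_compose)
  ultimately have 1: "Xvar t = of_int (sign (\<tau> \<circ> \<sigma>)) * pvar (srt (set t))" using Xvar_sort True assms by blast
  have 2: "Xvar ?t = of_int (sign \<sigma>) * pvar (srt (set t))" using Xvar_sort[of ?t \<sigma>] t' \<sigma> assms by simp
  have "permutation \<sigma>" "permutation \<tau>" using \<sigma>(1) assms(2) permutation_permutes by blast+
  then have "sign \<tau> * sign (\<tau> \<circ> \<sigma>) = sign \<sigma>" by (simp add: sign_compose)
  then have "(of_int (sign \<sigma>) :: int list cpoly) = of_int (sign \<tau>) * of_int (sign (\<tau> \<circ> \<sigma>))" by (metis of_int_mult)
  then show ?thesis using 1 2 by (simp add: mult.assoc)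
next
  case False
  then have "\<not> distinct (permute_list \<tau> t)" using assms by simp
  then show ?thesis using False by (simp add: Xvar_not_distinct)
qed

text \<open>The sign convention for arbitrary subscripts matches the alternation of minors,
  including the vanishing on repeated subscripts.\<close>

lemma psub_Xvar:
  fixes Z :: "int \<Rightarrow> int \<Rightarrow> 'b::comm_monoid_add \<Rightarrow>\<^sub>0 complex"
  assumes "set t \<subseteq> rws 1"
  shows "psub (minor Z) (Xvar t) = minor Z t"
proof (cases "distinct t")
  case True
  then obtain \<sigma> where \<sigma>: "\<sigma> permutes {..<length t}" "permute_list \<sigma> t = srt (set t)" using sort_perm_ex assms by blast
  have "psub (minor Z) (Xvar t) = of_int (sign \<sigma>) * minor Z (permute_list \<sigma> t)"
    using Xvar_sort[OF True assms \<sigma>] \<sigma> by (simp add: psub_mult psub_of_int)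
  also have "\<dots> = (of_int (sign \<sigma>) * of_int (sign \<sigma>)) * minor Z t"
    by (simp add: minor_permute[OF \<sigma>(1)] mult.assoc)
  also have "\<dots> = minor Z t" by (simp flip: of_int_mult)
  finally show ?thesis .
qed (simp add: Xvar_not_distinct minor_not_distinct)

lemma permute_list_transpose_adj:
  "permute_list (Transposition.transpose (length u) (Suc (length u))) (u @ [a, b] @ w) = u @ [b, a] @ w"
  "Transposition.transpose (length u) (Suc (length u)) permutes {..<length (u @ [a, b] @ w)}"
proof -
  show p: "Transposition.transpose (length u) (Suc (length u)) permutes {..<length (u @ [a, b] @ w)}"
    by (intro permutes_swap_id) auto
  show "permute_list (Transposition.transpose (length u) (Suc (length u))) (u @ [a, b] @ w) = u @ [b, a] @ w"
    by (rule nth_equalityI) (use p in \<open>auto simp: permute_list_nth nth_append nth_Cons' Transposition.transpose_def\<close>)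
qed

lemma Xvar_swap: "set (u @ [a, b] @ w) \<subseteq> rws 1 \<Longrightarrow> Xvar (u @ [b, a] @ w) = - Xvar (u @ [a, b] @ w)"
  using Xvar_permute[OF _ permute_list_transpose_adj(2)[of u a b w]] permute_list_transpose_adj(1)[of u a b w]
  by (simp add: sign_swap_id)

text \<open>A pair of adjacent subscripts passes each further subscript by two transpositions, so no
  sign arises.\<close>

lemma Xvar_block: "set (u @ [a, b] @ v @ w) \<subseteq> rws 1 \<Longrightarrow> Xvar (u @ [a, b] @ v @ w) = Xvar (u @ v @ [a, b] @ w)"
proof (induction v arbitrary: u)
  case (Cons c v)
  have "Xvar (u @ [a, c] @ b # v @ w) = - Xvar ((u @ [a]) @ [b, c] @ v @ w)"
    using Xvar_swap[of "u @ [a]" b c "v @ w"] Cons.prems by simp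
  moreover have "Xvar (u @ [c, a] @ b # v @ w) = - Xvar (u @ [a, c] @ b # v @ w)"
    using Xvar_swap[of u a c "b # v @ w"] Cons.prems by simp
  ultimately have "Xvar (u @ [a, b] @ (c # v) @ w) = Xvar ((u @ [c]) @ [a, b] @ v @ w)" by simp
  also have "\<dots> = Xvar ((u @ [c]) @ v @ [a, b] @ w)" using Cons.prems by (intro Cons.IH) auto
  finally show ?case by simp
qed simp

section \<open>The isotropic flag satisfies the linear relations\<close>

definition psi :: "int list cpoly \<Rightarrow> laurent" where "psi = psub (minor isotropic)"

text \<open>In a fixed Leibniz term the last two columns sit in two definite rows. Antisymmetrising
  in \<open>l\<close> and \<open>- l\<close> and summing over \<open>l\<close> leaves the symplectic
  product of these two rows as a factor, which vanishes by \<open>omg_0\<close>.\<close>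

lemma minor_omega:
  assumes "length t + 2 \<le> n"
  shows "(\<Sum>l\<in>{1..int n}. minor isotropic (t @ [l, - l])) = 0"
proof -
  let ?k = "length t" and ?A = "{..<length t + 2}"
  have swap: "minor isotropic (t @ [- l, l]) = - minor isotropic (t @ [l, - l])" for l
    using minor_permute[OF permute_list_transpose_adj(2)[of t l "- l" "[]"], of isotropic] permute_list_transpose_adj(1)[of t l "- l" "[]"]
    by (simp add: sign_swap_id)
  define T where "T p a b = (\<Prod>i<?k + 2. isotropic (int i + 1) ((t @ [a, b]) ! p i))" for p a b
  have m: "minor isotropic (t @ [a, b]) = (\<Sum>p | p permutes ?A. of_int (sign p) * T p a b)" for a b
    by (simp add: minor_def T_def)
  have zero: "(\<Sum>l\<in>{1..int n}. T p l (- l) - T p (- l) l) = 0" if p: "p permutes ?A" for p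
  proof -
    define a b where "a = inv_into UNIV p ?k" and "b = inv_into UNIV p (Suc ?k)"
    have ip: "inv_into UNIV p permutes ?A" using p by (rule permutes_inv)
    have pab: "p a = ?k" "p b = Suc ?k" using permutes_inverses(1)[OF p] by (simp_all add: a_def b_def)
    have ab: "a < ?k + 2" "b < ?k + 2" using permutes_in_image[OF ip] by (simp_all add: a_def b_def)
    have neq: "a \<noteq> b" using pab by auto
    have s: "{..<?k + 2} = insert a (insert b (?A - {a, b}))" using ab by auto
    have T: "T p x y = isotropic (int a + 1) x * isotropic (int b + 1) y * (\<Prod>i\<in>?A - {a, b}. isotropic (int i + 1) (t ! p i))" for x y
    proof -
      have "T p x y = isotropic (int a + 1) ((t @ [x, y]) ! p a) * (isotropic (int b + 1) ((t @ [x, y]) ! p b) * (\<Prod>i\<in>?A - {a, b}. isotropic (int i + 1) ((t @ [x, y]) ! p i)))"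
        unfolding T_def by (subst s) (use neq in \<open>simp add: prod.insert\<close>)
      also have "(\<Prod>i\<in>?A - {a, b}. isotropic (int i + 1) ((t @ [x, y]) ! p i)) = (\<Prod>i\<in>?A - {a, b}. isotropic (int i + 1) (t ! p i))"
      proof (intro prod.cong refl)
        fix i assume i: "i \<in> ?A - {a, b}"
        then have "p i < ?k + 2" using permutes_in_image[OF p, of i] by simp
        moreover have "p i \<noteq> p a" "p i \<noteq> p b" using i permutes_inj[OF p] by (auto dest: injD)
        ultimately have "p i < ?k" using pab by linarith
        then show "isotropic (int i + 1) ((t @ [x, y]) ! p i) = isotropic (int i + 1) (t ! p i)" by (simp add: nth_append)
      qed
      finally show ?thesis by (simp add: pab nth_append mult.assoc)
    qed
    have "(\<Sum>l\<in>{1..int n}. T p l (- l) - T p (- l) l) = omg (int a + 1) (int b + 1) * (\<Prod>i\<in>?A - {a, b}. isotropic (int i + 1) (t ! p i))"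
      unfolding T omg_def sum_distrib_right by (intro sum.cong refl) (simp add: algebra_simps)
    also have "omg (int a + 1) (int b + 1) = 0" using ab assms by (intro omg_0) auto
    finally show ?thesis by simp
  qed
  let ?S = "\<Sum>l\<in>{1..int n}. minor isotropic (t @ [l, - l])"
  \<comment> \<open>Exchanging the last two columns changes the sign of a minor, so the
    antisymmetrised sum is twice the original one.\<close>
  have "?S + ?S = (\<Sum>l\<in>{1..int n}. minor isotropic (t @ [l, - l]) - minor isotropic (t @ [- l, l]))"
    by (simp add: swap sum.distrib[symmetric])
  also have "\<dots> = (\<Sum>l\<in>{1..int n}. \<Sum>p | p permutes ?A. of_int (sign p) * (T p l (- l) - T p (- l) l))"
    unfolding m by (simp add: sum_subtractf algebra_simps)
  also have "\<dots> = (\<Sum>p | p permutes ?A. of_int (sign p) * (\<Sum>l\<in>{1..int n}. T p l (- l) - T p (- l) l))"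
    by (subst sum.swap) (simp add: sum_distrib_left)
  also have "\<dots> = 0" by (intro sum.neutral) (simp add: zero)
  finally have "?S = - ?S" by (simp add: add_eq_0_iff)
  then show ?thesis by (rule poly_mapping_eq_uminus_self)
qed

definition L_gen :: "int list cpoly set"
  where "L_gen = {\<Sum>l=1..int n. Xvar (t @ [l, - l]) | t. \<exists>k. k + 2 \<le> n \<and> t \<in> tuples n k}"

lemma L_space_eq: "L_space n = pv.span L_gen"
  by (simp add: L_space_def cspan_eq L_gen_def)

lemma pm_rws: "1 \<le> l \<Longrightarrow> l \<le> int n \<Longrightarrow> l \<in> rws 1 \<and> - l \<in> rws 1"
  by (auto simp: rws_def)

lemma psi_L: "p \<in> L_space n \<Longrightarrow> psi p = 0"
  unfolding L_space_eq
proof (induction rule: pv.span_induct_alt)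
  case base then show ?case by (simp add: psi_def)
next
  case (step c x y)
  obtain t k where t: "x = (\<Sum>l=1..int n. Xvar (t @ [l, - l]))" "k + 2 \<le> n" "t \<in> tuples n k"
    using step(1) by (auto simp: L_gen_def)
  have "psi x = (\<Sum>l=1..int n. minor isotropic (t @ [l, - l]))"
    unfolding t psi_def psub_sum using tuplesD[OF t(3)] pm_rws by (intro sum.cong refl psub_Xvar) auto
  then have "psi x = 0" using minor_omega[of t] t tuplesD[OF t(3)] by simp
  then show ?case using step by (simp add: psi_def psub_add psub_scale)
qed

lemma psi_I_A: "p \<in> I_A n \<Longrightarrow> psi p = 0"
proof -
  assume "p \<in> I_A n"
  then have "psub pluecker_minor p = 0" by (simp add: I_A_def psubst_eq)
  then have "psub (\<lambda>v. psub (\<lambda>(i, j). isotropic i j) (pluecker_minor v)) p = 0" by (metis psub_0 psub_comp)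
  then show ?thesis by (simp add: pluecker_minor_eq psub_minor psi_def)
qed

section \<open>Admissible tuples and order ideals\<close>

lemma Theta_iff: "t \<in> Theta n \<longleftrightarrow> (\<exists>k\<in>{1..n}. t \<in> tuples n k \<and> set t \<in> admk k)"
proof -
  have "admissible n t \<longleftrightarrow> set t \<in> admk k" if "t \<in> tuples n k" for k
    using tuplesD[OF that] that tuples_iff by (auto simp: admissible_def admk_def)
  then show ?thesis by (auto simp: Theta_def all_tuples_def)
qed

lemma ThetaD: "t \<in> Theta n \<Longrightarrow> t \<in> tuples n (length t) \<and> set t \<in> admk (length t) \<and> 1 \<le> length t \<and> length t \<le> n \<and> t \<in> all_tuples n"
  using tuplesD unfolding Theta_iff all_tuples_def by auto

definition ideal_of :: "int list \<Rightarrow> (int \<times> int) set"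
  where "ideal_of t = inv_into (ideals_k n (length t)) (\<lambda>J. ideal_tuple J ` {1..int (length t)}) (set t)"

lemma ideal_of:
  assumes "t \<in> Theta n"
  shows "ideal_of t \<in> ideals_k n (length t)" "ideal_tuple (ideal_of t) ` {1..int (length t)} = set t"
proof -
  note b = bij_ideals_admk[of "length t"]
  have "set t \<in> (\<lambda>J. ideal_tuple J ` {1..int (length t)}) ` ideals_k n (length t)"
    using b ThetaD[OF assms] by (auto simp: bij_betw_def)
  then show "ideal_of t \<in> ideals_k n (length t)" "ideal_tuple (ideal_of t) ` {1..int (length t)} = set t"
    unfolding ideal_of_def by (rule inv_into_into, rule f_inv_into_f)
qed

lemma ideal_of_srt:
  assumes J: "J \<in> ideals_k n k" "1 \<le> k"
  shows "srt (ideal_tuple J ` {1..int k}) \<in> Theta n" "length (srt (ideal_tuple J ` {1..int k})) = k" "ideal_of (srt (ideal_tuple J ` {1..int k})) = J"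
proof -
  let ?S = "ideal_tuple J ` {1..int k}"
  have kn: "k \<le> n" using ideals_k_diag[OF J(1)] by simp
  have S: "?S \<in> admk k" using ideal_tuple_admk[OF J(1)] .
  then have S1: "?S \<subseteq> rws 1" "card ?S = k" by (auto simp: admk_def)
  show T: "srt ?S \<in> Theta n" unfolding Theta_iff using S S1 J kn srt_tuples[OF S1] by (intro bexI[of _ k]) (auto simp: set_srt)
  show l: "length (srt ?S) = k" using S1 length_srt by simp
  show "ideal_of (srt ?S) = J" using ideal_of[OF T] l S1 by (intro ideal_tuple_determines[of _ k]) (auto simp: set_srt J)
qed

lemma pvar_inj: "pvar s = pvar t \<longleftrightarrow> s = t"
proof
  assume "pvar s = pvar t"
  then have "lk (pvar s) (sg s 1) = lk (pvar t) (sg s 1)" by simp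
  then have "sg t (1::nat) = sg s 1" by (auto simp: pvar_def lookup_single when_def split: if_splits)
  then have "lk (sg t (1::nat)) s = lk (sg s 1) s" by simp
  then show "s = t" by (auto simp: lookup_single when_def split: if_splits)
qed simp

lemma pvar_neq_uminus: "pvar s \<noteq> - pvar t"
proof
  assume a: "pvar s = - pvar t"
  have "lk (pvar s) (sg s 1) = 1" by (simp add: pvar_def)
  moreover have "lk (- pvar t) (sg s 1) = (if sg t (1::nat) = sg s 1 then -1 else 0)" by (auto simp: pvar_def lookup_single when_def)
  ultimately show False using a by (auto split: if_splits)
qed

lemma J_of_eq:
  assumes t: "t \<in> Theta n"
  shows "J_of n \<O> t = ideal_of t"
proof -
  let ?k = "length t"
  have "t = srt (set t)" using ThetaD[OF t] tuplesD by blast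
  have iff: "(let X = Xvar (map (w_OJ n \<O> J) [1..int ?k]) in pvar t = X \<or> pvar t = - X) \<longleftrightarrow> ideal_tuple J ` {1..int ?k} = set t"
    if J: "J \<in> ideals_k n ?k" for J
  proof -
    note Jk = ideals_k_diag[OF J]
    let ?l = "map (w_OJ n \<O> J) [1..int ?k]"
    have eq: "?l = map (ideal_tuple J) [1..int ?k]"
      using w_OJ_ideal_tuple[OF Jk(3)] Jk(1) by (intro map_cong) auto
    have s: "set ?l = ideal_tuple J ` {1..int ?k}" "distinct ?l" unfolding eq using ideal_tuple_inj_on[OF J] by (simp_all add: distinct_map)
    have "ideal_tuple J ` {1..int ?k} \<subseteq> rws 1" using ideal_tuple_admk[OF J] by (simp add: admk_def)
    then have r: "set ?l \<subseteq> rws 1" unfolding s(1) .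
    have X: "Xvar ?l = pvar (srt (set ?l)) \<or> Xvar ?l = - pvar (srt (set ?l))"
    proof -
      obtain \<sigma> where \<sigma>: "\<sigma> permutes {..<length ?l}" "permute_list \<sigma> ?l = srt (set ?l)" using sort_perm_ex s r by blast
      show ?thesis using Xvar_sort[OF s(2) r \<sigma>] by (cases \<sigma> rule: sign_cases) auto
    qed
    have "(pvar t = Xvar ?l \<or> pvar t = - Xvar ?l) \<longleftrightarrow> t = srt (set ?l)"
      using X pvar_inj[of t "srt (set ?l)"] pvar_neq_uminus[of t "srt (set ?l)"] by (elim disjE) simp_all
    also have "\<dots> \<longleftrightarrow> set ?l = set t" using \<open>t = srt (set t)\<close> set_srt[OF r] by metis
    finally show ?thesis using s by (simp add: Let_def)
  qed
  show ?thesis unfolding J_of_def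
  proof (rule the_equality)
    show "ideal_of t \<in> ideals_k n ?k \<and> (let X = Xvar (map (w_OJ n \<O> (ideal_of t)) [1..int ?k]) in pvar t = X \<or> pvar t = - X)"
      using iff ideal_of[OF t] by blast
    fix J assume "J \<in> ideals_k n ?k \<and> (let X = Xvar (map (w_OJ n \<O> J) [1..int ?k]) in pvar t = X \<or> pvar t = - X)"
    then have J: "J \<in> ideals_k n ?k" "ideal_tuple J ` {1..int ?k} = set t" using iff by blast+
    then show "J = ideal_of t" using ideal_tuple_determines[OF J(1) ideal_of(1)[OF t]] ideal_of(2)[OF t] by simp
  qed
qed

definition ex1 :: "int list \<Rightarrow> (int \<times> int \<Rightarrow>\<^sub>0 int)" where "ex1 t = xi n \<O> (ind (M_set \<O> (ideal_of t)))"

lemma ex1_dd: "t \<in> Theta n \<Longrightarrow> ex1 t = dd (length t) (ideal_tuple (ideal_of t))"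
  unfolding ex1_def dd_def using xi_ind_M[OF ideal_of(1)] by simp

lemma leads_psi_pvar: "t \<in> Theta n \<Longrightarrow> \<exists>c. c \<noteq> 0 \<and> leads (psi (pvar t)) (ex1 t) c"
  using leads_minor[OF ideal_of(1), of t t] ideal_of(2)[of t] ThetaD[of t] tuplesD[of t "length t"] by (simp add: psi_def ex1_dd)

lemma ex1_vecs: "ex1 t \<in> vecs n"
  unfolding ex1_def by (rule xi_vecs)

lemma ex1_inj: "inj_on ex1 (Theta n)"
proof (rule inj_onI)
  fix s t assume st: "s \<in> Theta n" "t \<in> Theta n" "ex1 s = ex1 t"
  then have eq: "dd (length s) (ideal_tuple (ideal_of s)) = dd (length t) (ideal_tuple (ideal_of t))" by (simp add: ex1_dd)
  have iff: "(i \<in> {1..int (length s)} \<and> ideal_tuple (ideal_of s) i = j) \<longleftrightarrow> (i \<in> {1..int (length t)} \<and> ideal_tuple (ideal_of t) i = j)" for i j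
  proof -
    have "lk (dd (length s) (ideal_tuple (ideal_of s))) (i, j) = lk (dd (length t) (ideal_tuple (ideal_of t))) (i, j)" using eq by simp
    then show ?thesis unfolding lookup_dd by (auto split: if_splits)
  qed
  then have "ideal_tuple (ideal_of s) ` {1..int (length s)} = ideal_tuple (ideal_of t) ` {1..int (length t)}"
  proof (intro Set.set_eqI)
    fix j show "j \<in> ideal_tuple (ideal_of s) ` {1..int (length s)} \<longleftrightarrow> j \<in> ideal_tuple (ideal_of t) ` {1..int (length t)}"
      unfolding image_iff using iff by metis
  qed
  then have "set s = set t" using ideal_of(2)[OF st(1)] ideal_of(2)[OF st(2)] by simp
  then show "s = t" using ThetaD st tuplesD by metis
qed

section \<open>Independence from distinct leading exponents\<close>

lemma le_less_A_trans: "leA x y \<Longrightarrow> less_A n \<O> y z \<Longrightarrow> less_A n \<O> x z"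
  using less_A_trans by (auto simp: leA_def)

text \<open>Among the indices with nonzero coefficient the one with the largest leading exponent is
  taken; as the exponents are distinct, all other terms lie strictly below it.\<close>

lemma leads_combination:
  assumes I: "finite I" and f: "\<And>i. i \<in> I \<Longrightarrow> leads (f i) (x i) (c i) \<and> c i \<noteq> 0 \<and> x i \<in> vecs n"
    and inj: "inj_on x I" and a: "i1 \<in> I" "a i1 \<noteq> 0"
  shows "\<exists>i0\<in>I. a i0 \<noteq> 0 \<and> leads (\<Sum>i\<in>I. sg 0 (a i) * f i) (x i0) (a i0 * c i0) \<and> (\<forall>i\<in>I. a i \<noteq> 0 \<longrightarrow> leA (x i) (x i0))"
proof -
  let ?K = "{i \<in> I. a i \<noteq> 0}"
  have "\<exists>y\<in>x ` ?K. \<forall>z\<in>x ` ?K. leA z y" using I a f by (intro leA_max_ex) auto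
  then obtain i0 where i0: "i0 \<in> I" "a i0 \<noteq> 0" "\<And>i. i \<in> I \<Longrightarrow> a i \<noteq> 0 \<Longrightarrow> leA (x i) (x i0)" by auto
  have "leads (sg 0 (a i) * f i) (x i0) (if i = i0 then a i0 * c i0 else 0)" if i: "i \<in> I" for i
  proof (cases "i = i0 \<or> a i = 0")
    case True
    then show ?thesis using f[OF i] leads_scale[of "f i" "x i" "c i" "a i"] by (auto simp: leads_0)
  next
    case False
    then have "less_A n \<O> (x i) (x i0)" using i0 i inj by (auto simp: leA_def inj_on_def)
    then have "leads (f i) (x i0) 0" using f[OF i] by (intro leads_less) (auto simp: leads_def intro: le_less_A_trans)
    then show ?thesis using False leads_scale[of "f i" "x i0" 0 "a i"] by simp
  qed
  then have "leads (\<Sum>i\<in>I. sg 0 (a i) * f i) (x i0) (\<Sum>i\<in>I. if i = i0 then a i0 * c i0 else 0)" by (rule leads_sum)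
  then show ?thesis using i0 I by (intro bexI[of _ i0]) auto
qed

lemma leads_independent:
  assumes I: "finite I" and f: "\<And>i. i \<in> I \<Longrightarrow> leads (f i) (x i) (c i) \<and> c i \<noteq> 0 \<and> x i \<in> vecs n"
    and inj: "inj_on x I" and 0: "(\<Sum>i\<in>I. sg 0 (a i) * f i) = 0" and i: "i \<in> I"
  shows "a i = 0"
proof (rule ccontr)
  assume "a i \<noteq> 0"
  then obtain i0 where i0: "i0 \<in> I" "a i0 \<noteq> 0" "leads (\<Sum>i\<in>I. sg 0 (a i) * f i) (x i0) (a i0 * c i0)"
    using leads_combination[OF I f inj i] by blast
  have "a i0 * c i0 \<noteq> 0" using f[OF i0(1)] i0(2) by simp
  then show False using leads_nonzero[OF i0(3)] 0 by simp
qed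

lemma finite_tuples: "finite (all_tuples n)"
proof -
  have "all_tuples n \<subseteq> srt ` Pow (rws 1)" unfolding all_tuples_def using tuples_iff by blast
  then show ?thesis by (rule finite_subset) simp
qed

lemma finite_Theta: "finite (Theta n)"
  using finite_subset[OF _ finite_tuples] by (auto simp: Theta_def)

lemma span_pvar_coeffs:
  assumes "finite A" "p \<in> pv.span (pvar ` A)"
  shows "\<exists>a. p = (\<Sum>t\<in>A. sg 0 (a t) * pvar t)"
proof -
  have "\<exists>u. p = (\<Sum>v\<in>pvar ` A. sg 0 (u v) * v)" using assms pv.span_finite[of "pvar ` A"] by auto
  then obtain u where "p = (\<Sum>v\<in>pvar ` A. sg 0 (u v) * v)" ..
  also have "\<dots> = (\<Sum>t\<in>A. sg 0 (u (pvar t)) * pvar t)"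
    by (subst sum.reindex) (auto simp: inj_on_def pvar_inj)
  finally show ?thesis by auto
qed

text \<open>\<open>psi\<close> kills \<open>L_space\<close>, but it sends the admissible variables
  to elements with distinct leading exponents. This is the uniqueness behind
  \<open>straighten\<close>.\<close>

lemma L_inter_span: "p \<in> L_space n \<Longrightarrow> p \<in> pv.span (pvar ` Theta n) \<Longrightarrow> p = 0"
proof -
  assume p: "p \<in> L_space n" "p \<in> pv.span (pvar ` Theta n)"
  obtain a where a: "p = (\<Sum>t\<in>Theta n. sg 0 (a t) * pvar t)" using span_pvar_coeffs[OF finite_Theta p(2)] by blast
  have 0: "(\<Sum>t\<in>Theta n. sg 0 (a t) * psi (pvar t)) = 0"
    using psi_L[OF p(1)] a by (simp add: psi_def psub_sum psub_scale)
  define c where "c t = (SOME c. c \<noteq> 0 \<and> leads (psi (pvar t)) (ex1 t) c)" for t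
  have "c t \<noteq> 0 \<and> leads (psi (pvar t)) (ex1 t) (c t)" if "t \<in> Theta n" for t
    unfolding c_def using leads_psi_pvar[OF that] by (rule someI_ex)
  then have "a t = 0" if "t \<in> Theta n" for t
    using leads_independent[of "Theta n" "\<lambda>t. psi (pvar t)" ex1 c a t] finite_Theta ex1_vecs ex1_inj 0 that by blast
  then show "p = 0" using a by simp
qed

end

section \<open>Straightening of non-admissible variables\<close>

text \<open>Double counting: a set with \<open>Suc r\<close> elements arises once for each choice of
  the element inserted last.\<close>

lemma sum_insert_subsets:
  fixes g :: "'i set \<Rightarrow> 'a::comm_semiring_1"
  assumes "finite D"
  shows "(\<Sum>A | A \<subseteq> D \<and> card A = r. \<Sum>m\<in>D - A. g (insert m A)) = of_nat (Suc r) * (\<Sum>B | B \<subseteq> D \<and> card B = Suc r. g B)"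
proof -
  have fin: "finite {A. A \<subseteq> D \<and> card A = q}" for q using assms by simp
  have finA: "finite A" if "A \<subseteq> D" for A using that assms finite_subset by blast
  have "(\<Sum>A | A \<subseteq> D \<and> card A = r. \<Sum>m\<in>D - A. g (insert m A))
      = (\<Sum>(A, m)\<in>Sigma {A. A \<subseteq> D \<and> card A = r} (\<lambda>A. D - A). g (insert m A))"
    using fin assms by (subst sum.Sigma) auto
  also have "\<dots> = (\<Sum>(B, m)\<in>Sigma {B. B \<subseteq> D \<and> card B = Suc r} (\<lambda>B. B). g B)"
  proof (rule sum.reindex_bij_witness[of _ "\<lambda>(B, m). (B - {m}, m)" "\<lambda>(A, m). (insert m A, m)"])
    fix a assume "a \<in> Sigma {A. A \<subseteq> D \<and> card A = r} (\<lambda>A. D - A)"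
    then show "(case case a of (A, m) \<Rightarrow> (insert m A, m) of (B, m) \<Rightarrow> (B - {m}, m)) = a"
      "(case a of (A, m) \<Rightarrow> (insert m A, m)) \<in> Sigma {B. B \<subseteq> D \<and> card B = Suc r} (\<lambda>B. B)"
      "(case case a of (A, m) \<Rightarrow> (insert m A, m) of (B, m) \<Rightarrow> g B) = (case a of (A, m) \<Rightarrow> g (insert m A))"
      using finA by auto
  next
    fix b assume "b \<in> Sigma {B. B \<subseteq> D \<and> card B = Suc r} (\<lambda>B. B)"
    then show "(case case b of (B, m) \<Rightarrow> (B - {m}, m) of (A, m) \<Rightarrow> (insert m A, m)) = b"
      "(case b of (B, m) \<Rightarrow> (B - {m}, m)) \<in> Sigma {A. A \<subseteq> D \<and> card A = r} (\<lambda>A. D - A)"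
      using finA by (auto simp: card_Diff_singleton insert_absorb)
  qed
  also have "\<dots> = (\<Sum>B | B \<subseteq> D \<and> card B = Suc r. \<Sum>m\<in>B. g B)"
    using fin finA by (subst sum.Sigma) auto
  also have "\<dots> = of_nat (Suc r) * (\<Sum>B | B \<subseteq> D \<and> card B = Suc r. g B)"
    by (subst sum_distrib_left) (auto intro: sum.cong)
  finally show ?thesis .
qed

text \<open>De Concini's trick: modulo the relations that replace one element of a set by any other one, the
  set \<open>D\<close> is proportional to the sum of all sets of the same size that are disjoint from it.\<close>

lemma exchange_disjoint:
  fixes Y :: "'i set \<Rightarrow> 'v cpoly"
  assumes U: "finite U" "D \<subseteq> U" and L: "pv.subspace L"
    and rel: "\<And>S. S \<subseteq> U \<Longrightarrow> card S + 1 = card D \<Longrightarrow> (\<Sum>m\<in>U - S. Y (insert m S)) \<in> L"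
  shows "\<exists>c. Y D - sg 0 c * (\<Sum>F | F \<subseteq> U - D \<and> card F = card D. Y F) \<in> L"
proof -
  let ?j = "card D" and ?E = "U - D"
  have fD: "finite D" "finite ?E" using U finite_subset by auto
  \<comment> \<open>The sum of \<open>Y\<close> over all sets obtained by trading \<open>a\<close>
    elements of \<open>D\<close> for \<open>a\<close> elements outside \<open>D\<close>. The
    relations for sets with one element less link \<open>A a\<close> with
    \<open>A (a + 1)\<close>.\<close>
  define A where "A a = (\<Sum>D' | D' \<subseteq> D \<and> card D' = ?j - a. \<Sum>F | F \<subseteq> ?E \<and> card F = a. Y (D' \<union> F))" for a
  have step: "of_nat (?j - a) * A a + of_nat (a + 1) * A (a + 1) \<in> L" if a: "a < ?j" for a
  proof -
    obtain r where r: "?j - a = Suc r" "r = ?j - (a + 1)" using a by (metis Suc_diff_Suc Suc_eq_plus1)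
    let ?P = "{D'. D' \<subseteq> D \<and> card D' = r}" and ?Q = "{F. F \<subseteq> ?E \<and> card F = a}"
    have one: "(\<Sum>m\<in>D - D'. Y (insert m D' \<union> F)) + (\<Sum>m\<in>?E - F. Y (D' \<union> insert m F)) \<in> L"
      if d: "D' \<in> ?P" "F \<in> ?Q" for D' F
    proof -
      have fin: "finite D'" "finite F" using d fD finite_subset by blast+
      have "card (D' \<union> F) = r + a" using d fin by (subst card_Un_disjoint) auto
      then have "(\<Sum>m\<in>U - (D' \<union> F). Y (insert m (D' \<union> F))) \<in> L" using d U r a by (intro rel) auto
      also have "U - (D' \<union> F) = (D - D') \<union> (?E - F)" using d U by auto
      also have "(\<Sum>m\<in>(D - D') \<union> (?E - F). Y (insert m (D' \<union> F)))
          = (\<Sum>m\<in>D - D'. Y (insert m (D' \<union> F))) + (\<Sum>m\<in>?E - F. Y (insert m (D' \<union> F)))"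
        using fD by (intro sum.union_disjoint) auto
      finally show ?thesis by simp
    qed
    have "(\<Sum>D'\<in>?P. \<Sum>F\<in>?Q. (\<Sum>m\<in>D - D'. Y (insert m D' \<union> F)) + (\<Sum>m\<in>?E - F. Y (D' \<union> insert m F))) \<in> L"
      using one by (intro pv.subspace_sum[OF L]) blast
    also have "(\<Sum>D'\<in>?P. \<Sum>F\<in>?Q. (\<Sum>m\<in>D - D'. Y (insert m D' \<union> F)) + (\<Sum>m\<in>?E - F. Y (D' \<union> insert m F)))
      = (\<Sum>F\<in>?Q. \<Sum>D'\<in>?P. \<Sum>m\<in>D - D'. Y (insert m D' \<union> F)) + (\<Sum>D'\<in>?P. \<Sum>F\<in>?Q. \<Sum>m\<in>?E - F. Y (D' \<union> insert m F))"
      unfolding sum.distrib by (subst sum.swap) simp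
    also have "(\<Sum>F\<in>?Q. \<Sum>D'\<in>?P. \<Sum>m\<in>D - D'. Y (insert m D' \<union> F)) = (\<Sum>F\<in>?Q. of_nat (Suc r) * (\<Sum>B | B \<subseteq> D \<and> card B = Suc r. Y (B \<union> F)))"
      by (intro sum.cong refl sum_insert_subsets fD)
    also have "\<dots> = of_nat (?j - a) * A a"
      unfolding A_def r(1) sum_distrib_left[symmetric] by (subst sum.swap) simp
    also have "(\<Sum>D'\<in>?P. \<Sum>F\<in>?Q. \<Sum>m\<in>?E - F. Y (D' \<union> insert m F)) = (\<Sum>D'\<in>?P. of_nat (Suc a) * (\<Sum>B | B \<subseteq> ?E \<and> card B = Suc a. Y (D' \<union> B)))"
      by (intro sum.cong refl sum_insert_subsets fD)
    also have "\<dots> = of_nat (a + 1) * A (a + 1)"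
      unfolding A_def r(2) sum_distrib_left[symmetric] by simp
    finally show ?thesis .
  qed
  \<comment> \<open>Each link has the nonzero coefficient \<open>?j - a\<close> at
    \<open>A a\<close>, so \<open>A 0\<close>, which is \<open>Y D\<close>, can be pushed step by
    step to \<open>A ?j\<close>, where nothing of \<open>D\<close> is left.\<close>
  have "a \<le> ?j \<Longrightarrow> \<exists>c. A 0 - sg 0 c * A a \<in> L" for a
  proof (induction a)
    case 0
    then show ?case using pv.subspace_0[OF L] by (intro exI[of _ 1]) simp
  next
    case (Suc a)
    then obtain c where c: "A 0 - sg 0 c * A a \<in> L" by auto
    let ?q = "complex_of_nat (?j - a)"
    have q: "?q \<noteq> 0" using Suc by simp
    have nat1: "of_nat m = sg (0 :: 'v \<Rightarrow>\<^sub>0 nat) (complex_of_nat m)" for m by simp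
    have s1: "sg 0 (inverse ?q) * (of_nat (?j - a) * A a + of_nat (a + 1) * A (a + 1)) \<in> L"
      using pv.subspace_scale[OF L step] Suc by simp
    have "sg 0 (inverse ?q) * (of_nat (?j - a) * A a + of_nat (a + 1) * A (a + 1))
        = (sg 0 (inverse ?q) * sg 0 ?q) * A a + (sg 0 (inverse ?q) * sg 0 (of_nat (a + 1))) * A (a + 1)"
      unfolding nat1 by (simp only: distrib_left mult.assoc)
    also have "\<dots> = A a + sg 0 (inverse ?q * of_nat (a + 1)) * A (a + 1)"
      using q by (simp add: mult_single)
    finally have e1: "sg 0 (inverse ?q) * (of_nat (?j - a) * A a + of_nat (a + 1) * A (a + 1))
        = A a + sg 0 (inverse ?q * of_nat (a + 1)) * A (a + 1)" .
    define q2 where "q2 = inverse ?q * of_nat (a + 1)"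
    have s2: "A a + sg 0 q2 * A (a + 1) \<in> L" using s1 unfolding e1 q2_def .
    have "(A 0 - sg 0 c * A a) + sg 0 c * (A a + sg 0 q2 * A (a + 1)) \<in> L"
      by (rule pv.subspace_add[OF L c pv.subspace_scale[OF L s2]])
    also have "(A 0 - sg 0 c * A a) + sg 0 c * (A a + sg 0 q2 * A (a + 1)) = A 0 - sg 0 (- (c * q2)) * A (a + 1)"
      by (simp add: distrib_left single_uminus mult.assoc[symmetric] mult_single)
    finally show ?case by (metis Suc_eq_plus1)
  qed
  then obtain c where c: "A 0 - sg 0 c * A ?j \<in> L" by blast
  have XX: "{D'. D' \<subseteq> D \<and> card D' = ?j} = {D}" using card_subset_eq[OF fD(1)] by auto
  have z: "{F. F \<subseteq> G \<and> card F = 0} = {{}}" if "finite G" for G :: "'i set"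
    using finite_subset[OF _ that] by auto
  have "A 0 = Y D" using z[OF fD(2)] XX by (simp add: A_def)
  moreover have "A ?j = (\<Sum>F | F \<subseteq> ?E \<and> card F = ?j. Y F)" using z[OF fD(1)] by (simp add: A_def)
  ultimately show ?thesis using c by auto
qed

context marked_poset begin

section \<open>Lists of opposite pairs\<close>

definition pairs :: "int list \<Rightarrow> int list" where "pairs xs = concat (map (\<lambda>m. [m, - m]) xs)"

lemma pairs_simps [simp]: "pairs [] = []" "pairs (x # xs) = x # (- x) # pairs xs" "pairs (xs @ ys) = pairs xs @ pairs ys"
  by (simp_all add: pairs_def)

lemma set_pairs: "set (pairs xs) = set xs \<union> uminus ` set xs"
  by (induction xs) auto

lemma length_pairs: "length (pairs xs) = 2 * length xs"
  by (induction xs) auto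

lemma distinct_pairs: "distinct (pairs xs) \<longleftrightarrow> distinct xs \<and> set xs \<inter> uminus ` set xs = {}"
proof (induction xs)
  case (Cons x xs)
  have "- x \<in> uminus ` set xs \<longleftrightarrow> x \<in> set xs" "x \<in> uminus ` set xs \<longleftrightarrow> - x \<in> set xs" by force+
  then show ?case using Cons by (auto simp: set_pairs)
qed simp

lemma insort_split: "\<exists>ys zs. xs = ys @ zs \<and> insort m xs = ys @ m # zs" for m :: int
proof (induction xs)
  case (Cons x xs)
  then obtain ys zs where "xs = ys @ zs" "insort m xs = ys @ m # zs" by blast
  then show ?case
    by (cases "m \<le> x") (force intro: exI[of _ "[]"], force intro: exI[of _ "x # ys"])
qed simp

lemma Xvar_pairs_insert:
  assumes "finite S" "m \<notin> S" "set u \<subseteq> rws 1" "S \<subseteq> {1..int n}" "m \<in> {1..int n}"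
  shows "Xvar (u @ pairs (sorted_list_of_set S) @ [m, - m]) = Xvar (u @ pairs (sorted_list_of_set (insert m S)))"
proof -
  obtain ys zs where yz: "sorted_list_of_set S = ys @ zs" "insort m (sorted_list_of_set S) = ys @ m # zs"
    using insort_split by blast
  have "sorted_list_of_set (insert m S) = ys @ m # zs" using assms(1,2) yz by (simp add: sorted_list_of_set_insert_remove)
  moreover have "set ys \<union> set zs = S" using yz assms(1) by (metis set_append set_sorted_list_of_set)
  then have "set ((u @ pairs ys) @ [m, - m] @ pairs zs @ []) \<subseteq> rws 1"
    using assms(3-5) by (auto simp: set_pairs rws_def)
  then have "Xvar ((u @ pairs ys) @ [m, - m] @ pairs zs @ []) = Xvar ((u @ pairs ys) @ pairs zs @ [m, - m] @ [])"
    by (rule Xvar_block)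
  ultimately show ?thesis using yz by simp
qed

text \<open>The generators use increasing tuples; sorting an arbitrary \<open>t\<close> multiplies
  all summands by the same sign, since the last two subscripts stay in place.\<close>

lemma L_relation:
  assumes t: "distinct t" "set t \<subseteq> rws 1" "length t + 2 \<le> n"
  shows "(\<Sum>l\<in>{1..int n}. Xvar (t @ [l, - l])) \<in> L_space n"
proof -
  obtain \<sigma> where \<sigma>: "\<sigma> permutes {..<length t}" "permute_list \<sigma> t = srt (set t)" using sort_perm_ex t by blast
  have \<sigma>': "\<sigma> permutes {..<length (t @ [a, b])}" for a b :: int by (rule permutes_subset[OF \<sigma>(1)]) auto
  have ap: "permute_list \<sigma> (t @ [a, b]) = srt (set t) @ [a, b]" for a b
  proof (rule nth_equalityI)
    have len: "length (srt (set t)) = length t" using length_srt t distinct_card by metis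
    then show "length (permute_list \<sigma> (t @ [a, b])) = length (srt (set t) @ [a, b])" by simp
    fix i assume i: "i < length (permute_list \<sigma> (t @ [a, b]))"
    show "permute_list \<sigma> (t @ [a, b]) ! i = (srt (set t) @ [a, b]) ! i"
    proof (cases "i < length t")
      case True
      have s: "\<sigma> i < length t" using permutes_in_image[OF \<sigma>(1), of i] True by simp
      have "permute_list \<sigma> (t @ [a, b]) ! i = (t @ [a, b]) ! \<sigma> i" using i permute_list_nth[OF \<sigma>'[of a b], of i] by simp
      also have "\<dots> = permute_list \<sigma> t ! i" using s permute_list_nth[OF \<sigma>(1) True] by (simp add: nth_append)
      finally show ?thesis using True len by (simp add: nth_append \<sigma>(2))
    next
      case False
      then have s: "\<sigma> i = i" using permutes_not_in[OF \<sigma>(1)] by simp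
      have "permute_list \<sigma> (t @ [a, b]) ! i = (t @ [a, b]) ! \<sigma> i" using i permute_list_nth[OF \<sigma>'[of a b], of i] by simp
      then show ?thesis using False len s by (simp add: nth_append)
    qed
  qed
  have "Xvar (srt (set t) @ [l, - l]) = of_int (sign \<sigma>) * Xvar (t @ [l, - l])" if "l \<in> {1..int n}" for l
    using Xvar_permute[OF _ \<sigma>', of l "- l"] t pm_rws[of l] that by (simp add: ap)
  then have "(\<Sum>l\<in>{1..int n}. Xvar (t @ [l, - l])) = of_int (sign \<sigma>) * (\<Sum>l\<in>{1..int n}. Xvar (srt (set t) @ [l, - l]))"
    unfolding sum_distrib_left by (intro sum.cong refl) (simp add: mult.assoc[symmetric] flip: of_int_mult)
  also have "\<dots> = sg 0 (of_int (sign \<sigma>)) * (\<Sum>l\<in>{1..int n}. Xvar (srt (set t) @ [l, - l]))" by simp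
  also have "\<dots> \<in> L_space n"
    unfolding L_space_eq
  proof (intro pv.span_scale pv.span_base)
    have "srt (set t) \<in> tuples n (length t)" using t distinct_card by (intro srt_tuples) auto
    then show "(\<Sum>l\<in>{1..int n}. Xvar (srt (set t) @ [l, - l])) \<in> L_gen" using t unfolding L_gen_def by blast
  qed
  finally show ?thesis .
qed

text \<open>The position of \<open>j\<close> in the order \<open>-1 < 1 < -2 < 2 < \<dots>\<close>; binary weights let the last element at
  which two sets differ decide.\<close>

definition position :: "int \<Rightarrow> nat" where "position j = nat (if 0 < j then 2 * j else - 2 * j - 1)"

definition bit_weight :: "int set \<Rightarrow> nat" where "bit_weight S = (\<Sum>i\<in>S. 2 ^ position i)"

lemma L_subspace: "pv.subspace (L_space n)"
  unfolding L_space_eq by (rule pv.subspace_span)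

text \<open>The contribution to \<open>bit_weight\<close> of the pairs \<open>m\<close>,
  \<open>- m\<close> with \<open>m\<close> in \<open>D\<close>.\<close>

definition epair :: "int set \<Rightarrow> nat" where "epair D = (\<Sum>m\<in>D. 2 ^ position m + 2 ^ position (- m))"

lemma epair_le: "epair {1..int l} < 2 ^ (2 * l + 1)"
proof (induction l)
  case (Suc l)
  have "{1..int (Suc l)} = insert (int (Suc l)) {1..int l}" by auto
  then have "epair {1..int (Suc l)} = 2 ^ position (int (Suc l)) + 2 ^ position (- int (Suc l)) + epair {1..int l}" by (simp add: epair_def)
  moreover have "position (int (Suc l)) = 2 * l + 2" "position (- int (Suc l)) = 2 * l + 1" by (simp_all add: position_def nat_eq_iff)
  ultimately show ?case using Suc by simp
qed (simp add: epair_def)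

text \<open>All pairs up to \<open>l\<close> together weigh less than the lightest bit of any later
  pair.\<close>

lemma epair_less:
  assumes "D \<subseteq> {1..int l}" "finite F" "M \<in> F" "int l < M"
  shows "epair D < epair F"
proof -
  have "epair D \<le> epair {1..int l}" unfolding epair_def using assms(1) by (intro sum_mono2) auto
  also have "\<dots> < 2 ^ (2 * l + 1)" by (rule epair_le)
  also have "\<dots> \<le> 2 ^ position M" using assms(4) by (intro power_increasing) (auto simp: position_def)
  also have "\<dots> \<le> (\<Sum>m\<in>{M}. 2 ^ position m + 2 ^ position (- m))" by simp
  also have "\<dots> \<le> epair F" unfolding epair_def using assms by (intro sum_mono2) auto
  finally show ?thesis .
qed

lemma pos_disjoint: "F \<subseteq> {1..} \<Longrightarrow> F \<inter> uminus ` F = {}" for F :: "int set"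
proof -
  assume F: "F \<subseteq> {1..}"
  have False if "x \<in> F" "- x \<in> F" for x using subsetD[OF F that(1)] subsetD[OF F that(2)] by simp
  then show ?thesis by auto
qed

lemma bit_weight_pairs:
  assumes "finite A" "finite F" "F \<subseteq> {1..}" "A \<inter> (F \<union> uminus ` F) = {}"
  shows "bit_weight (A \<union> F \<union> uminus ` F) = bit_weight A + epair F"
proof -
  have d: "F \<inter> uminus ` F = {}" using pos_disjoint assms(3) .
  have "bit_weight (A \<union> F \<union> uminus ` F) = bit_weight A + bit_weight (F \<union> uminus ` F)"
    unfolding bit_weight_def Un_assoc using assms by (intro sum.union_disjoint) auto
  also have "bit_weight (F \<union> uminus ` F) = bit_weight F + bit_weight (uminus ` F)"
    unfolding bit_weight_def using assms d by (intro sum.union_disjoint) auto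
  also have "bit_weight (uminus ` F) = (\<Sum>m\<in>F. 2 ^ position (- m))" unfolding bit_weight_def by (subst sum.reindex) (auto simp: inj_on_def)
  finally show ?thesis by (simp add: bit_weight_def epair_def sum.distrib)
qed

text \<open>A set that violates admissibility at \<open>l\<close> has too many elements of absolute
  value at most \<open>l\<close>. All its pairs \<open>m\<close>, \<open>- m\<close> up to
  \<open>l\<close> are traded by \<open>exchange_disjoint\<close> for pairs at fresh indices. There
  are too few fresh indices up to \<open>l\<close>, so a later one occurs and the weight
  rises.\<close>

lemma straighten_step:
  assumes t: "t \<in> Theta' n"
  shows "\<exists>Q\<in>pv.span (pvar ` {t' \<in> tuples n (length t). bit_weight (set t) < bit_weight (set t')}). pvar t - Q \<in> L_space n"
proof -
  define k where "k = length t"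
  define T where "T = set t"
  have tk: "t \<in> tuples n k" "1 \<le> k" "k \<le> n" "\<not> admissible n t"
    using t tuplesD by (auto simp: Theta'_def all_tuples_def k_def)
  have tt: "T \<subseteq> rws 1" "distinct t" "t = srt T" "card T = k"
    using tuplesD[OF tk(1)] distinct_card[of t] by (auto simp: T_def k_def)
  have finT: "finite T" by (simp add: T_def)
  obtain l where l: "l \<in> {1..n}" "l < card {i \<in> T. \<bar>i\<bar> \<le> int l}"
    using tk(4) tt(2) unfolding admissible_def T_def by (auto simp: not_le)
  \<comment> \<open>\<open>Sg\<close> holds the elements without partner, \<open>PP\<close> the
    positive members of the pairs, divided into \<open>D\<close> up to \<open>l\<close> and
    \<open>C\<close> beyond. \<open>C\<close> is kept fixed, and \<open>U\<close> collects the
    indices whose pair is blocked neither by \<open>Sg\<close> nor by \<open>C\<close>.\<close>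
  define Sg where "Sg = {i \<in> T. - i \<notin> T}"
  define PP where "PP = {m \<in> T. 0 < m \<and> - m \<in> T}"
  define C where "C = {m \<in> PP. int l < m}"
  define D where "D = {m \<in> PP. m \<le> int l}"
  define U where "U = {1..int n} - (\<lambda>i. \<bar>i\<bar>) ` Sg - C"
  have fin: "finite Sg" "finite PP" "finite C" "finite D" "finite U"
    using finT by (auto simp: Sg_def PP_def C_def D_def U_def)
  have PPn: "PP \<subseteq> {1..int n}" using tt(1) by (auto simp: PP_def rws_def)
  have PPd: "PP \<inter> (\<lambda>i. \<bar>i\<bar>) ` Sg = {}" by (auto simp: PP_def Sg_def abs_if split: if_splits)
  have DU: "D \<subseteq> U" using PPn PPd by (auto simp: D_def U_def C_def)
  have Un: "U \<subseteq> {1..int n}" by (auto simp: U_def)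
  have Cn: "C \<subseteq> {1..int n}" using PPn by (auto simp: C_def)
  have Teq: "T = Sg \<union> PP \<union> uminus ` PP"
  proof (intro Set.set_eqI iffI)
    fix x assume x: "x \<in> T"
    then have "x \<noteq> 0" using tt(1) by (auto simp: rws_def)
    show "x \<in> Sg \<union> PP \<union> uminus ` PP"
    proof (cases "- x \<in> T")
      case True
      then have "x \<in> PP \<or> - x \<in> PP" using x \<open>x \<noteq> 0\<close> by (auto simp: PP_def)
      then show ?thesis by (metis UnI1 UnI2 imageI minus_minus)
    qed (use x in \<open>simp add: Sg_def\<close>)
  qed (auto simp: Sg_def PP_def)
  define Y where "Y S = Xvar (srt Sg @ pairs (sorted_list_of_set (S \<union> C)))" for S
  have Sgr: "Sg \<subseteq> rws 1" using tt(1) by (auto simp: Sg_def)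
  have base: "distinct (srt Sg @ pairs (sorted_list_of_set (S \<union> C)))"
    "set (srt Sg @ pairs (sorted_list_of_set (S \<union> C))) = Sg \<union> (S \<union> C) \<union> uminus ` (S \<union> C)"
    "Sg \<union> (S \<union> C) \<union> uminus ` (S \<union> C) \<subseteq> rws 1"
    "length (srt Sg @ pairs (sorted_list_of_set (S \<union> C))) = card Sg + 2 * (card S + card C)"
    "Sg \<inter> ((S \<union> C) \<union> uminus ` (S \<union> C)) = {}"
    if S: "S \<subseteq> U" for S
  proof -
    have fS: "finite S" using S fin finite_subset by blast
    have SC: "S \<union> C \<subseteq> {1..int n}" using S Un Cn by auto
    have st: "set (sorted_list_of_set (S \<union> C)) = S \<union> C" using fS fin by simp
    have SCd: "S \<union> C \<subseteq> {1..int n} - (\<lambda>i. \<bar>i\<bar>) ` Sg" using S PPd Cn by (auto simp: U_def C_def)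
    show dj: "Sg \<inter> ((S \<union> C) \<union> uminus ` (S \<union> C)) = {}"
    proof -
      have False if x: "x \<in> Sg" "x \<in> S \<union> C \<or> x \<in> uminus ` (S \<union> C)" for x
      proof -
        have "\<bar>x\<bar> \<notin> S \<union> C" using SCd x(1) by blast
        moreover have "\<bar>x\<bar> \<in> S \<union> C" using x(2)
        proof
          assume "x \<in> S \<union> C"
          moreover from this have "1 \<le> x" using subsetD[OF SC] by simp
          ultimately show ?thesis by simp
        next
          assume "x \<in> uminus ` (S \<union> C)"
          then obtain m where "m \<in> S \<union> C" "x = - m" by blast
          moreover from this have "1 \<le> m" using subsetD[OF SC] by simp
          ultimately show ?thesis by simp
        qed
        ultimately show False by blast
      qed
      then show ?thesis by blast
    qed
    have dj2: "(S \<union> C) \<inter> uminus ` (S \<union> C) = {}" using SC by (intro pos_disjoint) auto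
    show "set (srt Sg @ pairs (sorted_list_of_set (S \<union> C))) = Sg \<union> (S \<union> C) \<union> uminus ` (S \<union> C)"
      using Sgr by (simp add: set_srt set_pairs st Un_assoc)
    show "distinct (srt Sg @ pairs (sorted_list_of_set (S \<union> C)))"
      using dj dj2 Sgr unfolding distinct_append distinct_pairs set_pairs st set_srt[OF Sgr] by simp
    show "Sg \<union> (S \<union> C) \<union> uminus ` (S \<union> C) \<subseteq> rws 1" using Sgr SC by (auto simp: rws_def)
    have "S \<inter> C = {}" using S by (auto simp: U_def)
    then show "length (srt Sg @ pairs (sorted_list_of_set (S \<union> C))) = card Sg + 2 * (card S + card C)"
      using fS fin Sgr by (simp add: length_srt length_pairs card_Un_disjoint)
  qed
  have DC: "D \<union> C = PP" by (auto simp: D_def C_def)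
  have setD: "set (srt Sg @ pairs (sorted_list_of_set (D \<union> C))) = T" using base(2)[OF DU] DC Teq by (simp add: Un_assoc)
  have len: "card Sg + 2 * (card D + card C) = k"
    using base(1,4)[OF DU] setD distinct_card tt(4) by metis
  have rel: "(\<Sum>m\<in>U - S. Y (insert m S)) \<in> L_space n" if S: "S \<subseteq> U" "card S + 1 = card D" for S
  proof -
    let ?b = "srt Sg @ pairs (sorted_list_of_set (S \<union> C))"
    have fS: "finite S" using S fin finite_subset by blast
    have "length ?b + 2 = k" using base(4)[OF S(1)] len S(2) by simp
    then have "(\<Sum>m\<in>{1..int n}. Xvar (?b @ [m, - m])) \<in> L_space n"
      using base[OF S(1)] tk by (intro L_relation) auto
    \<comment> \<open>For an index that is blocked or already used a subscript is repeated, and the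
      variable is zero.\<close>
    also have "(\<Sum>m\<in>{1..int n}. Xvar (?b @ [m, - m])) = (\<Sum>m\<in>U - S. Xvar (?b @ [m, - m]))"
    proof (rule sum.mono_neutral_right)
      show "\<forall>m\<in>{1..int n} - (U - S). Xvar (?b @ [m, - m]) = 0"
      proof
        fix m assume m: "m \<in> {1..int n} - (U - S)"
        then have "m \<in> (\<lambda>i. \<bar>i\<bar>) ` Sg \<or> m \<in> S \<union> C" by (auto simp: U_def)
        then have "m \<in> set ?b \<or> - m \<in> set ?b" unfolding base(2)[OF S(1)] by (auto simp: abs_if split: if_splits)
        then show "Xvar (?b @ [m, - m]) = 0" by (intro Xvar_not_distinct) auto
      qed
    qed (use Un in auto)
    also have "\<dots> = (\<Sum>m\<in>U - S. Y (insert m S))"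
    proof (intro sum.cong refl)
      fix m assume m: "m \<in> U - S"
      have "Xvar (srt Sg @ pairs (sorted_list_of_set (S \<union> C)) @ [m, - m]) = Xvar (srt Sg @ pairs (sorted_list_of_set (insert m (S \<union> C))))"
        using m fS fin Sgr S(1) Un Cn by (intro Xvar_pairs_insert) (auto simp: set_srt U_def)
      then show "Xvar (?b @ [m, - m]) = Y (insert m S)" by (simp add: Y_def)
    qed
    finally show ?thesis .
  qed
  obtain c where c: "Y D - sg 0 c * (\<Sum>F | F \<subseteq> U - D \<and> card F = card D. Y F) \<in> L_space n"
    using exchange_disjoint[OF fin(5) DU L_subspace, of Y] rel by blast
  let ?B = "{t' \<in> tuples n (length t). bit_weight (set t) < bit_weight (set t')}"
  have YF: "Y F \<in> pv.span (pvar ` ?B)" if F: "F \<subseteq> U - D" "card F = card D" for F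
  proof -
    have FU: "F \<subseteq> U" using F by auto
    have fF: "finite F" using FU fin finite_subset by blast
    let ?b = "srt Sg @ pairs (sorted_list_of_set (F \<union> C))"
    \<comment> \<open>Otherwise \<open>F\<close>, \<open>D\<close> and the absolute values of the
      unpaired elements up to \<open>l\<close> are disjoint parts of \<open>{1..l}\<close>. As
      \<open>F\<close> has the size of \<open>D\<close>, the set \<open>T\<close> then has at most
      \<open>l\<close> elements of absolute value at most \<open>l\<close>, against the choice of
      \<open>l\<close>.\<close>
    have "\<exists>M\<in>F. int l < M"
    proof (rule ccontr)
      assume nM: "\<not> (\<exists>M\<in>F. int l < M)"
      have Fl: "F \<subseteq> {1..int l} - (\<lambda>i. \<bar>i\<bar>) ` {i \<in> Sg. \<bar>i\<bar> \<le> int l} - D"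
      proof
        fix x assume x: "x \<in> F"
        then have "x \<in> U" "x \<notin> D" "x \<le> int l" using F(1) nM by auto
        then show "x \<in> {1..int l} - (\<lambda>i. \<bar>i\<bar>) ` {i \<in> Sg. \<bar>i\<bar> \<le> int l} - D" by (auto simp: U_def)
      qed
      let ?Sl = "{i \<in> Sg. \<bar>i\<bar> \<le> int l}"
      have inj: "inj_on (\<lambda>i. \<bar>i\<bar>) Sg" by (auto simp: inj_on_def Sg_def abs_eq_iff)
      have cS: "card ((\<lambda>i. \<bar>i\<bar>) ` ?Sl) = card ?Sl" by (rule card_image) (rule inj_on_subset[OF inj], auto)
      have sub: "(\<lambda>i. \<bar>i\<bar>) ` ?Sl \<union> D \<subseteq> {1..int l}" using PPn Sgr by (auto simp: D_def rws_def)
      have dj: "(\<lambda>i. \<bar>i\<bar>) ` ?Sl \<inter> D = {}" using PPd by (auto simp: D_def)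
      have "F \<inter> ((\<lambda>i. \<bar>i\<bar>) ` ?Sl \<union> D) = {}" using Fl by auto
      then have "card (F \<union> ((\<lambda>i. \<bar>i\<bar>) ` ?Sl \<union> D)) = card F + (card ?Sl + card D)"
        using fF fin dj cS by (simp add: card_Un_disjoint)
      moreover have "card (F \<union> ((\<lambda>i. \<bar>i\<bar>) ` ?Sl \<union> D)) \<le> card {1..int l}" using Fl sub by (intro card_mono) auto
      ultimately have "card ?Sl + 2 * card D \<le> l" using F(2) by simp
      moreover have "{i \<in> T. \<bar>i\<bar> \<le> int l} \<subseteq> ?Sl \<union> D \<union> uminus ` D" unfolding Teq by (auto simp: D_def PP_def)
      then have "card {i \<in> T. \<bar>i\<bar> \<le> int l} \<le> card (?Sl \<union> D \<union> uminus ` D)" using fin by (intro card_mono) auto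
      moreover have "card (?Sl \<union> D \<union> uminus ` D) \<le> card ?Sl + card D + card (uminus ` D)"
        using card_Un_le[of "?Sl \<union> D" "uminus ` D"] card_Un_le[of ?Sl D] by linarith
      moreover have "card (uminus ` D) \<le> card D" using fin by (intro card_image_le) auto
      ultimately show False using l(2) by linarith
    qed
    then obtain M where M: "M \<in> F" "int l < M" by blast
    have e1: "bit_weight (Sg \<union> (S \<union> C) \<union> uminus ` (S \<union> C)) = bit_weight Sg + epair S + epair C" if S: "S \<subseteq> U" for S
    proof -
      have fS: "finite S" using S fin finite_subset by blast
      have "bit_weight (Sg \<union> (S \<union> C) \<union> uminus ` (S \<union> C)) = bit_weight Sg + epair (S \<union> C)"
      proof (rule bit_weight_pairs[OF fin(1) _ _ base(5)[OF S]])
        show "finite (S \<union> C)" using fS fin by simp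
        show "S \<union> C \<subseteq> {1..}" using S Un Cn by auto
      qed
      also have "epair (S \<union> C) = epair S + epair C" unfolding epair_def
        using fS fin S by (intro sum.union_disjoint) (auto simp: U_def)
      finally show ?thesis by simp
    qed
    have "D \<subseteq> {1..int l}" using PPn by (auto simp: D_def)
    then have "epair D < epair F" using fF M by (intro epair_less) auto
    then have lt: "bit_weight (set t) < bit_weight (set ?b)" using e1[OF DU] e1[OF FU] base(2)[OF DU] base(2)[OF FU] setD by (simp add: T_def)
    define V where "V = set ?b"
    have Vr: "V \<subseteq> rws 1" unfolding V_def base(2)[OF FU] by (rule base(3)[OF FU])
    have Vk: "card V = k" unfolding V_def using distinct_card[OF base(1)[OF FU]] base(4)[OF FU] len F(2) by simp
    have "bit_weight (set t) < bit_weight V" unfolding V_def by (rule lt)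
    then have mem: "srt V \<in> ?B" using srt_tuples[OF Vr Vk] set_srt[OF Vr] by (simp add: k_def)
    then have sp: "pvar (srt V) \<in> pv.span (pvar ` ?B)" by (intro pv.span_base imageI)
    from Xvar_cases[of ?b] Vr have "Y F = 0 \<or> Y F = pvar (srt V) \<or> Y F = - pvar (srt V)"
      unfolding Y_def V_def by blast
    then show ?thesis using sp pv.span_zero pv.span_neg[OF sp] by (elim disjE) simp_all
  qed
  define Q where "Q = sg 0 c * (\<Sum>F | F \<subseteq> U - D \<and> card F = card D. Y F)"
  have Q: "Q \<in> pv.span (pvar ` ?B)" unfolding Q_def using YF by (intro pv.span_scale pv.span_sum) auto
  have br: "set (srt Sg @ pairs (sorted_list_of_set (D \<union> C))) \<subseteq> rws 1" unfolding setD by (rule tt(1))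
  have "Y D = pvar t \<or> Y D = - pvar t"
  proof -
    obtain \<sigma> where \<sigma>: "\<sigma> permutes {..<length (srt Sg @ pairs (sorted_list_of_set (D \<union> C)))}"
      "permute_list \<sigma> (srt Sg @ pairs (sorted_list_of_set (D \<union> C))) = srt (set (srt Sg @ pairs (sorted_list_of_set (D \<union> C))))"
      using sort_perm_ex[OF base(1)[OF DU] br] by blast
    from Xvar_sort[OF base(1)[OF DU] br \<sigma>] have "Y D = of_int (sign \<sigma>) * pvar t"
      unfolding Y_def setD tt(3)[symmetric] .
    then show ?thesis by (cases \<sigma> rule: sign_cases) auto
  qed
  then show ?thesis
  proof
    assume "Y D = pvar t"
    then show ?thesis using c Q unfolding Q_def by (intro bexI[of _ Q]) (auto simp: Q_def)
  next
    assume "Y D = - pvar t"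
    then have "pvar t - (- Q) = - (Y D - Q)" by simp
    moreover have "- (Y D - Q) \<in> L_space n" using pv.subspace_neg[OF L_subspace c] by (simp add: Q_def)
    ultimately show ?thesis using pv.span_neg[OF Q] by (intro bexI[of _ "- Q"]) auto
  qed
qed

lemma span_replace:
  assumes L: "pv.subspace L" and B: "\<And>b. b \<in> B \<Longrightarrow> \<exists>R\<in>pv.span A. b - R \<in> L" and q: "q \<in> pv.span B"
  shows "\<exists>R\<in>pv.span A. q - R \<in> L"
  using q
proof (induction rule: pv.span_induct_alt)
  case base then show ?case using pv.subspace_0[OF L] pv.span_zero by (intro bexI[of _ 0]) auto
next
  case (step c x y)
  then obtain R1 R2 where R: "R1 \<in> pv.span A" "x - R1 \<in> L" "R2 \<in> pv.span A" "y - R2 \<in> L" using B by blast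
  have "sg 0 c * (x - R1) + (y - R2) \<in> L" by (intro pv.subspace_add[OF L] pv.subspace_scale[OF L] R)
  also have "sg 0 c * (x - R1) + (y - R2) = (sg 0 c * x + y) - (sg 0 c * R1 + R2)" by (simp add: algebra_simps)
  finally show ?case by (intro bexI[of _ "sg 0 c * R1 + R2"] pv.span_add pv.span_scale R)
qed

lemma all_tuples_iff: "t \<in> all_tuples n \<longleftrightarrow> t \<in> tuples n (length t) \<and> 1 \<le> length t \<and> length t \<le> n"
  by (auto simp: all_tuples_def tuples_def)

lemma Theta_cases: "t \<in> all_tuples n \<Longrightarrow> t \<in> Theta n \<or> t \<in> Theta' n" and Theta_disjoint: "t \<in> Theta n \<Longrightarrow> t \<notin> Theta' n"
  and Theta_all: "t \<in> Theta n \<Longrightarrow> t \<in> all_tuples n" and Theta'_all: "t \<in> Theta' n \<Longrightarrow> t \<in> all_tuples n"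
  by (auto simp: Theta_def Theta'_def)

lemma bit_weight_bound: "S \<subseteq> rws 1 \<Longrightarrow> bit_weight S \<le> bit_weight (rws 1)"
  unfolding bit_weight_def by (intro sum_mono2) auto

text \<open>\<open>straighten_step\<close> raises the bit weight, which is bounded by that of the
  whole index set, and keeps the length.\<close>

lemma straighten_exists:
  assumes "t \<in> all_tuples n"
  shows "\<exists>R\<in>pv.span (pvar ` {t' \<in> Theta n. length t' = length t}). pvar t - R \<in> L_space n"
  using assms
proof (induction "bit_weight (rws 1) - bit_weight (set t)" arbitrary: t rule: less_induct)
  case less
  show ?case
  proof (cases "t \<in> Theta n")
    case True
    then show ?thesis using pv.subspace_0[OF L_subspace] by (intro bexI[of _ "pvar t"] pv.span_base) auto
  next
    case False
    then have t: "t \<in> Theta' n" using Theta_cases less.prems by blast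
    let ?B = "{t' \<in> tuples n (length t). bit_weight (set t) < bit_weight (set t')}"
    obtain Q where Q: "Q \<in> pv.span (pvar ` ?B)" "pvar t - Q \<in> L_space n" using straighten_step[OF t] by blast
    have "\<exists>R\<in>pv.span (pvar ` {t' \<in> Theta n. length t' = length t}). b - R \<in> L_space n" if b: "b \<in> pvar ` ?B" for b
    proof -
      obtain t' where t': "b = pvar t'" "t' \<in> tuples n (length t)" "bit_weight (set t) < bit_weight (set t')" using b by blast
      have l: "length t' = length t" "t' \<in> all_tuples n" "set t' \<subseteq> rws 1"
        using tuplesD[OF t'(2)] t'(2) less.prems by (auto simp: all_tuples_iff)
      have "bit_weight (rws 1) - bit_weight (set t') < bit_weight (rws 1) - bit_weight (set t)" using t'(3) bit_weight_bound[OF l(3)] by linarith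
      from less.hyps[OF this l(2)] show ?thesis using l t' by simp
    qed
    from span_replace[OF L_subspace this Q(1)] obtain R where
      R: "R \<in> pv.span (pvar ` {t' \<in> Theta n. length t' = length t})" "Q - R \<in> L_space n" by blast
    have "(pvar t - Q) + (Q - R) \<in> L_space n" by (rule pv.subspace_add[OF L_subspace Q(2) R(2)])
    then show ?thesis using R(1) by (intro bexI[of _ R]) auto
  qed
qed

lemma straighten:
  assumes "t \<in> all_tuples n"
  shows "straighten n t \<in> pv.span (pvar ` {t' \<in> Theta n. length t' = length t})" "pvar t - straighten n t \<in> L_space n"
proof -
  obtain R where R: "R \<in> pv.span (pvar ` {t' \<in> Theta n. length t' = length t})" "pvar t - R \<in> L_space n"
    using straighten_exists[OF assms] by blast
  have mono: "pv.span (pvar ` {t' \<in> Theta n. length t' = length t}) \<subseteq> pv.span (pvar ` Theta n)"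
    by (intro pv.span_mono) auto
  have "straighten n t = R" unfolding straighten_def cspan_eq
  proof (rule the_equality)
    show "R \<in> pv.span (pvar ` Theta n) \<and> pvar t - R \<in> L_space n" using R mono by blast
    fix R' assume R': "R' \<in> pv.span (pvar ` Theta n) \<and> pvar t - R' \<in> L_space n"
    have "(pvar t - R) - (pvar t - R') \<in> L_space n" by (rule pv.subspace_diff[OF L_subspace R(2) conjunct2[OF R']])
    then have "R' - R \<in> L_space n" by (simp add: algebra_simps)
    moreover have "R' - R \<in> pv.span (pvar ` Theta n)" using R R' mono by (intro pv.span_diff) auto
    ultimately have "R' - R = 0" by (rule L_inter_span)
    then show "R' = R" by simp
  qed
  then show "straighten n t \<in> pv.span (pvar ` {t' \<in> Theta n. length t' = length t})" "pvar t - straighten n t \<in> L_space n"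
    using R by simp_all
qed

section \<open>The homomorphism to the ring of admissible variables\<close>

definition rhov :: "int list \<Rightarrow> int list cpoly" where "rhov t = (if t \<in> Theta' n then straighten n t else pvar t)"

lemma rho1_eq: "rho1 n = psub rhov"
  by (simp add: rho1_def psubst_eq fun_eq_iff rhov_def[abs_def])

lemma rho_id: "p \<in> pring (Theta n) \<Longrightarrow> rho1 n p = p"
  using psub_cong[of p "Theta n" rhov pvar] Theta_disjoint by (auto simp: rho1_eq rhov_def psub_pvar_id)

lemma rhov_L: "t \<in> all_tuples n \<Longrightarrow> pvar t - rhov t \<in> L_space n"
  using straighten(2) pv.subspace_0[OF L_subspace] by (auto simp: rhov_def)

lemma rhov_span: "t \<in> all_tuples n \<Longrightarrow> rhov t \<in> pv.span (pvar ` Theta n)"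
proof -
  assume t: "t \<in> all_tuples n"
  have "pv.span (pvar ` {t' \<in> Theta n. length t' = length t}) \<subseteq> pv.span (pvar ` Theta n)" by (intro pv.span_mono) auto
  then show ?thesis using straighten(1)[OF t] Theta_cases[OF t] by (auto simp: rhov_def intro: pv.span_base)
qed

lemma span_pvar_pring: "p \<in> pv.span (pvar ` V) \<Longrightarrow> p \<in> pring V"
  by (rule pring_cspan[rotated]) (auto intro: pring_pvar)

lemma rho_pring: "p \<in> pring (all_tuples n) \<Longrightarrow> rho1 n p \<in> pring (Theta n)"
  unfolding rho1_eq by (rule pring_psub) (auto intro: span_pvar_pring rhov_span)

lemma Xvar_span: "set t \<subseteq> rws 1 \<Longrightarrow> 1 \<le> length t \<Longrightarrow> length t \<le> n \<Longrightarrow> Xvar t \<in> pv.span (pvar ` all_tuples n)"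
proof -
  assume t: "set t \<subseteq> rws 1" "1 \<le> length t" "length t \<le> n"
  have "pvar (srt (set t)) \<in> pv.span (pvar ` all_tuples n)" if "distinct t"
    using srt_tuples[OF t(1), of "length t"] t distinct_card[OF that] by (intro pv.span_base imageI) (auto simp: all_tuples_def)
  then show ?thesis using Xvar_cases[OF t(1)] pv.span_zero pv.span_neg by fastforce
qed

lemma L_span: "p \<in> L_space n \<Longrightarrow> p \<in> pv.span (pvar ` all_tuples n)"
proof -
  assume "p \<in> L_space n"
  moreover have "L_gen \<subseteq> pv.span (pvar ` all_tuples n)"
  proof
    fix g assume "g \<in> L_gen"
    then obtain t k where t: "g = (\<Sum>l=1..int n. Xvar (t @ [l, - l]))" "k + 2 \<le> n" "t \<in> tuples n k" by (auto simp: L_gen_def)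
    show "g \<in> pv.span (pvar ` all_tuples n)" unfolding t(1)
      using tuplesD[OF t(3)] t(2) pm_rws by (intro pv.span_sum Xvar_span) auto
  qed
  ultimately show ?thesis unfolding L_space_eq using pv.span_minimal[OF _ pv.subspace_span] by blast
qed

text \<open>The difference \<open>p - rho1 n p\<close> lies in \<open>L_space\<close>, hence so does
  \<open>rho1 n p\<close>. The latter is a combination of admissible variables, and
  \<open>L_inter_span\<close> applies.\<close>

lemma rho_L:
  assumes "p \<in> L_space n"
  shows "rho1 n p = 0"
proof -
  obtain a where a: "p = (\<Sum>t\<in>all_tuples n. sg 0 (a t) * pvar t)"
    using span_pvar_coeffs[OF finite_tuples L_span[OF assms]] by blast
  have r: "rho1 n p = (\<Sum>t\<in>all_tuples n. sg 0 (a t) * rhov t)"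
    by (simp add: a rho1_eq psub_sum psub_scale)
  have "(\<Sum>t\<in>all_tuples n. sg 0 (a t) * (pvar t - rhov t)) \<in> L_space n"
    by (intro pv.subspace_sum[OF L_subspace] pv.subspace_scale[OF L_subspace] rhov_L)
  then have "p - rho1 n p \<in> L_space n" unfolding r by (subst a) (simp add: right_diff_distrib sum_subtractf)
  from pv.subspace_diff[OF L_subspace assms this] have "rho1 n p \<in> L_space n" by simp
  moreover have "rho1 n p \<in> pv.span (pvar ` Theta n)" unfolding r by (intro pv.span_sum pv.span_scale rhov_span)
  ultimately show ?thesis using L_inter_span by simp
qed

lemma psi_rho:
  assumes "p \<in> pring (all_tuples n)"
  shows "psi (rho1 n p) = psi p"
proof -
  have "psi (rhov t) = psi (pvar t)" if "t \<in> all_tuples n" for t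
    using psi_L[OF rhov_L[OF that]] by (simp add: psi_def psub_diff)
  then have "psub (\<lambda>t. psi (rhov t)) p = psub (\<lambda>t. psi (pvar t)) p" by (intro psub_cong[OF assms])
  then show ?thesis by (simp add: rho1_eq psi_def psub_comp)
qed

lemma I_C_psi: "p \<in> I_C n \<Longrightarrow> psi p = 0"
  using psi_rho psi_I_A by (auto simp: I_C_def I_A_def)

lemma I_C_pring: "p \<in> I_C n \<Longrightarrow> p \<in> pring (Theta n)"
  using rho_pring by (auto simp: I_C_def I_A_def)

lemma I_A_mult: "p \<in> pring (all_tuples n) \<Longrightarrow> h \<in> I_A n \<Longrightarrow> p * h \<in> I_A n"
  by (auto simp: I_A_def psubst_eq psub_mult pring_mult)

lemma I_A_add: "h \<in> I_A n \<Longrightarrow> h' \<in> I_A n \<Longrightarrow> h + h' \<in> I_A n"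
  by (auto simp: I_A_def psubst_eq psub_add pring_add)

lemma I_C_0: "0 \<in> I_C n"
proof -
  have "0 \<in> I_A n" by (simp add: I_A_def psubst_eq)
  then show ?thesis unfolding I_C_def by (metis imageI psub_0 rho1_eq)
qed

lemma I_C_add: "p \<in> I_C n \<Longrightarrow> q \<in> I_C n \<Longrightarrow> p + q \<in> I_C n"
proof -
  assume "p \<in> I_C n" "q \<in> I_C n"
  then obtain h h' where "h \<in> I_A n" "h' \<in> I_A n" "p = rho1 n h" "q = rho1 n h'" by (auto simp: I_C_def)
  then have "p + q = rho1 n (h + h')" "h + h' \<in> I_A n" by (simp_all add: rho1_eq psub_add I_A_add)
  then show ?thesis by (auto simp: I_C_def)
qed

lemma pring_Theta_all: "p \<in> pring (Theta n) \<Longrightarrow> p \<in> pring (all_tuples n)"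
  by (rule pring_mono[rotated]) (auto simp: Theta_def)

lemma I_C_mult: "p \<in> pring (Theta n) \<Longrightarrow> q \<in> I_C n \<Longrightarrow> p * q \<in> I_C n"
proof -
  assume p: "p \<in> pring (Theta n)" "q \<in> I_C n"
  then obtain h where h: "h \<in> I_A n" "q = rho1 n h" by (auto simp: I_C_def)
  have "rho1 n (p * h) = rho1 n p * rho1 n h" by (simp add: rho1_eq psub_mult)
  then have "p * q = rho1 n (p * h)" using h rho_id[OF p(1)] by simp
  then show ?thesis using I_A_mult[OF pring_Theta_all[OF p(1)] h(1)] by (auto simp: I_C_def)
qed

lemma I_C_uminus: "p \<in> I_C n \<Longrightarrow> - p \<in> I_C n"
  using I_C_mult[OF pring_uminus[OF pring_1], of p] by simp

lemma I_C_diff: "p \<in> I_C n \<Longrightarrow> q \<in> I_C n \<Longrightarrow> p - q \<in> I_C n"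
  using I_C_add[of p "- q"] I_C_uminus by simp

text \<open>The preimage of \<open>I_C\<close>. It is closed under multiplication by all polynomials
  and contains both \<open>I_A\<close> and \<open>L_space\<close>, so quadratic and linear relations
  can be mixed freely before passing to admissible variables.\<close>

definition rho_kernel :: "int list cpoly set" where "rho_kernel = {p \<in> pring (all_tuples n). rho1 n p \<in> I_C n}"

lemma rho_kernel_I_A: "p \<in> I_A n \<Longrightarrow> p \<in> rho_kernel"
  by (auto simp: rho_kernel_def I_C_def I_A_def)

lemma rho_kernel_L: "p \<in> L_space n \<Longrightarrow> p \<in> rho_kernel"
  using span_pvar_pring[OF L_span] rho_L I_C_0 by (auto simp: rho_kernel_def)

lemma rho_kernel_add: "p \<in> rho_kernel \<Longrightarrow> q \<in> rho_kernel \<Longrightarrow> p + q \<in> rho_kernel"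
  by (auto simp: rho_kernel_def rho1_eq psub_add pring_add I_C_add)

lemma rho_kernel_mult: "p \<in> pring (all_tuples n) \<Longrightarrow> q \<in> rho_kernel \<Longrightarrow> p * q \<in> rho_kernel"
proof -
  assume p: "p \<in> pring (all_tuples n)" "q \<in> rho_kernel"
  have "rho1 n (p * q) = rho1 n p * rho1 n q" by (simp add: rho1_eq psub_mult)
  then show ?thesis using p I_C_mult[OF rho_pring[OF p(1)]] by (auto simp: rho_kernel_def pring_mult)
qed

lemma rho_kernel_subspace: "pv.subspace rho_kernel"
proof (rule pv.subspaceI)
  show "0 \<in> rho_kernel" by (auto simp: rho_kernel_def rho1_eq I_C_0)
qed (auto intro: rho_kernel_add rho_kernel_mult)

section \<open>Pluecker relations\<close>

lemma prod_lessThan_add: "(\<Prod>x<a + b. f x) = (\<Prod>x<a. f x) * (\<Prod>j<b. f (a + j :: nat) :: 'a::comm_monoid_mult)"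
  by (induction b) (auto simp: mult.assoc)

lemma sum_swap3: "(\<Sum>x\<in>A. \<Sum>y\<in>B. \<Sum>z\<in>C. f x y z) = (\<Sum>y\<in>B. \<Sum>z\<in>C. \<Sum>x\<in>A. f x y z)"
  by (rule trans[OF sum.swap]) (intro sum.cong refl sum.swap)

lemma prod_columns:
  assumes "p permutes {..<k}"
  shows "(\<Prod>i<k. Z (int i + 1) (t ! p i)) = (\<Prod>c<k. Z (int (inv_into UNIV p c) + 1) (t ! c) :: 'a::comm_monoid_mult)"
proof -
  have "bij_betw p {..<k} {..<k}" using assms by (rule permutes_imp_bij)
  from prod.reindex_bij_betw[OF this, of "\<lambda>c. Z (int (inv_into UNIV p c) + 1) (t ! c)"]
  show ?thesis using permutes_inverses(2)[OF assms] by simp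
qed

text \<open>In a product of two Leibniz terms every subscript from \<open>a @ b\<close> is evaluated
  in one of the first \<open>length u + length b\<close> rows. There are more such subscripts than
  rows, so two of them share a row, and their exchange cancels the antisymmetrised sum.\<close>

lemma pluecker_relation:
  fixes Z :: "int \<Rightarrow> int \<Rightarrow> 'b::comm_monoid_add \<Rightarrow>\<^sub>0 complex"
  assumes len: "length a + length v \<le> length u + length b" "length u + length b < length a + length b"
  shows "(\<Sum>\<sigma> | \<sigma> permutes {..<length a + length b}. of_int (sign \<sigma>) *
      (minor Z (u @ drop (length a) (permute_list \<sigma> (a @ b))) * minor Z (take (length a) (permute_list \<sigma> (a @ b)) @ v))) = 0"
proof -
  let ?m = "length a" and ?k = "length u + length b" and ?k' = "length a + length v" and ?N = "length a + length b"
  let ?c = "a @ b"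
  let ?T = "\<lambda>\<sigma>. u @ drop ?m (permute_list \<sigma> ?c)" and ?S = "\<lambda>\<sigma>. take ?m (permute_list \<sigma> ?c) @ v"
  define F where "F p p' \<sigma> = (\<Prod>i<?k. Z (int i + 1) (?T \<sigma> ! p i)) * (\<Prod>i<?k'. Z (int i + 1) (?S \<sigma> ! p' i))" for p p' \<sigma>
  have zero: "(\<Sum>\<sigma> | \<sigma> permutes {..<?N}. of_int (sign \<sigma>) * F p p' \<sigma>) = 0"
    if p: "p permutes {..<?k}" and p': "p' permutes {..<?k'}" for p p'
  proof -
    \<comment> \<open>The row, counted from 0, in which the subscript at place \<open>x\<close> is
      evaluated: the first block goes into the second minor, behind which \<open>v\<close> follows;
      the other block goes into the first minor, behind \<open>u\<close>.\<close>
    define g where "g x = (if x < ?m then inv_into UNIV p' x else inv_into UNIV p (length u + (x - ?m)))" for x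
    define A where "A = (\<Prod>c<length u. Z (int (inv_into UNIV p c) + 1) (u ! c)) * (\<Prod>j<length v. Z (int (inv_into UNIV p' (?m + j)) + 1) (v ! j))"
    have F: "F p p' \<sigma> = A * (\<Prod>x<?N. Z (int (g x) + 1) (?c ! \<sigma> x))" if s: "\<sigma> permutes {..<?N}" for \<sigma>
    proof -
      have s': "\<sigma> permutes {..<length ?c}" using s by simp
      have 1: "(\<Prod>i<?k. Z (int i + 1) (?T \<sigma> ! p i)) = (\<Prod>c<length u. Z (int (inv_into UNIV p c) + 1) (u ! c)) *
          (\<Prod>j<length b. Z (int (inv_into UNIV p (length u + j)) + 1) (?c ! \<sigma> (?m + j)))"
      proof -
        have "(\<Prod>i<?k. Z (int i + 1) (?T \<sigma> ! p i)) = (\<Prod>c<?k. Z (int (inv_into UNIV p c) + 1) (?T \<sigma> ! c))"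
          by (rule prod_columns[OF p])
        also have "\<dots> = (\<Prod>c<length u. Z (int (inv_into UNIV p c) + 1) (?T \<sigma> ! c)) *
            (\<Prod>j<length b. Z (int (inv_into UNIV p (length u + j)) + 1) (?T \<sigma> ! (length u + j)))"
          by (rule prod_lessThan_add)
        also have "(\<Prod>c<length u. Z (int (inv_into UNIV p c) + 1) (?T \<sigma> ! c)) = (\<Prod>c<length u. Z (int (inv_into UNIV p c) + 1) (u ! c))"
          by (intro prod.cong refl) (simp add: nth_append)
        also have "(\<Prod>j<length b. Z (int (inv_into UNIV p (length u + j)) + 1) (?T \<sigma> ! (length u + j)))
            = (\<Prod>j<length b. Z (int (inv_into UNIV p (length u + j)) + 1) (?c ! \<sigma> (?m + j)))"
          by (intro prod.cong refl) (simp add: nth_append permute_list_nth[OF s'] del: append_assoc)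
        finally show ?thesis .
      qed
      have 2: "(\<Prod>i<?k'. Z (int i + 1) (?S \<sigma> ! p' i)) = (\<Prod>c<?m. Z (int (inv_into UNIV p' c) + 1) (?c ! \<sigma> c)) *
          (\<Prod>j<length v. Z (int (inv_into UNIV p' (?m + j)) + 1) (v ! j))"
      proof -
        have "(\<Prod>i<?k'. Z (int i + 1) (?S \<sigma> ! p' i)) = (\<Prod>c<?k'. Z (int (inv_into UNIV p' c) + 1) (?S \<sigma> ! c))"
          by (rule prod_columns[OF p'])
        also have "\<dots> = (\<Prod>c<?m. Z (int (inv_into UNIV p' c) + 1) (?S \<sigma> ! c)) *
            (\<Prod>j<length v. Z (int (inv_into UNIV p' (?m + j)) + 1) (?S \<sigma> ! (?m + j)))"
          by (rule prod_lessThan_add)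
        also have "(\<Prod>c<?m. Z (int (inv_into UNIV p' c) + 1) (?S \<sigma> ! c)) = (\<Prod>c<?m. Z (int (inv_into UNIV p' c) + 1) (?c ! \<sigma> c))"
          by (intro prod.cong refl) (simp add: nth_append permute_list_nth[OF s'])
        also have "(\<Prod>j<length v. Z (int (inv_into UNIV p' (?m + j)) + 1) (?S \<sigma> ! (?m + j)))
            = (\<Prod>j<length v. Z (int (inv_into UNIV p' (?m + j)) + 1) (v ! j))"
          by (intro prod.cong refl) (simp add: nth_append)
        finally show ?thesis .
      qed
      have 3: "(\<Prod>x<?N. Z (int (g x) + 1) (?c ! \<sigma> x)) = (\<Prod>c<?m. Z (int (inv_into UNIV p' c) + 1) (?c ! \<sigma> c)) *
          (\<Prod>j<length b. Z (int (inv_into UNIV p (length u + j)) + 1) (?c ! \<sigma> (?m + j)))"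
        unfolding prod_lessThan_add by (intro arg_cong2[of _ _ _ _ "(*)"] prod.cong refl) (auto simp: g_def)
      show ?thesis unfolding F_def 1 2 3 A_def by (simp only: ac_simps)
    qed
    have gk: "g x < ?k" if "x < ?N" for x
    proof (cases "x < ?m")
      case True
      then have "g x < ?k'" using permutes_in_image[OF permutes_inv[OF p'], of x] by (simp add: g_def)
      then show ?thesis using len(1) by simp
    next
      case False
      then show ?thesis using permutes_in_image[OF permutes_inv[OF p], of "length u + (x - ?m)"] that by (simp add: g_def)
    qed
    have "\<not> inj_on g {..<?N}"
    proof
      assume "inj_on g {..<?N}"
      then have "card {..<?N} \<le> card {..<?k}" using gk by (intro card_inj_on_le[of g]) auto
      then show False using len(2) by simp
    qed
    then obtain x y where xy: "x < ?N" "y < ?N" "x \<noteq> y" "g x = g y" by (auto simp: inj_on_def)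
    let ?\<tau> = "Transposition.transpose x y"
    have \<tau>: "?\<tau> permutes {..<?N}" using xy by (intro permutes_swap_id) auto
    have gt: "g (?\<tau> z) = g z" for z using xy(4) by (simp add: Transposition.transpose_def)
    show ?thesis
    proof (rule sum_permutes_antisym[OF xy(3)])
      fix \<sigma> assume s: "\<sigma> permutes {..<?N}"
      have "(\<Prod>z<?N. Z (int (g z) + 1) (?c ! \<sigma> (?\<tau> z))) = (\<Prod>z<?N. Z (int (g (?\<tau> z)) + 1) (?c ! \<sigma> (?\<tau> z)))"
        by (simp add: gt)
      also have "\<dots> = (\<Prod>z<?N. Z (int (g z) + 1) (?c ! \<sigma> z))"
        by (rule prod.reindex_bij_betw[OF permutes_imp_bij[OF \<tau>], of "\<lambda>z. Z (int (g z) + 1) (?c ! \<sigma> z)"])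
      finally show "F p p' (\<sigma> \<circ> ?\<tau>) = F p p' \<sigma>"
        using F[OF s] F[OF permutes_compose[OF \<tau> s]] by simp
    qed (use xy in auto)
  qed
  have m: "minor Z (?T \<sigma>) * minor Z (?S \<sigma>) = (\<Sum>p | p permutes {..<?k}. \<Sum>p' | p' permutes {..<?k'}. of_int (sign p) * of_int (sign p') * F p p' \<sigma>)" for \<sigma>
  proof -
    have l: "length (?T \<sigma>) = ?k" "length (?S \<sigma>) = ?k'" by simp_all
    show ?thesis unfolding minor_def l sum_product F_def by (intro sum.cong refl) (simp only: ac_simps)
  qed
  have "(\<Sum>\<sigma> | \<sigma> permutes {..<?N}. of_int (sign \<sigma>) * (minor Z (?T \<sigma>) * minor Z (?S \<sigma>)))
      = (\<Sum>\<sigma> | \<sigma> permutes {..<?N}. \<Sum>p | p permutes {..<?k}. \<Sum>p' | p' permutes {..<?k'}. of_int (sign p) * of_int (sign p') * (of_int (sign \<sigma>) * F p p' \<sigma>))"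
    unfolding m sum_distrib_left by (intro sum.cong refl) (simp only: ac_simps)
  also have "\<dots> = (\<Sum>p | p permutes {..<?k}. \<Sum>p' | p' permutes {..<?k'}. of_int (sign p) * of_int (sign p') * (\<Sum>\<sigma> | \<sigma> permutes {..<?N}. of_int (sign \<sigma>) * F p p' \<sigma>))"
    unfolding sum_distrib_left by (rule sum_swap3)
  also have "\<dots> = 0" by (intro sum.neutral ballI) (simp add: zero)
  finally show ?thesis .
qed

lemma Xvar_pring: "set t \<subseteq> rws 1 \<Longrightarrow> 1 \<le> length t \<Longrightarrow> length t \<le> n \<Longrightarrow> Xvar t \<in> pring (all_tuples n)"
  using span_pvar_pring[OF Xvar_span] .

lemma pluecker_I_A:
  assumes len: "length a + length v \<le> length u + length b" "length u + length b < length a + length b"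
    and n: "length u + length b \<le> n" "1 \<le> length u + length b" "1 \<le> length a + length v"
    and N: "set (a @ b) \<subseteq> rws 1" "set u \<subseteq> rws 1" "set v \<subseteq> rws 1"
  shows "(\<Sum>\<sigma> | \<sigma> permutes {..<length a + length b}. of_int (sign \<sigma>) *
      (Xvar (u @ drop (length a) (permute_list \<sigma> (a @ b))) * Xvar (take (length a) (permute_list \<sigma> (a @ b)) @ v))) \<in> I_A n"
proof -
  have T: "set (u @ drop (length a) (permute_list \<sigma> (a @ b))) \<subseteq> rws 1" and S: "set (take (length a) (permute_list \<sigma> (a @ b)) @ v) \<subseteq> rws 1"
    if s: "\<sigma> permutes {..<length a + length b}" for \<sigma>
  proof -
    have "set (permute_list \<sigma> (a @ b)) = set (a @ b)" using s by (intro set_permute_list) simp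
    then show "set (u @ drop (length a) (permute_list \<sigma> (a @ b))) \<subseteq> rws 1" "set (take (length a) (permute_list \<sigma> (a @ b)) @ v) \<subseteq> rws 1"
      using N set_drop_subset[of "length a" "permute_list \<sigma> (a @ b)"] set_take_subset[of "length a" "permute_list \<sigma> (a @ b)"] by auto
  qed
  let ?R = "\<Sum>\<sigma> | \<sigma> permutes {..<length a + length b}. of_int (sign \<sigma>) *
      (Xvar (u @ drop (length a) (permute_list \<sigma> (a @ b))) * Xvar (take (length a) (permute_list \<sigma> (a @ b)) @ v))"
  have R: "?R \<in> pring (all_tuples n)"
    using T S len n by (intro pring_sum pring_mult pring_of_int Xvar_pring) auto
  have pm: "pluecker_minor = minor (\<lambda>i j. pvar (i, j))" by (simp add: fun_eq_iff pluecker_minor_eq)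
  have "psub (minor (\<lambda>i j. pvar (i, j))) ?R = (\<Sum>\<sigma> | \<sigma> permutes {..<length a + length b}. of_int (sign \<sigma>) *
      (minor (\<lambda>i j. pvar (i, j)) (u @ drop (length a) (permute_list \<sigma> (a @ b))) * minor (\<lambda>i j. pvar (i, j)) (take (length a) (permute_list \<sigma> (a @ b)) @ v)))"
    unfolding psub_sum psub_mult psub_of_int by (intro sum.cong refl) (simp only: psub_Xvar[OF T] psub_Xvar[OF S] mem_Collect_eq)
  also have "\<dots> = 0" by (rule pluecker_relation[OF len])
  finally have "psub pluecker_minor ?R = 0" unfolding pm .
  with R show ?thesis by (simp only: I_A_def psubst_eq mem_Collect_eq)
qed

end

section \<open>Spanning by standard monomials\<close>

definition lsum :: "('v \<Rightarrow> nat) \<Rightarrow> ('v \<Rightarrow>\<^sub>0 nat) \<Rightarrow> nat" where "lsum h m = (\<Sum>t\<in>ks m. lk m t * h t)"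

lemma lsum_superset: "finite V \<Longrightarrow> ks m \<subseteq> V \<Longrightarrow> lsum h m = (\<Sum>t\<in>V. lk m t * h t)"
  unfolding lsum_def by (rule sum.mono_neutral_left) (auto simp: in_keys_iff)

lemma lsum_add: "lsum h (m + m') = lsum h m + lsum h m'"
proof -
  let ?V = "ks m \<union> ks m'"
  have "ks (m + m') \<subseteq> ?V" by (rule keys_add)
  then show ?thesis by (simp add: lsum_superset[where V = ?V] lookup_add algebra_simps sum.distrib)
qed

lemma lsum_0 [simp]: "lsum h 0 = 0" by (simp add: lsum_def)

lemma lsum_single: "lsum h (sg t c) = c * h t"
  by (cases "c = 0") (auto simp: lsum_def)

lemma monomial_split: "t \<in> ks m \<Longrightarrow> \<exists>m0. m = m0 + sg t 1" for m :: "'v \<Rightarrow>\<^sub>0 nat"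
proof -
  assume t: "t \<in> ks m"
  have "m = (m - sg t 1) + sg t 1"
    by (rule poly_mapping_eqI) (use t in \<open>auto simp: lookup_add lookup_minus lookup_single when_def in_keys_iff\<close>)
  then show ?thesis by blast
qed

lemma keys_add_nat: "ks (m + m') = ks m \<union> ks (m' :: 'v \<Rightarrow>\<^sub>0 nat)"
  by (auto simp: in_keys_iff lookup_add)

lemma span_mult_left: "q \<in> pv.span B \<Longrightarrow> p * q \<in> pv.span ((*) p ` B)"
proof (induction rule: pv.span_induct_alt)
  case base then show ?case by (simp add: pv.span_zero)
next
  case (step c x y)
  have "p * (sg 0 c * x + y) = sg 0 c * (p * x) + p * y" by (simp add: algebra_simps)
  then show ?case using step by (auto intro!: pv.span_add pv.span_scale intro: pv.span_base)
qed

definition dgr :: "(int list \<Rightarrow>\<^sub>0 nat) \<Rightarrow> nat \<Rightarrow> nat" where "dgr m k = lsum (\<lambda>t. if length t = k then 1 else 0) m"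

lemma dgr_add: "dgr (m + m') k = dgr m k + dgr m' k"
  by (simp add: dgr_def lsum_add)

lemma dgr_single: "dgr (sg t c) k = (if length t = k then c else 0)"
  by (simp add: dgr_def lsum_single)

lemma homogeneous_iff: "homogeneous n \<mu> p \<longleftrightarrow> (\<forall>m\<in>ks p. \<forall>k\<in>{1..n}. dgr m k = \<mu> k)"
proof -
  have "(\<Sum>t\<in>{t \<in> ks m. length t = k}. lk m t) = dgr m k" for m k
  proof -
    have "dgr m k = (\<Sum>t\<in>ks m. if length t = k then lk m t else 0)"
      unfolding dgr_def lsum_def by (intro sum.cong) auto
    also have "\<dots> = (\<Sum>t\<in>ks m \<inter> {t. length t = k}. lk m t)" by (simp add: sum.inter_restrict)
    also have "ks m \<inter> {t. length t = k} = {t \<in> ks m. length t = k}" by auto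
    finally show ?thesis by simp
  qed
  then show ?thesis by (simp add: homogeneous_def)
qed

lemma setcompr_pair_image: "{f x y | x y. P x y} = (\<lambda>b. f (fst b) (snd b)) ` {(x, y). P x y}"
  by force

context marked_poset begin

text \<open>A permutation that keeps \<open>b\<close> as the set of the last block is a product of
  permutations \<open>s1\<close> and \<open>s2\<close> of the two blocks. Each variable absorbs the
  sign of one of them, which cancels the sign in front; all such terms coincide.\<close>

lemma good_term:
  assumes d: "distinct (a @ b)" and \<sigma>: "\<sigma> permutes {..<length a + length b}"
    and good: "set (drop (length a) (permute_list \<sigma> (a @ b))) = set b"
    and N: "set (a @ b) \<subseteq> rws 1" "set u \<subseteq> rws 1" "set v \<subseteq> rws 1"
  shows "of_int (sign \<sigma>) * (Xvar (u @ drop (length a) (permute_list \<sigma> (a @ b))) * Xvar (take (length a) (permute_list \<sigma> (a @ b)) @ v))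
    = Xvar (u @ b) * Xvar (a @ v)"
proof -
  let ?m = "length a" and ?N = "length a + length b" and ?c = "a @ b"
  let ?p = "permute_list \<sigma> ?c"
  have s': "\<sigma> permutes {..<length ?c}" using \<sigma> by simp
  have pn: "?p ! x = ?c ! \<sigma> x" if "x < ?N" for x using permute_list_nth[OF s'] that by simp
  have im: "\<sigma> x < ?N \<longleftrightarrow> x < ?N" for x using permutes_in_image[OF \<sigma>, of x] by simp
  have hi: "?m \<le> \<sigma> x \<and> \<sigma> x < ?N" if x: "?m \<le> x" "x < ?N" for x
  proof -
    have "?p ! x \<in> set (drop ?m ?p)" using x by (auto simp: in_set_conv_nth intro!: exI[of _ "x - ?m"])
    then have "?c ! \<sigma> x \<in> set b" using good pn[OF x(2)] by simp
    moreover have "?c ! \<sigma> x \<in> set a" if "\<sigma> x < ?m" using that by (simp add: nth_append)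
    ultimately show ?thesis using d im[of x] x by (meson distinct_append disjoint_iff not_le)
  qed
  have lo: "\<sigma> x < ?m" if x: "x < ?m" for x
  proof (rule ccontr)
    assume nl: "\<not> \<sigma> x < ?m"
    have inj: "inj_on \<sigma> {?m..<?N}" using permutes_inj[OF \<sigma>] by (rule inj_on_subset) simp
    have "\<sigma> ` {?m..<?N} = {?m..<?N}"
      using hi inj by (intro endo_inj_surj) auto
    moreover have "\<sigma> x \<in> {?m..<?N}" using nl im[of x] x by simp
    ultimately obtain y where y: "y \<in> {?m..<?N}" "\<sigma> x = \<sigma> y" by (metis imageE)
    have "x = y" by (rule injD[OF permutes_inj[OF \<sigma>] y(2)])
    then show False using x y(1) by simp
  qed
  define s1 where "s1 x = (if x < ?m then \<sigma> x else x)" for x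
  define s2 where "s2 x = (if x < ?m then x else \<sigma> x)" for x
  have inj: "inj \<sigma>" using permutes_inj[OF \<sigma>] .
  have p1: "s1 permutes {..<?m}"
  proof (rule bij_imp_permutes)
    have "inj_on s1 {..<?m}" using inj by (auto simp: s1_def inj_on_def)
    moreover have "s1 ` {..<?m} \<subseteq> {..<?m}" using lo by (auto simp: s1_def)
    ultimately show "bij_betw s1 {..<?m} {..<?m}" by (simp add: bij_betw_def endo_inj_surj)
  qed (auto simp: s1_def)
  have p2: "s2 permutes {?m..<?N}"
  proof (rule bij_imp_permutes)
    have "inj_on s2 {?m..<?N}" using inj by (auto simp: s2_def inj_on_def)
    moreover have "s2 ` {?m..<?N} \<subseteq> {?m..<?N}" using hi by (auto simp: s2_def)
    ultimately show "bij_betw s2 {?m..<?N} {?m..<?N}" by (simp add: bij_betw_def endo_inj_surj)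
    fix x assume "x \<notin> {?m..<?N}"
    then show "s2 x = x" using permutes_not_in[OF \<sigma>, of x] by (auto simp: s2_def)
  qed
  have "\<sigma> = s1 \<circ> s2"
  proof
    fix x show "\<sigma> x = (s1 \<circ> s2) x"
      using hi[of x] permutes_not_in[OF \<sigma>, of x] by (cases "x < ?N") (auto simp: s1_def s2_def)
  qed
  moreover have "permutation s1" "permutation s2" using p1 p2 permutation_permutes by blast+
  ultimately have sgn: "sign \<sigma> = sign s1 * sign s2" by (simp add: sign_compose)
  have A: "Xvar (take ?m ?p @ v) = of_int (sign s1) * Xvar (a @ v)"
  proof -
    have p1': "s1 permutes {..<length (a @ v)}" by (rule permutes_subset[OF p1]) auto
    have "take ?m ?p @ v = permute_list s1 (a @ v)"
    proof (rule nth_equalityI)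
      fix i assume i: "i < length (take ?m ?p @ v)"
      have r: "permute_list s1 (a @ v) ! i = (a @ v) ! s1 i" using permute_list_nth[OF p1'] i by simp
      show "(take ?m ?p @ v) ! i = permute_list s1 (a @ v) ! i"
      proof (cases "i < ?m")
        case True then show ?thesis unfolding r using lo[OF True] pn[of i] by (simp add: nth_append s1_def)
      next
        case False then show ?thesis unfolding r by (simp add: nth_append s1_def)
      qed
    qed simp
    then show ?thesis using Xvar_permute[OF _ p1'] N by simp
  qed
  define f where "f x = x - ?m + length u" for x
  have bf: "bij_betw f {?m..<?N} {length u..<length u + length b}"
    by (rule bij_betw_byWitness[where f' = "\<lambda>x. x - length u + ?m"]) (auto simp: f_def)
  define t2 where "t2 = map_permutation {?m..<?N} f s2"
  have t2: "t2 permutes {length u..<length u + length b}" unfolding t2_def by (rule map_permutation_permutes[OF bf p2])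
  have sg2: "sign t2 = sign s2" unfolding t2_def using bf p2 by (intro sign_map_permutation) (auto simp: bij_betw_def)
  have B: "Xvar (u @ drop ?m ?p) = of_int (sign s2) * Xvar (u @ b)"
  proof -
    have t2': "t2 permutes {..<length (u @ b)}" by (rule permutes_subset[OF t2]) auto
    have "u @ drop ?m ?p = permute_list t2 (u @ b)"
    proof (rule nth_equalityI)
      fix i assume i: "i < length (u @ drop ?m ?p)"
      have r: "permute_list t2 (u @ b) ! i = (u @ b) ! t2 i" using permute_list_nth[OF t2'] i by simp
      show "(u @ drop ?m ?p) ! i = permute_list t2 (u @ b) ! i"
      proof (cases "i < length u")
        case True
        then have "t2 i = i" using permutes_not_in[OF t2] by simp
        then show ?thesis unfolding r using True by (simp add: nth_append)
      next
        case False
        define j where "j = i - length u"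
        have j: "j < length b" "i = f (?m + j)" using i False by (auto simp: j_def f_def)
        have "t2 i = f (s2 (?m + j))" unfolding t2_def j(2)
          using bf j by (intro map_permutation_apply) (auto simp: bij_betw_def)
        then have t: "t2 i = \<sigma> (?m + j) - ?m + length u" by (simp add: s2_def f_def)
        have "(u @ drop ?m ?p) ! i = drop ?m ?p ! j" using False by (simp only: nth_append j_def if_False)
        also have "\<dots> = ?p ! (?m + j)" by (rule nth_drop) simp
        also have "\<dots> = ?c ! \<sigma> (?m + j)" using j(1) by (intro pn) simp
        also have "\<dots> = b ! (\<sigma> (?m + j) - ?m)" using hi[of "?m + j"] j(1) by (simp add: nth_append)
        finally show ?thesis unfolding r t by (simp add: nth_append)
      qed
    qed simp
    then show ?thesis using Xvar_permute[OF _ t2'] N sg2 by simp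
  qed
  have "of_int (sign \<sigma>) * (Xvar (u @ drop ?m ?p) * Xvar (take ?m ?p @ v))
    = (of_int (sign s1) * of_int (sign s1)) * (of_int (sign s2) * of_int (sign s2)) * (Xvar (u @ b) * Xvar (a @ v))"
    unfolding A B sgn of_int_mult by (simp only: ac_simps)
  also have "\<dots> = Xvar (u @ b) * Xvar (a @ v)" by (simp flip: of_int_mult)
  finally show ?thesis .
qed

lemma bit_weight_Un: "finite S \<Longrightarrow> finite T \<Longrightarrow> S \<inter> T = {} \<Longrightarrow> bit_weight (S \<union> T) = bit_weight S + bit_weight T"
  unfolding bit_weight_def by (rule sum.union_disjoint)

text \<open>As many elements leave \<open>B\<close> as enter it; the former weigh at least
  \<open>2 ^ Suc e\<close> each, the latter at most \<open>2 ^ e\<close>.\<close>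

lemma bit_weight_exchange:
  assumes fin: "finite A" "finite B" and A: "\<And>i. i \<in> A \<Longrightarrow> position i \<le> e" and B: "\<And>i. i \<in> B \<Longrightarrow> e < position i"
    and B': "B' \<subseteq> A \<union> B" "card B' = card B" "B' \<noteq> B"
  shows "bit_weight B' < bit_weight B"
proof -
  have fB': "finite B'" using B' fin finite_subset by blast
  have eq: "bit_weight B' = bit_weight (B' \<inter> B) + bit_weight (B' - B)" "bit_weight B = bit_weight (B' \<inter> B) + bit_weight (B - B')"
  proof -
    have "bit_weight ((B' \<inter> B) \<union> (B' - B)) = bit_weight (B' \<inter> B) + bit_weight (B' - B)" by (rule bit_weight_Un) (use fB' in auto)
    moreover have "(B' \<inter> B) \<union> (B' - B) = B'" by auto
    ultimately show "bit_weight B' = bit_weight (B' \<inter> B) + bit_weight (B' - B)" by simp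
    have "bit_weight ((B' \<inter> B) \<union> (B - B')) = bit_weight (B' \<inter> B) + bit_weight (B - B')" by (rule bit_weight_Un) (use fB' fin in auto)
    moreover have "(B' \<inter> B) \<union> (B - B') = B" by auto
    ultimately show "bit_weight B = bit_weight (B' \<inter> B) + bit_weight (B - B')" by simp
  qed
  have "card (B' - B) = card B' - card (B' \<inter> B)" by (rule card_Diff_subset_Int) (use fin in auto)
  moreover have "card (B - B') = card B - card (B \<inter> B')" by (rule card_Diff_subset_Int) (use fin in auto)
  ultimately have c: "card (B' - B) = card (B - B')" using B'(2) by (simp add: Int_commute)
  have ne: "B - B' \<noteq> {}"
  proof
    assume "B - B' = {}"
    then have "B \<subseteq> B'" by auto
    then show False using B' fB' card_subset_eq by metis
  qed
  have "bit_weight (B' - B) \<le> (\<Sum>i\<in>B' - B. 2 ^ e)" unfolding bit_weight_def using B'(1) A by (intro sum_mono power_increasing) auto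
  also have "\<dots> = card (B - B') * 2 ^ e" by (simp add: c)
  also have "\<dots> < card (B - B') * 2 ^ Suc e" using ne fin by (simp add: card_gt_0_iff)
  also have "\<dots> = (\<Sum>i\<in>B - B'. 2 ^ Suc e)" by simp
  also have "\<dots> \<le> bit_weight (B - B')" unfolding bit_weight_def using B by (intro sum_mono power_increasing) (auto simp: Suc_le_eq)
  finally show ?thesis using eq by simp
qed

text \<open>The violation at \<open>e\<close> means that the initial part \<open>A\<close> of
  \<open>S\<close> and the final part \<open>B\<close> of \<open>T\<close> together have more
  elements than \<open>T\<close>, as \<open>pluecker_relation\<close> demands. The terms that keep
  \<open>B\<close> in place add up to a nonzero multiple of the given product; every other nonzero
  term moves weight from \<open>T\<close> to \<open>S\<close>.\<close>

lemma exchange_step: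
  assumes T: "T \<in> all_tuples n" and S: "S \<in> all_tuples n" and len: "length S \<le> length T"
    and e: "card {i \<in> set T. position i \<le> e} < card {i \<in> set S. position i \<le> e}"
  shows "\<exists>Q\<in>pv.span {pvar T' * pvar S' | T' S'. T' \<in> tuples n (length T) \<and> S' \<in> tuples n (length S) \<and>
      (\<exists>d>0. bit_weight (set T') + d = bit_weight (set T) \<and> bit_weight (set S') = bit_weight (set S) + d)}. pvar T * pvar S - Q \<in> rho_kernel"
proof -
  define A where "A = {i \<in> set S. position i \<le> e}"
  define B where "B = {i \<in> set T. e < position i}"
  define a b u v where "a = srt A" and "b = srt B" and "u = srt (set T - B)" and "v = srt (set S - A)"
  let ?m = "length a" and ?N = "length a + length b"
  have TT: "set T \<subseteq> rws 1" "distinct T" "T = srt (set T)" and SS: "set S \<subseteq> rws 1" "distinct S" "S = srt (set S)"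
    and n: "1 \<le> length T" "length T \<le> n" "1 \<le> length S"
    using tuplesD T S by (auto simp: all_tuples_iff)
  have r: "A \<subseteq> rws 1" "B \<subseteq> rws 1" "set T - B \<subseteq> rws 1" "set S - A \<subseteq> rws 1" using TT(1) SS(1) by (auto simp: A_def B_def)
  have fin: "finite A" "finite B" by (simp_all add: A_def B_def)
  have sets: "set a = A" "set b = B" "set u = set T - B" "set v = set S - A"
    unfolding a_def b_def u_def v_def using r by (simp_all add: set_srt)
  have AB: "A \<inter> B = {}" by (auto simp: A_def B_def)
  have cT: "card (set T) = length T" "card (set S) = length S" using TT SS distinct_card by blast+
  have lab: "length a = card A" "length b = card B" "length u = length T - card B" "length v = length S - card A"
    unfolding a_def b_def u_def v_def using r cT by (simp_all add: length_srt card_Diff_subset fin A_def B_def)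
  have cB: "card B \<le> length T" "card A \<le> length S" using cT card_mono[of "set T" B] card_mono[of "set S" A] by (auto simp: A_def B_def)
  have "card (set T) = card {i \<in> set T. position i \<le> e} + card B"
    unfolding B_def by (subst card_Un_disjoint[symmetric]) (auto intro: arg_cong[of _ _ card])
  then have big: "length T < card A + card B" using e cT by (simp add: A_def)
  have dd1: "distinct a" "distinct b" "distinct u" "distinct v" by (simp_all add: a_def b_def u_def v_def)
  have d: "distinct (a @ b)" unfolding distinct_append sets using dd1 AB by blast
  have N: "set (a @ b) \<subseteq> rws 1" unfolding set_append sets using r by blast
  have N2: "set u \<subseteq> rws 1" "set v \<subseteq> rws 1" unfolding sets using r by blast+
  define pT where "pT \<sigma> = u @ drop ?m (permute_list \<sigma> (a @ b))" for \<sigma>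
  define pS where "pS \<sigma> = take ?m (permute_list \<sigma> (a @ b)) @ v" for \<sigma>
  define F where "F \<sigma> = of_int (sign \<sigma>) * (Xvar (pT \<sigma>) * Xvar (pS \<sigma>))" for \<sigma>
  let ?P = "{\<sigma>. \<sigma> permutes {..<?N}}"
  define G where "G = {\<sigma> \<in> ?P. set (drop ?m (permute_list \<sigma> (a @ b))) = set b}"
  have R: "(\<Sum>\<sigma>\<in>?P. F \<sigma>) \<in> I_A n"
    unfolding F_def pT_def pS_def using lab cB big n len by (intro pluecker_I_A N N2) simp_all
  have finP: "finite ?P" by (simp add: finite_permutations)
  have Gs: "F \<sigma> = Xvar (u @ b) * Xvar (a @ v)" if "\<sigma> \<in> G" for \<sigma>
    unfolding F_def pT_def pS_def using that by (intro good_term d N N2) (simp_all add: G_def)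
  \<comment> \<open>The identity keeps \<open>B\<close> in place, so the number
    \<open>card G\<close>, by which the relation is divided later, is positive.\<close>
  have idG: "id \<in> G" by (simp add: G_def permutes_id)
  have finG: "finite G" using finP by (rule finite_subset[rotated]) (auto simp: G_def)
  have g: "0 < card G" unfolding card_gt_0_iff using idG finG by blast
  let ?B = "{pvar T' * pvar S' | T' S'. T' \<in> tuples n (length T) \<and> S' \<in> tuples n (length S) \<and>
      (\<exists>d>0. bit_weight (set T') + d = bit_weight (set T) \<and> bit_weight (set S') = bit_weight (set S) + d)}"
  have bad: "F \<sigma> \<in> pv.span ?B" if s: "\<sigma> \<in> ?P - G" for \<sigma>
  proof -
    have sp: "\<sigma> permutes {..<length (a @ b)}" using s by simp
    define p where "p = permute_list \<sigma> (a @ b)"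
    define B' where "B' = set (drop ?m p)"
    define A' where "A' = set (take ?m p)"
    have pd: "distinct p" "set p = A \<union> B" "length p = ?N"
      unfolding p_def using sp d sets by simp_all
    have U: "A' \<union> B' = A \<union> B" unfolding A'_def B'_def using pd(2) by (metis append_take_drop_id set_append)
    have dj: "A' \<inter> B' = {}" unfolding A'_def B'_def using pd(1) by (metis append_take_drop_id distinct_append)
    have cB': "card B' = card B" unfolding B'_def using pd lab by (simp add: distinct_card)
    have fin': "finite A'" "finite B'" by (simp_all add: A'_def B'_def)
    have "B' \<noteq> B" using s sets by (auto simp: G_def B'_def p_def)
    then have lt: "bit_weight B' < bit_weight B" using U cB' fin by (intro bit_weight_exchange[of A B e]) (auto simp: A_def B_def)
    have "bit_weight A' + bit_weight B' = bit_weight A + bit_weight B" using bit_weight_Un[OF fin' dj] bit_weight_Un[OF fin AB] U by simp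
    have sT: "set (pT \<sigma>) = (set T - B) \<union> B'" and sS: "set (pS \<sigma>) = A' \<union> (set S - A)"
      using sets by (simp_all add: pT_def pS_def p_def[symmetric] A'_def B'_def)
    have rT: "set (pT \<sigma>) \<subseteq> rws 1" "set (pS \<sigma>) \<subseteq> rws 1" unfolding sT sS using r U by blast+
    have lT: "length (pT \<sigma>) = length T" "length (pS \<sigma>) = length S"
      using lab cB pd(3) by (simp_all add: pT_def pS_def p_def[symmetric])
    show ?thesis
    proof (cases "distinct (pT \<sigma>) \<and> distinct (pS \<sigma>)")
      case True
      let ?T' = "srt (set (pT \<sigma>))" and ?S' = "srt (set (pS \<sigma>))"
      have tup: "?T' \<in> tuples n (length T)" "?S' \<in> tuples n (length S)"
        using True rT lT by (auto intro!: srt_tuples simp: distinct_card)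
      have dT: "(set T - B) \<inter> B' = {}" using True sets by (auto simp: pT_def B'_def p_def)
      have dS: "A' \<inter> (set S - A) = {}" using True sets by (auto simp: pS_def A'_def p_def)
      have e1: "bit_weight (set (pT \<sigma>)) = bit_weight (set T - B) + bit_weight B'" unfolding sT using dT fin' by (intro bit_weight_Un) auto
      have e2: "bit_weight (set (pS \<sigma>)) = bit_weight A' + bit_weight (set S - A)" unfolding sS using dS fin' by (intro bit_weight_Un) auto
      have "set T = (set T - B) \<union> B" by (auto simp: B_def)
      then have e3: "bit_weight (set T) = bit_weight (set T - B) + bit_weight B" using bit_weight_Un[of "set T - B" B] fin by auto
      have "set S = A \<union> (set S - A)" by (auto simp: A_def)
      then have e4: "bit_weight (set S) = bit_weight A + bit_weight (set S - A)" using bit_weight_Un[of A "set S - A"] fin by auto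
      have "pvar ?T' * pvar ?S' \<in> ?B"
        using tup rT e1 e2 e3 e4 lt \<open>bit_weight A' + bit_weight B' = bit_weight A + bit_weight B\<close>
        by (intro CollectI exI[of _ ?T'] exI[of _ ?S'] conjI exI[of _ "bit_weight B - bit_weight B'"]) (simp_all add: set_srt)
      then have sp1: "pvar ?T' * pvar ?S' \<in> pv.span ?B" by (rule pv.span_base)
      have "Xvar (pT \<sigma>) = 0 \<or> Xvar (pT \<sigma>) = pvar ?T' \<or> Xvar (pT \<sigma>) = - pvar ?T'"
        "Xvar (pS \<sigma>) = 0 \<or> Xvar (pS \<sigma>) = pvar ?S' \<or> Xvar (pS \<sigma>) = - pvar ?S'"
        using Xvar_cases[OF rT(1)] Xvar_cases[OF rT(2)] by blast+
      then have "Xvar (pT \<sigma>) * Xvar (pS \<sigma>) \<in> pv.span ?B"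
        using sp1 pv.span_zero pv.span_neg[OF sp1] by (elim disjE) simp_all
      then have "sg 0 (of_int (sign \<sigma>)) * (Xvar (pT \<sigma>) * Xvar (pS \<sigma>)) \<in> pv.span ?B" by (rule pv.span_scale)
      then show ?thesis by (simp add: F_def)
    next
      case False
      then have "F \<sigma> = 0" using Xvar_not_distinct by (auto simp: F_def)
      then show ?thesis by (simp add: pv.span_zero)
    qed
  qed
  define Q where "Q = (\<Sum>\<sigma>\<in>?P - G. F \<sigma>)"
  have Q: "Q \<in> pv.span ?B" unfolding Q_def by (rule pv.span_sum) (rule bad)
  have "(\<Sum>\<sigma>\<in>?P. F \<sigma>) = (\<Sum>\<sigma>\<in>G. F \<sigma>) + Q"
    unfolding Q_def using finP by (subst sum.subset_diff[of G ?P]) (auto simp: G_def add.commute)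
  also have "(\<Sum>\<sigma>\<in>G. F \<sigma>) = of_nat (card G) * (Xvar (u @ b) * Xvar (a @ v))" using Gs by simp
  finally have K1: "of_nat (card G) * (Xvar (u @ b) * Xvar (a @ v)) + Q \<in> rho_kernel" using rho_kernel_I_A[OF R] by simp
  have ub: "set (u @ b) = set T" "set (a @ v) = set S" unfolding set_append sets by (auto simp: A_def B_def)
  have "distinct (u @ b)" "distinct (a @ v)" unfolding distinct_append sets using dd1 by blast+
  then have "(Xvar (u @ b) = pvar T \<or> Xvar (u @ b) = - pvar T) \<and> (Xvar (a @ v) = pvar S \<or> Xvar (a @ v) = - pvar S)"
  proof -
    have X: "Xvar t = pvar (srt (set t)) \<or> Xvar t = - pvar (srt (set t))" if t: "distinct t" "set t \<subseteq> rws 1" for t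
    proof -
      obtain \<sigma> where \<sigma>: "\<sigma> permutes {..<length t}" "permute_list \<sigma> t = srt (set t)" using sort_perm_ex t by blast
      show ?thesis using Xvar_sort[OF t \<sigma>] by (cases \<sigma> rule: sign_cases) auto
    qed
    assume ds: "distinct (u @ b)" "distinct (a @ v)"
    have "set (u @ b) \<subseteq> rws 1" "set (a @ v) \<subseteq> rws 1" unfolding ub using TT(1) SS(1) by blast+
    from X[OF ds(1) this(1)] X[OF ds(2) this(2)] show ?thesis unfolding ub TT(3)[symmetric] SS(3)[symmetric] by blast
  qed
  then have pm: "Xvar (u @ b) * Xvar (a @ v) = pvar T * pvar S \<or> Xvar (u @ b) * Xvar (a @ v) = - (pvar T * pvar S)" by auto
  let ?g = "complex_of_nat (card G)"
  have gi: "sg 0 (inverse ?g) * (of_nat (card G) * X) = (X :: int list cpoly)" for X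
  proof -
    have "sg 0 (inverse ?g) * (of_nat (card G) * X) = (sg 0 (inverse ?g) * sg 0 ?g) * X" by (simp add: mult.assoc)
    also have "sg (0 :: int list \<Rightarrow>\<^sub>0 nat) (inverse ?g) * sg 0 ?g = 1" unfolding mult_single using g by simp
    finally show ?thesis by simp
  qed
  have K2: "Xvar (u @ b) * Xvar (a @ v) + sg 0 (inverse ?g) * Q \<in> rho_kernel"
    using pv.subspace_scale[OF rho_kernel_subspace K1, of "inverse ?g"] by (simp add: distrib_left gi)
  have Q2: "sg 0 (inverse ?g) * Q \<in> pv.span ?B" by (rule pv.span_scale[OF Q])
  from pm show ?thesis
  proof
    assume "Xvar (u @ b) * Xvar (a @ v) = pvar T * pvar S"
    then show ?thesis using K2 pv.span_neg[OF Q2] by (intro bexI[of _ "- (sg 0 (inverse ?g) * Q)"]) auto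
  next
    assume x: "Xvar (u @ b) * Xvar (a @ v) = - (pvar T * pvar S)"
    have "pvar T * pvar S - sg 0 (inverse ?g) * Q \<in> rho_kernel" using pv.subspace_neg[OF rho_kernel_subspace K2] x by simp
    then show ?thesis using Q2 by blast
  qed
qed

text \<open>Tuples are padded to length \<open>n\<close> by entries heavier than everything else, so that a Pluecker
  exchange always moves weight to the heavier factor and increases the sum of the squares.\<close>

definition padded_weight :: "int list \<Rightarrow> nat" where "padded_weight t = bit_weight (set t) + (bit_weight (rws 1) + 1) * (n - length t)"

definition mu :: "(int list \<Rightarrow>\<^sub>0 nat) \<Rightarrow> nat" where "mu = lsum (\<lambda>t. padded_weight t ^ 2)"

definition count_upto :: "int list \<Rightarrow> nat \<Rightarrow> nat" where "count_upto t e = card {i \<in> set t. position i \<le> e}"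

text \<open>The columnwise order of tableaux in counting form: \<open>s\<close> is at least as long
  as \<open>t\<close> and, sorted by \<open>position\<close>, its entries are place by place no
  later than those of \<open>t\<close>.\<close>

definition tuple_le :: "int list \<Rightarrow> int list \<Rightarrow> bool" where "tuple_le s t \<longleftrightarrow> length t \<le> length s \<and> (\<forall>e. count_upto t e \<le> count_upto s e)"

definition std_mon :: "(int list \<Rightarrow>\<^sub>0 nat) \<Rightarrow> bool"
  where "std_mon m \<longleftrightarrow> ks m \<subseteq> Theta n \<and> (\<forall>s\<in>ks m. \<forall>t\<in>ks m. tuple_le s t \<or> tuple_le t s)"

lemma sq_exchange: "d > 0 \<Longrightarrow> x + d \<le> y \<Longrightarrow> (x + d)\<^sup>2 + y\<^sup>2 < x\<^sup>2 + (y + d)\<^sup>2" for x y d :: nat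
proof -
  assume d: "d > 0" "x + d \<le> y"
  have "d * x < d * y" using d by simp
  then have "d * x + d * x < d * y + d * y" by (rule add_strict_mono) fact
  moreover have "(x + d)\<^sup>2 + y\<^sup>2 = (d * x + d * x) + (x\<^sup>2 + y\<^sup>2 + d\<^sup>2)" "x\<^sup>2 + (y + d)\<^sup>2 = (d * y + d * y) + (x\<^sup>2 + y\<^sup>2 + d\<^sup>2)"
    by (simp_all add: power2_eq_square algebra_simps)
  ultimately show ?thesis by (simp only: add_less_cancel_right)
qed

lemma tuple_padded_weight: "t' \<in> tuples n (length t) \<Longrightarrow> padded_weight t' + bit_weight (set t) = padded_weight t + bit_weight (set t')"
  by (simp add: padded_weight_def tuples_def)

lemma lsum_le: "(\<And>t. t \<in> ks m \<Longrightarrow> h t \<le> B) \<Longrightarrow> lsum h m \<le> B * lsum (\<lambda>_. 1) m"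
  unfolding lsum_def sum_distrib_left by (intro sum_mono) (simp add: mult.commute)

lemma lsum_dgr: "ks m \<subseteq> all_tuples n \<Longrightarrow> lsum (\<lambda>_. 1) m = (\<Sum>k\<in>{1..n}. dgr m k)"
proof -
  assume m: "ks m \<subseteq> all_tuples n"
  have "(\<Sum>k\<in>{1..n}. dgr m k) = (\<Sum>t\<in>ks m. \<Sum>k\<in>{1..n}. if k = length t then lk m t else 0)"
    unfolding dgr_def lsum_def by (subst sum.swap) (auto intro!: sum.cong)
  also have "\<dots> = (\<Sum>t\<in>ks m. lk m t)"
  proof (intro sum.cong refl)
    fix t assume "t \<in> ks m"
    then have "length t \<in> {1..n}" using m all_tuples_iff by auto
    then show "(\<Sum>k\<in>{1..n}. if k = length t then lk m t else 0) = lk m t" by simp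
  qed
  finally show ?thesis by (simp add: lsum_def)
qed

lemma tuples_all: "1 \<le> k \<Longrightarrow> k \<le> n \<Longrightarrow> t \<in> tuples n k \<Longrightarrow> t \<in> all_tuples n"
  by (auto simp: all_tuples_def)

lemma rho_kernel_span_step:
  assumes "sg m (1::complex) = p * sg m0 1" "p - Q \<in> rho_kernel" "Q \<in> pv.span (f ` B)" "ks m0 \<subseteq> all_tuples n"
    and "\<And>b. b \<in> B \<Longrightarrow> f b * sg m0 1 = sg (g b) 1"
    and "\<And>b. b \<in> B \<Longrightarrow> \<exists>R\<in>pv.span W. sg (g b) 1 - R \<in> rho_kernel"
  shows "\<exists>R\<in>pv.span W. sg m 1 - R \<in> rho_kernel"
proof -
  have "sg m0 1 * (p - Q) \<in> rho_kernel" by (intro rho_kernel_mult assms pring_single)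
  moreover have "sg m0 1 * (p - Q) = sg m 1 - sg m0 1 * Q" by (simp add: assms(1) algebra_simps)
  ultimately have K: "sg m 1 - sg m0 1 * Q \<in> rho_kernel" by simp
  have im: "(*) (sg m0 1) ` f ` B = (\<lambda>b. sg (g b) 1) ` B"
    unfolding image_image using assms(5) by (intro image_cong refl) (simp add: mult.commute)
  have "sg m0 1 * Q \<in> pv.span ((\<lambda>b. sg (g b) 1) ` B)" using span_mult_left[OF assms(3), of "sg m0 1"] unfolding im .
  from span_replace[OF rho_kernel_subspace _ this] obtain R where R: "R \<in> pv.span W" "sg m0 1 * Q - R \<in> rho_kernel" using assms(6) by blast
  have "(sg m 1 - sg m0 1 * Q) + (sg m0 1 * Q - R) \<in> rho_kernel" by (rule rho_kernel_add[OF K R(2)])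
  then show ?thesis using R(1) by (intro bexI[of _ R]) auto
qed

text \<open>Induction on the distance of \<open>mu\<close> from a bound that depends on the degree
  only. A non-admissible factor is replaced by heavier ones, an incomparable pair by pairs with a
  larger sum of squares; both raise \<open>mu\<close> and keep the degree.\<close>

lemma standard_spanning:
  assumes "ks m \<subseteq> all_tuples n"
  shows "\<exists>R\<in>pv.span ((\<lambda>m'. sg m' 1) ` {m'. std_mon m' \<and> dgr m' = dgr m}). sg m 1 - R \<in> rho_kernel"
  using assms
proof (induction "(padded_weight [] + bit_weight (rws 1))\<^sup>2 * (\<Sum>k\<in>{1..n}. dgr m k) - mu m" arbitrary: m rule: less_induct)
  case (less m)
  let ?W = "(\<lambda>m'. sg m' (1::complex)) ` {m'. std_mon m' \<and> dgr m' = dgr m}"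
  have bound: "mu m' \<le> (padded_weight [] + bit_weight (rws 1))\<^sup>2 * (\<Sum>k\<in>{1..n}. dgr m' k)" if m': "ks m' \<subseteq> all_tuples n" for m'
  proof -
    have "padded_weight t \<le> padded_weight [] + bit_weight (rws 1)" if "t \<in> ks m'" for t
    proof -
      have "bit_weight (set t) \<le> bit_weight (rws 1)" using that m' all_tuples_iff[of t] tuplesD[of t "length t"] by (intro bit_weight_bound) auto
      moreover have "(bit_weight (rws 1) + 1) * (n - length t) \<le> (bit_weight (rws 1) + 1) * n" by (intro mult_left_mono) auto
      ultimately show ?thesis by (simp add: padded_weight_def)
    qed
    then show ?thesis unfolding mu_def lsum_dgr[OF m', symmetric] by (intro lsum_le power_mono) auto
  qed
  have rec: "\<exists>R\<in>pv.span ?W. sg m' 1 - R \<in> rho_kernel" if m': "ks m' \<subseteq> all_tuples n" "dgr m' = dgr m" "mu m < mu m'" for m'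
    using less.hyps[of m'] bound[OF m'(1)] m' by simp
  show ?case
  proof (cases "std_mon m")
    case True
    then show ?thesis using pv.subspace_0[OF rho_kernel_subspace] by (intro bexI[of _ "sg m 1"] pv.span_base) auto
  next
    case False
    then consider (nonadm) T where "T \<in> ks m" "T \<in> Theta' n"
      | (incomp) T S where "T \<in> ks m" "S \<in> ks m" "\<not> tuple_le S T" "\<not> tuple_le T S"
      using less.prems Theta_cases unfolding std_mon_def by blast
    then show ?thesis
    proof cases
      case nonadm
      obtain m0 where m0: "m = m0 + sg T 1" using monomial_split[OF nonadm(1)] by blast
      let ?B = "{t' \<in> tuples n (length T). bit_weight (set T) < bit_weight (set t')}"
      obtain Q where Q: "Q \<in> pv.span (pvar ` ?B)" "pvar T - Q \<in> L_space n" using straighten_step[OF nonadm(2)] by blast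
      have T: "1 \<le> length T" "length T \<le> n" using nonadm(2) Theta'_all all_tuples_iff by blast+
      have k0: "ks m0 \<subseteq> all_tuples n" using less.prems by (auto simp: m0 keys_add_nat)
      show ?thesis
      proof (rule rho_kernel_span_step[where m = m and p = "pvar T" and Q = Q and f = pvar and ?m0.0 = m0 and B = ?B and W = ?W
            and g = "\<lambda>t'. m0 + sg t' 1", OF _ rho_kernel_L[OF Q(2)] Q(1) k0])
        show "sg m 1 = pvar T * sg m0 1" by (simp add: m0 pvar_def mult_single add.commute)
        show "pvar b * sg m0 1 = sg (m0 + sg b 1) 1" for b by (simp add: pvar_def mult_single add.commute)
        fix b assume b: "b \<in> ?B"
        then have lb: "length b = length T" by (auto simp: tuples_def)
        have "padded_weight T < padded_weight b" using tuple_padded_weight[of b T] b by auto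
        then have "padded_weight T ^ 2 < padded_weight b ^ 2" by (intro power_strict_mono) auto
        then have "mu m < mu (m0 + sg b 1)" by (simp add: m0 mu_def lsum_add lsum_single)
        moreover have "ks (m0 + sg b 1) \<subseteq> all_tuples n" using k0 b tuples_all[OF T] by (auto simp: keys_add_nat)
        moreover have "dgr (m0 + sg b 1) = dgr m" by (simp add: fun_eq_iff m0 dgr_add dgr_single lb)
        ultimately show "\<exists>R\<in>pv.span ?W. sg (m0 + sg b 1) 1 - R \<in> rho_kernel" by (intro rec)
      qed
    next
      case incomp
      \<comment> \<open>The names are assigned so that \<open>S\<close> is the factor of larger
        padded weight, to which the exchange moves further weight.\<close>
      obtain T S where TS: "T \<in> ks m" "S \<in> ks m" "\<not> tuple_le S T" "\<not> tuple_le T S" "padded_weight T \<le> padded_weight S"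
        using incomp by (metis nle_le)
      have all: "T \<in> all_tuples n" "S \<in> all_tuples n" using TS less.prems by auto
      have l: "1 \<le> length T" "length T \<le> n" "1 \<le> length S" "length S \<le> n" using all all_tuples_iff by blast+
      \<comment> \<open>One missing subscript counts for more than any whole set, so the factor of
        larger padded weight cannot be the longer one.\<close>
      have len: "length S \<le> length T"
      proof (rule ccontr)
        assume "\<not> length S \<le> length T"
        then have "n - length S + 1 \<le> n - length T" using l by simp
        then have "(bit_weight (rws 1) + 1) * (n - length S + 1) \<le> (bit_weight (rws 1) + 1) * (n - length T)" by (rule mult_left_mono) simp
        moreover have "bit_weight (set S) \<le> bit_weight (rws 1)" using all all_tuples_iff[of S] tuplesD[of S "length S"] by (intro bit_weight_bound) auto
        ultimately show False using TS(5) by (simp add: padded_weight_def)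
      qed
      obtain e where e: "card {i \<in> set T. position i \<le> e} < card {i \<in> set S. position i \<le> e}"
        using TS(4) len by (auto simp: tuple_le_def count_upto_def not_le)
      have "T \<noteq> S" using TS(3) by (auto simp: tuple_le_def)
      obtain m1 where m1: "m = m1 + sg T 1" using monomial_split[OF TS(1)] by blast
      have S1: "S \<in> ks m1" using TS(2) \<open>T \<noteq> S\<close> by (auto simp: m1 keys_add_nat)
      obtain m0 where m0: "m1 = m0 + sg S 1" using monomial_split[OF S1] by blast
      let ?B = "{(T', S'). T' \<in> tuples n (length T) \<and> S' \<in> tuples n (length S) \<and>
        (\<exists>d>0. bit_weight (set T') + d = bit_weight (set T) \<and> bit_weight (set S') = bit_weight (set S) + d)}"
      have im: "{pvar T' * pvar S' | T' S'. T' \<in> tuples n (length T) \<and> S' \<in> tuples n (length S) \<and>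
        (\<exists>d>0. bit_weight (set T') + d = bit_weight (set T) \<and> bit_weight (set S') = bit_weight (set S) + d)} = (\<lambda>b. pvar (fst b) * pvar (snd b)) ` ?B"
        by (rule setcompr_pair_image)
      obtain Q where Q: "Q \<in> pv.span ((\<lambda>b. pvar (fst b) * pvar (snd b)) ` ?B)" "pvar T * pvar S - Q \<in> rho_kernel"
        using exchange_step[OF all len e] unfolding im by (rule bexE)
      have k0: "ks m0 \<subseteq> all_tuples n" using less.prems by (auto simp: m0 m1 keys_add_nat)
      show ?thesis
      proof (rule rho_kernel_span_step[where m = m and p = "pvar T * pvar S" and Q = Q and f = "\<lambda>b. pvar (fst b) * pvar (snd b)"
            and ?m0.0 = m0 and B = ?B and W = ?W and g = "\<lambda>b. m0 + sg (snd b) 1 + sg (fst b) 1", OF _ Q(2,1) k0])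
        show "sg m 1 = pvar T * pvar S * sg m0 1" by (simp add: m0 m1 pvar_def mult_single ac_simps)
        show "pvar (fst b) * pvar (snd b) * sg m0 1 = sg (m0 + sg (snd b) 1 + sg (fst b) 1) 1" for b
          by (simp add: pvar_def mult_single ac_simps)
        fix b assume "b \<in> ?B"
        then obtain T' S' d where b: "b = (T', S')" "T' \<in> tuples n (length T)" "S' \<in> tuples n (length S)"
          "d > 0" "bit_weight (set T') + d = bit_weight (set T)" "bit_weight (set S') = bit_weight (set S) + d" by auto
        have lb: "length T' = length T" "length S' = length S" using b by (auto simp: tuples_def)
        have "padded_weight T = padded_weight T' + d" "padded_weight S' = padded_weight S + d" using tuple_padded_weight[OF b(2)] tuple_padded_weight[OF b(3)] b by simp_all
        then have "padded_weight T ^ 2 + padded_weight S ^ 2 < padded_weight T' ^ 2 + padded_weight S' ^ 2" using sq_exchange[OF b(4), of "padded_weight T'" "padded_weight S"] TS(5) by simp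
        then have "mu m < mu (m0 + sg S' 1 + sg T' 1)" by (simp add: m0 m1 mu_def lsum_add lsum_single)
        moreover have "ks (m0 + sg S' 1 + sg T' 1) \<subseteq> all_tuples n"
          using k0 b(2,3) tuples_all[OF l(1,2)] tuples_all[OF l(3,4)] by (auto simp: keys_add_nat)
        moreover have "dgr (m0 + sg S' 1 + sg T' 1) = dgr m" by (simp add: fun_eq_iff m0 m1 dgr_add dgr_single lb)
        ultimately show "\<exists>R\<in>pv.span ?W. sg (m0 + sg (snd b) 1 + sg (fst b) 1) 1 - R \<in> rho_kernel" using rec[of "m0 + sg S' 1 + sg T' 1"] b(1) by simp
      qed
    qed
  qed
qed

section \<open>Monomials supported on chains of order ideals\<close>

definition chn_mon :: "(int list \<Rightarrow>\<^sub>0 nat) \<Rightarrow> bool"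
  where "chn_mon m \<longleftrightarrow> ks m \<subseteq> Theta n \<and> (\<forall>s\<in>ks m. \<forall>t\<in>ks m. ideal_of s \<subseteq> ideal_of t \<or> ideal_of t \<subseteq> ideal_of s)"

text \<open>The exponent of a monomial before \<open>xi\<close> is applied; these sums reappear as
  points of the polytope.\<close>

definition ideal_sum :: "(int list \<Rightarrow>\<^sub>0 nat) \<Rightarrow> (int \<times> int \<Rightarrow>\<^sub>0 int)"
  where "ideal_sum m = (\<Sum>t\<in>ks m. frag_cmul (int (lk m t)) (ind (M_set \<O> (ideal_of t))))"

lemma expo_eq: "ks m \<subseteq> Theta n \<Longrightarrow> expo n \<O> m = (\<Sum>t\<in>ks m. frag_cmul (int (lk m t)) (ex1 t))"
  unfolding expo_def ex1_def using J_of_eq by (intro sum.cong refl) auto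

lemma expo_ideal_sum: "ks m \<subseteq> Theta n \<Longrightarrow> expo n \<O> m = xi n \<O> (ideal_sum m)"
  by (simp add: expo_eq ideal_sum_def xi_sum xi_cmul ex1_def)

lemma lookup_ind: "finite M \<Longrightarrow> lk (ind M) p = (if p \<in> M then 1 else 0)"
  by (auto simp: ind_def lookup_sum lookup_single when_def sum.delta cong: if_cong)

lemma M_set_ideal_of: "t \<in> Theta n \<Longrightarrow> M_set \<O> (ideal_of t) \<subseteq> poset n" "t \<in> Theta n \<Longrightarrow> finite (M_set \<O> (ideal_of t))"
  "t \<in> Theta n \<Longrightarrow> ideal_of t \<in> ideals n"
proof -
  assume "t \<in> Theta n"
  then show i: "ideal_of t \<in> ideals n" using ideal_of ideals_k_diag by blast
  show s: "M_set \<O> (ideal_of t) \<subseteq> poset n" using M_set_subset[OF i] ideal_poset[OF i] by (rule order_trans)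
  show "finite (M_set \<O> (ideal_of t))" by (rule finite_subset[OF s]) simp
qed

lemma lookup_ideal_sum: "ks m \<subseteq> Theta n \<Longrightarrow> lk (ideal_sum m) p = int (lsum (\<lambda>t. if p \<in> M_set \<O> (ideal_of t) then 1 else 0) m)"
  unfolding ideal_sum_def lsum_def lookup_sum of_nat_sum
  by (intro sum.cong refl) (auto simp: lookup_ind M_set_ideal_of)

lemma ideal_sum_vecs: "ks m \<subseteq> Theta n \<Longrightarrow> ideal_sum m \<in> vecs n"
proof -
  assume m: "ks m \<subseteq> Theta n"
  have "lk (ideal_sum m) p = 0" if "p \<notin> poset n" for p
  proof -
    have "p \<notin> M_set \<O> (ideal_of t)" if "t \<in> ks m" for t using M_set_ideal_of(1)[of t] m that \<open>p \<notin> poset n\<close> by blast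
    then show ?thesis by (simp add: lookup_ideal_sum[OF m] lsum_def)
  qed
  then show ?thesis by (auto simp: vecs_def in_keys_iff)
qed

text \<open>With multiplicity, \<open>ff\<close> counts the ideals that contain \<open>p\<close> and
  \<open>gg\<close> those with an element strictly above \<open>p\<close>. For a chain,
  \<open>ff\<close> determines the ideals; the aim is to recover it from
  \<open>ideal_sum\<close>.\<close>

definition ff :: "(int list \<Rightarrow>\<^sub>0 nat) \<Rightarrow> int \<times> int \<Rightarrow> nat" where "ff m p = lsum (\<lambda>t. if p \<in> ideal_of t then 1 else 0) m"
definition gg :: "(int list \<Rightarrow>\<^sub>0 nat) \<Rightarrow> int \<times> int \<Rightarrow> nat" where "gg m p = lsum (\<lambda>t. if \<exists>q\<in>ideal_of t. p \<prec>\<^sub>P q then 1 else 0) m"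

lemma lsum_mono: "(\<And>t. t \<in> ks m \<Longrightarrow> h t \<le> h' t) \<Longrightarrow> lsum h m \<le> lsum h' m"
  unfolding lsum_def by (intro sum_mono mult_left_mono) auto

lemma lsum_cong: "(\<And>t. t \<in> ks m \<Longrightarrow> h t = h' t) \<Longrightarrow> lsum h m = lsum h' m"
  unfolding lsum_def by (intro sum.cong) auto

text \<open>Let \<open>q\<close> be an element strictly above \<open>p\<close> in the smallest ideal
  of the chain that has one. Every other ideal with such an element contains this ideal, hence
  \<open>q\<close>.\<close>

lemma gg_ff:
  assumes "chn_mon m"
  shows "gg m p = 0 \<or> (\<exists>q\<in>poset n. p \<prec>\<^sub>P q \<and> gg m p = ff m q)"
proof (cases "\<exists>t\<in>ks m. \<exists>q\<in>ideal_of t. p \<prec>\<^sub>P q")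
  case True
  let ?K = "{t \<in> ks m. \<exists>q\<in>ideal_of t. p \<prec>\<^sub>P q}"
  have fin: "finite (ideal_of ` ?K)" by simp
  have ne: "ideal_of ` ?K \<noteq> {}" using True by auto
  obtain J where J: "J \<in> ideal_of ` ?K" "\<forall>b\<in>ideal_of ` ?K. b \<subseteq> J \<longrightarrow> J = b"
    using finite_has_minimal[OF fin ne] by (rule bexE)
  obtain t where t: "t \<in> ?K" "J = ideal_of t" using J(1) by (rule imageE) simp
  have "\<exists>q\<in>ideal_of t. p \<prec>\<^sub>P q" using t(1) by simp
  then obtain q where q: "q \<in> ideal_of t" "p \<prec>\<^sub>P q" by (rule bexE)
  have tT: "t \<in> Theta n" using t assms by (auto simp: chn_mon_def)
  have "(\<exists>q\<in>ideal_of s. p \<prec>\<^sub>P q) \<longleftrightarrow> q \<in> ideal_of s" if s: "s \<in> ks m" for s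
  proof
    assume ex: "\<exists>q\<in>ideal_of s. p \<prec>\<^sub>P q"
    then have sK: "ideal_of s \<in> ideal_of ` ?K" using s by blast
    have "ideal_of s \<subseteq> ideal_of t \<or> ideal_of t \<subseteq> ideal_of s" using assms s t by (auto simp: chn_mon_def)
    then show "q \<in> ideal_of s"
    proof
      assume "ideal_of s \<subseteq> ideal_of t"
      then have "ideal_of t = ideal_of s" using bspec[OF J(2) sK] t(2) by simp
      then show ?thesis using q by simp
    qed (use q in blast)
  qed (use q in blast)
  then have "gg m p = ff m q" unfolding gg_def ff_def by (intro lsum_cong) simp
  moreover have "q \<in> poset n" using q ideal_poset[OF M_set_ideal_of(3)[OF tT]] by blast
  ultimately show ?thesis using q by blast
next
  case False
  then have "gg m p = 0" by (simp add: gg_def lsum_def)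
  then show ?thesis by simp
qed

lemma ff_le_gg: "p \<prec>\<^sub>P q \<Longrightarrow> ff m q \<le> gg m p"
  unfolding ff_def gg_def by (intro lsum_mono) auto

text \<open>An element of an ideal is either maximal in it or strictly below another element, and
  outside \<open>\<O>\<close> only the maximal ones belong to \<open>M_set\<close>.\<close>

lemma ff_split:
  assumes m: "ks m \<subseteq> Theta n" and p: "p \<in> poset n" "p \<notin> \<O>"
  shows "int (ff m p) = lk (ideal_sum m) p + int (gg m p)"
proof -
  have "(if p \<in> ideal_of t then 1 else 0) = (if p \<in> M_set \<O> (ideal_of t) then 1 else 0) + (if \<exists>q\<in>ideal_of t. p \<prec>\<^sub>P q then 1 else (0::nat))"
    if "t \<in> ks m" for t
  proof -
    have J: "ideal_of t \<in> ideals n" using m that M_set_ideal_of by blast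
    have "p \<in> ideal_of t" if "\<exists>q\<in>ideal_of t. p \<prec>\<^sub>P q" using that J p by (auto simp: ideals_def pprec_def)
    then show ?thesis using p(2) by (auto simp: M_set_def max_elems_def)
  qed
  then have "ff m p = lsum (\<lambda>t. (if p \<in> M_set \<O> (ideal_of t) then 1 else 0) + (if \<exists>q\<in>ideal_of t. p \<prec>\<^sub>P q then 1 else 0)) m"
    unfolding ff_def by (intro lsum_cong)
  also have "\<dots> = lsum (\<lambda>t. if p \<in> M_set \<O> (ideal_of t) then 1 else 0) m + gg m p"
    by (simp add: gg_def lsum_def sum.distrib distrib_left)
  finally show ?thesis using lookup_ideal_sum[OF m] by simp
qed

text \<open>Downward induction on the poset. On \<open>\<O>\<close> the value is a coordinate of
  \<open>ideal_sum\<close>. Elsewhere \<open>gg\<close> has to be added, and by \<open>gg_ff\<close>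
  and \<open>ff_le_gg\<close> it is the maximum of 0 and the values of \<open>ff\<close> strictly
  above. The same recursion defines \<open>tf\<close> for points of the polytope.\<close>

lemma ff_determined:
  assumes m: "chn_mon m" "chn_mon m'" and eq: "ideal_sum m = ideal_sum m'" and p: "p \<in> poset n"
  shows "ff m p = ff m' p"
  using p
\<comment> \<open>The coordinate sum is at most \<open>3 * n\<close>, so the natural number used as
  measure does not get truncated at 0.\<close>
proof (induction "nat (4 * int n - (fst p + ky (snd p)))" arbitrary: p rule: less_induct)
  case less
  have k: "ks m \<subseteq> Theta n" "ks m' \<subseteq> Theta n" using m by (auto simp: chn_mon_def)
  show ?case
  proof (cases "p \<in> \<O>")
    case True
    have "int (ff a p) = lk (ideal_sum a) p" if "ks a \<subseteq> Theta n" for a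
      unfolding lookup_ideal_sum[OF that] ff_def using True by (intro arg_cong[of _ _ int] lsum_cong) (auto simp: M_set_def max_elems_def)
    from this[OF k(1)] this[OF k(2)] eq show ?thesis by simp
  next
    case False
    have IH: "ff m q = ff m' q" if q: "q \<in> poset n" "p \<prec>\<^sub>P q" for q
    proof -
      obtain a b c d where ab: "p = (a, b)" "q = (c, d)" by (cases p, cases q) auto
      have P: "(a, b) \<in> poset n" "(c, d) \<in> poset n" using less.prems q ab by auto
      have le: "a \<le> c" "ky b \<le> ky d" "(a, b) \<noteq> (c, d)" using pprec_ky[OF P] q ab by auto
      have bd: "c \<le> int n" "ky d \<le> 2 * int n" using P ky_bounds[of d] row_mono[of 1 c] by (auto simp: poset_iff)
      have "a + ky b < c + ky d"
      proof (rule ccontr)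
        assume "\<not> a + ky b < c + ky d"
        then have "a = c" "ky b = ky d" using le by auto
        then show False using le(3) P ky_inj_row[of a b d] by (auto simp: poset_iff)
      qed
      then show ?thesis using bd ab n1 by (intro less.hyps q(1)) auto
    qed
    have "gg x p \<le> gg y p" if x: "chn_mon x" and xy: "\<And>q. q \<in> poset n \<Longrightarrow> p \<prec>\<^sub>P q \<Longrightarrow> ff x q = ff y q" for x y
      using gg_ff[OF x, of p] xy ff_le_gg[of p _ y] by fastforce
    then have "gg m p = gg m' p" using IH m by (metis order_antisym)
    then show ?thesis using ff_split[OF k(1) less.prems False] ff_split[OF k(2) less.prems False] eq by simp
  qed
qed

lemma ideal_of_inj: "s \<in> Theta n \<Longrightarrow> t \<in> Theta n \<Longrightarrow> ideal_of s = ideal_of t \<Longrightarrow> s = t"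
proof -
  assume *: "s \<in> Theta n" "t \<in> Theta n" "ideal_of s = ideal_of t"
  then have "length s = length t" using ideal_of(1)[OF *(1)] ideal_of(1)[OF *(2)] by (simp add: ideals_k_def)
  then have "set s = set t" using ideal_of(2)[OF *(1)] ideal_of(2)[OF *(2)] *(3) by simp
  then show ?thesis using ThetaD[OF *(1)] ThetaD[OF *(2)] tuplesD by metis
qed

lemma ideal_of_bottom: "t \<in> Theta n \<Longrightarrow> (1, 1) \<in> ideal_of t"
  using ideals_k_diag(1)[OF ideal_of(1)] ThetaD by fastforce

lemma chn_max:
  assumes "chn_mon m" "m \<noteq> 0"
  shows "\<exists>t\<in>ks m. ideal_of t = {p \<in> poset n. 0 < ff m p}"
proof -
  have fin: "finite (ideal_of ` ks m)" by simp
  have ne: "ideal_of ` ks m \<noteq> {}"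
  proof
    assume "ideal_of ` ks m = {}"
    then have "lk m t = lk 0 t" for t by (simp add: in_keys_iff[symmetric] lk_notin_ks)
    then show False using assms(2) poly_mapping_eqI by blast
  qed
  obtain J where J: "J \<in> ideal_of ` ks m" "\<forall>b\<in>ideal_of ` ks m. J \<subseteq> b \<longrightarrow> J = b"
    using finite_has_maximal[OF fin ne] by (rule bexE)
  obtain t where t: "t \<in> ks m" "J = ideal_of t" using J(1) by (rule imageE) simp
  have sub: "ideal_of s \<subseteq> ideal_of t" if s: "s \<in> ks m" for s
  proof -
    have "ideal_of s \<subseteq> ideal_of t \<or> ideal_of t \<subseteq> ideal_of s" using assms(1) t(1) s by (simp add: chn_mon_def)
    then show ?thesis using bspec[OF J(2), of "ideal_of s"] s t(2) by auto
  qed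
  have tT: "t \<in> Theta n" using t assms by (auto simp: chn_mon_def)
  have "0 < ff m p \<longleftrightarrow> p \<in> ideal_of t" for p
  proof
    assume "0 < ff m p"
    then have ff0: "ff m p \<noteq> 0" by simp
    have "\<exists>s\<in>ks m. p \<in> ideal_of s"
    proof (rule ccontr)
      assume "\<not> (\<exists>s\<in>ks m. p \<in> ideal_of s)"
      then have "ff m p = 0" unfolding ff_def lsum_def by (intro sum.neutral) simp
      then show False using ff0 by simp
    qed
    then show "p \<in> ideal_of t" using sub by blast
  next
    assume p: "p \<in> ideal_of t"
    have "0 < lk m t * (if p \<in> ideal_of t then 1 else 0)" using t(1) p by (simp add: in_keys_iff)
    also have "\<dots> \<le> ff m p" unfolding ff_def lsum_def by (rule member_le_sum[OF t(1)]) auto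
    finally show "0 < ff m p" .
  qed
  then have "ideal_of t = {p \<in> poset n. 0 < ff m p}" using ideal_poset[OF M_set_ideal_of(3)[OF tT]] by auto
  then show ?thesis using t by blast
qed

text \<open>By \<open>chn_max\<close> the largest ideal of a chain is the support of
  \<open>ff\<close>; it is split off from both monomials, and the number of factors
  decreases.\<close>

lemma chn_ff_inj:
  assumes "chn_mon m" "chn_mon m'" "\<And>p. p \<in> poset n \<Longrightarrow> ff m p = ff m' p"
  shows "m = m'"
  using assms
proof (induction "lsum (\<lambda>_. 1) m" arbitrary: m m' rule: less_induct)
  case (less m m')
  have P1: "(1, 1) \<in> poset n" using n1 by (simp add: poset_iff rws_def)
  have pos: "0 < ff a (1, 1) \<longleftrightarrow> a \<noteq> 0" if a: "chn_mon a" for a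
  proof
    assume "a \<noteq> 0"
    then obtain t where t: "t \<in> ks a" "ideal_of t = {p \<in> poset n. 0 < ff a p}" using chn_max a by blast
    then have "(1, 1) \<in> ideal_of t" using ideal_of_bottom a by (auto simp: chn_mon_def)
    then show "0 < ff a (1, 1)" using t(2) by auto
  qed (auto simp: ff_def)
  show ?case
  proof (cases "m = 0")
    case True
    then show ?thesis using pos[OF less.prems(1)] pos[OF less.prems(2)] less.prems(3)[OF P1] by auto
  next
    case False
    then have "m' \<noteq> 0" using pos[OF less.prems(1)] pos[OF less.prems(2)] less.prems(3)[OF P1] by auto
    obtain t where t: "t \<in> ks m" "ideal_of t = {p \<in> poset n. 0 < ff m p}" using chn_max[OF less.prems(1) False] by blast
    obtain t' where t': "t' \<in> ks m'" "ideal_of t' = {p \<in> poset n. 0 < ff m' p}" using chn_max[OF less.prems(2) \<open>m' \<noteq> 0\<close>] by blast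
    have "ideal_of t = ideal_of t'" using t(2) t'(2) less.prems(3) by auto
    then have "t = t'" using t(1) t'(1) less.prems(1,2) by (intro ideal_of_inj) (auto simp: chn_mon_def)
    obtain m0 where m0: "m = m0 + sg t 1" using monomial_split[OF t(1)] by blast
    obtain m0' where m0': "m' = m0' + sg t 1" using monomial_split[OF t'(1)] \<open>t = t'\<close> by blast
    have "chn_mon m0" "chn_mon m0'" using less.prems(1,2) by (auto simp: chn_mon_def m0 m0' keys_add_nat)
    moreover have "ff m0 p = ff m0' p" if "p \<in> poset n" for p
      using less.prems(3)[OF that] by (simp add: ff_def m0 m0' lsum_add)
    ultimately have "m0 = m0'" by (intro less.hyps) (auto simp: m0 lsum_add lsum_single)
    then show ?thesis by (simp add: m0 m0')
  qed
qed

lemma expo_vecs: "ks m \<subseteq> Theta n \<Longrightarrow> expo n \<O> m \<in> vecs n"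
  using xi_vecs by (simp add: expo_ideal_sum)

lemma expo_inj: "inj_on (expo n \<O>) {m. chn_mon m}"
proof (rule inj_onI)
  fix m m' assume *: "m \<in> {m. chn_mon m}" "m' \<in> {m. chn_mon m}" "expo n \<O> m = expo n \<O> m'"
  then have k: "ks m \<subseteq> Theta n" "ks m' \<subseteq> Theta n" by (auto simp: chn_mon_def)
  then have "ideal_sum m = ideal_sum m'" using *(3) xi_bij ideal_sum_vecs unfolding bij_betw_def by (auto simp: expo_ideal_sum dest: inj_onD)
  then show "m = m'" using chn_ff_inj[of m m'] ff_determined[of m m'] * by blast
qed

section \<open>Counting standard monomials\<close>

text \<open>An injective order-preserving map from admissible tuples to order ideals; it carries standard
  monomials to chain monomials of the same degree.\<close>

definition count_ideal :: "int list \<Rightarrow> (int \<times> int) set"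
  where "count_ideal t = {(i, j) \<in> poset n. i \<le> int (count_upto t (nat (2 * int n - ky j + i)))}"

lemma position_inj: "i \<in> rws 1 \<Longrightarrow> j \<in> rws 1 \<Longrightarrow> position i = position j \<longleftrightarrow> i = j"
  by (auto simp: position_def rws_def nat_eq_iff eq_nat_nat_iff split: if_splits) presburger+

lemma position_bounds: "i \<in> rws 1 \<Longrightarrow> 1 \<le> position i \<and> position i \<le> 2 * n"
  by (auto simp: position_def rws_def split: if_splits)

lemma position_abs: "i \<in> rws 1 \<Longrightarrow> position i \<le> 2 * l \<longleftrightarrow> \<bar>i\<bar> \<le> int l"
  by (auto simp: position_def rws_def split: if_splits)

lemma count_upto_mono: "e \<le> e' \<Longrightarrow> count_upto t e \<le> count_upto t e'"
  unfolding count_upto_def by (intro card_mono) auto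

text \<open>Positions are distinct, so raising the bound by one admits at most one further
  entry.\<close>

lemma count_upto_Suc: "set t \<subseteq> rws 1 \<Longrightarrow> count_upto t (e + r) \<le> count_upto t e + r"
proof (induction r)
  case (Suc r)
  have "{i \<in> set t. position i \<le> e + Suc r} \<subseteq> {i \<in> set t. position i \<le> e + r} \<union> {i \<in> set t. position i = e + Suc r}" by auto
  then have "count_upto t (e + Suc r) \<le> card ({i \<in> set t. position i \<le> e + r} \<union> {i \<in> set t. position i = e + Suc r})"
    unfolding count_upto_def by (intro card_mono) auto
  also have "\<dots> \<le> count_upto t (e + r) + card {i \<in> set t. position i = e + Suc r}" unfolding count_upto_def by (rule card_Un_le)
  also have "card {i \<in> set t. position i = e + Suc r} \<le> 1"
  proof -
    have "a = b" if "a \<in> {i \<in> set t. position i = e + Suc r}" "b \<in> {i \<in> set t. position i = e + Suc r}" for a b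
      using position_inj[of a b] Suc.prems that by (simp add: subset_iff)
    then show ?thesis using card_le_Suc0_iff_eq[of "{i \<in> set t. position i = e + Suc r}"] by simp
  qed
  finally show ?case using Suc by simp
qed simp

lemma count_upto_top: "t \<in> tuples n k \<Longrightarrow> 2 * n \<le> e \<Longrightarrow> count_upto t e = k"
proof -
  assume t: "t \<in> tuples n k" "2 * n \<le> e"
  have "set t \<subseteq> rws 1" "card (set t) = k" using tuples_iff t by blast+
  moreover from this have "{i \<in> set t. position i \<le> e} = set t" using position_bounds t(2) by (fastforce dest: subsetD)
  ultimately show ?thesis by (simp add: count_upto_def)
qed

lemma Theta_rws: "t \<in> Theta n \<Longrightarrow> set t \<subseteq> rws 1"
  using ThetaD tuplesD by blast

text \<open>Admissibility bounds the count at the even bounds \<open>2 * l\<close> by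
  \<open>l\<close>; the 1 comes from rounding \<open>e\<close> up to an even number.\<close>

lemma count_upto_adm: "t \<in> Theta n \<Longrightarrow> e \<le> 2 * n \<Longrightarrow> 2 * count_upto t e \<le> e + 1"
proof -
  assume t: "t \<in> Theta n" "e \<le> 2 * n"
  define l where "l = (e + 1) div 2"
  have r: "set t \<subseteq> rws 1" using Theta_rws t by blast
  have "count_upto t (2 * l) \<le> l"
  proof (cases "l = 0")
    case True
    then have e: "{i \<in> set t. position i \<le> 2 * l} = {}" using position_bounds r by fastforce
    show ?thesis unfolding count_upto_def e by simp
  next
    case False
    moreover have "l \<le> n" using t(2) unfolding l_def by linarith
    ultimately have "l \<in> {1..n}" by simp
    then have "card {i \<in> set t. \<bar>i\<bar> \<le> int l} \<le> l" using ThetaD[OF t(1)] by (simp add: admk_def)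
    moreover have "{i \<in> set t. position i \<le> 2 * l} = {i \<in> set t. \<bar>i\<bar> \<le> int l}" using position_abs r by blast
    ultimately show ?thesis by (simp add: count_upto_def)
  qed
  moreover have "count_upto t e \<le> count_upto t (2 * l)" by (rule count_upto_mono) (simp add: l_def)
  ultimately show ?thesis unfolding l_def by linarith
qed

text \<open>Going down from \<open>(i, j)\<close> may lower the bound in \<open>count_upto\<close>,
  but by no more than the drop of the first coordinate, and by \<open>count_upto_Suc\<close> the
  count then drops by no more than that. On the diagonal \<open>ky i = i\<close> turns the bound
  into \<open>2 * n\<close>, so the condition there compares \<open>i\<close> with
  \<open>length t\<close>.\<close>

lemma count_ideal_ideal:
  assumes t: "t \<in> Theta n"
  shows "count_ideal t \<in> ideals_k n (length t)"
proof -
  have r: "set t \<subseteq> rws 1" using Theta_rws t by blast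
  have tt: "t \<in> tuples n (length t)" "length t \<le> n" using ThetaD t by blast+
  have "q \<in> count_ideal t" if pq: "p \<in> count_ideal t" "q \<in> poset n" "q \<preceq>\<^sub>P p" for p q
  proof -
    obtain i j c d where ij: "p = (i, j)" "q = (c, d)" by (cases p, cases q) auto
    have P: "(i, j) \<in> poset n" "(c, d) \<in> poset n" using pq ij by (auto simp: count_ideal_def)
    have le: "c \<le> i" "ky d \<le> ky j" using pleq_ky[OF P(2,1)] pq ij by auto
    have i: "i \<le> int (count_upto t (nat (2 * int n - ky j + i)))" using pq ij by (simp add: count_ideal_def)
    have b: "1 \<le> c" "ky j \<le> 2 * int n" "1 \<le> i" using P ky_bounds[of j] row_mono[of 1 i] by (auto simp: poset_iff)
    let ?e = "nat (2 * int n - ky d + c)" and ?e' = "nat (2 * int n - ky j + i)"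
    have "c \<le> int (count_upto t ?e)"
    proof (cases "?e' \<le> ?e")
      case True
      then have "count_upto t ?e' \<le> count_upto t ?e" by (rule count_upto_mono)
      then show ?thesis using i le by linarith
    next
      case False
      then have e: "?e' = ?e + (?e' - ?e)" by simp
      have "count_upto t ?e' \<le> count_upto t ?e + (?e' - ?e)" using count_upto_Suc[OF r, of ?e "?e' - ?e"] e by simp
      moreover have "int (?e' - ?e) = (2 * int n - ky j + i) - (2 * int n - ky d + c)" using False b le by simp
      ultimately show ?thesis using i le by linarith
    qed
    then show ?thesis using pq(2) ij by (simp add: count_ideal_def)
  qed
  then have id: "count_ideal t \<in> ideals n" unfolding ideals_def by (auto simp: count_ideal_def)
  have "(i, i) \<in> count_ideal t \<longleftrightarrow> i \<in> {1..int (length t)}" for i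
  proof (cases "1 \<le> i \<and> i \<le> int n")
    case True
    then have "ky i = i" by (simp add: ky_def)
    then show ?thesis using True count_upto_top[OF tt(1), of "2 * n"] by (auto simp: count_ideal_def poset_iff rws_def nat_mult_distrib)
  next
    case False
    then show ?thesis using tt(2) by (auto simp: count_ideal_def poset_iff)
  qed
  then have "count_ideal t \<inter> diag n = (\<lambda>i. (i, i)) ` {1..int (length t)}" using tt(2) by (fastforce simp: diag_def)
  then have "card (count_ideal t \<inter> diag n) = length t" by (simp add: card_image inj_on_def)
  then show ?thesis using id by (simp add: ideals_k_def)
qed

lemma count_ideal_mono: "tuple_le s t \<Longrightarrow> count_ideal t \<subseteq> count_ideal s"
proof -
  assume "tuple_le s t"
  then have "int (count_upto t e) \<le> int (count_upto s e)" for e by (simp add: tuple_le_def)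
  then show ?thesis unfolding count_ideal_def by (auto intro: order_trans)
qed

text \<open>The count at \<open>e\<close> is tested by a single point: \<open>i\<close> is the count
  itself and \<open>j\<close> is chosen so that the bound becomes \<open>e\<close>. Row
  \<open>i\<close> has the keys from \<open>i\<close> to \<open>2 * n + 1 - i\<close>, and that the
  required key respects the upper limit is exactly \<open>count_upto_adm\<close>.\<close>

lemma count_ideal_count_upto_le:
  assumes t: "t \<in> Theta n" and sub: "count_ideal t \<subseteq> count_ideal s" and e: "e \<le> 2 * n"
  shows "count_upto t e \<le> count_upto s e"
proof (cases "count_upto t e = 0")
  case False
  define i where "i = int (count_upto t e)"
  define x where "x = i + 2 * int n - int e"
  \<comment> \<open>\<open>x\<close> is the key required of \<open>j\<close>; the two branches
    invert \<open>ky\<close>.\<close>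
  define j where "j = (if x \<le> int n then x else x - 2 * int n - 1)"
  have i: "1 \<le> i" "2 * i \<le> int e + 1" using False count_upto_adm[OF t e] by (auto simp: i_def)
  have x: "i \<le> x" "x \<le> 2 * int n + 1 - i" using i e by (auto simp: x_def)
  have j: "j \<in> rws i" "ky j = x" using x i e by (auto simp: j_def rws_def ky_def)
  have P: "(i, j) \<in> poset n" using j i e by (auto simp: poset_iff)
  have e': "nat (2 * int n - ky j + i) = e" by (simp add: j x_def)
  have "(i, j) \<in> count_ideal t" using P e' by (simp add: count_ideal_def i_def)
  then have "(i, j) \<in> count_ideal s" using sub by blast
  then show ?thesis using e' by (simp add: count_ideal_def i_def)
qed simp

lemma count_ideal_inj: "s \<in> Theta n \<Longrightarrow> t \<in> Theta n \<Longrightarrow> count_ideal s = count_ideal t \<Longrightarrow> s = t"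
proof -
  assume st: "s \<in> Theta n" "t \<in> Theta n" "count_ideal s = count_ideal t"
  have c: "count_upto s e = count_upto t e" if "e \<le> 2 * n" for e
    using count_ideal_count_upto_le[OF st(1), of t e] count_ideal_count_upto_le[OF st(2), of s e] st(3) that by simp
  have mem: "i \<in> set a \<longleftrightarrow> count_upto a (position i - 1) < count_upto a (position i)" if i: "i \<in> rws 1" and a: "a \<in> Theta n" for i a
  proof
    assume "i \<in> set a"
    then have "i \<in> {k \<in> set a. position k \<le> position i}" "i \<notin> {k \<in> set a. position k \<le> position i - 1}" using position_bounds[OF i] by auto
    then show "count_upto a (position i - 1) < count_upto a (position i)" unfolding count_upto_def by (intro psubset_card_mono) auto
  next
    assume lt: "count_upto a (position i - 1) < count_upto a (position i)"
    show "i \<in> set a"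
    proof (rule ccontr)
      assume "i \<notin> set a"
      then have "{k \<in> set a. position k \<le> position i} \<subseteq> {k \<in> set a. position k \<le> position i - 1}"
        using position_inj[OF _ i] Theta_rws[OF a] by (auto simp: le_eq_less_or_eq)
      then have "count_upto a (position i) \<le> count_upto a (position i - 1)" unfolding count_upto_def by (intro card_mono) auto
      then show False using lt by simp
    qed
  qed
  have "i \<in> set s \<longleftrightarrow> i \<in> set t" if i: "i \<in> rws 1" for i
  proof -
    have "position i \<le> 2 * n" "position i - 1 \<le> 2 * n" using position_bounds[OF i] by auto
    then show ?thesis using mem[OF i st(1)] mem[OF i st(2)] c by simp
  qed
  then have "set s = set t" using Theta_rws[OF st(1)] Theta_rws[OF st(2)] by blast
  then show "s = t" using ThetaD[OF st(1)] ThetaD[OF st(2)] tuplesD by metis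
qed

definition chain_tuple :: "int list \<Rightarrow> int list" where "chain_tuple t = srt (ideal_tuple (count_ideal t) ` {1..int (length t)})"

lemma chain_tuple: "t \<in> Theta n \<Longrightarrow> chain_tuple t \<in> Theta n \<and> length (chain_tuple t) = length t \<and> ideal_of (chain_tuple t) = count_ideal t"
  unfolding chain_tuple_def using ideal_of_srt[OF count_ideal_ideal] ThetaD by blast

lemma chain_tuple_inj: "inj_on chain_tuple (Theta n)"
  using chain_tuple count_ideal_inj by (intro inj_onI) metis

definition chain_monomial :: "(int list \<Rightarrow>\<^sub>0 nat) \<Rightarrow> (int list \<Rightarrow>\<^sub>0 nat)" where "chain_monomial m = (\<Sum>t\<in>ks m. sg (chain_tuple t) (lk m t))"

lemma lookup_chain_monomial: "ks m \<subseteq> Theta n \<Longrightarrow> t \<in> Theta n \<Longrightarrow> lk (chain_monomial m) (chain_tuple t) = lk m t"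
proof -
  assume m: "ks m \<subseteq> Theta n" "t \<in> Theta n"
  have "lk (chain_monomial m) (chain_tuple t) = (\<Sum>s\<in>ks m. if s = t then lk m t else 0)"
    unfolding chain_monomial_def lookup_sum using m chain_tuple_inj by (intro sum.cong refl) (auto simp: lookup_single when_def inj_on_def)
  then show ?thesis by (simp add: in_keys_iff)
qed

lemma keys_chain_monomial: "ks (chain_monomial m) \<subseteq> chain_tuple ` ks m"
  unfolding chain_monomial_def by (rule order_trans[OF keys_sum]) (auto split: if_splits)

lemma chain_monomial_chn: "std_mon m \<Longrightarrow> chn_mon (chain_monomial m)"
proof -
  assume m: "std_mon m"
  have k: "ks m \<subseteq> Theta n" using m by (simp add: std_mon_def)
  have "ideal_of (chain_tuple s) \<subseteq> ideal_of (chain_tuple t) \<or> ideal_of (chain_tuple t) \<subseteq> ideal_of (chain_tuple s)" if "s \<in> ks m" "t \<in> ks m" for s t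
  proof -
    have "tuple_le s t \<or> tuple_le t s" using m that by (simp add: std_mon_def)
    moreover have "ideal_of (chain_tuple s) = count_ideal s" "ideal_of (chain_tuple t) = count_ideal t" using chain_tuple k that by blast+
    ultimately show ?thesis using count_ideal_mono by metis
  qed
  then show ?thesis using keys_chain_monomial[of m] chain_tuple k unfolding chn_mon_def by (smt (verit) image_iff subset_eq)
qed

lemma lsum_sum: "lsum h (\<Sum>i\<in>I. f i) = (\<Sum>i\<in>I. lsum h (f i))"
  by (induction I rule: infinite_finite_induct) (auto simp: lsum_add)

lemma chain_monomial_dgr: "ks m \<subseteq> Theta n \<Longrightarrow> dgr (chain_monomial m) = dgr m"
proof
  fix k assume m: "ks m \<subseteq> Theta n"
  have "dgr (chain_monomial m) k = (\<Sum>t\<in>ks m. lk m t * (if length (chain_tuple t) = k then 1 else 0))"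
    by (simp add: dgr_def chain_monomial_def lsum_sum lsum_single)
  also have "\<dots> = dgr m k" unfolding dgr_def lsum_def using chain_tuple m by (intro sum.cong refl) auto
  finally show "dgr (chain_monomial m) k = dgr m k" .
qed

lemma chain_monomial_inj: "inj_on chain_monomial {m. std_mon m}"
proof (rule inj_onI)
  fix m m' assume *: "m \<in> {m. std_mon m}" "m' \<in> {m. std_mon m}" "chain_monomial m = chain_monomial m'"
  then have k: "ks m \<subseteq> Theta n" "ks m' \<subseteq> Theta n" by (auto simp: std_mon_def)
  show "m = m'"
  proof (rule poly_mapping_eqI)
    fix t show "lk m t = lk m' t"
    proof (cases "t \<in> Theta n")
      case True
      then show ?thesis using lookup_chain_monomial[OF k(1)] lookup_chain_monomial[OF k(2)] *(3) by metis
    next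
      case False
      then have "t \<notin> ks m" "t \<notin> ks m'" using k by auto
      then show ?thesis by (simp add: in_keys_iff)
    qed
  qed
qed

section \<open>Monomials of fixed degree\<close>

definition Cset :: "(nat \<Rightarrow> nat) \<Rightarrow> (int list \<Rightarrow>\<^sub>0 nat) set" where "Cset d = {m. chn_mon m \<and> dgr m = d}"
definition Sset :: "(nat \<Rightarrow> nat) \<Rightarrow> (int list \<Rightarrow>\<^sub>0 nat) set" where "Sset d = {m. std_mon m \<and> dgr m = d}"

lemma finite_monomials: "finite {m. ks m \<subseteq> Theta n \<and> dgr m = d}"
proof -
  let ?B = "\<Sum>k\<in>{1..n}. d k"
  let ?M = "{m. ks m \<subseteq> Theta n \<and> dgr m = d}"
  have "lk m t \<le> ?B" if m: "m \<in> ?M" for m t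
  proof -
    have "ks m \<subseteq> all_tuples n" using m Theta_all by blast
    then have B: "lsum (\<lambda>_. 1) m = ?B" using lsum_dgr[of m] m by simp
    show ?thesis
    proof (cases "t \<in> ks m")
      case True
      have "lk m t * 1 \<le> lsum (\<lambda>_. 1) m" unfolding lsum_def by (rule member_le_sum[OF True]) auto
      then show ?thesis using B by simp
    qed (simp add: in_keys_iff)
  qed
  then have "(\<lambda>m. restrict (lk m) (Theta n)) ` ?M \<subseteq> PiE (Theta n) (\<lambda>_. {..?B})" by auto
  then have "finite ((\<lambda>m. restrict (lk m) (Theta n)) ` ?M)"
    by (rule finite_subset) (intro finite_PiE finite_Theta finite_atMost)
  moreover have "inj_on (\<lambda>m. restrict (lk m) (Theta n)) ?M"
  proof (rule inj_onI)
    fix m m' assume *: "m \<in> ?M" "m' \<in> ?M" "restrict (lk m) (Theta n) = restrict (lk m') (Theta n)"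
    show "m = m'"
    proof (rule poly_mapping_eqI)
      fix t show "lk m t = lk m' t"
      proof (cases "t \<in> Theta n")
        case True then show ?thesis using fun_cong[OF *(3), of t] by simp
      next
        case False
        then have "t \<notin> ks m" "t \<notin> ks m'" using * by auto
        then show ?thesis by (simp add: in_keys_iff)
      qed
    qed
  qed
  ultimately show ?thesis using finite_imageD by blast
qed

lemma finite_CS: "finite (Cset d)" "finite (Sset d)"
  by (rule finite_subset[OF _ finite_monomials[of d]], auto simp: Cset_def Sset_def chn_mon_def std_mon_def)+

lemma card_S_le_C: "card (Sset d) \<le> card (Cset d)"
proof (rule card_inj_on_le[OF _ _ finite_CS(1)])
  show "inj_on chain_monomial (Sset d)" using chain_monomial_inj by (rule inj_on_subset) (auto simp: Sset_def)
  show "chain_monomial ` Sset d \<subseteq> Cset d" using chain_monomial_chn chain_monomial_dgr by (auto simp: Sset_def Cset_def std_mon_def)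
qed

section \<open>The chain monomials form a basis\<close>

lemma psi_mono: "psi (sg m 1) = (\<Prod>t\<in>ks m. psi (pvar t) ^ lk m t)"
  by (simp add: psi_def psub_single mev_def)

lemma psi_scale: "psi (sg 0 c * p) = sg 0 c * psi p"
  by (simp add: psi_def psub_scale)

lemma psi_single: "psi (sg m c) = sg 0 c * psi (sg m 1)"
  by (simp add: psi_def psub_single)

lemma psi_add: "psi (p + q) = psi p + psi q" and psi_diff: "psi (p - q) = psi p - psi q"
  and psi_mult: "psi (p * q) = psi p * psi q" and psi_sum: "psi (\<Sum>i\<in>I. g i) = (\<Sum>i\<in>I. psi (g i))"
  and psi_0: "psi 0 = 0" and psi_1: "psi 1 = 1"
  by (simp_all add: psi_def psub_add psub_diff psub_mult psub_sum)

lemma psi_expand: "psi p = (\<Sum>m\<in>ks p. sg 0 (lk p m) * psi (sg m 1))"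
proof -
  have "psi p = psi (\<Sum>m\<in>ks p. sg m (lk p m))" by (simp add: sum_single_lookup)
  then show ?thesis by (simp only: psi_sum psi_single[symmetric])
qed

lemma leads_psi_mono: "ks m \<subseteq> Theta n \<Longrightarrow> \<exists>c. c \<noteq> 0 \<and> leads (psi (sg m 1)) (expo n \<O> m) c"
proof -
  assume m: "ks m \<subseteq> Theta n"
  obtain c where c: "\<And>t. t \<in> Theta n \<Longrightarrow> c t \<noteq> 0 \<and> leads (psi (pvar t)) (ex1 t) (c t)"
    using bchoice[of "Theta n" "\<lambda>t c. c \<noteq> 0 \<and> leads (psi (pvar t)) (ex1 t) c"] leads_psi_pvar by blast
  have "leads (\<Prod>t\<in>ks m. psi (pvar t) ^ lk m t) (\<Sum>t\<in>ks m. frag_cmul (int (lk m t)) (ex1 t)) (\<Prod>t\<in>ks m. c t ^ lk m t)"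
    using c m by (intro leads_prod leads_power) auto
  moreover have "(\<Prod>t\<in>ks m. c t ^ lk m t) \<noteq> 0" using c m by auto
  ultimately show ?thesis unfolding psi_mono expo_eq[OF m] by blast
qed

lemma supported_psi: assumes "p \<in> pring (Theta n)" shows "supported (psi p)"
proof -
  have v: "supported (psi (pvar t))" if "t \<in> Theta n" for t
    using supported_minor[of t] ThetaD[OF that] tuplesD[of t "length t"] unfolding psi_def psub_pvar by blast
  show ?thesis unfolding psi_expand[of p] psi_mono
    using assms v by (intro supported_sum supported_mult supported_prod supported_power supported_single vecs_0) (auto simp: pring_def)
qed

abbreviation pm :: "(int list \<Rightarrow>\<^sub>0 nat) \<Rightarrow> laurent" where "pm m \<equiv> psi (sg m 1)"

lemma rho_kernel_psi: "p \<in> rho_kernel \<Longrightarrow> psi p = 0"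
  using psi_rho[of p] I_C_psi by (auto simp: rho_kernel_def)

lemma psi_span: "R \<in> pv.span ((\<lambda>m. sg m 1) ` A) \<Longrightarrow> psi R \<in> pv.span (pm ` A)"
proof (induction rule: pv.span_induct_alt)
  case (step c x y)
  then show ?case by (auto simp: psi_add psi_scale intro!: pv.span_add pv.span_scale intro: pv.span_base)
qed (simp add: psi_0 pv.span_zero)

lemma pm_span_S:
  assumes "ks m \<subseteq> all_tuples n" "dgr m = d"
  shows "pm m \<in> pv.span (pm ` Sset d)"
proof -
  obtain R where R: "R \<in> pv.span ((\<lambda>m'. sg m' 1) ` {m'. std_mon m' \<and> dgr m' = dgr m})" "sg m 1 - R \<in> rho_kernel"
    using standard_spanning[OF assms(1)] by blast
  have "pm m = psi R" using rho_kernel_psi[OF R(2)] by (simp add: psi_diff)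
  then show ?thesis using psi_span[OF R(1)] assms(2) by (simp add: Sset_def)
qed

lemma Cset_Theta: "m \<in> Cset d \<Longrightarrow> ks m \<subseteq> Theta n \<and> ks m \<subseteq> all_tuples n \<and> dgr m = d"
  using Theta_all by (auto simp: Cset_def chn_mon_def)

lemma independentI:
  assumes fin: "finite A" and z: "\<And>a i. (\<Sum>i\<in>A. sg 0 (a i) * f i) = 0 \<Longrightarrow> i \<in> A \<Longrightarrow> a i = 0"
  shows "pv.independent (f ` A) \<and> inj_on f A"
proof -
  have inj: "inj_on f A"
  proof (rule inj_onI, rule ccontr)
    fix x y assume xy: "x \<in> A" "y \<in> A" "f x = f y" "x \<noteq> y"
    let ?a = "\<lambda>i. if i = x then 1 else if i = y then - 1 else (0::complex)"
    have "(\<Sum>i\<in>A. sg 0 (?a i) * f i) = (\<Sum>i\<in>A. (if i = x then f x else 0) + (if i = y then - f y else 0))"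
      using xy by (intro sum.cong) auto
    also have "\<dots> = 0" using xy fin by (simp add: sum.distrib)
    finally have "?a x = 0" by (rule z) (rule xy)
    then show False by simp
  qed
  moreover have "pv.independent (f ` A)"
    unfolding pv.independent_explicit_finite_subsets
  proof (intro allI impI ballI)
    fix B u v assume B: "B \<subseteq> f ` A" "finite B" "(\<Sum>v\<in>B. sg 0 (u v) * v) = 0" "v \<in> B"
    let ?A = "{i \<in> A. f i \<in> B}"
    have "f ` ?A = B" using B by auto
    moreover have "inj_on f ?A" using inj by (rule inj_on_subset) auto
    ultimately have "bij_betw f ?A B" unfolding bij_betw_def by blast
    then have "(\<Sum>v\<in>B. sg 0 (u v) * v) = (\<Sum>i\<in>?A. sg 0 (u (f i)) * f i)"
      by (rule sum.reindex_bij_betw[symmetric])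
    also have "\<dots> = (\<Sum>i\<in>A. sg 0 (if f i \<in> B then u (f i) else 0) * f i)"
      using fin by (intro sum.mono_neutral_cong_left) auto
    finally have "\<And>i. i \<in> A \<Longrightarrow> (if f i \<in> B then u (f i) else 0) = 0" using z[of "\<lambda>i. if f i \<in> B then u (f i) else 0"] B(3) by auto
    moreover obtain i where "i \<in> A" "v = f i" using B by auto
    ultimately show "u v = 0" using B(4) by metis
  qed
  ultimately show ?thesis by blast
qed

lemma pm_C_comb_zero: "(\<Sum>m\<in>Cset d. sg 0 (a m) * pm m) = 0 \<Longrightarrow> m \<in> Cset d \<Longrightarrow> a m = 0"
proof -
  assume *: "(\<Sum>m\<in>Cset d. sg 0 (a m) * pm m) = 0" "m \<in> Cset d"
  obtain c where c: "\<And>m. m \<in> Cset d \<Longrightarrow> c m \<noteq> 0 \<and> leads (pm m) (expo n \<O> m) (c m)"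
    using bchoice[of "Cset d" "\<lambda>m c. c \<noteq> 0 \<and> leads (pm m) (expo n \<O> m) c"] leads_psi_mono Cset_Theta by blast
  have "inj_on (expo n \<O>) (Cset d)" using expo_inj by (rule inj_on_subset) (auto simp: Cset_def)
  then show ?thesis using leads_independent[of "Cset d" pm "expo n \<O>" c a m] finite_CS c * expo_vecs Cset_Theta by blast
qed

lemma pm_C: "pv.independent (pm ` Cset d)" "inj_on pm (Cset d)"
  using independentI[of "Cset d" pm] finite_CS pm_C_comb_zero by blast+

text \<open>The chain monomials are independent, the standard ones span, and there are at least as many
  of the former as of the latter: hence both are bases.\<close>

lemma pm_S_C: "pv.span (pm ` Sset d) = pv.span (pm ` Cset d)" "pv.independent (pm ` Sset d)" "inj_on pm (Sset d)"
proof -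
  let ?S = "pm ` Sset d" and ?C = "pm ` Cset d"
  have CS: "?C \<subseteq> pv.span ?S" using pm_span_S Cset_Theta by blast
  have cS: "card ?S \<le> card (Sset d)" using finite_CS by (intro card_image_le)
  have cC: "card ?C = card (Cset d)" using pm_C(2) by (rule card_image)
  have fS: "finite ?S" and fC: "finite ?C" using finite_CS by simp_all
  have bound: "card X \<le> card ?S" if "pv.independent X" "X \<subseteq> pv.span ?S" for X
    using pv.independent_span_bound[OF fS that] by (rule conjunct2)
  have "card ?C \<le> card ?S" using pm_C(1) CS by (rule bound)
  then have eq: "card ?S = card (Sset d)" "card ?S = card ?C" using cS cC card_S_le_C[of d] by linarith+
  \<comment> \<open>A standard monomial outside the span of the chain monomials could be added to
    these, giving an independent set larger than a spanning one.\<close>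
  have SC: "?S \<subseteq> pv.span ?C"
  proof (rule subsetI, rule ccontr)
    fix s assume s: "s \<in> ?S" "s \<notin> pv.span ?C"
    then have "pv.independent (insert s ?C)" using pm_C(1) by (intro pv.independent_insertI)
    moreover have "insert s ?C \<subseteq> pv.span ?S" using CS pv.span_base[OF s(1)] by (rule insert_subsetI[rotated])
    ultimately have "card (insert s ?C) \<le> card ?S" by (rule bound)
    moreover have "s \<notin> ?C" using s(2) pv.span_base[of s ?C] by (rule contrapos_nn)
    ultimately show False using card_insert_disjoint[OF fC] eq(2) by simp
  qed
  show sp: "pv.span ?S = pv.span ?C"
    using pv.span_minimal[OF CS pv.subspace_span] pv.span_minimal[OF SC pv.subspace_span] by (rule subset_antisym[rotated])
  show "inj_on pm (Sset d)" using eq(1) finite_CS by (intro eq_card_imp_inj_on)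
  show "pv.independent ?S"
  proof
    assume "pv.dependent ?S"
    then obtain s where s: "s \<in> ?S" "s \<in> pv.span (?S - {s})" unfolding pv.dependent_def by (rule bexE)
    have "pv.span ?S = pv.span (?S - {s})" using pv.span_redundant[OF s(2)] insert_Diff[OF s(1)] by simp
    then have "?C \<subseteq> pv.span (?S - {s})" using CS by simp
    then have "card ?C \<le> card (?S - {s})" using pv.independent_span_bound[OF finite_Diff[OF fS] pm_C(1)] by blast
    moreover have "card (?S - {s}) < card ?S" using fS s(1) by (rule card_Diff1_less)
    ultimately show False using eq(2) by simp
  qed
qed

lemma pm_S_comb_zero: "(\<Sum>m\<in>Sset d. sg 0 (a m) * pm m) = 0 \<Longrightarrow> m \<in> Sset d \<Longrightarrow> a m = 0"
proof -
  assume *: "(\<Sum>m\<in>Sset d. sg 0 (a m) * pm m) = 0" "m \<in> Sset d"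
  let ?g = "\<lambda>v. a (inv_into (Sset d) pm v)"
  have inv: "?g (pm m) = a m" if "m \<in> Sset d" for m
    using inv_into_f_f[OF pm_S_C(3)[of d] that] by simp
  have "(\<Sum>v\<in>pm ` Sset d. sg 0 (?g v) * v) = (\<Sum>m\<in>Sset d. sg 0 (?g (pm m)) * pm m)"
    using sum.reindex[OF pm_S_C(3)[of d], of "\<lambda>v. sg 0 (?g v) * v"] by (simp only: comp_def)
  also have "\<dots> = (\<Sum>m\<in>Sset d. sg 0 (a m) * pm m)" using inv by (intro sum.cong refl) simp
  finally have "?g (pm m) = 0"
    using * finite_CS(2)[of d] by (intro pv.independentD[OF pm_S_C(2)[of d] _ subset_refl]) auto
  then show ?thesis using inv[OF *(2)] by simp
qed

definition hom :: "(nat \<Rightarrow> nat) \<Rightarrow> int list cpoly set"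
  where "hom d = {p \<in> pring (Theta n). \<forall>m\<in>ks p. dgr m = d}"

lemma hom_std:
  assumes "p \<in> hom d"
  shows "\<exists>b. p - (\<Sum>m\<in>Sset d. sg m (b m)) \<in> rho_kernel"
proof -
  have mem: "\<forall>m\<in>ks p. \<exists>R. R \<in> pv.span ((\<lambda>m'. sg m' 1) ` Sset d) \<and> sg m 1 - R \<in> rho_kernel"
  proof
    fix m assume "m \<in> ks p"
    then have "ks m \<subseteq> all_tuples n" "dgr m = d" using assms Theta_all by (auto simp: hom_def pring_def)
    then show "\<exists>R. R \<in> pv.span ((\<lambda>m'. sg m' 1) ` Sset d) \<and> sg m 1 - R \<in> rho_kernel"
      using standard_spanning[of m] by (simp add: Sset_def Bex_def)
  qed
  obtain R where R: "\<And>m. m \<in> ks p \<Longrightarrow> R m \<in> pv.span ((\<lambda>m'. sg m' 1) ` Sset d)" "\<And>m. m \<in> ks p \<Longrightarrow> sg m 1 - R m \<in> rho_kernel"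
    using bchoice[OF mem] by blast
  let ?R = "\<Sum>m\<in>ks p. sg 0 (lk p m) * R m"
  have "?R \<in> pv.span ((\<lambda>m'. sg m' 1) ` Sset d)" using R by (intro pv.span_sum pv.span_scale) auto
  then obtain u where u: "?R = (\<Sum>v\<in>(\<lambda>m'. sg m' 1) ` Sset d. sg 0 (u v) * v)"
    using pv.span_finite[of "(\<lambda>m'. sg m' 1) ` Sset d"] finite_CS by auto
  have "inj_on (\<lambda>m'. sg m' (1::complex)) (Sset d)" by (rule inj_onI) (metis keys_single insertI1 singletonD zero_neq_one)
  then have "?R = (\<Sum>m\<in>Sset d. sg 0 (u (sg m 1)) * sg m 1)" unfolding u by (subst sum.reindex) simp_all
  then have 1: "?R = (\<Sum>m\<in>Sset d. sg m (u (sg m 1)))" by (simp add: mult_single)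
  have "p = (\<Sum>m\<in>ks p. sg 0 (lk p m) * sg m 1)" by (simp add: mult_single sum_single_lookup)
  then have "p - ?R = (\<Sum>m\<in>ks p. sg 0 (lk p m) * (sg m 1 - R m))" by (simp add: sum_subtractf right_diff_distrib)
  also have "\<dots> \<in> rho_kernel" using R by (intro pv.subspace_sum[OF rho_kernel_subspace] pv.subspace_scale[OF rho_kernel_subspace]) auto
  finally show ?thesis unfolding 1 by (rule exI[of _ "\<lambda>m. u (sg m 1)"])
qed

text \<open>Modulo \<open>rho_kernel\<close>, \<open>p\<close> is a combination of standard
  monomials, whose coefficients vanish because the images of these under \<open>psi\<close> are
  independent. So \<open>p\<close> lies in \<open>rho_kernel\<close>, and \<open>rho1\<close> fixes
  it. With \<open>I_C_psi\<close>, the ideal is the kernel of \<open>psi\<close> on each graded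
  piece.\<close>

lemma psi_zero_I_C: assumes "p \<in> hom d" "psi p = 0" shows "p \<in> I_C n"
proof -
  obtain b where b: "p - (\<Sum>m\<in>Sset d. sg m (b m)) \<in> rho_kernel" using hom_std[OF assms(1)] by blast
  have "(\<Sum>m\<in>Sset d. sg 0 (b m) * pm m) = 0"
    using rho_kernel_psi[OF b] assms(2) by (simp add: psi_diff psi_sum psi_single[of _ "b _"])
  then have "b m = 0" if "m \<in> Sset d" for m using pm_S_comb_zero that by blast
  then have "p \<in> rho_kernel" using b by simp
  then show ?thesis using rho_id assms(1) by (auto simp: rho_kernel_def hom_def)
qed

lemma hom_psi_comb:
  assumes "p \<in> hom d"
  shows "\<exists>a. psi p = (\<Sum>m\<in>Cset d. sg 0 (a m) * pm m)"
proof -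
  have "psi p \<in> pv.span (pm ` Cset d)" unfolding psi_expand[of p] pm_S_C(1)[symmetric]
    using assms Theta_all by (intro pv.span_sum pv.span_scale pm_span_S) (auto simp: hom_def pring_def)
  then obtain u where u: "psi p = (\<Sum>v\<in>pm ` Cset d. sg 0 (u v) * v)"
    using pv.span_finite[of "pm ` Cset d"] finite_CS by auto
  have "psi p = (\<Sum>m\<in>Cset d. sg 0 (u (pm m)) * pm m)" unfolding u using pm_C(2) by (subst sum.reindex) simp_all
  then show ?thesis by (rule exI[of _ "\<lambda>m. u (pm m)"])
qed

lemma hom_sum: "(\<And>i. i \<in> I \<Longrightarrow> f i \<in> hom d) \<Longrightarrow> (\<Sum>i\<in>I. f i) \<in> hom d"
proof -
  assume *: "\<And>i. i \<in> I \<Longrightarrow> f i \<in> hom d"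
  have "ks (\<Sum>i\<in>I. f i) \<subseteq> (\<Union>i\<in>I. ks (f i))" by (rule keys_sum)
  then show ?thesis using * by (fastforce simp: hom_def intro: pring_sum)
qed

lemma hom_diff: "p \<in> hom d \<Longrightarrow> q \<in> hom d \<Longrightarrow> p - q \<in> hom d"
  using keys_diff[of p q] by (auto simp: hom_def intro: pring_diff)

lemma hom_single: "ks m \<subseteq> Theta n \<Longrightarrow> dgr m = d \<Longrightarrow> sg m c \<in> hom d"
  by (auto simp: hom_def intro: pring_single)

text \<open>In an expansion by chain monomials the leading terms cannot cancel: every monomial that
  occurs has exponent at most \<open>lead (psi p)\<close>, so the expansion itself lies in this step
  of the filtration. The second claim limits the possible values to exponents of chain
  monomials.\<close>

lemma hom_representative:
  assumes "p \<in> hom d" "psi p \<noteq> 0"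
  shows "\<exists>q. q \<in> filt n \<O> (lead (psi p)) \<and> p - q \<in> I_C n"
    and "\<exists>m\<in>Cset d. lead (psi p) = expo n \<O> m"
proof -
  obtain a where a: "psi p = (\<Sum>m\<in>Cset d. sg 0 (a m) * pm m)" using hom_psi_comb[OF assms(1)] by blast
  obtain c where c: "\<And>m. m \<in> Cset d \<Longrightarrow> c m \<noteq> 0 \<and> leads (pm m) (expo n \<O> m) (c m)"
    using bchoice[of "Cset d" "\<lambda>m c. c \<noteq> 0 \<and> leads (pm m) (expo n \<O> m) c"] leads_psi_mono Cset_Theta by blast
  have c': "\<And>m. m \<in> Cset d \<Longrightarrow> leads (pm m) (expo n \<O> m) (c m) \<and> c m \<noteq> 0 \<and> expo n \<O> m \<in> vecs n"
    using c expo_vecs Cset_Theta by blast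
  have inj: "inj_on (expo n \<O>) (Cset d)" using expo_inj by (rule inj_on_subset) (auto simp: Cset_def)
  obtain m1 where m1: "m1 \<in> Cset d" "a m1 \<noteq> 0"
  proof (rule ccontr)
    assume "\<not> thesis"
    then have "a m = 0" if "m \<in> Cset d" for m using that \<open>\<And>m1. m1 \<in> Cset d \<Longrightarrow> a m1 \<noteq> 0 \<Longrightarrow> thesis\<close> by blast
    then have "psi p = 0" unfolding a by (intro sum.neutral) simp
    then show False using assms by simp
  qed
  obtain m0 where m0: "m0 \<in> Cset d" "a m0 \<noteq> 0" "leads (psi p) (expo n \<O> m0) (a m0 * c m0)"
      "\<forall>m\<in>Cset d. a m \<noteq> 0 \<longrightarrow> leA (expo n \<O> m) (expo n \<O> m0)"
    using leads_combination[where f = pm and x = "expo n \<O>" and c = c and a = a, OF finite_CS(1)[of d] _ inj m1] c' unfolding a by blast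
  have ld: "lead (psi p) = expo n \<O> m0" using leads_lead[OF m0(3)] m0(2) c[OF m0(1)] by simp
  show "\<exists>m\<in>Cset d. lead (psi p) = expo n \<O> m" using ld m0(1) by blast
  let ?q = "\<Sum>m\<in>Cset d. sg m (a m)"
  have "?q \<in> hom d" by (intro hom_sum hom_single) (use Cset_Theta in blast)+
  moreover have "psi ?q = psi p" unfolding a psi_sum by (intro sum.cong refl) (rule psi_single)
  ultimately have "p - ?q \<in> I_C n" using psi_zero_I_C[OF hom_diff[OF assms(1)]] by (simp add: psi_diff)
  moreover have "?q \<in> filt n \<O> (lead (psi p))"
    unfolding filt_def cspan_eq ld
  proof (rule pv.span_sum)
    fix m assume m: "m \<in> Cset d"
    show "sg m (a m) \<in> pv.span {sg m 1 |m. ks m \<subseteq> Theta n \<and> (less_A n \<O> (expo n \<O> m) (expo n \<O> m0) \<or> expo n \<O> m = expo n \<O> m0)}"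
    proof (cases "a m = 0")
      case False
      then have "leA (expo n \<O> m) (expo n \<O> m0)" using m0(4) m by blast
      then have "sg m 1 \<in> pv.span {sg m 1 |m. ks m \<subseteq> Theta n \<and> (less_A n \<O> (expo n \<O> m) (expo n \<O> m0) \<or> expo n \<O> m = expo n \<O> m0)}"
        using Cset_Theta[OF m] unfolding leA_def by (intro pv.span_base) blast
      from pv.span_scale[OF this, of "a m"] show ?thesis by (simp add: mult_single)
    qed (simp add: pv.span_zero)
  qed
  ultimately show "\<exists>q. q \<in> filt n \<O> (lead (psi p)) \<and> p - q \<in> I_C n" by blast
qed

text \<open>The exponent assigned to a monomial is the leading exponent of its image, so the
  filtration bounds all exponents of the image.\<close>

lemma filt_psi: assumes "q \<in> filt n \<O> x" "y \<in> ks (psi q)" shows "leA y x"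
proof -
  have "\<forall>y\<in>ks (psi q). leA y x" using assms(1) unfolding filt_def cspan_eq
  proof (induction rule: pv.span_induct_alt)
    case (step c m q)
    then obtain m' where m': "m = sg m' 1" "ks m' \<subseteq> Theta n" "leA (expo n \<O> m') x" unfolding leA_def by blast
    have "leA y x" if y: "y \<in> ks (psi (sg 0 c * m))" for y
    proof -
      have "y \<in> ks (psi m)" using y keys_single0_mult unfolding psi_scale by blast
      then have "leA y (expo n \<O> m')" using leads_psi_mono[OF m'(2)] unfolding leads_def m'(1) by blast
      then show ?thesis using m'(3) leA_trans by blast
    qed
    then show ?case using step keys_add[of "psi (sg 0 c * m)" "psi q"] unfolding psi_add by blast
  qed (simp add: psi_0)
  then show ?thesis using assms(2) by blast
qed

section \<open>The symplectic Pluecker algebra\<close>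

lemma cross_trans:
  fixes a :: "'r::comm_ring_1"
  assumes "a * b' = a' * b" "a' * c' = c * b'"
  shows "a * c' * b' = c * b * b'"
proof -
  have "a * c' * b' = (a * b') * c'" by (simp only: mult_ac)
  also have "\<dots> = (a' * c') * b" unfolding assms(1) by (simp only: mult_ac)
  also have "\<dots> = c * b * b'" unfolding assms(2) by (simp only: mult_ac)
  finally show ?thesis .
qed

lemma diff_eq_of_add_eq:
  fixes a :: "'g::ab_group_add"
  assumes "a + b' = a' + b"
  shows "a - b = a' - b'"
proof -
  have "a - b = (a + b') - b' - b" by simp
  also have "\<dots> = a' - b'" unfolding assms by simp
  finally show ?thesis .
qed

lemma cross_mult:
  fixes a :: "'r::comm_ring_1"
  assumes "a * b1 = a1 * b" "c * d1 = c1 * d"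
  shows "(a1 * c1) * (b * d) = (a * c) * (b1 * d1)"
proof -
  have "(a1 * c1) * (b * d) = (a1 * b) * (c1 * d)" by (simp only: mult_ac)
  also have "\<dots> = (a * c) * (b1 * d1)" unfolding assms[symmetric] by (simp only: mult_ac)
  finally show ?thesis .
qed

lemma I_C_ideal: "ideal (I_C n) (Theta_ring n)" and Theta_cring: "cring (Theta_ring n)"
proof -
  have ab: "abelian_group (Theta_ring n)"
    by (rule abelian_groupI) (auto simp: Theta_ring_def pring_add algebra_simps intro: exI[of _ "- x" for x] pring_uminus bexI[of _ "- x" for x])
  have cm: "comm_monoid (Theta_ring n)"
    by (rule comm_monoidI) (auto simp: Theta_ring_def pring_mult algebra_simps)
  show cr: "cring (Theta_ring n)"
    by (rule cringI[OF ab cm]) (auto simp: Theta_ring_def algebra_simps)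
  interpret T: cring "Theta_ring n" by (rule cr)
  have car: "carrier (Theta_ring n) = pring (Theta n)" by (simp add: Theta_ring_def)
  have inv: "\<ominus>\<^bsub>Theta_ring n\<^esub> p = - p" if "p \<in> pring (Theta n)" for p
    using that T.minus_equality[of "- p" p] by (simp add: Theta_ring_def pring_uminus)
  show "ideal (I_C n) (Theta_ring n)"
  proof (rule idealI)
    show "ring (Theta_ring n)" by (rule T.ring_axioms)
    show "subgroup (I_C n) (add_monoid (Theta_ring n))"
    proof
      fix x assume x: "x \<in> I_C n"
      have "inv\<^bsub>add_monoid (Theta_ring n)\<^esub> x = - x"
        using inv[OF I_C_pring[OF x]] by (simp add: a_inv_def)
      then show "inv\<^bsub>add_monoid (Theta_ring n)\<^esub> x \<in> I_C n" using I_C_uminus[OF x] by simp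
    qed (use I_C_pring I_C_0 I_C_add in \<open>auto simp: Theta_ring_def\<close>)
  next
    fix a x assume "a \<in> I_C n" "x \<in> carrier (Theta_ring n)"
    then show "x \<otimes>\<^bsub>Theta_ring n\<^esub> a \<in> I_C n" "a \<otimes>\<^bsub>Theta_ring n\<^esub> x \<in> I_C n"
      using I_C_mult[of x a] by (simp_all add: Theta_ring_def mult.commute)
  qed
qed

lemma cls_eq: "cls n p = (\<lambda>h. h + p) ` I_C n"
  by (auto simp: cls_def a_r_coset_def r_coset_def Theta_ring_def)

lemma cls_eq_iff: "cls n p = cls n q \<longleftrightarrow> p - q \<in> I_C n"
proof
  assume "cls n p = cls n q"
  moreover have "0 + p \<in> cls n p" unfolding cls_eq using I_C_0 by (rule imageI)
  ultimately obtain h where "h \<in> I_C n" "p = h + q" unfolding cls_eq by auto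
  then show "p - q \<in> I_C n" by simp
next
  assume pq: "p - q \<in> I_C n"
  have "h + p = (h + (p - q)) + q" "h + q = (h - (p - q)) + p" for h by simp_all
  then show "cls n p = cls n q" unfolding cls_eq using I_C_add[OF _ pq] I_C_diff[OF _ pq] by blast
qed

lemma cls_psi: "cls n p = cls n q \<Longrightarrow> psi p = psi q"
  using I_C_psi[of "p - q"] by (simp add: cls_eq_iff psi_diff)

lemma cls_hom: "cls n \<in> Ring.ring_hom (Theta_ring n) (RC n)"
  proof -
  have "cls n = a_r_coset (Theta_ring n) (I_C n)" by (rule ext) (simp add: cls_def)
  then show ?thesis using ideal.rcos_ring_hom[OF I_C_ideal] by (simp add: RC_def)
qed

lemma cls_mult: "p \<in> pring (Theta n) \<Longrightarrow> q \<in> pring (Theta n) \<Longrightarrow> cls n p \<otimes>\<^bsub>RC n\<^esub> cls n q = cls n (p * q)"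
  and cls_add: "p \<in> pring (Theta n) \<Longrightarrow> q \<in> pring (Theta n) \<Longrightarrow> cls n p \<oplus>\<^bsub>RC n\<^esub> cls n q = cls n (p + q)"
  and cls_1: "\<one>\<^bsub>RC n\<^esub> = cls n 1"
  using cls_hom by (auto simp: Ring.ring_hom_def Theta_ring_def)

lemma cls_0: "\<zero>\<^bsub>RC n\<^esub> = cls n 0"
proof -
  have "\<zero>\<^bsub>RC n\<^esub> = I_C n" by (simp add: RC_def FactRing_def)
  then show ?thesis by (simp add: cls_eq)
qed

lemma cls_pow: "p \<in> pring (Theta n) \<Longrightarrow> cls n p [^]\<^bsub>RC n\<^esub> (m::nat) = cls n (p ^ m)"
proof (induction m)
  case (Suc m)
  interpret R: ring "RC n" unfolding RC_def using ideal.quotient_is_ring[OF I_C_ideal] .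
  show ?case using Suc by (simp add: cls_mult pring_power mult.commute)
qed (simp add: cls_1)

text \<open>\<open>homogeneous\<close> looks at the degrees in \<open>{1..n}\<close> only,
  \<open>hom\<close> at all of them; truncation reconciles the two, since no admissible tuple has
  another length.\<close>

definition trunc :: "(nat \<Rightarrow> nat) \<Rightarrow> nat \<Rightarrow> nat" where "trunc \<mu> k = (if k \<in> {1..n} then \<mu> k else 0)"

lemma dgr_out: "ks m \<subseteq> Theta n \<Longrightarrow> k \<notin> {1..n} \<Longrightarrow> dgr m k = 0"
  unfolding dgr_def lsum_def by (intro sum.neutral) (use ThetaD in auto)

lemma homogeneous_hom: "p \<in> pring (Theta n) \<Longrightarrow> homogeneous n \<mu> p \<longleftrightarrow> p \<in> hom (trunc \<mu>)"
proof -
  assume p: "p \<in> pring (Theta n)"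
  have "(\<forall>k\<in>{1..n}. dgr m k = \<mu> k) \<longleftrightarrow> dgr m = trunc \<mu>" if "m \<in> ks p" for m
    using p that dgr_out[of m] by (auto simp: trunc_def fun_eq_iff pring_def)
  then show ?thesis using p by (simp add: hom_def homogeneous_iff)
qed

lemma hom_pring: "p \<in> hom d \<Longrightarrow> p \<in> pring (Theta n)"
  by (simp add: hom_def)

lemma RC_comp_eq: "RC_comp n \<mu> = cls n ` hom (trunc \<mu>)"
proof -
  have "{p \<in> pring (Theta n). homogeneous n \<mu> p} = hom (trunc \<mu>)" using homogeneous_hom hom_pring by blast
  then show ?thesis by (simp add: RC_comp_def)
qed

lemma hom_trunc: "p \<in> hom d \<Longrightarrow> p \<in> hom (trunc d)"
proof -
  assume p: "p \<in> hom d"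
  have "dgr m = trunc d" if "m \<in> ks p" for m
    using p that dgr_out[of m] by (auto simp: trunc_def fun_eq_iff pring_def hom_def)
  then show ?thesis using p by (simp add: hom_def)
qed

lemma hom_mult: "p \<in> hom d \<Longrightarrow> q \<in> hom e \<Longrightarrow> p * q \<in> hom (\<lambda>k. d k + e k)"
  using keys_mult[of p q] by (fastforce simp: hom_def dgr_add fun_eq_iff intro: pring_mult)

lemma hom_add: "p \<in> hom d \<Longrightarrow> q \<in> hom d \<Longrightarrow> p + q \<in> hom d"
  using keys_add[of p q] by (auto simp: hom_def intro: pring_add)

lemma dgr_0: "dgr 0 = (\<lambda>_. 0)" by (auto simp: dgr_def)

lemma hom_const: "sg 0 c \<in> hom (\<lambda>_. 0)"
  by (rule hom_single) (simp_all add: dgr_0)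

lemma cls_zero_iff: "p \<in> hom d \<Longrightarrow> cls n p = \<zero>\<^bsub>RC n\<^esub> \<longleftrightarrow> psi p = 0"
  using I_C_psi psi_zero_I_C by (auto simp: cls_0 cls_eq_iff)

text \<open>\<open>hom_representative\<close> shows that the filtration step at
  \<open>lead (psi p)\<close> is reached, \<open>filt_psi\<close> that no smaller one is.\<close>

lemma nu_cls:
  assumes p: "p \<in> hom d" "psi p \<noteq> 0"
  shows "nu n \<O> (cls n p) = lead (psi p)"
  unfolding nu_def
proof (rule the_equality)
  note l = lead_leads[OF supported_psi[OF hom_pring[OF p(1)]] p(2)]
  obtain q where q: "q \<in> filt n \<O> (lead (psi p))" "p - q \<in> I_C n" using hom_representative(1)[OF p] by blast
  have mem: "cls n p \<in> cls n ` filt n \<O> (lead (psi p))" using q cls_eq_iff by blast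
  have min: "leA (lead (psi p)) y" if y: "cls n p \<in> cls n ` filt n \<O> y" for y
  proof -
    obtain q where q: "q \<in> filt n \<O> y" "cls n p = cls n q" using y by (rule imageE) simp
    have "psi p = psi q" using q(2) by (rule cls_psi)
    then show ?thesis using lead_le[OF supported_psi[OF hom_pring[OF p(1)]] p(2)] filt_psi[OF q(1)] by simp
  qed
  show "lead (psi p) \<in> vecs n \<and> cls n p \<in> cls n ` filt n \<O> (lead (psi p)) \<and>
    (\<forall>y\<in>vecs n. cls n p \<in> cls n ` filt n \<O> y \<longrightarrow> less_A n \<O> (lead (psi p)) y \<or> lead (psi p) = y)"
    using l mem min unfolding leA_def by blast
  show "x = lead (psi p)" if x: "x \<in> vecs n \<and> cls n p \<in> cls n ` filt n \<O> x \<and>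
    (\<forall>y\<in>vecs n. cls n p \<in> cls n ` filt n \<O> y \<longrightarrow> less_A n \<O> x y \<or> x = y)" for x
  proof (rule leA_antisym)
    show "leA x (lead (psi p))" using x l mem unfolding leA_def by blast
    show "leA (lead (psi p)) x" using x min by blast
  qed
qed

section \<open>The function field\<close>

definition good :: "int list cpoly \<Rightarrow> int list cpoly \<Rightarrow> bool"
  where "good p q \<longleftrightarrow> (\<exists>d. p \<in> hom d \<and> q \<in> hom d) \<and> psi q \<noteq> 0"

lemma good_pring: "good p q \<Longrightarrow> p \<in> pring (Theta n) \<and> q \<in> pring (Theta n)"
  using hom_pring by (auto simp: good_def)

lemma good_supported: "good p q \<Longrightarrow> supported (psi p) \<and> supported (psi q) \<and> psi q \<noteq> 0"
  using supported_psi good_pring by (auto simp: good_def)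

lemma frac_pairs_eq: "frac_pairs n = {(cls n p, cls n q) | p q. good p q}"
proof (intro Set.set_eqI iffI)
  fix x assume "x \<in> frac_pairs n"
  then obtain \<mu> p q where x: "x = (cls n p, cls n q)" "p \<in> hom (trunc \<mu>)" "q \<in> hom (trunc \<mu>)" "cls n q \<noteq> \<zero>\<^bsub>RC n\<^esub>"
    unfolding frac_pairs_def RC_comp_eq by auto
  then have "good p q" using cls_zero_iff unfolding good_def by blast
  then show "x \<in> {(cls n p, cls n q) | p q. good p q}" using x(1) by blast
next
  fix x assume "x \<in> {(cls n p, cls n q) | p q. good p q}"
  then obtain p q where x: "x = (cls n p, cls n q)" "good p q" by blast
  then obtain d where d: "p \<in> hom (trunc d)" "q \<in> hom (trunc d)" "psi q \<noteq> 0" using hom_trunc unfolding good_def by blast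
  then have "cls n q \<noteq> \<zero>\<^bsub>RC n\<^esub>" using cls_zero_iff by blast
  then show "x \<in> frac_pairs n" using d x(1) unfolding frac_pairs_def RC_comp_eq by blast
qed

lemma good_frac_pairs: "good p q \<Longrightarrow> (cls n p, cls n q) \<in> frac_pairs n"
  unfolding frac_pairs_eq by blast

text \<open>Since \<open>I_C\<close> is the kernel of \<open>psi\<close> on graded pieces, equality
  of fractions is cross multiplication of Laurent polynomials.\<close>

lemma frac_rel_iff:
  assumes g: "good p q" "good p' q'"
  shows "((cls n p, cls n q), (cls n p', cls n q')) \<in> frac_rel n \<longleftrightarrow> psi p * psi q' = psi p' * psi q"
proof -
  obtain d e where d: "p \<in> hom d" "q \<in> hom d" "p' \<in> hom e" "q' \<in> hom e" using g unfolding good_def by blast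
  have h: "p * q' \<in> hom (\<lambda>k. d k + e k)" "p' * q \<in> hom (\<lambda>k. d k + e k)"
    using hom_mult[OF d(1,4)] hom_mult[OF d(3,2)] by (simp_all add: add.commute)
  have "((cls n p, cls n q), (cls n p', cls n q')) \<in> frac_rel n \<longleftrightarrow> cls n p \<otimes>\<^bsub>RC n\<^esub> cls n q' = cls n p' \<otimes>\<^bsub>RC n\<^esub> cls n q"
    using good_frac_pairs[OF g(1)] good_frac_pairs[OF g(2)] by (simp add: frac_rel_def)
  also have "\<dots> \<longleftrightarrow> cls n (p * q') = cls n (p' * q)" using good_pring[OF g(1)] good_pring[OF g(2)] by (simp add: cls_mult)
  also have "\<dots> \<longleftrightarrow> psi p * psi q' = psi p' * psi q"
    using psi_zero_I_C[OF hom_diff[OF h]] cls_psi[of "p * q'" "p' * q"] by (auto simp: cls_eq_iff psi_diff psi_mult)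
  finally show ?thesis .
qed

lemma supported_cancel: "supported f \<Longrightarrow> supported g \<Longrightarrow> supported h \<Longrightarrow> h \<noteq> 0 \<Longrightarrow> f * h = g * h \<Longrightarrow> f = g"
  using supported_mult_nonzero[OF supported_diff[of f g], of h] by (auto simp: left_diff_distrib)

lemma frac_equiv: "equiv (frac_pairs n) (frac_rel n)"
proof (rule equivI)
  show "refl_on (frac_pairs n) (frac_rel n)"
    unfolding refl_on_def by (auto simp: frac_pairs_eq frac_rel_iff)
  show "frac_rel n \<subseteq> frac_pairs n \<times> frac_pairs n" by (auto simp: frac_rel_def)
  show "sym (frac_rel n)" unfolding sym_def by (auto simp: frac_rel_def)
  show "trans (frac_rel n)"
  proof (rule transI)
    fix x y z assume xy: "(x, y) \<in> frac_rel n" "(y, z) \<in> frac_rel n"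
    then have "x \<in> frac_pairs n" "y \<in> frac_pairs n" "z \<in> frac_pairs n" by (auto simp: frac_rel_def)
    then obtain p q p' q' p'' q'' where g: "x = (cls n p, cls n q)" "good p q" "y = (cls n p', cls n q')" "good p' q'"
      "z = (cls n p'', cls n q'')" "good p'' q''" unfolding frac_pairs_eq by blast
    have e: "psi p * psi q' = psi p' * psi q" "psi p' * psi q'' = psi p'' * psi q'"
      using xy frac_rel_iff[OF g(2,4)] frac_rel_iff[OF g(4,6)] unfolding g(1,3,5) by simp_all
    have "psi p * psi q'' * psi q' = psi p'' * psi q * psi q'"
      using e by (rule cross_trans)
    \<comment> \<open>Transitivity needs the cancellation of \<open>psi q'\<close>; leading
      exponents show that nonzero supported Laurent polynomials have a nonzero product.\<close>
    then have "psi p * psi q'' = psi p'' * psi q"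
      using good_supported[OF g(2)] good_supported[OF g(4)] good_supported[OF g(6)]
        supported_cancel[of "psi p * psi q''" "psi p'' * psi q" "psi q'"] by (simp add: supported_mult)
    then show "(x, z) \<in> frac_rel n" using frac_rel_iff[OF g(2,6)] unfolding g(1,5) by simp
  qed
qed

definition fr :: "int list cpoly \<Rightarrow> int list cpoly \<Rightarrow> rat_fun" where "fr p q = ratio n (cls n p) (cls n q)"

lemma fr_eq_iff: "good p q \<Longrightarrow> good p' q' \<Longrightarrow> fr p q = fr p' q' \<longleftrightarrow> psi p * psi q' = psi p' * psi q"
proof -
  assume g: "good p q" "good p' q'"
  then have m: "(cls n p, cls n q) \<in> frac_pairs n" "(cls n p', cls n q') \<in> frac_pairs n" unfolding frac_pairs_eq by blast+
  show ?thesis unfolding fr_def ratio_def eq_equiv_class_iff[OF frac_equiv m] using frac_rel_iff[OF g] .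
qed

lemma fr_mem: "good p q \<Longrightarrow> x \<in> fr p q \<Longrightarrow> \<exists>p' q'. x = (cls n p', cls n q') \<and> good p' q' \<and> psi p * psi q' = psi p' * psi q"
proof -
  assume g: "good p q" "x \<in> fr p q"
  then have r: "((cls n p, cls n q), x) \<in> frac_rel n" by (simp add: fr_def ratio_def)
  then have "x \<in> frac_pairs n" by (auto simp: frac_rel_def)
  then obtain p' q' where x: "x = (cls n p', cls n q')" "good p' q'" unfolding frac_pairs_eq by blast
  then show ?thesis using r frac_rel_iff[OF g(1) x(2)] by blast
qed

lemma fr_self: "good p q \<Longrightarrow> (cls n p, cls n q) \<in> fr p q"
  using frac_rel_iff[of p q p q] by (simp add: fr_def ratio_def)

lemma UN_const: "a \<in> A \<Longrightarrow> (\<And>x. x \<in> A \<Longrightarrow> f x = c) \<Longrightarrow> (\<Union>x\<in>A. f x) = c"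
  by auto

lemma good_mult: "good p q \<Longrightarrow> good p' q' \<Longrightarrow> good (p * p') (q * q')"
proof -
  assume g: "good p q" "good p' q'"
  then obtain d e where d: "p \<in> hom d" "q \<in> hom d" "p' \<in> hom e" "q' \<in> hom e" unfolding good_def by blast
  have "psi (q * q') \<noteq> 0" using g[THEN good_supported] supported_mult_nonzero by (simp add: psi_mult)
  then show ?thesis unfolding good_def using hom_mult[OF d(1,3)] hom_mult[OF d(2,4)] by blast
qed

lemma good_add: "good p q \<Longrightarrow> good p' q' \<Longrightarrow> good (p * q' + p' * q) (q * q')"
proof -
  assume g: "good p q" "good p' q'"
  then obtain d e where d: "p \<in> hom d" "q \<in> hom d" "p' \<in> hom e" "q' \<in> hom e" unfolding good_def by blast
  have h: "p * q' \<in> hom (\<lambda>k. d k + e k)" "p' * q \<in> hom (\<lambda>k. d k + e k)"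
    using hom_mult[OF d(1,4)] hom_mult[OF d(3,2)] by (simp_all add: add.commute)
  have "psi (q * q') \<noteq> 0" using g[THEN good_supported] supported_mult_nonzero by (simp add: psi_mult)
  then show ?thesis unfolding good_def using hom_add[OF h] hom_mult[OF d(2,4)] by blast
qed

lemma CF_mult: "good p q \<Longrightarrow> good p' q' \<Longrightarrow> fr p q \<otimes>\<^bsub>CF n\<^esub> fr p' q' = fr (p * p') (q * q')"
proof -
  assume g: "good p q" "good p' q'"
  have "(\<Union>y\<in>fr p' q'. case y of (b, b') \<Rightarrow> ratio n (a \<otimes>\<^bsub>RC n\<^esub> b) (a' \<otimes>\<^bsub>RC n\<^esub> b')) = fr (p * p') (q * q')"
    if a: "(a, a') \<in> fr p q" for a a'
  proof (rule UN_const[OF fr_self[OF g(2)]])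
    obtain p1 q1 where 1: "a = cls n p1" "a' = cls n q1" "good p1 q1" "psi p * psi q1 = psi p1 * psi q"
      using fr_mem[OF g(1) a] by blast
    fix y assume "y \<in> fr p' q'"
    then obtain p2 q2 where 2: "y = (cls n p2, cls n q2)" "good p2 q2" "psi p' * psi q2 = psi p2 * psi q'"
      using fr_mem[OF g(2)] by blast
    have "psi (p1 * p2) * psi (q * q') = psi (p * p') * psi (q1 * q2)"
      unfolding psi_mult using 1(4) 2(3) by (rule cross_mult)
    then have "fr (p1 * p2) (q1 * q2) = fr (p * p') (q * q')"
      using fr_eq_iff[OF good_mult[OF 1(3) 2(2)] good_mult[OF g]] by simp
    then show "(case y of (b, b') \<Rightarrow> ratio n (a \<otimes>\<^bsub>RC n\<^esub> b) (a' \<otimes>\<^bsub>RC n\<^esub> b')) = fr (p * p') (q * q')"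
      using good_pring[OF 1(3)] good_pring[OF 2(2)] by (simp add: 1 2 cls_mult fr_def)
  qed
  then show ?thesis unfolding CF_def monoid.simps using fr_self[OF g(1)] by (intro UN_const) auto
qed

lemma CF_add: "good p q \<Longrightarrow> good p' q' \<Longrightarrow> fr p q \<oplus>\<^bsub>CF n\<^esub> fr p' q' = fr (p * q' + p' * q) (q * q')"
proof -
  assume g: "good p q" "good p' q'"
  let ?f = "\<lambda>a a' b b'. ratio n ((a \<otimes>\<^bsub>RC n\<^esub> b') \<oplus>\<^bsub>RC n\<^esub> (b \<otimes>\<^bsub>RC n\<^esub> a')) (a' \<otimes>\<^bsub>RC n\<^esub> b')"
  have "(\<Union>y\<in>fr p' q'. case y of (b, b') \<Rightarrow> ?f a a' b b') = fr (p * q' + p' * q) (q * q')"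
    if a: "(a, a') \<in> fr p q" for a a'
  proof (rule UN_const[OF fr_self[OF g(2)]])
    obtain p1 q1 where 1: "a = cls n p1" "a' = cls n q1" "good p1 q1" "psi p * psi q1 = psi p1 * psi q"
      using fr_mem[OF g(1) a] by blast
    fix y assume "y \<in> fr p' q'"
    then obtain p2 q2 where 2: "y = (cls n p2, cls n q2)" "good p2 q2" "psi p' * psi q2 = psi p2 * psi q'"
      using fr_mem[OF g(2)] by blast
    have "psi (p1 * q2 + p2 * q1) * psi (q * q') = (psi p1 * psi q) * (psi q2 * psi q') + (psi p2 * psi q') * (psi q1 * psi q)"
      unfolding psi_mult psi_add by (simp add: algebra_simps)
    also have "\<dots> = (psi p * psi q1) * (psi q2 * psi q') + (psi p' * psi q2) * (psi q1 * psi q)" using 1(4) 2(3) by simp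
    also have "\<dots> = psi (p * q' + p' * q) * psi (q1 * q2)"
      unfolding psi_mult psi_add by (simp add: algebra_simps)
    finally have "fr (p1 * q2 + p2 * q1) (q1 * q2) = fr (p * q' + p' * q) (q * q')"
      using fr_eq_iff[OF good_add[OF 1(3) 2(2)] good_add[OF g]] by simp
    then show "(case y of (b, b') \<Rightarrow> ?f a a' b b') = fr (p * q' + p' * q) (q * q')"
      using good_pring[OF 1(3)] good_pring[OF 2(2)] by (simp add: 1 2 cls_mult cls_add pring_mult fr_def)
  qed
  then show ?thesis unfolding CF_def ring.simps using fr_self[OF g(1)] by (intro UN_const) auto
qed

lemma good_const: "good (sg 0 c) 1"
  using hom_const[of c] hom_const[of 1] by (auto simp: good_def psi_1)

lemma good_01: "good 0 1" "good 1 1"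
  using good_const[of 0] good_const[of 1] by simp_all

lemma CF_0: "\<zero>\<^bsub>CF n\<^esub> = fr 0 1"
  by (simp add: CF_def fr_def cls_0 cls_1)

lemma CF_const_eq: "CF_const n c = fr (sg 0 c) 1"
  by (simp add: CF_const_def fr_def cls_1 pconst_def)

lemma fr_zero_iff: "good p q \<Longrightarrow> fr p q = \<zero>\<^bsub>CF n\<^esub> \<longleftrightarrow> psi p = 0"
  using fr_eq_iff[OF _ good_01(1), of p q] by (simp add: CF_0 psi_0 psi_1)

lemma CF_carrier: "f \<in> carrier (CF n) \<Longrightarrow> \<exists>p q. good p q \<and> f = fr p q"
  by (auto simp: CF_def quotient_def frac_pairs_eq fr_def ratio_def)

lemma nu_F_fr: "good p q \<Longrightarrow> psi p \<noteq> 0 \<Longrightarrow> nu_F n \<O> (fr p q) = lead (psi p) - lead (psi q)"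
proof -
  assume g: "good p q" "psi p \<noteq> 0"
  have nu: "nu n \<O> (cls n p') - nu n \<O> (cls n q') = lead (psi p') - lead (psi q')" if "good p' q'" "psi p' \<noteq> 0" for p' q'
    using that nu_cls unfolding good_def by metis
  have "(case x of (a, b) \<Rightarrow> nu n \<O> a - nu n \<O> b) = lead (psi p) - lead (psi q)" if x: "x \<in> fr p q" for x
  proof -
    obtain p' q' where 1: "x = (cls n p', cls n q')" "good p' q'" "psi p * psi q' = psi p' * psi q"
      using fr_mem[OF g(1) x] by blast
    note V = good_supported[OF g(1)] good_supported[OF 1(2)]
    have ne: "psi p' \<noteq> 0" using supported_mult_nonzero[of "psi p" "psi q'"] V g(2) 1(3) by auto
    have "lead (psi p) + lead (psi q') = lead (psi p') + lead (psi q)"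
      using lead_mult[of "psi p" "psi q'"] lead_mult[of "psi p'" "psi q"] V g(2) ne 1(3) by simp
    then have "lead (psi p) - lead (psi q) = lead (psi p') - lead (psi q')" by (rule diff_eq_of_add_eq)
    then show ?thesis using nu[OF 1(2) ne] by (simp add: 1(1))
  qed
  then have "(\<lambda>(a, b). nu n \<O> a - nu n \<O> b) ` fr p q = {lead (psi p) - lead (psi q)}" using fr_self[OF g(1)] by force
  then show ?thesis by (simp add: nu_F_def)
qed

definition xinv :: "(int \<times> int \<Rightarrow>\<^sub>0 int) \<Rightarrow> (int \<times> int \<Rightarrow>\<^sub>0 int)" where "xinv = inv_into (vecs n) (xi n \<O>)"

lemma xinv: "v \<in> vecs n \<Longrightarrow> xinv v \<in> vecs n \<and> xi n \<O> (xinv v) = v"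
  using xi_bij unfolding xinv_def bij_betw_def by (metis f_inv_into_f inv_into_into)

lemma xinv_xi: "v \<in> vecs n \<Longrightarrow> xinv (xi n \<O> v) = v"
  using xi_bij unfolding xinv_def bij_betw_def by (metis inv_into_f_f)

lemma xinv_add: "u \<in> vecs n \<Longrightarrow> v \<in> vecs n \<Longrightarrow> xinv (u + v) = xinv u + xinv v"
  using xinv_xi[of "xinv u + xinv v"] xinv[of u] xinv[of v] by (simp add: xi_add vecs_add)

lemma nu_xi_fr: "good p q \<Longrightarrow> psi p \<noteq> 0 \<Longrightarrow> nu_xi n \<O> (fr p q) = xinv (lead (psi p) - lead (psi q))"
  by (simp add: nu_xi_def nu_F_fr xinv_def)

lemma lead_vecs: "supported f \<Longrightarrow> f \<noteq> 0 \<Longrightarrow> lead f \<in> vecs n"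
  using lead_leads by blast

lemma lead_diff_vecs: "good p q \<Longrightarrow> psi p \<noteq> 0 \<Longrightarrow> lead (psi p) - lead (psi q) \<in> vecs n"
  using good_supported[of p q] lead_vecs by (simp add: vecs_diff)

lemma order_A_xi: "total_group_order n (less_A_xi n \<O>)"
proof -
  have inj: "xi n \<O> x = xi n \<O> y \<Longrightarrow> x = y" if "x \<in> vecs n" "y \<in> vecs n" for x y :: "int \<times> int \<Rightarrow>\<^sub>0 int"
    using xi_bij that unfolding bij_betw_def by (metis inj_onD)
  show ?thesis unfolding total_group_order_def less_A_xi_def
  proof (intro conjI ballI impI)
    fix x y :: "int \<times> int \<Rightarrow>\<^sub>0 int" assume "x \<in> vecs n" "y \<in> vecs n" "x \<noteq> y"
    then have "xi n \<O> x \<noteq> xi n \<O> y" using inj[of x y] by metis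
    then show "less_A n \<O> (xi n \<O> x) (xi n \<O> y) \<or> less_A n \<O> (xi n \<O> y) (xi n \<O> x)"
      by (rule less_A_total[OF xi_vecs xi_vecs])
  next
    fix x y z :: "int \<times> int \<Rightarrow>\<^sub>0 int"
    show "less_A n \<O> (xi n \<O> (x + z)) (xi n \<O> (y + z))" if "less_A n \<O> (xi n \<O> x) (xi n \<O> y)"
      using that by (simp add: xi_add less_A_add)
    show "less_A n \<O> (xi n \<O> x) (xi n \<O> z)"
      if t: "less_A n \<O> (xi n \<O> x) (xi n \<O> y) \<and> less_A n \<O> (xi n \<O> y) (xi n \<O> z)"
      using less_A_trans[OF conjunct1[OF t] conjunct2[OF t]] .
  qed (rule less_A_irrefl)
qed

lemma leA_xi: "x \<in> vecs n \<Longrightarrow> y \<in> vecs n \<Longrightarrow> leA (xi n \<O> x) (xi n \<O> y) \<longleftrightarrow> less_A_xi n \<O> x y \<or> x = y"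
  using inj_on_eq_iff[OF bij_betw_imp_inj_on[OF xi_bij], of x y] unfolding leA_def less_A_xi_def by blast

lemma lead_add_le:
  assumes "supported f" "supported g" "f + g \<noteq> 0" "f \<noteq> 0 \<Longrightarrow> leA (lead f) x" "g \<noteq> 0 \<Longrightarrow> leA (lead g) x"
  shows "leA (lead (f + g)) x"
proof (rule lead_le)
  have *: "leA y x" if "supported h" "h \<noteq> 0 \<Longrightarrow> leA (lead h) x" "y \<in> ks h" for h y
  proof -
    have h: "h \<noteq> 0" using that(3) by auto
    then show ?thesis using lead_leads[OF that(1)] that(2,3) leA_trans unfolding leads_def by blast
  qed
  fix y assume "y \<in> ks (f + g)"
  then show "leA y x" using keys_add[of f g] *[of f y] *[of g y] assms by blast
qed (use assms supported_add in auto)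

lemma valuation_nu_xi: "is_valuation n (less_A_xi n \<O>) (nu_xi n \<O>)"
proof -
  let ?K = "carrier (CF n) - {\<zero>\<^bsub>CF n\<^esub>}"
  have K: "\<exists>p q. good p q \<and> psi p \<noteq> 0 \<and> f = fr p q" if "f \<in> ?K" for f
    using CF_carrier[of f] fr_zero_iff that by blast
  have m: "nu_xi n \<O> (fr p q \<otimes>\<^bsub>CF n\<^esub> fr p' q') = nu_xi n \<O> (fr p q) + nu_xi n \<O> (fr p' q')"
    if g: "good p q" "psi p \<noteq> 0" "good p' q'" "psi p' \<noteq> 0" for p q p' q'
  proof -
    note V = good_supported[OF g(1)] good_supported[OF g(3)]
    have "psi (p * p') \<noteq> 0" using V supported_mult_nonzero g by (simp add: psi_mult)
    then have "nu_xi n \<O> (fr p q \<otimes>\<^bsub>CF n\<^esub> fr p' q') = xinv (lead (psi (p * p')) - lead (psi (q * q')))"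
      using CF_mult[OF g(1,3)] nu_xi_fr[OF good_mult[OF g(1,3)]] by simp
    also have "lead (psi (p * p')) - lead (psi (q * q')) = (lead (psi p) - lead (psi q)) + (lead (psi p') - lead (psi q'))"
      using V g by (simp add: psi_mult lead_mult)
    finally show ?thesis using g by (simp add: xinv_add lead_diff_vecs nu_xi_fr)
  qed
  have c: "nu_xi n \<O> (CF_const n c \<otimes>\<^bsub>CF n\<^esub> f) = nu_xi n \<O> f" if "f \<in> ?K" "c \<noteq> 0" for f c
  proof -
    obtain p q where p: "good p q" "psi p \<noteq> 0" "f = fr p q" using K[OF \<open>f \<in> ?K\<close>] by blast
    have pc: "psi (sg 0 c) = sg 0 c" using psi_scale[of c 1] by (simp add: psi_1)
    have "leads (sg 0 c) 0 c" by (rule leads_single)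
    then have z: "lead (psi (sg 0 c)) = 0" "lead (psi 1) = 0" using leads_lead \<open>c \<noteq> 0\<close> leads_1 by (simp_all add: pc psi_1)
    have ne: "psi (sg 0 c) \<noteq> 0" unfolding pc using leads_nonzero[OF leads_single \<open>c \<noteq> 0\<close>] .
    have "nu_xi n \<O> (fr (sg 0 c) 1) = xinv 0"
      using nu_xi_fr[OF good_const ne] z by simp
    also have "\<dots> = 0" using xinv_xi[of 0] by (simp add: vecs_0 xi_0)
    finally show ?thesis using m[OF good_const[of c] ne p(1,2)] by (simp add: CF_const_eq p(3))
  qed
  have a: "leA (xi n \<O> (nu_xi n \<O> (f \<oplus>\<^bsub>CF n\<^esub> g))) (xi n \<O> w) \<and> nu_xi n \<O> (f \<oplus>\<^bsub>CF n\<^esub> g) \<in> vecs n"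
    if fg: "f \<in> ?K" "g \<in> ?K" "f \<oplus>\<^bsub>CF n\<^esub> g \<noteq> \<zero>\<^bsub>CF n\<^esub>"
      and w: "w \<in> vecs n" "leA (xi n \<O> (nu_xi n \<O> f)) (xi n \<O> w)" "leA (xi n \<O> (nu_xi n \<O> g)) (xi n \<O> w)" for f g w
  proof -
    obtain p q where p: "good p q" "psi p \<noteq> 0" "f = fr p q" using K[OF fg(1)] by blast
    obtain p' q' where p': "good p' q'" "psi p' \<noteq> 0" "g = fr p' q'" using K[OF fg(2)] by blast
    note V = good_supported[OF p(1)] good_supported[OF p'(1)]
    note s = CF_add[OF p(1) p'(1)] and gs = good_add[OF p(1) p'(1)]
    have ne: "psi (p * q' + p' * q) \<noteq> 0" using fg(3) fr_zero_iff[OF gs] s p(3) p'(3) by simp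
    have xf: "xi n \<O> (nu_xi n \<O> f) = lead (psi p) - lead (psi q)" "xi n \<O> (nu_xi n \<O> g) = lead (psi p') - lead (psi q')"
      using p p' xinv lead_diff_vecs by (simp_all add: nu_xi_fr)
    \<comment> \<open>\<open>?l\<close> is the leading exponent of the common denominator. Adding it
      clears denominators and leaves a statement about the sum of two Laurent polynomials.\<close>
    let ?l = "lead (psi q) + lead (psi q')"
    have "leA (lead (psi p) - lead (psi q) + ?l) (xi n \<O> w + ?l)" "leA (lead (psi p') - lead (psi q') + ?l) (xi n \<O> w + ?l)"
      using leA_add[OF w(2) leA_refl] leA_add[OF w(3) leA_refl] unfolding xf by blast+
    moreover have "lead (psi p * psi q') = lead (psi p) - lead (psi q) + ?l"
      "lead (psi p' * psi q) = lead (psi p') - lead (psi q') + ?l"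
      using V p(2) p'(2) by (simp_all add: lead_mult)
    ultimately have "leA (lead (psi p * psi q')) (xi n \<O> w + ?l)" "leA (lead (psi p' * psi q)) (xi n \<O> w + ?l)"
      by simp_all
    then have "leA (lead (psi (p * q' + p' * q))) (xi n \<O> w + ?l)"
      using V ne unfolding psi_add psi_mult by (intro lead_add_le supported_mult) auto
    then have "leA (lead (psi (p * q' + p' * q)) + - ?l) (xi n \<O> w + ?l + - ?l)" using leA_refl by (rule leA_add)
    then have "leA (lead (psi (p * q' + p' * q)) - ?l) (xi n \<O> w)" by (simp only: diff_conv_add_uminus[symmetric] add_diff_cancel_right')
    moreover have "lead (psi (q * q')) = ?l" using V by (simp add: psi_mult lead_mult)
    ultimately have l: "leA (lead (psi (p * q' + p' * q)) - lead (psi (q * q'))) (xi n \<O> w)" by (simp only:)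
    have nv: "nu_xi n \<O> (f \<oplus>\<^bsub>CF n\<^esub> g) = xinv (lead (psi (p * q' + p' * q)) - lead (psi (q * q')))"
      using nu_xi_fr[OF gs ne] s p(3) p'(3) by simp
    show ?thesis unfolding nv using l xinv[OF lead_diff_vecs[OF gs ne]] by simp
  qed
  have v: "nu_xi n \<O> f \<in> vecs n" if f: "f \<in> ?K" for f
  proof -
    obtain p q where p: "good p q" "psi p \<noteq> 0" "f = fr p q" using K[OF f] by blast
    then show ?thesis using xinv lead_diff_vecs by (simp add: nu_xi_fr)
  qed
  have mm: "nu_xi n \<O> (f \<otimes>\<^bsub>CF n\<^esub> g) = nu_xi n \<O> f + nu_xi n \<O> g" if "f \<in> ?K" "g \<in> ?K" for f g
    using m K[OF that(1)] K[OF that(2)] by blast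
  have aa: "less_A_xi n \<O> (nu_xi n \<O> (f \<oplus>\<^bsub>CF n\<^esub> g)) w \<or> nu_xi n \<O> (f \<oplus>\<^bsub>CF n\<^esub> g) = w"
    if fg: "f \<in> ?K" "g \<in> ?K" "f \<oplus>\<^bsub>CF n\<^esub> g \<noteq> \<zero>\<^bsub>CF n\<^esub>"
      and w: "w = (if less_A_xi n \<O> (nu_xi n \<O> f) (nu_xi n \<O> g) then nu_xi n \<O> g else nu_xi n \<O> f)" for f g w
  proof -
    note vf = v[OF fg(1)] and vg = v[OF fg(2)]
    have wv: "w \<in> vecs n" using vf vg by (simp add: w)
    have "leA (xi n \<O> (nu_xi n \<O> f)) (xi n \<O> w) \<and> leA (xi n \<O> (nu_xi n \<O> g)) (xi n \<O> w)"
    proof (cases "less_A_xi n \<O> (nu_xi n \<O> f) (nu_xi n \<O> g)")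
      case False
      then have "leA (xi n \<O> (nu_xi n \<O> g)) (xi n \<O> (nu_xi n \<O> f))"
        using leA_total[OF xi_vecs xi_vecs, of "nu_xi n \<O> f" "nu_xi n \<O> g"]
        unfolding leA_def less_A_xi_def by auto
      then show ?thesis using False by (simp add: w)
    qed (simp add: w leA_def less_A_xi_def)
    then have "leA (xi n \<O> (nu_xi n \<O> (f \<oplus>\<^bsub>CF n\<^esub> g))) (xi n \<O> w) \<and> nu_xi n \<O> (f \<oplus>\<^bsub>CF n\<^esub> g) \<in> vecs n"
      using a[OF fg wv] by blast
    then show ?thesis using leA_xi[OF _ wv] by blast
  qed
  show ?thesis unfolding is_valuation_def Let_def
    using v mm c aa by (intro conjI ballI allI impI) auto
qed

section \<open>The section \<open>\<tau>\<close> and the values of the valuation\<close>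

abbreviation tt :: "nat \<Rightarrow> int list" where "tt k \<equiv> [1..int k]"

lemma tt_tuples: "k \<le> n \<Longrightarrow> tt k \<in> tuples n k"
proof -
  assume k: "k \<le> n"
  have "sorted_wrt (\<lessdot>) (tt k)"
    unfolding sorted_wrt_iff_nth_less by (auto simp: nless_def)
  then show ?thesis using k by (auto simp: tuples_def signed_range_def)
qed

lemma tt_Theta: "1 \<le> k \<Longrightarrow> k \<le> n \<Longrightarrow> tt k \<in> Theta n"
proof -
  assume k: "1 \<le> k" "k \<le> n"
  have "card {i \<in> {1..int k}. \<bar>i\<bar> \<le> int l} \<le> l" for l
  proof -
    have "card {i \<in> {1..int k}. \<bar>i\<bar> \<le> int l} \<le> card {1..int l}" by (intro card_mono) auto
    then show ?thesis by simp
  qed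
  then have "admissible n (tt k)" by (simp add: admissible_def)
  then show ?thesis using tt_tuples[OF k(2)] k unfolding Theta_def all_tuples_def by auto
qed

text \<open>The tuple permutes \<open>{1..k}\<close>, and its entry in row \<open>j\<close>, being
  positive and in \<open>rws j\<close>, is at least \<open>j\<close>. Equal sums then force equality
  everywhere.\<close>

lemma ideal_tuple_tt: "1 \<le> k \<Longrightarrow> k \<le> n \<Longrightarrow> i \<in> {1..int k} \<Longrightarrow> ideal_tuple (ideal_of (tt k)) i = i"
proof -
  assume k: "1 \<le> k" "k \<le> n" "i \<in> {1..int k}"
  note J = ideal_of[OF tt_Theta[OF k(1,2)]]
  have J1: "ideal_of (tt k) \<in> ideals_k n k" and J2: "ideal_tuple (ideal_of (tt k)) ` {1..int k} = {1..int k}" using J by simp_all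
  have inj: "inj_on (ideal_tuple (ideal_of (tt k))) {1..int k}" using ideal_tuple_inj_on[OF J1] .
  have ge: "j \<le> ideal_tuple (ideal_of (tt k)) j" if j: "j \<in> {1..int k}" for j
  proof -
    have "(j, j) \<in> ideal_of (tt k)" "ideal_of (tt k) \<in> ideals n" using ideals_k_diag[OF J1] j by auto
    then have "ideal_tuple (ideal_of (tt k)) j \<in> rws j" using ideal_tuple_row by blast
    moreover have "ideal_tuple (ideal_of (tt k)) j \<in> {1..int k}" using J2 j by blast
    ultimately show ?thesis by (auto simp: rws_def)
  qed
  have "(\<Sum>j\<in>{1..int k}. ideal_tuple (ideal_of (tt k)) j) = (\<Sum>j\<in>{1..int k}. j)"
    using sum.reindex[OF inj, of "\<lambda>x. x"] J2 by simp
  then show ?thesis using sum_mono_inv[of "\<lambda>j. j" "{1..int k}" "ideal_tuple (ideal_of (tt k))"] ge k(3) by simp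
qed

lemma J_id_eq: "1 \<le> k \<Longrightarrow> k \<le> n \<Longrightarrow> J_id n \<O> k = ideal_of (tt k)"
proof -
  assume k: "1 \<le> k" "k \<le> n"
  have J1: "ideal_of (tt k) \<in> ideals_k n k" using ideal_of(1)[OF tt_Theta[OF k]] by simp
  have w: "w_OJ n \<O> J i = ideal_tuple J i" if "J \<in> ideals_k n k" "i \<in> {1..int k}" for J i
    using ideals_k_diag[OF that(1)] that(2) w_OJ_ideal_tuple by auto
  show ?thesis unfolding J_id_def
  proof (rule the_equality)
    show "ideal_of (tt k) \<in> ideals_k n k \<and> (\<forall>i\<in>{1..int k}. w_OJ n \<O> (ideal_of (tt k)) i = i)"
      using J1 w[OF J1] ideal_tuple_tt[OF k] by simp
    fix J assume J: "J \<in> ideals_k n k \<and> (\<forall>i\<in>{1..int k}. w_OJ n \<O> J i = i)"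
    have "ideal_tuple J ` {1..int k} = {1..int k}" using J w[of J] by force
    moreover have "ideal_tuple (ideal_of (tt k)) ` {1..int k} = {1..int k}" using ideal_tuple_tt[OF k] by force
    ultimately have "ideal_tuple J ` {1..int k} = ideal_tuple (ideal_of (tt k)) ` {1..int k}" by simp
    then show "J = ideal_of (tt k)"
      using inj_onD[OF bij_betw_imp_inj_on[OF bij_ideals_admk[OF k(2)]], of J "ideal_of (tt k)"] J J1 by blast
  qed
qed

definition tmon :: "(nat \<Rightarrow> nat) \<Rightarrow> (int list \<Rightarrow>\<^sub>0 nat)" where "tmon a = (\<Sum>k=1..n. sg (tt k) (a k))"

lemma tt_inj: "tt k = tt l \<longleftrightarrow> k = l"
proof
  assume "tt k = tt l"
  then have "length (tt k) = length (tt l)" by (rule arg_cong)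
  then show "k = l" by simp
qed (rule arg_cong)

lemma lk_tmon: "lk (tmon a) t = (\<Sum>k=1..n. if tt k = t then a k else 0)"
  by (simp add: tmon_def lookup_sum lookup_single when_def)

lemma ks_tmon: "ks (tmon a) \<subseteq> tt ` {1..n}"
proof
  fix t assume "t \<in> ks (tmon a)"
  then have "(\<Sum>k=1..n. if tt k = t then a k else 0) \<noteq> 0" by (simp add: in_keys_iff lk_tmon)
  then obtain k where "k \<in> {1..n}" "(if tt k = t then a k else 0) \<noteq> 0" by (rule sum.not_neutral_contains_not_neutral)
  then show "t \<in> tt ` {1..n}" by (auto split: if_splits)
qed

lemma lk_tmon_tt: "k \<in> {1..n} \<Longrightarrow> lk (tmon a) (tt k) = a k"
  unfolding lk_tmon tt_inj by (simp add: sum.delta)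

lemma tmon_Theta: "ks (tmon a) \<subseteq> Theta n"
  using ks_tmon[of a] tt_Theta by auto

lemma lsum_tmon: "lsum g (tmon a) = (\<Sum>k=1..n. a k * g (tt k))"
  unfolding tmon_def by (induction rule: infinite_finite_induct[of _ "{1..n}"]) (simp_all add: lsum_add lsum_single lsum_0)

lemma dgr_tmon: "dgr (tmon a) = trunc a"
proof
  fix k show "dgr (tmon a) k = trunc a k"
    by (simp add: dgr_def lsum_tmon trunc_def if_distrib sum.delta cong: if_cong)
qed

lemma sg_tmon: "sg (tmon a) 1 = (\<Prod>k=1..n. pvar (tt k) ^ a k)"
proof -
  have p: "pvar t ^ c = sg (sg t c) 1" for t and c :: nat
    by (induction c) (simp_all add: pvar_def mult_single single_add[symmetric])
  have "(\<Prod>k\<in>A. sg (sg (tt k) (a k)) (1::complex)) = sg (\<Sum>k\<in>A. sg (tt k) (a k)) 1" for A :: "nat set"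
    by (induction A rule: infinite_finite_induct) (simp_all add: mult_single)
  then show ?thesis by (simp add: p tmon_def)
qed

lemma tau_eq: "tau n a = cls n (sg (tmon a) 1)"
proof -
  have "Xvar (tt k) = pvar (tt k)" if "k \<in> {1..n}" for k using Xvar_tuple[OF tt_tuples[of k]] that by simp
  then show ?thesis by (simp add: tau_def sg_tmon)
qed

lemma tmon_hom: "sg (tmon a) 1 \<in> hom (trunc a)"
  by (rule hom_single[OF tmon_Theta dgr_tmon])

lemma tau_pow: "tau n a [^]\<^bsub>RC n\<^esub> m = tau n (\<lambda>k. m * a k)"
proof -
  have "sg (tmon a) (1::complex) ^ m = sg (tmon (\<lambda>k. m * a k)) 1"
    by (simp add: sg_tmon prod_power_distrib power_mult[symmetric] mult.commute)
  then show ?thesis by (simp add: tau_eq cls_pow[OF hom_pring[OF tmon_hom]])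
qed

lemma pm_nonzero: "ks m \<subseteq> Theta n \<Longrightarrow> pm m \<noteq> 0 \<and> lead (pm m) = expo n \<O> m"
  using leads_psi_mono[of m] leads_nonzero leads_lead by blast

lemma tau_H0: "tau n a \<in> H0 n a - {\<zero>\<^bsub>RC n\<^esub>}"
  using cls_zero_iff[OF tmon_hom] pm_nonzero[OF tmon_Theta] tmon_hom unfolding H0_def RC_comp_eq tau_eq by blast

lemma good_tmon: "p \<in> hom (trunc a) \<Longrightarrow> good p (sg (tmon a) 1)"
  using tmon_hom pm_nonzero[OF tmon_Theta] unfolding good_def by blast

lemma nu_value:
  assumes "p \<in> hom (trunc a)" "lead (psi p) = expo n \<O> m" "ks m \<subseteq> Theta n" "psi p \<noteq> 0"
  shows "nu_xi n \<O> (ratio n (cls n p) (tau n a)) = ideal_sum m - ideal_sum (tmon a)"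
proof -
  have e: "expo n \<O> m - expo n \<O> (tmon a) = xi n \<O> (ideal_sum m - ideal_sum (tmon a))"
    using assms(3) tmon_Theta by (simp add: expo_ideal_sum xi_diff)
  have "nu_xi n \<O> (fr p (sg (tmon a) 1)) = xinv (expo n \<O> m - expo n \<O> (tmon a))"
    using nu_xi_fr[OF good_tmon[OF assms(1)] assms(4)] assms(2) pm_nonzero[OF tmon_Theta] by simp
  also have "\<dots> = ideal_sum m - ideal_sum (tmon a)" unfolding e
    using ideal_sum_vecs assms(3) tmon_Theta by (intro xinv_xi vecs_diff) blast+
  finally show ?thesis by (simp add: fr_def tau_eq)
qed

definition rl :: "(int \<times> int \<Rightarrow>\<^sub>0 int) \<Rightarrow> (int \<times> int \<Rightarrow>\<^sub>0 real)" where "rl = Poly_Mapping.map real_of_int"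

lemma lk_rl: "lk (rl x) p = real_of_int (lk x p)"
  by (simp add: rl_def Poly_Mapping.map.rep_eq when_def)

definition pts :: "(nat \<Rightarrow> nat) \<Rightarrow> (int \<times> int \<Rightarrow>\<^sub>0 real) set"
  where "pts a = {(1 / real m) *\<^sub>R rl (nu_xi n \<O> (ratio n \<sigma> (tau n a [^]\<^bsub>RC n\<^esub> m))) | m \<sigma>.
          0 < m \<and> \<sigma> \<in> H0 n (\<lambda>k. m * a k) - {\<zero>\<^bsub>RC n\<^esub>}}"

lemma NO_body_pts: "NO_body n a (tau n a) (less_A_xi n \<O>) (nu_xi n \<O>) = closure (convex hull (pts a))"
  unfolding NO_body_def pts_def rl_def using tau_H0 order_A_xi valuation_nu_xi by simp

text \<open>By \<open>hom_representative\<close> the leading exponent of a section is that of a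
  chain monomial, and the denominator is a monomial with known exponent.\<close>

lemma pts_subset:
  assumes "x \<in> pts a"
  shows "\<exists>m m'. 0 < m \<and> ks m' \<subseteq> Theta n \<and> dgr m' = trunc (\<lambda>k. m * a k) \<and>
    x = (1 / real m) *\<^sub>R rl (ideal_sum m' - ideal_sum (tmon (\<lambda>k. m * a k)))"
proof -
  obtain m \<sigma> where m: "0 < m" "\<sigma> \<in> H0 n (\<lambda>k. m * a k)" "\<sigma> \<noteq> \<zero>\<^bsub>RC n\<^esub>"
    "x = (1 / real m) *\<^sub>R rl (nu_xi n \<O> (ratio n \<sigma> (tau n (\<lambda>k. m * a k))))"
    using assms unfolding pts_def tau_pow by blast
  obtain p where p: "p \<in> hom (trunc (\<lambda>k. m * a k))" "\<sigma> = cls n p" using m(2) unfolding H0_def RC_comp_eq by blast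
  have ne: "psi p \<noteq> 0" using m(3) p cls_zero_iff by blast
  obtain m' where m': "m' \<in> Cset (trunc (\<lambda>k. m * a k))" "lead (psi p) = expo n \<O> m'"
    using hom_representative(2)[OF p(1) ne] by blast
  have "nu_xi n \<O> (ratio n \<sigma> (tau n (\<lambda>k. m * a k))) = ideal_sum m' - ideal_sum (tmon (\<lambda>k. m * a k))"
    unfolding p(2) using Cset_Theta[OF m'(1)] by (intro nu_value[OF p(1) m'(2) _ ne]) blast
  then have "x = (1 / real m) *\<^sub>R rl (ideal_sum m' - ideal_sum (tmon (\<lambda>k. m * a k)))" using m(4) by simp
  then show ?thesis using m(1) Cset_Theta[OF m'(1)] by (intro exI[of _ m] exI[of _ m'] conjI) simp_all
qed

text \<open>The first power of the line bundle suffices, and the section may be taken to be a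
  monomial.\<close>

lemma pts_supset:
  assumes "ks m \<subseteq> Theta n" "dgr m = trunc a"
  shows "rl (ideal_sum m - ideal_sum (tmon a)) \<in> pts a"
proof -
  have p: "sg m 1 \<in> hom (trunc a)" using assms by (rule hom_single)
  have "cls n (sg m 1) \<in> H0 n a - {\<zero>\<^bsub>RC n\<^esub>}"
    using cls_zero_iff[OF p] pm_nonzero[OF assms(1)] p unfolding H0_def RC_comp_eq by blast
  moreover have "nu_xi n \<O> (ratio n (cls n (sg m 1)) (tau n a)) = ideal_sum m - ideal_sum (tmon a)"
    using pm_nonzero[OF assms(1)] by (intro nu_value[OF p _ assms(1)]) blast+
  ultimately show ?thesis unfolding pts_def tau_pow
    by (intro CollectI exI[of _ "Suc 0"] exI[of _ "cls n (sg m 1)"]) simp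
qed

lemma ideal_sum_tmon: "ideal_sum (tmon a) = (\<Sum>k=1..n. frag_cmul (int (a k)) (ind (M_set \<O> (J_id n \<O> k))))"
proof -
  have i: "inj_on tt {1..n}" using tt_inj by (intro inj_onI) blast
  have "ideal_sum (tmon a) = (\<Sum>t\<in>tt ` {1..n}. frag_cmul (int (lk (tmon a) t)) (ind (M_set \<O> (ideal_of t))))"
    unfolding ideal_sum_def using ks_tmon by (intro sum.mono_neutral_left) (auto simp: in_keys_iff)
  also have "\<dots> = (\<Sum>k=1..n. frag_cmul (int (lk (tmon a) (tt k))) (ind (M_set \<O> (ideal_of (tt k)))))"
    by (subst sum.reindex[OF i]) simp
  also have "\<dots> = (\<Sum>k=1..n. frag_cmul (int (a k)) (ind (M_set \<O> (J_id n \<O> k))))"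
    using J_id_eq lk_tmon_tt by (intro sum.cong refl) simp
  finally show ?thesis .
qed

lemma finite_J_id: "k \<in> {1..n} \<Longrightarrow> finite (M_set \<O> (J_id n \<O> k))"
  using M_set_ideal_of[OF tt_Theta[of k]] J_id_eq[of k] finite_poset finite_subset M_set_subset by auto

lemma lookup_scaleR: "lk (r *\<^sub>R x) p = r *\<^sub>R lk (x :: 'b \<Rightarrow>\<^sub>0 'c::real_vector) p"
proof -
  have "finite {i. r *\<^sub>R lk x i \<noteq> 0}" by (rule finite_subset[OF _ finite_keys[of x]]) (auto simp: in_keys_iff)
  then show ?thesis by (simp add: scaleR_poly_mapping_def)
qed

lemma rl_ideal_sum_tmon: "rl (ideal_sum (tmon a)) = x_lam n \<O> a"
proof (rule poly_mapping_eqI)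
  fix p
  show "lk (rl (ideal_sum (tmon a))) p = lk (x_lam n \<O> a) p"
    using finite_J_id by (auto simp: lk_rl ideal_sum_tmon x_lam_def lookup_sum lookup_scaleR lookup_ind intro!: sum.cong)
qed

lemma tmon_mult: "ideal_sum (tmon (\<lambda>k. m * a k)) = frag_cmul (int m) (ideal_sum (tmon a))"
  by (rule poly_mapping_eqI) (simp add: ideal_sum_tmon lookup_sum sum_distrib_left mult.assoc)

section \<open>The polytope\<close>

lemma pprec_irrefl: "\<not> p \<prec>\<^sub>P p"
  by (simp add: pprec_def)

lemma pprec_trans: "p \<in> poset n \<Longrightarrow> q \<in> poset n \<Longrightarrow> r \<in> poset n \<Longrightarrow> p \<prec>\<^sub>P q \<Longrightarrow> q \<prec>\<^sub>P r \<Longrightarrow> p \<prec>\<^sub>P r"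
proof -
  assume *: "p \<in> poset n" "q \<in> poset n" "r \<in> poset n" "p \<prec>\<^sub>P q" "q \<prec>\<^sub>P r"
  obtain i j i' j' i'' j'' where e: "p = (i, j)" "q = (i', j')" "r = (i'', j'')" by (cases p, cases q, cases r) blast
  note P = *(1,2,3)[unfolded e]
  have a: "i \<le> i' \<and> ky j \<le> ky j' \<and> (i, j) \<noteq> (i', j')" using *(4) pprec_ky[OF P(1,2)] by (simp add: e)
  have b: "i' \<le> i'' \<and> ky j' \<le> ky j'' \<and> (i', j') \<noteq> (i'', j'')" using *(5) pprec_ky[OF P(2,3)] by (simp add: e)
  have "(i, j) \<noteq> (i'', j'')"
  proof
    assume "(i, j) = (i'', j'')"
    then have "i = i'" "ky j = ky j'" using a b by auto
    then show False using a P(1,2) ky_inj_row[of i j j'] by (auto simp: poset_iff)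
  qed
  then show ?thesis using a b pprec_ky[OF P(1,3)] by (simp add: e)
qed

lemma pprec_bottom: "p \<in> poset n \<Longrightarrow> p \<noteq> (1, 1) \<Longrightarrow> (1, 1) \<prec>\<^sub>P p"
proof -
  assume p: "p \<in> poset n" "p \<noteq> (1, 1)"
  obtain i j where e: "p = (i, j)" by (cases p)
  have 1: "(1, 1) \<in> poset n" using n1 by (auto simp: poset_def)
  have "ky 1 \<le> ky j" using ky_diag[of 1 j] row_mono[of 1 i] p by (auto simp: e poset_iff)
  then show ?thesis using pprec_ky[OF 1, of i j] p by (auto simp: e poset_iff)
qed

lemma ideal_pprec: "J \<in> ideals n \<Longrightarrow> q \<in> J \<Longrightarrow> p \<in> poset n \<Longrightarrow> p \<prec>\<^sub>P q \<Longrightarrow> p \<in> J"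
  by (auto simp: ideals_def pprec_def)

text \<open>The homogeneous inequalities of the polytope. They define a convex cone, so they can be
  checked for single ideals and then added and scaled; the diagonal equations are handled
  separately.\<close>

definition Qineq :: "(int \<times> int \<Rightarrow> real) \<Rightarrow> bool" where
  "Qineq x \<longleftrightarrow> (\<forall>p\<in>poset n. 0 \<le> x p) \<and>
    (\<forall>p\<in>\<O>. \<forall>q\<in>poset n. \<forall>c. set c \<subseteq> poset n - \<O> \<and> sorted_wrt (\<prec>\<^sub>P) (p # c @ [q]) \<longrightarrow>
      (\<Sum>s\<leftarrow>c. x s) \<le> x p - x q)"

lemma Q_poly_iff: "x \<in> Q_poly n \<O> a \<longleftrightarrow>
    x \<in> vecs n \<and> (\<forall>i\<in>{1..n}. lk x (int i, int i) = real (lam n a i)) \<and> Qineq (lk x)"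
  by (simp add: Q_poly_def Qineq_def conj_assoc)

lemma Qineq_add: "Qineq x \<Longrightarrow> Qineq y \<Longrightarrow> Qineq (\<lambda>p. x p + y p)"
  unfolding Qineq_def sum_list_addf
  by (intro conjI ballI allI impI) (simp, metis (no_types, lifting) add_diff_add add_mono)

lemma Qineq_scale: "Qineq x \<Longrightarrow> 0 \<le> c \<Longrightarrow> Qineq (\<lambda>p. c * x p)"
  unfolding Qineq_def sum_list_const_mult right_diff_distrib[symmetric]
  by (intro conjI ballI allI impI) (simp, metis (no_types, lifting) mult_left_mono)

lemma Qineq_0: "Qineq (\<lambda>p. 0)"
  by (simp add: Qineq_def)

lemma Qineq_sum: "(\<And>i. i \<in> I \<Longrightarrow> Qineq (x i)) \<Longrightarrow> Qineq (\<lambda>p. \<Sum>i\<in>I. x i p)"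
  by (induction I rule: infinite_finite_induct) (simp_all add: Qineq_0 Qineq_add)

lemma sum_list_zero: "(\<And>s. s \<in> set c \<Longrightarrow> h s = 0) \<Longrightarrow> (\<Sum>s\<leftarrow>c. h s) = (0::real)"
  by (induction c) auto

text \<open>Outside \<open>\<O>\<close> the set \<open>M_set\<close> consists of maximal elements of
  \<open>J\<close>, so a chain there meets it at most once, and not at all if its upper end
  \<open>q\<close> lies in \<open>M_set\<close>. If the chain or \<open>q\<close> meets it, then
  \<open>p\<close> is below an element of \<open>J\<close> and belongs to \<open>M_set\<close> as a
  member of \<open>\<O>\<close>.\<close>

lemma Qineq_ideal:
  assumes J: "J \<in> ideals n"
  shows "Qineq (\<lambda>p. if p \<in> M_set \<O> J then 1 else 0)"
proof -
  let ?x = "\<lambda>p. if p \<in> M_set \<O> J then 1 else 0 :: real"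
  have one: "(\<Sum>s\<leftarrow>c. ?x s) \<le> 1 \<and> ((\<Sum>s\<leftarrow>c. ?x s) = 0 \<or> (\<exists>s\<in>set c. s \<in> J))"
    if "set c \<subseteq> poset n - \<O>" "sorted_wrt (\<prec>\<^sub>P) c" for c
    using that
  proof (induction c)
    case (Cons s c)
    have z: "(\<Sum>t\<leftarrow>c. ?x t) = 0" if "s \<in> M_set \<O> J"
    proof -
      have "s \<in> max_elems J" using that Cons.prems by (auto simp: M_set_def)
      then have "t \<notin> J" if "t \<in> set c" for t using Cons.prems(2) that by (auto simp: max_elems_def)
      then show ?thesis using M_set_subset[OF J] by (intro sum_list_zero) auto
    qed
    have IH: "(\<Sum>s\<leftarrow>c. ?x s) \<le> 1 \<and> ((\<Sum>s\<leftarrow>c. ?x s) = 0 \<or> (\<exists>s\<in>set c. s \<in> J))"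
      using Cons by simp
    show ?case
    proof (cases "s \<in> M_set \<O> J")
      case True
      then have "s \<in> J" using M_set_subset[OF J] by blast
      then show ?thesis using z[OF True] True by simp
    next
      case False
      then have "(\<Sum>s\<leftarrow>s # c. ?x s) = (\<Sum>s\<leftarrow>c. ?x s)" by simp
      then show ?thesis using IH by (metis list.set_intros(2))
    qed
  qed simp
  have "(\<Sum>s\<leftarrow>c. ?x s) \<le> ?x p - ?x q"
    if p: "p \<in> \<O>" "q \<in> poset n" and c: "set c \<subseteq> poset n - \<O>" "sorted_wrt (\<prec>\<^sub>P) (p # c @ [q])" for p q c
  proof -
    have s: "sorted_wrt (\<prec>\<^sub>P) c" "p \<prec>\<^sub>P q" "\<And>s. s \<in> set c \<Longrightarrow> p \<prec>\<^sub>P s \<and> s \<prec>\<^sub>P q"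
      using c(2) by (simp_all add: sorted_wrt_append)
    have pP: "p \<in> poset n" using p(1) O_poset by blast
    have pM: "p \<in> M_set \<O> J" if "r \<in> J" "p \<prec>\<^sub>P r" for r
      using ideal_pprec[OF J that(1) pP that(2)] p(1) by (simp add: M_set_def)
    show ?thesis
    proof (cases "q \<in> M_set \<O> J")
      case True
      then have qJ: "q \<in> J" using M_set_subset[OF J] by blast
      have "s \<notin> M_set \<O> J" if "s \<in> set c" for s
        using that s(3)[OF that] qJ c(1) by (auto simp: M_set_def max_elems_def)
      then have "(\<Sum>s\<leftarrow>c. ?x s) = 0" by (intro sum_list_zero) simp
      then show ?thesis using True pM[OF qJ s(2)] by simp
    next
      case False
      show ?thesis
      proof (cases "\<exists>s\<in>set c. s \<in> J")
        case True
        then obtain r where "r \<in> set c" "r \<in> J" by blast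
        then have "p \<in> M_set \<O> J" using pM s(3) by blast
        then show ?thesis using one[OF c(1) s(1)] False by simp
      next
        case n: False
        then have "(\<Sum>s\<leftarrow>c. ?x s) = 0" using one[OF c(1) s(1)] by blast
        then show ?thesis using False by simp
      qed
    qed
  qed
  then show ?thesis unfolding Qineq_def by simp
qed

lemma M_diag: "t \<in> Theta n \<Longrightarrow> i \<in> {1..n} \<Longrightarrow> (int i, int i) \<in> M_set \<O> (ideal_of t) \<longleftrightarrow> i \<le> length t"
proof -
  assume t: "t \<in> Theta n" "i \<in> {1..n}"
  have "(int i, int i) \<in> \<O>" using diag_O t(2) by (auto simp: diag_def)
  then have "(int i, int i) \<in> M_set \<O> (ideal_of t) \<longleftrightarrow> (int i, int i) \<in> ideal_of t"
    using M_set_subset[OF M_set_ideal_of(3)[OF t(1)]] by (auto simp: M_set_def)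
  then show ?thesis using ideals_k_diag(1)[OF ideal_of(1)[OF t(1)]] t(2) by auto
qed

lemma lsum_diag:
  assumes "ks m \<subseteq> Theta n" "i \<in> {1..n}"
  shows "lsum (\<lambda>t. if (int i, int i) \<in> M_set \<O> (ideal_of t) then 1 else 0) m = (\<Sum>k=i..n. dgr m k)"
proof -
  have "(\<Sum>k=i..n. dgr m k) = (\<Sum>t\<in>ks m. \<Sum>k=i..n. if k = length t then lk m t else 0)"
    unfolding dgr_def lsum_def by (subst sum.swap) (auto intro!: sum.cong)
  also have "\<dots> = (\<Sum>t\<in>ks m. lk m t * (if (int i, int i) \<in> M_set \<O> (ideal_of t) then 1 else 0))"
    using assms M_diag ThetaD by (intro sum.cong refl) (auto simp: sum.delta)
  finally show ?thesis by (simp add: lsum_def)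
qed

lemma ideal_sum_Q:
  assumes m: "ks m \<subseteq> Theta n" "dgr m = trunc (\<lambda>k. N * a k)" "0 < N"
  shows "(1 / real N) *\<^sub>R rl (ideal_sum m) \<in> Q_poly n \<O> a"
proof -
  have l: "lk ((1 / real N) *\<^sub>R rl (ideal_sum m)) p =
      1 / real N * (\<Sum>t\<in>ks m. real (lk m t) * (if p \<in> M_set \<O> (ideal_of t) then 1 else 0))" for p
    by (simp add: lookup_scaleR lk_rl lookup_ideal_sum[OF m(1)] lsum_def if_distrib cong: if_cong)
  have "Qineq (lk ((1 / real N) *\<^sub>R rl (ideal_sum m)))"
    unfolding l[abs_def] using m(1) M_set_ideal_of(3) by (intro Qineq_scale Qineq_sum Qineq_ideal) auto
  moreover have "(1 / real N) *\<^sub>R rl (ideal_sum m) \<in> vecs n"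
    using ideal_sum_vecs[OF m(1)] by (auto simp: vecs_def in_keys_iff lookup_scaleR lk_rl subset_iff)
  moreover have "lk ((1 / real N) *\<^sub>R rl (ideal_sum m)) (int i, int i) = real (lam n a i)" if i: "i \<in> {1..n}" for i
  proof -
    have "lsum (\<lambda>t. if (int i, int i) \<in> M_set \<O> (ideal_of t) then 1 else 0) m = (\<Sum>k=i..n. N * a k)"
      unfolding lsum_diag[OF m(1) i] m(2) using i by (intro sum.cong) (auto simp: trunc_def)
    also have "\<dots> = N * lam n a i" by (simp add: lam_def sum_distrib_left)
    finally show ?thesis using m(3) by (simp add: lookup_scaleR lk_rl lookup_ideal_sum[OF m(1)])
  qed
  ultimately show ?thesis unfolding Q_poly_iff by blast
qed

lemma convex_Q: "convex (Q_poly n \<O> a)"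
proof (rule convexI)
  fix x y :: "int \<times> int \<Rightarrow>\<^sub>0 real" and u v :: real
  assume *: "x \<in> Q_poly n \<O> a" "y \<in> Q_poly n \<O> a" "0 \<le> u" "0 \<le> v" "u + v = 1"
  have l: "lk (u *\<^sub>R x + v *\<^sub>R y) p = u * lk x p + v * lk y p" for p
    by (simp add: lookup_add lookup_scaleR)
  have "Qineq (lk (u *\<^sub>R x + v *\<^sub>R y))"
    unfolding l[abs_def] using * unfolding Q_poly_iff by (intro Qineq_add Qineq_scale) blast+
  moreover have "u *\<^sub>R x + v *\<^sub>R y \<in> vecs n"
  proof -
    have z: "lk x p = 0" "lk y p = 0" if "p \<notin> poset n" for p
      using *(1,2) that unfolding Q_poly_iff vecs_def by (auto simp: in_keys_iff)
    have "lk (u *\<^sub>R x + v *\<^sub>R y) p = 0" if "p \<notin> poset n" for p using z[OF that] by (simp add: l)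
    then show ?thesis unfolding vecs_def by (auto simp: in_keys_iff)
  qed
  moreover have "lk (u *\<^sub>R x + v *\<^sub>R y) (int i, int i) = real (lam n a i)" if i: "i \<in> {1..n}" for i
  proof -
    have "lk x (int i, int i) = real (lam n a i)" "lk y (int i, int i) = real (lam n a i)"
      using *(1,2) i unfolding Q_poly_iff by blast+
    then show ?thesis unfolding l using *(5) by (simp add: distrib_right[symmetric])
  qed
  ultimately show "u *\<^sub>R x + v *\<^sub>R y \<in> Q_poly n \<O> a" unfolding Q_poly_iff by blast
qed

section \<open>Decomposing points of the polytope\<close>

text \<open>The weights are the differences of consecutive elements of \<open>B\<close>, the first
  one taken from 0.\<close>

lemma weights_exist:
  fixes B :: "real set"
  assumes "finite B" "B \<subseteq> {0<..}"
  shows "\<exists>w. (\<forall>b\<in>B. 0 \<le> w b) \<and> (\<forall>c\<in>B. (\<Sum>b\<in>{b\<in>B. b \<le> c}. w b) = c)"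
  using assms
proof (induction B rule: finite_linorder_max_induct)
  case (insert b B)
  then obtain w where w: "\<forall>b\<in>B. 0 \<le> w b" "\<forall>c\<in>B. (\<Sum>b\<in>{b\<in>B. b \<le> c}. w b) = c" by auto
  let ?w = "w(b := b - (\<Sum>b\<in>B. w b))"
  have bB: "b \<notin> B" using insert.hyps by auto
  have le: "(\<Sum>b\<in>B. w b) \<le> b"
  proof (cases "B = {}")
    case True then show ?thesis using insert.prems by simp
  next
    case False
    then have M: "Max B \<in> B" using insert.hyps(1) by (rule Max_in[rotated])
    have "{b \<in> B. b \<le> Max B} = B" using insert.hyps(1) by auto
    then have "(\<Sum>b\<in>B. w b) = Max B" using w(2) M by metis
    then show ?thesis using insert.hyps(2) M by force
  qed
  have "(\<Sum>b\<in>{x \<in> insert b B. x \<le> c}. ?w b) = c" if c: "c \<in> insert b B" for c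
  proof (cases "c = b")
    case True
    have "{x \<in> insert b B. x \<le> c} = insert b B" using insert.hyps(2) by (auto simp: True)
    moreover have "(\<Sum>x\<in>B. ?w x) = (\<Sum>x\<in>B. w x)" using bB by (intro sum.cong) auto
    ultimately show ?thesis using insert.hyps(1) bB by (simp add: True)
  next
    case False
    then have cB: "c \<in> B" "c < b" using c insert.hyps(2) by auto
    then have "{x \<in> insert b B. x \<le> c} = {x \<in> B. x \<le> c}" by auto
    moreover have "(\<Sum>x\<in>{x \<in> B. x \<le> c}. ?w x) = (\<Sum>x\<in>{x \<in> B. x \<le> c}. w x)" using bB by (intro sum.cong) auto
    ultimately show ?thesis using w(2) cB by simp
  qed
  moreover have "\<forall>x\<in>insert b B. 0 \<le> ?w x" using w(1) le by auto
  ultimately show ?case by blast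
qed simp

text \<open>Each unit of the integer part of \<open>z\<close> yields one \<open>u\<close>, and a
  further one appears if the fractional part reaches \<open>\<theta>\<close>. The bound
  \<open>z \<le> real L\<close> ensures that none is cut off.\<close>

lemma threshold_count:
  fixes z \<theta> :: real
  assumes "0 < \<theta>" "\<theta> \<le> 1" "0 \<le> z" "z \<le> real L"
  shows "(\<Sum>u<L. if real u + \<theta> \<le> z then 1 else 0 :: real) = of_int \<lfloor>z\<rfloor> + (if \<theta> \<le> frac z then 1 else 0)"
proof -
  define N where "N = nat \<lfloor>z\<rfloor> + (if \<theta> \<le> frac z then 1 else 0)"
  have z: "z = real (nat \<lfloor>z\<rfloor>) + frac z" using assms(3) by (simp add: frac_def)
  have f: "0 \<le> frac z" "frac z < 1" using frac_ge_0 frac_lt_1 by blast+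
  have "{u. u < L \<and> real u + \<theta> \<le> z} = {..<N}"
  proof (intro Set.set_eqI iffI)
    fix u assume "u \<in> {u. u < L \<and> real u + \<theta> \<le> z}"
    then have u: "real u + \<theta> \<le> real (nat \<lfloor>z\<rfloor>) + frac z" using z by simp
    then have "real u < real (nat \<lfloor>z\<rfloor>) + 1" using f assms(1) by linarith
    then have "u \<le> nat \<lfloor>z\<rfloor>" by linarith
    moreover have "u \<noteq> nat \<lfloor>z\<rfloor>" if "\<not> \<theta> \<le> frac z" using u that by auto
    ultimately show "u \<in> {..<N}" unfolding N_def by (cases "\<theta> \<le> frac z") auto
  next
    fix u assume "u \<in> {..<N}"
    then have u: "u < N" by simp
    have le: "real u + \<theta> \<le> z"
    proof (cases "\<theta> \<le> frac z")
      case True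
      then have "real u \<le> real (nat \<lfloor>z\<rfloor>)" using u by (simp add: N_def)
      then show ?thesis using z True by linarith
    next
      case False
      then have "real u + 1 \<le> real (nat \<lfloor>z\<rfloor>)" using u by (simp add: N_def)
      then show ?thesis using z f assms(2) by linarith
    qed
    then have "real u < real L" using assms by linarith
    then show "u \<in> {u. u < L \<and> real u + \<theta> \<le> z}" using le by simp
  qed
  then have "(\<Sum>u<L. if real u + \<theta> \<le> z then 1 else 0 :: real) = real N"
    by (simp add: sum.If_cases Int_def)
  then show ?thesis using assms(3) by (simp add: N_def)
qed

text \<open>A finite form of the fact that the number of \<open>u\<close> with
  \<open>u + \<theta> \<le> z\<close>, averaged over \<open>\<theta>\<close> in
  \<open>(0, 1]\<close>, is \<open>z\<close>. The weights up to the fractional part of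
  \<open>z\<close> add up to it as soon as it occurs in \<open>B\<close>.\<close>

lemma weights_threshold:
  fixes w :: "real \<Rightarrow> real"
  assumes B: "finite B" "B \<subseteq> {0<..1}" "1 \<in> B" and w: "\<And>c. c \<in> B \<Longrightarrow> (\<Sum>b\<in>{b\<in>B. b \<le> c}. w b) = c"
    and z: "0 \<le> z" "z \<le> real L" "frac z = 0 \<or> frac z \<in> B"
  shows "(\<Sum>b\<in>B. w b * (\<Sum>u<L. if real u + b \<le> z then 1 else 0)) = z"
proof -
  have tot: "(\<Sum>b\<in>B. w b) = 1"
  proof -
    have "{b \<in> B. b \<le> 1} = B" using B(2) by auto
    then show ?thesis using w[OF B(3)] by simp
  qed
  have "(\<Sum>b\<in>B. w b * (\<Sum>u<L. if real u + b \<le> z then 1 else 0)) =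
      (\<Sum>b\<in>B. w b * (of_int \<lfloor>z\<rfloor> + (if b \<le> frac z then 1 else 0)))"
    using B(2) z by (intro sum.cong refl, subst threshold_count) auto
  also have "\<dots> = of_int \<lfloor>z\<rfloor> * (\<Sum>b\<in>B. w b) + (\<Sum>b\<in>B. if b \<le> frac z then w b else 0)"
  proof -
    have "w b * (of_int \<lfloor>z\<rfloor> + (if b \<le> frac z then 1 else 0)) = of_int \<lfloor>z\<rfloor> * w b + (if b \<le> frac z then w b else 0)" for b
      by (simp add: algebra_simps)
    then show ?thesis by (simp add: sum.distrib sum_distrib_left)
  qed
  also have "(\<Sum>b\<in>B. if b \<le> frac z then w b else 0) = (\<Sum>b\<in>{b\<in>B. b \<le> frac z}. w b)"
    by (rule sum.inter_filter[OF B(1), symmetric])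
  also have "\<dots> = frac z"
  proof (cases "frac z = 0")
    case True
    have e: "{b \<in> B. b \<le> frac z} = {}" unfolding True using B(2) by force
    show ?thesis unfolding e using True by simp
  qed (use z(3) w in blast)
  finally show ?thesis by (simp add: tot frac_def)
qed

text \<open>The point \<open>x\<close> of the polytope is turned into an antitone function on the poset by adding to each
  coordinate outside \<open>\<O>\<close> the largest value above it (\<open>0\<close> at maximal elements).\<close>

function tf :: "(int \<times> int \<Rightarrow> real) \<Rightarrow> int \<times> int \<Rightarrow> real" where
  "tf x p = (if p \<in> poset n - \<O> then x p + Max (insert 0 (tf x ` {q \<in> poset n. p \<prec>\<^sub>P q})) else x p)"
  by pat_completeness auto
termination
proof (relation "Wellfounded.measure (\<lambda>(x, p). card {q \<in> poset n. p \<prec>\<^sub>P q})")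
  fix x :: "int \<times> int \<Rightarrow> real" and p q
  assume "p \<in> poset n - \<O>" "q \<in> {q \<in> poset n. p \<prec>\<^sub>P q}"
  then have "{r \<in> poset n. q \<prec>\<^sub>P r} \<subset> {r \<in> poset n. p \<prec>\<^sub>P r}"
    using pprec_trans[of p q] pprec_irrefl[of q] by blast
  then have "card {r \<in> poset n. q \<prec>\<^sub>P r} < card {r \<in> poset n. p \<prec>\<^sub>P r}"
    by (intro psubset_card_mono) auto
  then show "((x, q), (x, p)) \<in> Wellfounded.measure (\<lambda>(x, p). card {q \<in> poset n. p \<prec>\<^sub>P q})" by simp
qed simp

declare tf.simps [simp del]

text \<open>The share of \<open>tf\<close> that comes from above. Its value 0 on \<open>\<O>\<close>
  makes \<open>tf\<close> the sum of \<open>x\<close> and \<open>tg\<close> on the whole poset;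
  outside \<open>\<O>\<close> it is the real counterpart of \<open>gg\<close>.\<close>

definition tg :: "(int \<times> int \<Rightarrow> real) \<Rightarrow> int \<times> int \<Rightarrow> real"
  where "tg x p = (if p \<in> \<O> then 0 else Max (insert 0 (tf x ` {q \<in> poset n. p \<prec>\<^sub>P q})))"

lemma tf_tg: "p \<in> poset n \<Longrightarrow> tf x p = x p + tg x p"
  by (subst tf.simps) (simp add: tg_def)

lemma tg_cases: "tg x p = 0 \<or> (\<exists>q\<in>poset n. p \<prec>\<^sub>P q \<and> tg x p = tf x q)"
proof (cases "p \<in> \<O>")
  case False
  have "Max (insert 0 (tf x ` {q \<in> poset n. p \<prec>\<^sub>P q})) \<in> insert 0 (tf x ` {q \<in> poset n. p \<prec>\<^sub>P q})"
    by (rule Max_in) auto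
  then show ?thesis using False by (auto simp: tg_def)
qed (simp add: tg_def)

lemma tg_ge: "0 \<le> tg x p" "p \<notin> \<O> \<Longrightarrow> q \<in> poset n \<Longrightarrow> p \<prec>\<^sub>P q \<Longrightarrow> tf x q \<le> tg x p"
  by (auto simp: tg_def intro: Max_ge)

text \<open>Unfolding the maxima yields a chain that starts at \<open>q\<close>, lies outside
  \<open>\<O>\<close> except possibly at its end, and realises the value. In this form
  \<open>tf\<close> can be compared with the inequalities of the polytope.\<close>

lemma tf_chain:
  assumes "q \<in> poset n"
  shows "\<exists>c r. set c \<subseteq> poset n - \<O> \<and> r \<in> poset n \<and> sorted_wrt (\<prec>\<^sub>P) (c @ [r]) \<and> hd (c @ [r]) = q \<and>
    tf x q = (\<Sum>s\<leftarrow>c. x s) + x r"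
  using assms
proof (induction "card {r \<in> poset n. q \<prec>\<^sub>P r}" arbitrary: q rule: less_induct)
  case less
  show ?case
  proof (cases "tg x q = 0")
    case True
    then have "tf x q = x q" using tf_tg[OF less.prems] by simp
    then show ?thesis using less.prems by (intro exI[of _ "[]"] exI[of _ q]) simp
  next
    case False
    then have qO: "q \<in> poset n - \<O>" using less.prems by (auto simp: tg_def)
    obtain r where r: "r \<in> poset n" "q \<prec>\<^sub>P r" "tg x q = tf x r" using tg_cases[of x q] False by blast
    have "{s \<in> poset n. r \<prec>\<^sub>P s} \<subset> {s \<in> poset n. q \<prec>\<^sub>P s}"
      using pprec_trans[OF less.prems r(1) _ r(2)] pprec_irrefl[of r] r(1,2) by blast
    then have "card {s \<in> poset n. r \<prec>\<^sub>P s} < card {s \<in> poset n. q \<prec>\<^sub>P s}"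
      by (intro psubset_card_mono) auto
    from less.hyps[OF this r(1)] obtain c s where c: "set c \<subseteq> poset n - \<O>" "s \<in> poset n"
      "sorted_wrt (\<prec>\<^sub>P) (c @ [s])" "hd (c @ [s]) = r" "tf x r = (\<Sum>s\<leftarrow>c. x s) + x s" by blast
    have "q \<prec>\<^sub>P t" if t: "t \<in> set (c @ [s])" for t
    proof (cases "t = r")
      case False
      have "r # tl (c @ [s]) = c @ [s]" using c(4) by (metis append_is_Nil_conv list.distinct(1) list.exhaust_sel)
      then have "r \<prec>\<^sub>P t" using c(3) t False by (metis set_ConsD sorted_wrt.simps(2))
      moreover have "t \<in> poset n" using t c(1,2) by auto
      ultimately show ?thesis using pprec_trans[OF less.prems r(1) _ r(2)] by blast
    qed (use r in simp)
    then have "sorted_wrt (\<prec>\<^sub>P) ((q # c) @ [s])" using c(3) by simp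
    moreover have "tf x q = (\<Sum>s\<leftarrow>q # c. x s) + x s" using tf_tg[OF less.prems, of x] r(3) c(5) by simp
    ultimately show ?thesis using c(1,2) qO by (intro exI[of _ "q # c"] exI[of _ s]) simp
  qed
qed

section \<open>Level ideals of a point of the polytope\<close>

context
  fixes x :: "int \<times> int \<Rightarrow>\<^sub>0 real" and a :: "nat \<Rightarrow> nat"
  assumes x: "x \<in> Q_poly n \<O> a"
begin

abbreviation "f \<equiv> tf (lk x)"
abbreviation "g \<equiv> tg (lk x)"
abbreviation "L \<equiv> lam n a 1"

lemma xQ: "p \<in> poset n \<Longrightarrow> 0 \<le> lk x p"
  "p \<in> \<O> \<Longrightarrow> q \<in> poset n \<Longrightarrow> set c \<subseteq> poset n - \<O> \<Longrightarrow> sorted_wrt (\<prec>\<^sub>P) (p # c @ [q]) \<Longrightarrow>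
    (\<Sum>s\<leftarrow>c. lk x s) \<le> lk x p - lk x q"
  using x unfolding Q_poly_iff Qineq_def by blast+

text \<open>Outside \<open>\<O>\<close> this is built into the recursion. At a point of
  \<open>\<O>\<close> it is the inequality of the polytope for the chain provided by
  \<open>tf_chain\<close>.\<close>

lemma f_antitone: "p \<in> poset n \<Longrightarrow> q \<in> poset n \<Longrightarrow> p \<prec>\<^sub>P q \<Longrightarrow> f q \<le> f p"
proof -
  assume p: "p \<in> poset n" "q \<in> poset n" "p \<prec>\<^sub>P q"
  show ?thesis
  proof (cases "p \<in> \<O>")
    case False
    then show ?thesis using tg_ge(2)[OF False p(2,3), of "lk x"] tf_tg[OF p(1), of "lk x"] xQ(1)[OF p(1)] by linarith
  next
    case True
    obtain c r where c: "set c \<subseteq> poset n - \<O>" "r \<in> poset n" "sorted_wrt (\<prec>\<^sub>P) (c @ [r])" "hd (c @ [r]) = q"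
      "f q = (\<Sum>s\<leftarrow>c. lk x s) + lk x r" using tf_chain[OF p(2), of "lk x"] by blast
    have "p \<prec>\<^sub>P t" if t: "t \<in> set (c @ [r])" for t
    proof (cases "t = q")
      case False
      have "q # tl (c @ [r]) = c @ [r]" using c(4) by (metis append_is_Nil_conv list.distinct(1) list.exhaust_sel)
      then have "q \<prec>\<^sub>P t" using c(3) t False by (metis set_ConsD sorted_wrt.simps(2))
      moreover have "t \<in> poset n" using t c(1,2) by auto
      ultimately show ?thesis using pprec_trans[OF p(1,2) _ p(3)] by blast
    qed (use p in simp)
    then have "sorted_wrt (\<prec>\<^sub>P) (p # c @ [r])" using c(3) by simp
    then have "(\<Sum>s\<leftarrow>c. lk x s) \<le> lk x p - lk x r" using xQ(2)[OF True c(2,1)] by blast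
    moreover have "f p = lk x p" using True by (subst tf.simps) simp
    ultimately show ?thesis using c(5) by linarith
  qed
qed

lemma f_nonneg: "p \<in> poset n \<Longrightarrow> 0 \<le> f p"
  using tf_tg[of p "lk x"] xQ(1)[of p] tg_ge(1)[of "lk x" p] by linarith

lemma diag_mem: "i \<in> {1..n} \<Longrightarrow> (int i, int i) \<in> \<O> \<and> (int i, int i) \<in> poset n"
  using diag_O by (auto simp: diag_def poset_def)

lemma f_diag: "i \<in> {1..n} \<Longrightarrow> f (int i, int i) = real (lam n a i)"
  using diag_mem[of i] x by (subst tf.simps) (simp add: Q_poly_iff)

lemma f_le: "p \<in> poset n \<Longrightarrow> f p \<le> real L"
  using f_antitone[of "(1, 1)" p] pprec_bottom[of p] f_diag[of 1] diag_mem[of 1] n1 by (cases "p = (1, 1)") auto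

lemma g_cases: "g p = 0 \<or> g p \<in> f ` poset n"
  using tg_cases by blast

lemma g_bounds: "0 \<le> g p \<and> g p \<le> real L"
  using g_cases[of p] f_le tg_ge(1)[of "lk x" p] by auto

definition Jv :: "real \<Rightarrow> (int \<times> int) set" where "Jv v = {p \<in> poset n. v \<le> f p}"

lemma Jv_ideal: "Jv v \<in> ideals n"
  unfolding ideals_def Jv_def
proof (rule CollectI, intro conjI ballI impI)
  fix p q assume "p \<in> {p \<in> poset n. v \<le> f p}" "q \<in> poset n" "q \<preceq>\<^sub>P p"
  then show "q \<in> {p \<in> poset n. v \<le> f p}"
    using f_antitone[of q p] by (cases "q = p") (auto simp: pprec_def)
qed auto

text \<open>Membership means \<open>g p < v \<le> f p\<close>. Outside \<open>\<O>\<close>,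
  maximality in the level ideal says that nothing above \<open>p\<close> reaches the level
  \<open>v\<close>; on \<open>\<O>\<close> the value of \<open>g\<close> is 0, which is below the
  level.\<close>

lemma M_Jv: "0 < v \<Longrightarrow> p \<in> poset n \<Longrightarrow>
  (if p \<in> M_set \<O> (Jv v) then 1 else 0 :: real) = (if v \<le> f p then 1 else 0) - (if v \<le> g p then 1 else 0)"
proof -
  assume v: "0 < v" "p \<in> poset n"
  have "p \<in> M_set \<O> (Jv v) \<longleftrightarrow> v \<le> f p \<and> \<not> v \<le> g p"
  proof (cases "p \<in> \<O>")
    case True
    then show ?thesis using v by (auto simp: M_set_def Jv_def tg_def max_elems_def)
  next
    case False
    have "v \<le> g p \<longleftrightarrow> (\<exists>q\<in>Jv v. p \<prec>\<^sub>P q)"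
    proof
      assume "v \<le> g p"
      then have "g p \<noteq> 0" using v by linarith
      then obtain q where "q \<in> poset n" "p \<prec>\<^sub>P q" "g p = f q" using tg_cases[of "lk x" p] by blast
      then show "\<exists>q\<in>Jv v. p \<prec>\<^sub>P q" using \<open>v \<le> g p\<close> by (intro bexI[of _ q]) (simp_all add: Jv_def)
    next
      assume "\<exists>q\<in>Jv v. p \<prec>\<^sub>P q"
      then obtain q where "q \<in> poset n" "v \<le> f q" "p \<prec>\<^sub>P q" unfolding Jv_def by blast
      then show "v \<le> g p" using tg_ge(2)[OF False, of q "lk x"] by linarith
    qed
    moreover have "p \<in> M_set \<O> (Jv v) \<longleftrightarrow> p \<in> Jv v \<and> \<not> (\<exists>q\<in>Jv v. p \<prec>\<^sub>P q)"
      using False by (auto simp: M_set_def max_elems_def)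
    ultimately show ?thesis using v by (auto simp: Jv_def)
  qed
  moreover have "g p \<le> f p" using tf_tg[OF v(2)] xQ(1)[OF v(2)] by simp
  ultimately show ?thesis by auto
qed

text \<open>The condition \<open>u < L\<close> puts \<open>(1, 1)\<close> into the level ideal, so
  the ideal belongs to a variable; the diagonal values of \<open>f\<close> give the number of its
  subscripts.\<close>

lemma Jv_Theta:
  assumes "0 < \<theta>" "\<theta> \<le> 1" "u < L"
  shows "\<exists>t. t \<in> Theta n \<and> ideal_of t = Jv (real u + \<theta>) \<and> (\<forall>i\<in>{1..n}. i \<le> length t \<longleftrightarrow> u < lam n a i)"
proof -
  let ?J = "Jv (real u + \<theta>)"
  define k where "k = card (?J \<inter> diag n)"
  have J: "?J \<in> ideals_k n k" using Jv_ideal by (simp add: ideals_k_def k_def)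
  have d: "(int i, int i) \<in> ?J \<longleftrightarrow> u < lam n a i" if i: "i \<in> {1..n}" for i
  proof -
    have "(int i, int i) \<in> ?J \<longleftrightarrow> real u + \<theta> \<le> real (lam n a i)" using diag_mem[OF i] f_diag[OF i] by (simp add: Jv_def)
    also have "\<dots> \<longleftrightarrow> u < lam n a i"
    proof
      assume "u < lam n a i"
      then have "real u + 1 \<le> real (lam n a i)" by linarith
      then show "real u + \<theta> \<le> real (lam n a i)" using assms(2) by linarith
    qed (use assms(1) in linarith)
    finally show ?thesis .
  qed
  have dk: "(int i, int i) \<in> ?J \<longleftrightarrow> i \<le> k" if "i \<in> {1..n}" for i
    using ideals_k_diag(1)[OF J, of "int i"] that by auto
  have "1 \<le> k" using d[of 1] dk[of 1] n1 assms(3) by auto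
  from ideal_of_srt[OF J this] show ?thesis using d dk by metis
qed

lemma threshold_monomial:
  assumes "0 < \<theta>" "\<theta> \<le> 1"
  shows "\<exists>m. ks m \<subseteq> Theta n \<and> dgr m = trunc a \<and>
    (\<forall>p\<in>poset n. lk (rl (ideal_sum m)) p = (\<Sum>u<L. (if real u + \<theta> \<le> f p then 1 else 0) - (if real u + \<theta> \<le> g p then 1 else 0)))"
proof -
  have "\<forall>u\<in>{..<L}. \<exists>t. t \<in> Theta n \<and> ideal_of t = Jv (real u + \<theta>) \<and> (\<forall>i\<in>{1..n}. i \<le> length t \<longleftrightarrow> u < lam n a i)"
    using Jv_Theta[OF assms] by blast
  from bchoice[OF this] obtain T where T: "\<And>u. u < L \<Longrightarrow> T u \<in> Theta n" "\<And>u. u < L \<Longrightarrow> ideal_of (T u) = Jv (real u + \<theta>)"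
    "\<And>u i. u < L \<Longrightarrow> i \<in> {1..n} \<Longrightarrow> i \<le> length (T u) \<longleftrightarrow> u < lam n a i" by (auto simp: Ball_def)
  define m where "m = (\<Sum>u<L. sg (T u) (1::nat))"
  have ls: "lsum h m = (\<Sum>u<L. h (T u))" for h
  proof -
    have "lsum h (\<Sum>u\<in>A. sg (T u) 1) = (\<Sum>u\<in>A. h (T u))" for A :: "nat set"
      by (induction A rule: infinite_finite_induct) (simp_all add: lsum_add lsum_single)
    then show ?thesis by (simp add: m_def)
  qed
  have mT: "ks m \<subseteq> Theta n"
  proof -
    have "ks m \<subseteq> (\<Union>u<L. ks (sg (T u) (1::nat)))" unfolding m_def by (rule keys_sum)
    then show ?thesis using T(1) by auto
  qed
  have "dgr m k = trunc a k" for k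
  proof (cases "k \<in> {1..n}")
    case False
    then show ?thesis using dgr_out[OF mT False] by (auto simp: trunc_def)
  next
    case True
    let ?l = "lam n a (Suc k)"
    have lk: "lam n a k = a k + ?l" using True by (simp add: lam_def sum.atLeast_Suc_atMost)
    have lL: "lam n a k \<le> L" unfolding lam_def using True by (intro sum_mono2) auto
    \<comment> \<open>Exactly \<open>k\<close> subscripts occur for the levels from
      \<open>lam n a (Suc k)\<close> up to but excluding \<open>lam n a k\<close>, an interval with
      \<open>a k\<close> elements.\<close>
    have "{u. u < L \<and> length (T u) = k} = {?l..<lam n a k}"
    proof (intro Set.set_eqI iffI)
      fix u assume "u \<in> {u. u < L \<and> length (T u) = k}"
      then have u: "u < L" "length (T u) = k" by auto
      have "\<not> u < ?l"
      proof (cases "Suc k \<le> n")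
        case True then show ?thesis using T(3)[OF u(1), of "Suc k"] u(2) by simp
      qed (simp add: lam_def)
      then show "u \<in> {?l..<lam n a k}" using T(3)[OF u(1) True] u(2) by simp
    next
      fix u assume u: "u \<in> {?l..<lam n a k}"
      then have uL: "u < L" using lL by simp
      have "k \<le> length (T u)" using T(3)[OF uL True] u by simp
      moreover have "\<not> Suc k \<le> length (T u)"
      proof
        assume "Suc k \<le> length (T u)"
        then show False using T(3)[OF uL, of "Suc k"] ThetaD[OF T(1)[OF uL]] u by auto
      qed
      ultimately show "u \<in> {u. u < L \<and> length (T u) = k}" using uL by simp
    qed
    then have "dgr m k = card {?l..<lam n a k}"
      unfolding dgr_def ls by (simp add: sum.If_cases Int_def)
    then show ?thesis using lk True by (simp add: trunc_def)
  qed
  then have "dgr m = trunc a" by blast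
  moreover have "lk (rl (ideal_sum m)) p = (\<Sum>u<L. (if real u + \<theta> \<le> f p then 1 else 0) - (if real u + \<theta> \<le> g p then 1 else 0))"
    if p: "p \<in> poset n" for p
  proof -
    have "lk (rl (ideal_sum m)) p = (\<Sum>u<L. if p \<in> M_set \<O> (ideal_of (T u)) then 1 else 0 :: real)"
      by (simp add: lk_rl lookup_ideal_sum[OF mT] ls if_distrib cong: if_cong)
    also have "\<dots> = (\<Sum>u<L. (if real u + \<theta> \<le> f p then 1 else 0) - (if real u + \<theta> \<le> g p then 1 else 0))"
      using assms(1) T(2) by (intro sum.cong refl, subst M_Jv[OF _ p, symmetric]) auto
    finally show ?thesis .
  qed
  ultimately show ?thesis using mT by blast
qed

text \<open>Averaging the level ideals \<open>f \<ge> u + \<theta>\<close> over \<open>\<theta> \<in> (0, 1]\<close>; only finitely many \<open>\<theta>\<close> matter.\<close>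

lemma decomposition: "x \<in> convex hull ((\<lambda>m. rl (ideal_sum m)) ` {m. ks m \<subseteq> Theta n \<and> dgr m = trunc a})"
proof -
  let ?S = "(\<lambda>m. rl (ideal_sum m)) ` {m. ks m \<subseteq> Theta n \<and> dgr m = trunc a}"
  \<comment> \<open>The thresholds needed are the fractional parts of the values of
    \<open>f\<close>; the values of \<open>g\<close> are among these values or 0. The element 1
    makes the total weight 1, and 0 is removed because thresholds are positive.\<close>
  define B where "B = insert 1 (frac ` f ` poset n) - {0}"
  have fB: "finite B" by (simp add: B_def)
  have B: "B \<subseteq> {0<..1}"
  proof
    fix b assume "b \<in> B"
    then have "b \<noteq> 0" "b = 1 \<or> (\<exists>y. b = frac y)" by (auto simp: B_def)
    then show "b \<in> {0<..1}" using frac_ge_0[where 'a = real] less_imp_le[OF frac_lt_1[where 'a = real]]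
      by (auto simp: less_le)
  qed
  have 1: "1 \<in> B" by (simp add: B_def)
  have "B \<subseteq> {0<..}" using B by auto
  from weights_exist[OF fB this] obtain w where w: "\<forall>b\<in>B. 0 \<le> w b" "\<forall>c\<in>B. (\<Sum>b\<in>{b\<in>B. b \<le> c}. w b) = c" by blast
  have "{b \<in> B. b \<le> 1} = B" using B by auto
  then have tot: "(\<Sum>b\<in>B. w b) = 1" using w(2) 1 by metis
  have "\<forall>\<theta>\<in>B. \<exists>m. ks m \<subseteq> Theta n \<and> dgr m = trunc a \<and>
    (\<forall>p\<in>poset n. lk (rl (ideal_sum m)) p = (\<Sum>u<L. (if real u + \<theta> \<le> f p then 1 else 0) - (if real u + \<theta> \<le> g p then 1 else 0)))"
    using B threshold_monomial by (meson greaterThanAtMost_iff subsetD)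
  from bchoice[OF this] obtain m where m: "\<And>\<theta>. \<theta> \<in> B \<Longrightarrow> ks (m \<theta>) \<subseteq> Theta n \<and> dgr (m \<theta>) = trunc a"
    "\<And>\<theta> p. \<theta> \<in> B \<Longrightarrow> p \<in> poset n \<Longrightarrow> lk (rl (ideal_sum (m \<theta>))) p =
      (\<Sum>u<L. (if real u + \<theta> \<le> f p then 1 else 0) - (if real u + \<theta> \<le> g p then 1 else 0))" by blast
  have "x = (\<Sum>b\<in>B. w b *\<^sub>R rl (ideal_sum (m b)))"
  proof (rule poly_mapping_eqI)
    fix p show "lk x p = lk (\<Sum>b\<in>B. w b *\<^sub>R rl (ideal_sum (m b))) p"
    proof (cases "p \<in> poset n")
      case False
      then have "lk x p = 0" using x by (auto simp: Q_poly_iff vecs_def in_keys_iff)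
      moreover have "lk (rl (ideal_sum (m b))) p = 0" if "b \<in> B" for b
        using ideal_sum_vecs[of "m b"] m(1)[OF that] False by (auto simp: vecs_def in_keys_iff lk_rl)
      ultimately show ?thesis by (simp add: lookup_sum lookup_scaleR)
    next
      case True
      have fz: "frac (f p) = 0 \<or> frac (f p) \<in> B" using True by (auto simp: B_def)
      have gz: "frac (g p) = 0 \<or> frac (g p) \<in> B" using g_cases[of p] by (auto simp: B_def)
      have "lk (\<Sum>b\<in>B. w b *\<^sub>R rl (ideal_sum (m b))) p =
          (\<Sum>b\<in>B. w b * (\<Sum>u<L. if real u + b \<le> f p then 1 else 0)) - (\<Sum>b\<in>B. w b * (\<Sum>u<L. if real u + b \<le> g p then 1 else 0))"
        unfolding lookup_sum lookup_scaleR sum_subtractf[symmetric]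
        by (intro sum.cong refl) (simp add: m(2)[OF _ True] sum_subtractf right_diff_distrib)
      also have "\<dots> = f p - g p"
        using weights_threshold[OF fB B 1, of w "f p" L] weights_threshold[OF fB B 1, of w "g p" L]
          w(2) fz gz f_nonneg[OF True] f_le[OF True] g_bounds[of p] by simp
      finally show ?thesis using tf_tg[OF True] by simp
    qed
  qed
  also have "\<dots> \<in> convex hull ?S"
    using w(1) tot m(1) by (intro convex_sum fB convex_convex_hull) (auto intro: hull_inc)
  finally show ?thesis .
qed

end

lemma Q_poly_hull: "Q_poly n \<O> a = convex hull ((\<lambda>m. rl (ideal_sum m)) ` {m. ks m \<subseteq> Theta n \<and> dgr m = trunc a})"
proof
  show "Q_poly n \<O> a \<subseteq> convex hull ((\<lambda>m. rl (ideal_sum m)) ` {m. ks m \<subseteq> Theta n \<and> dgr m = trunc a})"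
    using decomposition by blast
  have "rl (ideal_sum m) \<in> Q_poly n \<O> a" if "ks m \<subseteq> Theta n" "dgr m = trunc a" for m
    using ideal_sum_Q[of m 1 a] that by simp
  then show "convex hull ((\<lambda>m. rl (ideal_sum m)) ` {m. ks m \<subseteq> Theta n \<and> dgr m = trunc a}) \<subseteq> Q_poly n \<O> a"
    by (intro hull_minimal convex_Q) auto
qed

lemma rl_diff: "rl (x - y) = rl x - rl y"
  by (rule poly_mapping_eqI) (simp add: lk_rl lookup_minus)

text \<open>The polytope is the hull of finitely many points, hence compact, and the closure adds
  nothing. Sections of the line bundle itself already give all generating points; those of its
  powers stay inside because the inequalities are homogeneous and the diagonal values scale with the
  weight.\<close>

lemma NO_body_eq: "NO_body n a (tau n a) (less_A_xi n \<O>) (nu_xi n \<O>) = (\<lambda>x. x - x_lam n \<O> a) ` Q_poly n \<O> a"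
proof -
  let ?S = "(\<lambda>m. rl (ideal_sum m)) ` {m. ks m \<subseteq> Theta n \<and> dgr m = trunc a}"
  let ?T = "(\<lambda>x. x - x_lam n \<O> a) ` Q_poly n \<O> a"
  have T: "?T = convex hull ((\<lambda>x. - x_lam n \<O> a + x) ` ?S)"
    unfolding convex_hull_translation Q_poly_hull[of a, symmetric] by simp
  have fin: "finite ?S" using finite_monomials by blast
  have cv: "convex ?T" unfolding T by (rule convex_convex_hull)
  have cl: "closed ?T" unfolding T using fin by (intro compact_imp_closed finite_imp_compact_convex_hull) blast
  have "pts a \<subseteq> ?T"
  proof
    fix y assume "y \<in> pts a"
    then obtain N m where m: "0 < N" "ks m \<subseteq> Theta n" "dgr m = trunc (\<lambda>k. N * a k)"
      "y = (1 / real N) *\<^sub>R rl (ideal_sum m - ideal_sum (tmon (\<lambda>k. N * a k)))" using pts_subset by blast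
    have "(1 / real N) *\<^sub>R rl (ideal_sum (tmon (\<lambda>k. N * a k))) = rl (ideal_sum (tmon a))"
      by (rule poly_mapping_eqI) (use m(1) in \<open>simp add: lookup_scaleR lk_rl tmon_mult\<close>)
    then have "y = (1 / real N) *\<^sub>R rl (ideal_sum m) - x_lam n \<O> a"
      unfolding m(4) rl_diff scaleR_diff_right by (simp add: rl_ideal_sum_tmon)
    then show "y \<in> ?T" using ideal_sum_Q[OF m(2,3,1)] by blast
  qed
  then have 1: "convex hull (pts a) \<subseteq> ?T" using cv by (rule hull_minimal)
  have "(\<lambda>x. - x_lam n \<O> a + x) ` ?S \<subseteq> pts a"
    using pts_supset[of _ a] by (auto simp: rl_diff rl_ideal_sum_tmon)
  then have 2: "?T \<subseteq> convex hull (pts a)" unfolding T by (rule hull_mono)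
  have "convex hull (pts a) = ?T" using 1 2 by (rule subset_antisym)
  then show ?thesis using cl by (simp add: NO_body_pts)
qed

end

theorem theorem1p9p5:
  fixes n :: nat and \<O> :: "(int \<times> int) set" and a :: "nat \<Rightarrow> nat"
  assumes "1 \<le> n" and "diag n \<subseteq> \<O>" and "\<O> \<subseteq> poset n"
  shows "NO_body n a (tau n a) (less_A_xi n \<O>) (nu_xi n \<O>)
    = (\<lambda>x. x - x_lam n \<O> a) ` Q_poly n \<O> a"
proof -
  interpret marked_poset n \<O> using assms by unfold_locales
  show ?thesis by (rule NO_body_eq)
qed

end
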